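(* For $N\ge1$, $$\mathcal H_{2N,0}(t,u)=\sum_{\lambda\models N}u^{N-\ell(\lambda)}\Bigl(\prod_{a=1}^{\ell(\lambda)}(\lambda_a-1)!\,(t)_{\lambda_a+1}\Bigr)r_{2\lambda}.$$ For $N\ge0$, $$\mathcal H_{2N+1,0}(t,u)=\sum_{\lambda\models N+1}u^{N+1-\ell(\lambda)}\Bigl(\prod_{a=1}^{\ell(\lambda)}(\lambda_a-1)!\Bigr)\Bigl(\prod_{a=1}^{\ell(\lambda)-1}(t)_{\lambda_a+1}\Bigr)(t)_{\lambda_{\ell(\lambda)}}\,r_{2\lambda-\mathbf e_{\ell(\lambda)}}.$$ Because the $u$-degree determines the homological degree on this edge, these two identities determine every representation $H_k^{i,j}(n)$ with $k+j=\ell_n$.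
   Context: Conventions. $[m]=\{1,\dots,m\}$, $[0]=\varnothing$; $\mathbb K$ is a field of characteristic zero. For $m\ge0$, $m^+=\lceil m/2\rceil$ and $m^-=\lfloor m/2\rfloor$. $(x)_n=x(x+1)\cdots(x+n-1)$, $(x)_0=1$. A composition $\alpha=(\alpha_1,\dots,\alpha_r)\models n$ is a sequence of positive integers with sum $n$; $\ell(\alpha)=r$; its cut set is $D(\alpha)=\{\alpha_1,\alpha_1+\alpha_2,\dots,\alpha_1+\cdots+\alpha_{r-1}\}\subseteq[n-1]$. For $\beta,\alpha\models n$, $\beta\succeq\alpha$ means $D(\beta)\subseteq D(\alpha)$. For $S\subseteq[n-1]$, $\gamma_S$ is the composition of $n$ with $D(\gamma_S)=S$. The ribbon Schur function is $r_\alpha=\sum_{\beta\succeq\alpha}(-1)^{\ell(\alpha)-\ell(\beta)}h_\beta$, with $h_\beta=h_{\beta_1}h_{\beta_2}\cdots$ complete homogeneous. For a composition $\lambda=(\lambda_1,\dots,\lambda_r)$, $2\lambda=(2\lambda_1,\dots,2\lambda_r)$ and $2\lambda-\mathbf e_r=(2\lambda_1,\dots,2\lambda_{r-1},2\lambda_r-1)$. Zigzag compositions: $\delta_{2N}=(2,\dots,2)$ ($N$ parts) and $\delta_{2N+1}=(2,\dots,2,1)$ ($N$ twos); $\ell_n=\ell(\delta_n)=\lceil n/2\rceil$. Decorations. $c(\cdot)$ is the number of cycles of a permutation, fixed points included. $\mathfrak R_s$ is the set of permutations of $\{\ast,1,\dots,s\}$; the cycle containing $\ast$ is the root cycle, written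 starting at $\ast$. For $m\ge1$, $\mathcal D_m=\mathfrak S_{m^+}\times\mathfrak R_{m^-}$; for $\xi=(\sigma,\tau)\in\mathcal D_m$, $\deg_q\xi=m^+-c(\sigma)$ and $\deg_t\xi=c(\sigma)+c(\tau)-1$. Factorization cuts and defect. Let $\theta=(\sigma,\tau)\in\mathcal D_n$. A cut $c\in D(\delta_n)$ is a factorization cut of $\theta$ if (a) $\sigma([c^+])=[c^+]$; and (b) every nonroot cycle of $\tau$ lies entirely in $[c^-]$ or entirely in $\{c^-+1,\dots,n^-\}$, and in the root cycle $(\ast,a_1,\dots,a_u)$ all letters $\le c^-$ come before all letters $>c^-$. $F_{\delta_n}(\theta)$ is the set of factorization cuts, $\gamma_{\delta_n}(\theta)=\gamma_{F_{\delta_n}(\theta)}$, and $\operatorname{fd}_n(\theta)=c(\sigma)-|F_{\delta_n}(\theta)|-1$. Set $$\mathcal H_{n,d}(t,u)=\sum_{\theta\in\mathcal D_n,\ \operatorname{fd}_n(\theta)=d}t^{\deg_t\theta}u^{\deg_q\theta}r_{\gamma_{\delta_n}(\theta)}\qquad(d\ge0).$$ Decorated complex and homology (for the last sentence). For $\sigma\in\mathfrak S_a$, $\sigma'\in\mathfrak S_b$, $\sigma\oplus\sigma'\in\mathfrak S_{a+b}$ acts as $\sigma$ on $[a]$ and by $a+j\mapsto a+\sigma'(j)$ on the rest. For $\tau\in\mathfrak R_a$, $\upsilon\in\mathfrak R_b$ with root cycles $(\ast,a_1,\dots,a_u)$ and $(\ast,b_1,\dots,b_v)$, $\tau\star\upsilon\in\mathfrak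 R_{a+b}$ has root cycle $(\ast,a_1,\dots,a_u,a+b_1,\dots,a+b_v)$, and its nonroot cycles are those of $\tau$ together with those of $\upsilon$ with every letter shifted by $a$. If $a,b$ are not both odd, $(\sigma,\tau)\diamond(\sigma',\tau')=(\sigma\oplus\sigma',\tau\star\tau')$. $C_k^{t,q}(\delta_n)$ is the $\mathbb K$-space with basis the elements $(B_1,\dots,B_k;\xi_1,\dots,\xi_k)$ where $\beta\succeq\delta_n$, $\ell(\beta)=k$, $(B_1,\dots,B_k)$ is an ordered set partition of $[n]$ with $|B_i|=\beta_i$, and $\xi_i\in\mathcal D_{\beta_i}$; it is bigraded by the sums of the $\deg_t\xi_i$ and $\deg_q\xi_i$; $\mathfrak S_n$ acts on block labels. The differential is $\sum_{i=1}^{k-1}(-1)^{i-1}d_i$, where $d_i$ merges $B_i,B_{i+1}$ and multiplies $\xi_i\diamond\xi_{i+1}$. $H_k^{i,j}(n)$ is the part of $H_k(C_\bullet^{t,q}(\delta_n))$ of $t$-degree $i$ and $q$-degree $j$. With $\operatorname{ch}_{t,q}V=\sum_{d,e}\operatorname{ch}(V_{d,e})t^dq^e$ ($\operatorname{ch}$ the Frobenius characteristic), one has $\mathcal H_{n,0}(t,u)=\sum_{k\ge1,\,j\ge0,\,k+j=\ell_n}u^j[q^j]\operatorname{ch}_{t,q}H_k(C_\bullet^{t,q}(\delta_n))$, so the defect-zero layer is the edge $k+j=\ell_n$. *)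

theory Defs
  imports
    "HOL-Library.Poly_Mapping"
    "HOL-Library.Disjoint_Sets"
    "HOL-Combinatorics.Orbits"
    "HOL-Computational_Algebra.Polynomial"
begin

section \<open>The ambient ring of symmetric functions\<close>

text \<open>
  Formal power series in the variables $x_0, x_1, \ldots$: arbitrary coefficient functions on
  monomials (finitely supported exponent functions) with the convolution product. The ring of
  symmetric functions over the coefficient ring is the subalgebra generated by the complete
  homogeneous series \<open>hsym d\<close> below; \<open>psym d\<close> (for \<open>d \<ge> 1\<close>) are the power sums.
\<close>

typedef 'a mps = "UNIV :: ((nat \<Rightarrow>\<^sub>0 nat) \<Rightarrow> 'a) set"
  morphisms mcoeff Mps ..

lemma mcoeff_Mps [simp]: "mcoeff (Mps f) = f"
  by (simp add: Mps_inverse)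

lemma mps_eqI: "(\<And>m. mcoeff f m = mcoeff g m) \<Longrightarrow> f = g"
  by (metis ext mcoeff_inject)

definition splits :: "(nat \<Rightarrow>\<^sub>0 nat) \<Rightarrow> ((nat \<Rightarrow>\<^sub>0 nat) \<times> (nat \<Rightarrow>\<^sub>0 nat)) set" where
  "splits m = {(a, b). a + b = m}"

lemma finite_below: "finite {a :: nat \<Rightarrow>\<^sub>0 nat. \<exists>b. a + b = m}"
proof -
  have sub: "Poly_Mapping.lookup ` {a. \<exists>b. a + b = m} \<subseteq>
     {f. \<forall>x. (x \<in> Poly_Mapping.keys m \<longrightarrow>
               f x \<in> {..Max (Poly_Mapping.lookup m ` Poly_Mapping.keys m)}) \<and>
             (x \<notin> Poly_Mapping.keys m \<longrightarrow> f x = 0)}"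
    (is "_ \<subseteq> ?F")
  proof safe
    fix a b x assume "m = a + b" "x \<in> Poly_Mapping.keys (a + b)"
    have "Poly_Mapping.lookup a x \<le> Poly_Mapping.lookup (a + b) x" by (simp add: lookup_add)
    also have "\<dots> \<le> Max (Poly_Mapping.lookup (a + b) ` Poly_Mapping.keys (a + b))"
      using \<open>x \<in> Poly_Mapping.keys (a + b)\<close> by (intro Max_ge) auto
    finally show "Poly_Mapping.lookup a x \<le> Max (Poly_Mapping.lookup (a + b) ` Poly_Mapping.keys (a + b))" .
  next
    fix a b :: "nat \<Rightarrow>\<^sub>0 nat" and x assume "x \<notin> Poly_Mapping.keys (a + b)"
    then show "Poly_Mapping.lookup a x = 0" by (simp add: in_keys_iff lookup_add)
  qed
  have "finite ?F" by (rule finite_set_of_finite_funs) auto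
  then have "finite (Poly_Mapping.lookup ` {a. \<exists>b. a + b = m})" using sub finite_subset by blast
  then show ?thesis
    by (rule finite_imageD) (auto intro!: inj_onI poly_mapping_eqI)
qed

lemma finite_splits [simp]: "finite (splits m)"
proof (rule finite_subset)
  show "splits m \<subseteq> {a. \<exists>b. a + b = m} \<times> {a. \<exists>b. a + b = m}"
    by (auto simp: splits_def) (metis add.commute)
qed (simp add: finite_below)

instantiation mps :: (comm_ring_1) comm_ring_1
begin

definition zero_mps_def: "0 = Mps (\<lambda>_. 0)"
definition one_mps_def: "1 = Mps (\<lambda>m. if m = 0 then 1 else 0)"
definition plus_mps_def: "f + g = Mps (\<lambda>m. mcoeff f m + mcoeff g m)"
definition minus_mps_def: "f - g = Mps (\<lambda>m. mcoeff f m - mcoeff g m)"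
definition uminus_mps_def: "- f = Mps (\<lambda>m. - mcoeff f m)"
definition times_mps_def:
  "f * g = Mps (\<lambda>m. \<Sum>(a, b)\<in>splits m. mcoeff f a * mcoeff g b)"

instance
proof
  fix f g h :: "'a mps"
  show "f * g * h = f * (g * h)"
  proof (rule mps_eqI)
    fix m
    let ?L = "SIGMA p:splits m. splits (fst p)" and ?R = "SIGMA p:splits m. splits (snd p)"
    have "mcoeff (f * g * h) m =
        (\<Sum>(p, q)\<in>?L. mcoeff f (fst q) * mcoeff g (snd q) * mcoeff h (snd p))"
      by (simp add: times_mps_def sum.Sigma sum_distrib_right case_prod_unfold)
    also have "\<dots> = (\<Sum>(p, q)\<in>?R. mcoeff f (fst p) * (mcoeff g (fst q) * mcoeff h (snd q)))"
      by (rule sum.reindex_bij_witness[of _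
            "\<lambda>(p, q). ((fst p + fst q, snd q), (fst p, fst q))"
            "\<lambda>(p, q). ((fst q, snd q + snd p), (snd q, snd p))"])
         (auto simp: splits_def algebra_simps)
    also have "\<dots> = mcoeff (f * (g * h)) m"
      by (simp add: times_mps_def sum.Sigma sum_distrib_left case_prod_unfold)
    finally show "mcoeff (f * g * h) m = mcoeff (f * (g * h)) m" .
  qed
  show "f * g = g * f"
  proof (rule mps_eqI)
    fix m
    show "mcoeff (f * g) m = mcoeff (g * f) m"
      unfolding times_mps_def mcoeff_Mps
      by (rule sum.reindex_bij_witness[of _ prod.swap prod.swap])
         (auto simp: splits_def algebra_simps)
  qed
  show "1 * f = f"
  proof (rule mps_eqI)
    fix m
    have "mcoeff (1 * f) m = (\<Sum>p\<in>splits m. if p = (0, m) then mcoeff f m else 0)"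
      unfolding times_mps_def one_mps_def mcoeff_Mps
      by (rule sum.cong) (auto simp: splits_def split: if_splits)
    also have "\<dots> = mcoeff f m"
    proof -
      have "(0, m) \<in> splits m" by (simp add: splits_def)
      then show ?thesis by (subst sum.delta) simp_all
    qed
    finally show "mcoeff (1 * f) m = mcoeff f m" .
  qed
  show "(f + g) * h = f * h + g * h"
    by (rule mps_eqI)
       (simp add: times_mps_def plus_mps_def case_prod_unfold algebra_simps sum.distrib)
  show "(0 :: 'a mps) \<noteq> 1"
  proof
    assume "(0 :: 'a mps) = 1"
    then have "mcoeff (0 :: 'a mps) 0 = mcoeff 1 0" by simp
    then show False by (simp add: zero_mps_def one_mps_def)
  qed
qed (auto intro!: mps_eqI
       simp: plus_mps_def minus_mps_def uminus_mps_def zero_mps_def algebra_simps)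

end

definition mconst :: "'a \<Rightarrow> 'a::comm_ring_1 mps" where
  "mconst c = Mps (\<lambda>m. if m = 0 then c else 0)"

definition hsym :: "nat \<Rightarrow> 'a::comm_ring_1 mps" where
  "hsym d = Mps (\<lambda>m. if (\<Sum>x\<in>Poly_Mapping.keys m. Poly_Mapping.lookup m x) = d then 1 else 0)"

definition psym :: "nat \<Rightarrow> 'a::comm_ring_1 mps" where
  "psym d = Mps (\<lambda>m. if \<exists>x. m = Poly_Mapping.single x d then 1 else 0)"


section \<open>Compositions and ribbon Schur functions\<close>

definition composition :: "nat \<Rightarrow> nat list \<Rightarrow> bool" where
  "composition n \<alpha> \<longleftrightarrow> (\<forall>a\<in>set \<alpha>. 0 < a) \<and> sum_list \<alpha> = n"

definition cuts :: "nat list \<Rightarrow> nat set" where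
  "cuts \<alpha> = (\<lambda>i. sum_list (take i \<alpha>)) ` {1..<length \<alpha>}"

definition coarser :: "nat list \<Rightarrow> nat list \<Rightarrow> bool" where
  "coarser \<beta> \<alpha> \<longleftrightarrow> composition (sum_list \<alpha>) \<beta> \<and> cuts \<beta> \<subseteq> cuts \<alpha>"

definition comp_of_cuts :: "nat \<Rightarrow> nat set \<Rightarrow> nat list" where
  "comp_of_cuts n S = (THE \<alpha>. composition n \<alpha> \<and> cuts \<alpha> = S)"

definition ribbon :: "nat list \<Rightarrow> 'a::comm_ring_1 mps" where
  "ribbon \<alpha> = (\<Sum>\<beta> | coarser \<beta> \<alpha>.
     (- 1) ^ (length \<alpha> - length \<beta>) * prod_list (map hsym \<beta>))"

definition zigzag :: "nat \<Rightarrow> nat list" where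
  "zigzag n = replicate (n div 2) 2 @ (if odd n then [1] else [])"

definition dbl :: "nat list \<Rightarrow> nat list" where
  "dbl \<mu> = map (\<lambda>a. 2 * a) \<mu>"

definition dbl_dec :: "nat list \<Rightarrow> nat list" where
  "dbl_dec \<mu> = butlast (dbl \<mu>) @ [2 * last \<mu> - 1]"


section \<open>Decorations\<close>

abbreviation (input) up :: "nat \<Rightarrow> nat" where "up m \<equiv> (m + 1) div 2"
abbreviation (input) dn :: "nat \<Rightarrow> nat" where "dn m \<equiv> m div 2"

text \<open>
  Permutations of $[m]$ are functions that permute \<open>{1..m}\<close> (and fix everything else). The
  letter $\ast$ is encoded as \<open>0\<close>, so the elements of $\mathfrak R_s$ permute \<open>{0..s}\<close>.
\<close>

type_synonym deco = "(nat \<Rightarrow> nat) \<times> (nat \<Rightarrow> nat)"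

definition perm_cycles :: "(nat \<Rightarrow> nat) \<Rightarrow> nat set \<Rightarrow> nat set set" where
  "perm_cycles f A = orbit f ` A"

definition decos :: "nat \<Rightarrow> deco set" where
  "decos m = {(\<sigma>, \<tau>). \<sigma> permutes {1..up m} \<and> \<tau> permutes {0..dn m}}"

definition deg_q :: "nat \<Rightarrow> deco \<Rightarrow> nat" where
  "deg_q m \<xi> = up m - card (perm_cycles (fst \<xi>) {1..up m})"

definition deg_t :: "nat \<Rightarrow> deco \<Rightarrow> nat" where
  "deg_t m \<xi> =
     card (perm_cycles (fst \<xi>) {1..up m}) + card (perm_cycles (snd \<xi>) {0..dn m}) - 1"

text \<open>The word $a_1 \ldots a_u$ following $\ast$ in the root cycle.\<close>

definition root_word :: "(nat \<Rightarrow> nat) \<Rightarrow> nat list" where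
  "root_word \<tau> = map (\<lambda>i. (\<tau> ^^ i) 0) [1..<card (orbit \<tau> 0)]"

definition factor_cuts :: "nat \<Rightarrow> deco \<Rightarrow> nat set" where
  "factor_cuts n \<theta> = {c \<in> cuts (zigzag n).
     fst \<theta> ` {1..up c} = {1..up c} \<and>
     (\<forall>C \<in> perm_cycles (snd \<theta>) {0..dn n}.
        0 \<notin> C \<longrightarrow> C \<subseteq> {1..dn c} \<or> C \<subseteq> {dn c + 1..dn n}) \<and>
     (\<forall>i j. i < length (root_word (snd \<theta>)) \<and> j < length (root_word (snd \<theta>)) \<and>
        root_word (snd \<theta>) ! i \<le> dn c \<and> dn c < root_word (snd \<theta>) ! j \<longrightarrow> i < j)}"

definition fact_defect :: "nat \<Rightarrow> deco \<Rightarrow> int" where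
  "fact_defect n \<theta> =
     int (card (perm_cycles (fst \<theta>) {1..up n})) - int (card (factor_cuts n \<theta>)) - 1"

text \<open>
  Polynomials in $t$ and $u$ with symmetric function coefficients: $t$ is the inner and $u$ the
  outer variable, so the coefficient of $t^i u^j$ in \<open>P\<close> is \<open>coeff (coeff P j) i\<close>.
\<close>

definition tvar :: "'a::comm_ring_1 mps poly poly" where
  "tvar = [:[:0, 1:]:]"

definition uvar :: "'a::comm_ring_1 mps poly poly" where
  "uvar = [:0, 1:]"

definition symc :: "'a::comm_ring_1 mps \<Rightarrow> 'a mps poly poly" where
  "symc f = [:[:f:]:]"

definition defect_series :: "nat \<Rightarrow> nat \<Rightarrow> 'a::comm_ring_1 mps poly poly" where
  "defect_series n d = (\<Sum>\<theta> | \<theta> \<in> decos n \<and> fact_defect n \<theta> = int d.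
     tvar ^ deg_t n \<theta> * uvar ^ deg_q n \<theta> * symc (ribbon (comp_of_cuts n (factor_cuts n \<theta>))))"


section \<open>Representations of symmetric groups\<close>

text \<open>
  A representation is given as a subquotient \<open>num / den\<close> of a vector space; vectors of the
  representation are handled through representatives in \<open>num\<close>, and all laws are required
  modulo \<open>den\<close>. An honest subspace is the case \<open>den = {0}\<close>.
\<close>

record ('k, 'v) subquot =
  scal :: "'k \<Rightarrow> 'v \<Rightarrow> 'v"
  num :: "'v set"
  den :: "'v set"
  act :: "(nat \<Rightarrow> nat) \<Rightarrow> 'v \<Rightarrow> 'v"

definition quot_coords ::
    "('k::field, 'v::ab_group_add) subquot \<Rightarrow> 'v set \<Rightarrow> 'v \<Rightarrow> ('v \<Rightarrow> 'k) \<Rightarrow> bool" where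
  "quot_coords V S x c \<longleftrightarrow>
     (\<forall>y. y \<notin> S \<longrightarrow> c y = 0) \<and> x - (\<Sum>y\<in>S. scal V (c y) y) \<in> den V"

text \<open>The classes of the elements of \<open>S\<close> form a finite basis of \<open>num / den\<close>.\<close>

definition quot_basis :: "('k::field, 'v::ab_group_add) subquot \<Rightarrow> 'v set \<Rightarrow> bool" where
  "quot_basis V S \<longleftrightarrow> finite S \<and> S \<subseteq> num V \<and> (\<forall>x\<in>num V. \<exists>!c. quot_coords V S x c)"

definition quot_trace :: "('k::field, 'v::ab_group_add) subquot \<Rightarrow> ('v \<Rightarrow> 'v) \<Rightarrow> 'k" where
  "quot_trace V T = (let S = (SOME S. quot_basis V S) in
     \<Sum>y\<in>S. (THE c. quot_coords V S (T y) c) y)"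

text \<open>Finite-dimensional representations of $\mathfrak S_n$.\<close>

definition sn_rep :: "nat \<Rightarrow> ('k::field, 'v::ab_group_add) subquot \<Rightarrow> bool" where
  "sn_rep n V \<longleftrightarrow>
     vector_space (scal V) \<and>
     module.subspace (scal V) (num V) \<and> module.subspace (scal V) (den V) \<and> den V \<subseteq> num V \<and>
     (\<exists>S. quot_basis V S) \<and>
     (\<forall>p. p permutes {1..n} \<longrightarrow>
        act V p ` num V \<subseteq> num V \<and> act V p ` den V \<subseteq> den V \<and>
        (\<forall>x\<in>num V. \<forall>y\<in>num V. act V p (x + y) - (act V p x + act V p y) \<in> den V) \<and>
        (\<forall>c. \<forall>x\<in>num V. act V p (scal V c x) - scal V c (act V p x) \<in> den V)) \<and>
     (\<forall>x\<in>num V. act V id x - x \<in> den V) \<and>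
     (\<forall>p q. p permutes {1..n} \<and> q permutes {1..n} \<longrightarrow>
        (\<forall>x\<in>num V. act V (p \<circ> q) x - act V p (act V q x) \<in> den V))"

text \<open>
  \<open>f\<close> induces an equivariant linear bijection from \<open>num V / den V\<close> to \<open>num W / den W\<close>.
\<close>

definition sn_iso :: "nat \<Rightarrow> ('k::field, 'v::ab_group_add) subquot \<Rightarrow>
    ('k, 'w::ab_group_add) subquot \<Rightarrow> bool" where
  "sn_iso n V W \<longleftrightarrow> (\<exists>f.
     f ` num V \<subseteq> num W \<and>
     (\<forall>x\<in>num V. \<forall>y\<in>num V. f (x + y) - (f x + f y) \<in> den W) \<and>
     (\<forall>c. \<forall>x\<in>num V. f (scal V c x) - scal W c (f x) \<in> den W) \<and>
     (\<forall>x\<in>num V. f x \<in> den W \<longleftrightarrow> x \<in> den V) \<and>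
     (\<forall>y\<in>num W. \<exists>x\<in>num V. y - f x \<in> den W) \<and>
     (\<forall>p. p permutes {1..n} \<longrightarrow> (\<forall>x\<in>num V. f (act V p x) - act W p (f x) \<in> den W)))"

text \<open>The Frobenius characteristic, by its expansion into power sums.\<close>

definition frob :: "nat \<Rightarrow> ('k::field_char_0, 'v::ab_group_add) subquot \<Rightarrow> 'k mps" where
  "frob n V = mconst (1 / fact n) * (\<Sum>p | p permutes {1..n}.
     mconst (quot_trace V (act V p)) * (\<Prod>C\<in>perm_cycles p {1..n}. psym (card C)))"


section \<open>The decorated complex\<close>

definition oplus :: "nat \<Rightarrow> (nat \<Rightarrow> nat) \<Rightarrow> (nat \<Rightarrow> nat) \<Rightarrow> nat \<Rightarrow> nat" where
  "oplus a \<sigma> \<sigma>' x = (if x \<le> a then \<sigma> x else a + \<sigma>' (x - a))"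

text \<open>
  The successor function of $\tau \star \upsilon$: the last letter of the root cycle of \<open>\<tau>\<close>
  (the one sent to \<open>0\<close>) is followed by the shifted root word of \<open>\<upsilon>\<close>, whose last letter
  is sent back to \<open>0\<close>.
\<close>

definition star :: "nat \<Rightarrow> (nat \<Rightarrow> nat) \<Rightarrow> (nat \<Rightarrow> nat) \<Rightarrow> nat \<Rightarrow> nat" where
  "star a \<tau> \<upsilon> x =
     (let shift = (\<lambda>y. if y = 0 then 0 else a + y) in
      if x \<le> a then (if \<tau> x = 0 then shift (\<upsilon> 0) else \<tau> x) else shift (\<upsilon> (x - a)))"

text \<open>
  The product of decorations of sizes \<open>a\<close> and \<open>b\<close>, not both odd; it does not depend on \<open>b\<close>.
\<close>

definition deco_prod :: "nat \<Rightarrow> deco \<Rightarrow> deco \<Rightarrow> deco" where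
  "deco_prod a \<xi> \<xi>' = (oplus (up a) (fst \<xi>) (fst \<xi>'), star (dn a) (snd \<xi>) (snd \<xi>'))"

type_synonym gen = "nat set list \<times> deco list"

definition gens :: "nat \<Rightarrow> nat \<Rightarrow> nat \<Rightarrow> nat \<Rightarrow> gen set" where
  "gens n k i j = {(Bs, xs).
     length Bs = k \<and> length xs = k \<and>
     distinct Bs \<and> partition_on {1..n} (set Bs) \<and>
     coarser (map card Bs) (zigzag n) \<and>
     (\<forall>m<k. xs ! m \<in> decos (card (Bs ! m))) \<and>
     (\<Sum>m<k. deg_t (card (Bs ! m)) (xs ! m)) = i \<and>
     (\<Sum>m<k. deg_q (card (Bs ! m)) (xs ! m)) = j}"

definition pm_scale :: "'k::comm_ring_1 \<Rightarrow> ('b \<Rightarrow>\<^sub>0 'k) \<Rightarrow> ('b \<Rightarrow>\<^sub>0 'k)" where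
  "pm_scale c v = Poly_Mapping.map (\<lambda>a. c * a) v"

definition lin_ext :: "('b \<Rightarrow> ('c \<Rightarrow>\<^sub>0 'k)) \<Rightarrow> ('b \<Rightarrow>\<^sub>0 'k::comm_ring_1) \<Rightarrow> ('c \<Rightarrow>\<^sub>0 'k)" where
  "lin_ext f v = (\<Sum>b\<in>Poly_Mapping.keys v. pm_scale (Poly_Mapping.lookup v b) (f b))"

text \<open>\<open>merge m\<close> is $d_{m+1}$: list positions are counted from \<open>0\<close>.\<close>

definition merge :: "nat \<Rightarrow> gen \<Rightarrow> gen" where
  "merge m g = (case g of (Bs, xs) \<Rightarrow>
     (take m Bs @ (Bs ! m \<union> Bs ! Suc m) # drop (m + 2) Bs,
      take m xs @ deco_prod (card (Bs ! m)) (xs ! m) (xs ! Suc m) # drop (m + 2) xs))"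

definition boundary :: "(gen \<Rightarrow>\<^sub>0 'k) \<Rightarrow> (gen \<Rightarrow>\<^sub>0 'k::comm_ring_1)" where
  "boundary = lin_ext (\<lambda>g. \<Sum>m<length (fst g) - 1. Poly_Mapping.single (merge m g) ((- 1) ^ m))"

definition relabel :: "(nat \<Rightarrow> nat) \<Rightarrow> (gen \<Rightarrow>\<^sub>0 'k) \<Rightarrow> (gen \<Rightarrow>\<^sub>0 'k::comm_ring_1)" where
  "relabel p = lin_ext (\<lambda>(Bs, xs). Poly_Mapping.single (map (\<lambda>B. p ` B) Bs, xs) 1)"

definition chains :: "nat \<Rightarrow> nat \<Rightarrow> nat \<Rightarrow> nat \<Rightarrow> (gen \<Rightarrow>\<^sub>0 'k::comm_ring_1) set" where
  "chains n k i j = {v. Poly_Mapping.keys v \<subseteq> gens n k i j}"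

text \<open>
  The part of bidegree $(i, j)$ of the $k$-th homology; the differential preserves bidegrees.
\<close>

definition homology ::
    "nat \<Rightarrow> nat \<Rightarrow> nat \<Rightarrow> nat \<Rightarrow> ('k::comm_ring_1, gen \<Rightarrow>\<^sub>0 'k) subquot" where
  "homology n k i j = \<lparr>
     scal = pm_scale,
     num = {v \<in> chains n k i j. boundary v = 0},
     den = boundary ` chains n (Suc k) i j,
     act = relabel\<rparr>"

end

theory Submission
  imports Defs
begin

text \<open>Generating functions. A cut \<open>c\<close> is a factorization cut of \<open>\<theta>\<close> exactly when \<open>\<theta>\<close> is a product
of a decoration of size \<open>c\<close> and one of size \<open>n - c\<close>: both conditions in the definition say that no
letter beyond the cut is sent to a letter other than the root before the cut
(\<open>in_factor_cuts\<close>, \<open>deco_prod_surj\<close>). Hence the decorations whose factorization cuts contain the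
cuts of a composition \<open>\<beta>\<close> coarser than the zigzag correspond to lists of decorations of the
parts of \<open>\<beta>\<close> (\<open>bij_betw_total\<close>), and both degrees and the number of cycles of \<open>\<sigma>\<close> add up. Every
factor contributes at least one cycle of \<open>\<sigma>\<close>. So the defect is never negative, and it vanishes
exactly when each factor, cut at all factorization cuts, has a single cycle
(\<open>bij_betw_total_cyclic\<close>). The defect-zero series is then a sum over \<open>\<beta>\<close> of products of weights
of single parts: there are \<open>(\<lceil>b/2\<rceil> - 1)!\<close> choices of a full cycle \<open>\<sigma>\<close>, and the factor \<open>\<tau>\<close> contributes
a rising factorial (\<open>cyclic_weight_eq\<close>). Even \<open>n\<close> gives \<open>\<beta> = 2\<lambda>\<close>, odd \<open>n\<close> gives the last part
\<open>2\<lambda>\<^sub>r - 1\<close>.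

Homology on the edge. If \<open>k + j = \<lceil>n/2\<rceil>\<close>, then a generator in homological degree \<open>k\<close> and
\<open>q\<close>-degree \<open>j\<close> has \<open>k\<close> cycles in the \<open>\<sigma>\<close>-parts of its \<open>k\<close> blocks, hence one in each; in degree
\<open>k + 1\<close> there is nothing. So the homology is the kernel of the boundary map. A merged block is
recognised as the only one with two \<open>\<sigma>\<close>-cycles, and its two factors are determined by the product,
so two merges agree only if they are made at the same place and the generators differ only in how
the union of the two blocks is split (\<open>merge_eq_iff\<close>). Consequently a chain is a cycle iff, for each
place \<open>m\<close>, its coefficients sum to zero over every class of generators with the same merge at
\<open>m\<close>. Ordered set partitions are encoded as words, and forgetting separations is coarsening of words.
A set \<open>T\<close> of retained separations gives a permutation module on coarsened words; sorting inside the
coarse blocks, measured by descents, yields a basis of all functions that is compatible with every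
\<open>T\<close>. Its dual basis restricted to words with all descents is a basis of the kernel, and Moebius
inversion expresses the trace of a permutation there as an alternating sum of numbers of fixed
coarsened words (\<open>kernel_trace\<close>). Numbers of fixed words are the characters with characteristic
\<open>h\<^sub>\<gamma>\<close> (\<open>frob_block_words\<close>), and the alternating sum of the \<open>h\<^sub>\<gamma>\<close> is the ribbon function. Summing
over the sizes and decorations of the blocks gives the coefficient of the defect-zero series
(\<open>frob_homology\<close>, \<open>sum_labels\<close>).

Determination of the representation. The products of power sums over cycle types separate class
functions (\<open>class_function_zero\<close>), so equal Frobenius characteristics mean equal traces. In
characteristic zero equal traces mean isomorphic representations (\<open>equal_traces_imp_iso\<close>), by
averaging over the group.\<close>

abbreviation (input) lookup where "lookup \<equiv> Poly_Mapping.lookup"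
abbreviation (input) single where "single \<equiv> Poly_Mapping.single"
abbreviation (input) keys where "keys \<equiv> Poly_Mapping.keys"

section \<open>Cycles of permutations\<close>

lemma finite_perm_orbit: "\<lbrakk>p permutes A; finite A; x \<in> A\<rbrakk> \<Longrightarrow> orbit p x \<subseteq> A"
  by (rule permutes_orbit_subset)

lemma perm_self_in_orbit: "\<lbrakk>p permutes A; finite A\<rbrakk> \<Longrightarrow> x \<in> orbit p x"
  by (meson permutation_self_in_orbit permutation_permutes)

lemma orbit_subset_closed: "x \<in> C \<Longrightarrow> (\<And>y. y \<in> C \<Longrightarrow> f y \<in> C) \<Longrightarrow> orbit f x \<subseteq> C"
proof
  fix y assume a: "x \<in> C" "\<And>y. y \<in> C \<Longrightarrow> f y \<in> C" "y \<in> orbit f x"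
  from a(3) show "y \<in> C" by induction (auto intro: a)
qed

lemma orbit_closed: "y \<in> orbit f x \<Longrightarrow> f y \<in> orbit f x"
  by (rule orbit.step)

lemma orbit_eq_perm: "\<lbrakk>p permutes A; finite A; y \<in> orbit p x\<rbrakk> \<Longrightarrow> orbit p y = orbit p x"
  by (meson cyclic_on_orbit orbit_cyclic_eq3 permutation_permutes)

text \<open>Multiplying by a transposition with a new letter \<open>b\<close> inserts \<open>b\<close> into the cycle of \<open>c\<close>. With
\<open>permutes_insertE\<close> this drives every induction on the number of letters below.\<close>

lemma orbit_transpose_comp:
  assumes q: "q permutes A" "finite A" and b: "b \<notin> A" and c: "c \<in> A" and x: "x \<in> A"
  shows "orbit (transpose b c \<circ> q) x = (if c \<in> orbit q x then insert b (orbit q x) else orbit q x)"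
proof -
  let ?f = "transpose b c \<circ> q" and ?O = "orbit q x"
  have OA: "?O \<subseteq> A" using q x by (rule finite_perm_orbit)
  have qb: "q b = b" using q b by (simp add: permutes_not_in)
  have bc: "b \<noteq> c" using b c by auto
  have f: "?f y = (if q y = c then b else q y)" if "y \<in> A" for y
  proof -
    have "q y \<in> A" using that q by (simp add: permutes_in_image)
    then show ?thesis using b by (auto simp: transpose_def)
  qed
  have fb: "?f b = c" using qb by simp
  have xO: "x \<in> ?O" using q by (rule perm_self_in_orbit)
  have fin: "?f permutes insert b A"
    using q c by (intro permutes_compose permutes_swap_id) (auto intro: permutes_imp_permutes_insert)
  have xf: "x \<in> orbit ?f x" using fin q by (intro perm_self_in_orbit[of _ "insert b A"]) auto
  have sub1: "orbit ?f x \<subseteq> (if c \<in> ?O then insert b ?O else ?O)" (is "_ \<subseteq> ?C")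
  proof (rule orbit_subset_closed)
    show "x \<in> ?C" using xO by auto
    fix y assume y: "y \<in> ?C"
    show "?f y \<in> ?C"
    proof (cases "y = b")
      case True
      then have "c \<in> ?O" using y OA b by (auto split: if_splits)
      then show ?thesis using True fb by simp
    next
      case False
      then have yO: "y \<in> ?O" using y by (auto split: if_splits)
      then have "q y \<in> ?O" by (rule orbit_closed)
      moreover have "?f y = (if q y = c then b else q y)" using f[of y] yO OA by blast
      ultimately show ?thesis by auto
    qed
  qed
  have sub2: "?O \<subseteq> orbit ?f x \<inter> A"
  proof (rule orbit_subset_closed)
    show "x \<in> orbit ?f x \<inter> A" using x xf by simp
    fix y assume y: "y \<in> orbit ?f x \<inter> A"
    then have "?f y \<in> orbit ?f x" "?f (?f y) \<in> orbit ?f x" by (blast intro: orbit.intros)+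
    moreover have "q y \<in> A" using y q by (simp add: permutes_in_image)
    ultimately show "q y \<in> orbit ?f x \<inter> A"
      using f[of y] y fb by (cases "q y = c") auto
  qed
  have "b \<in> orbit ?f x" if cO: "c \<in> ?O"
  proof -
    obtain z where z: "z \<in> ?O" "q z = c"
    proof -
      have "\<exists>z\<in>?O. q z = c" using cO by (cases rule: orbit.cases) (use xO in auto)
      then show ?thesis using that by blast
    qed
    then have "z \<in> A" "z \<in> orbit ?f x" using sub2 by auto
    then have "?f z \<in> orbit ?f x" by (intro orbit.step)
    moreover have "?f z = b" using f[OF \<open>z \<in> A\<close>] z by simp
    ultimately have "b \<in> orbit ?f x" by argo
    then show ?thesis by simp
  qed
  then show ?thesis using sub1 sub2 by (auto split: if_splits)
qed

abbreviation cyc :: "('a \<Rightarrow> 'a) \<Rightarrow> 'a set \<Rightarrow> nat" where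
  "cyc f A \<equiv> card (orbit f ` A)"

lemma cyc_transpose_comp:
  assumes q: "q permutes A" "finite A" and b: "b \<notin> A" and c: "c \<in> insert b A"
  shows "cyc (transpose b c \<circ> q) (insert b A) = cyc q A + (if c = b then 1 else 0)"
proof (cases "c = b")
  case True
  have "orbit q b = {b}" using q b by (simp add: orbit_eq_singleton_iff permutes_not_in)
  moreover have "{b} \<notin> orbit q ` A" using finite_perm_orbit[OF q] b by auto
  ultimately show ?thesis using True q by (simp add: transpose_same card_insert_disjoint)
next
  case False
  then have cA: "c \<in> A" using c by simp
  let ?f = "transpose b c \<circ> q"
  define h where "h C = (if c \<in> C then insert b C else C)" for C :: "'a set"
  have hx: "orbit ?f x = h (orbit q x)" if "x \<in> A" for x
    using orbit_transpose_comp[OF q b cA that] by (simp add: h_def)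
  have fin: "?f permutes insert b A"
    using q c by (intro permutes_compose permutes_swap_id) (auto intro: permutes_imp_permutes_insert)
  have "c \<in> orbit q c" using q by (rule perm_self_in_orbit)
  then have "b \<in> orbit ?f c" using hx[OF cA] by (simp add: h_def)
  then have "orbit ?f b = orbit ?f c" using fin q by (intro orbit_eq_perm[of _ "insert b A"]) auto
  then have "orbit ?f ` insert b A = orbit ?f ` A" using cA by auto
  also have "\<dots> = h ` orbit q ` A" using hx by (auto simp: image_image)
  finally have "cyc ?f (insert b A) = card (h ` orbit q ` A)" by simp
  also have "\<dots> = cyc q A"
  proof (rule card_image, rule inj_onI)
    fix C D assume "C \<in> orbit q ` A" "D \<in> orbit q ` A" "h C = h D"
    moreover from this have "b \<notin> C" "b \<notin> D" using finite_perm_orbit[OF q] b by blast+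
    ultimately show "C = D" unfolding h_def by (auto split: if_splits)
  qed
  finally show ?thesis using False by simp
qed

lemma permutes_insertE:
  assumes "p permutes insert b A" "b \<notin> A"
  obtains c q where "c \<in> insert b A" "q permutes A" "p = transpose b c \<circ> q"
proof -
  have "p \<in> (\<lambda>(b', p). transpose b b' \<circ> p) ` {(b', p). b' \<in> insert b A \<and> p \<in> {p. p permutes A}}"
    using assms permutes_insert[of b A] by blast
  then show ?thesis using that by auto
qed

text \<open>Two permutations whose supports share at most one letter can be multiplied without destroying
cycles: the two cycles through the common letter fuse into one, all others survive. This covers
both parts of a product of decorations, with an empty overlap for \<open>\<sigma>\<close> and overlap \<open>{0}\<close> for \<open>\<tau>\<close>.\<close>

lemma cyc_comp:
  assumes p: "p permutes A" "finite A" and B: "finite B" and AB: "card (A \<inter> B) \<le> 1"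
    and q: "q permutes B"
  shows "cyc (q \<circ> p) (A \<union> B) + card (A \<inter> B) = cyc p A + cyc q B"
proof -
  have main: "cyc (q \<circ> p) (A \<union> (I \<union> D)) + card I = cyc p A + cyc q (I \<union> D)"
    if "finite D" "D \<inter> A = {}" "q permutes (I \<union> D)" "I \<subseteq> A" "card I \<le> 1" for I D q
    using that
  proof (induction D arbitrary: q rule: finite_induct)
    case empty
    have fI: "finite I" using empty(3) p finite_subset by auto
    have "q = id"
    proof (cases "I = {}")
      case False
      then have "card I = 1" using empty fI by (metis card_0_eq le_neq_implies_less less_one)
      then obtain z where "I = {z}" by (auto simp: card_1_singleton_iff)
      then show ?thesis using empty by (simp add: permutes_sing)
    qed (use empty in simp)
    have "orbit (id :: 'a \<Rightarrow> 'a) = (\<lambda>x. {x})" by (rule ext) (simp add: orbit_eq_singleton_iff)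
    then have "card (orbit (id :: 'a \<Rightarrow> 'a) ` I) = card I" by (simp add: card_image)
    moreover have "A \<union> (I \<union> {}) = A" using empty by auto
    ultimately show ?case using \<open>q = id\<close> by (simp only: id_comp Un_empty_right comp_id)
  next
    case (insert b D)
    have eq: "I \<union> insert b D = insert b (I \<union> D)" "A \<union> insert b (I \<union> D) = insert b (A \<union> (I \<union> D))" by auto
    have bI: "b \<notin> I \<union> D" "b \<notin> A \<union> (I \<union> D)" using insert by auto
    obtain c q' where c: "c \<in> insert b (I \<union> D)" "q' permutes I \<union> D" "q = transpose b c \<circ> q'"
      using permutes_insertE[of q b "I \<union> D"] insert.prems bI eq by auto
    have fI: "finite I" using insert.prems p finite_subset by auto
    have IH: "cyc (q' \<circ> p) (A \<union> (I \<union> D)) + card I = cyc p A + cyc q' (I \<union> D)"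
      by (rule insert.IH) (use insert.prems c in auto)
    have qp: "q' \<circ> p permutes A \<union> (I \<union> D)"
      using p c by (intro permutes_compose) (auto intro: permutes_subset)
    have "cyc q (I \<union> insert b D) = cyc q' (I \<union> D) + (if c = b then 1 else 0)"
      unfolding c(3) eq using c fI insert bI by (intro cyc_transpose_comp) auto
    moreover have "cyc (q \<circ> p) (A \<union> (I \<union> insert b D)) = cyc (q' \<circ> p) (A \<union> (I \<union> D)) + (if c = b then 1 else 0)"
      unfolding c(3) eq comp_assoc using c fI insert bI p qp by (intro cyc_transpose_comp) auto
    ultimately show ?case using IH by linarith
  qed
  have eq: "(A \<inter> B) \<union> (B - A) = B" by auto
  show ?thesis using main[of "B - A" q "A \<inter> B"] B q AB unfolding eq by auto
qed

lemma cyc_conj: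
  assumes f: "f permutes A" and h: "inj_on h A" and g: "\<And>x. x \<in> A \<Longrightarrow> g (h x) = h (f x)"
  shows "cyc g (h ` A) = cyc f A"
proof -
  have orb: "orbit g (h x) = h ` orbit f x" if x: "x \<in> A" for x
  proof
    have A: "y \<in> A" if "y \<in> orbit f x" for y using permutes_orbit_subset[OF f x] that by (rule subsetD)
    show "orbit g (h x) \<subseteq> h ` orbit f x"
    proof
      fix y assume "y \<in> orbit g (h x)"
      then show "y \<in> h ` orbit f x"
      proof induction
        case base
        show ?case unfolding g[OF x] by (intro imageI orbit.base)
      next
        case (step y)
        then obtain z where z: "z \<in> orbit f x" "y = h z" by blast
        then have "g y = h (f z)" using g A by simp
        then show ?case using z(1) by (metis imageI orbit.step)
      qed
    qed
    show "h ` orbit f x \<subseteq> orbit g (h x)"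
    proof safe
      fix z assume "z \<in> orbit f x"
      then show "h z \<in> orbit g (h x)"
      proof induction
        case base
        have "g (h x) \<in> orbit g (h x)" by (rule orbit.base)
        then show ?case unfolding g[OF x] .
      next
        case (step z)
        have "g (h z) \<in> orbit g (h x)" using step by (intro orbit.step)
        then show ?case using g[OF A[OF step.hyps]] by argo
      qed
    qed
  qed
  have "orbit g ` h ` A = (\<lambda>C. h ` C) ` orbit f ` A" unfolding image_image using orb by (rule image_cong[OF refl])
  moreover have "inj_on (\<lambda>C. h ` C) (orbit f ` A)"
    by (rule inj_on_subset[OF inj_on_image_Pow[OF h]]) (use permutes_orbit_subset[OF f] in blast)
  ultimately show ?thesis by (simp add: card_image)
qed

lemma sum_permutes_insert:
  fixes g :: "('a \<Rightarrow> 'a) \<Rightarrow> 'b::comm_monoid_add"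
  assumes "b \<notin> A" "finite A"
  shows "(\<Sum>p | p permutes insert b A. g p) = (\<Sum>c\<in>insert b A. \<Sum>q | q permutes A. g (transpose b c \<circ> q))"
  by (rule sum_over_permutations_insert) (use assms in auto)

text \<open>Each new letter either forms its own cycle, contributing \<open>x\<close>, or is inserted after one of
the letters present.\<close>

lemma sum_permutes_cyc_pochhammer:
  fixes x :: "'b::comm_ring_1"
  assumes "finite A"
  shows "(\<Sum>p | p permutes A. x ^ cyc p A) = pochhammer x (card A)"
  using assms
proof (induction A rule: finite_induct)
  case empty
  then show ?case by simp
next
  case (insert b A)
  have "(\<Sum>p | p permutes insert b A. x ^ cyc p (insert b A)) =
    (\<Sum>c\<in>insert b A. \<Sum>q | q permutes A. x ^ (cyc q A + (if c = b then 1 else 0)))"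
    unfolding sum_permutes_insert[OF insert(2,1)]
    by (intro sum.cong refl arg_cong[where f = "\<lambda>n. x ^ n"] cyc_transpose_comp) (use insert in auto)
  also have "\<dots> = (\<Sum>q | q permutes A. x ^ (cyc q A + 1)) + (\<Sum>c\<in>A. \<Sum>q | q permutes A. x ^ (cyc q A))"
  proof -
    have "(\<Sum>c\<in>A. \<Sum>q | q permutes A. x ^ (cyc q A + (if c = b then 1 else 0))) = (\<Sum>c\<in>A. \<Sum>q | q permutes A. x ^ (cyc q A))"
      using insert by (intro sum.cong refl) auto
    then show ?thesis by (subst sum.insert[OF insert(1,2)]) simp
  qed
  also have "\<dots> = pochhammer x (card A) * (x + of_nat (card A))"
    by (simp add: insert.IH sum_distrib_left[symmetric] algebra_simps)
  finally show ?case using insert by (simp add: pochhammer_Suc)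
qed

lemma cyc_pos: "finite A \<Longrightarrow> A \<noteq> {} \<Longrightarrow> cyc p A > 0"
  by (simp add: card_gt_0_iff)

text \<open>By induction on the letters: only insertions after an existing letter keep a single cycle.\<close>

lemma card_single_cycle:
  assumes "finite A" "A \<noteq> {}"
  shows "card {p. p permutes A \<and> cyc p A = 1} = fact (card A - 1)"
  using assms
proof (induction A rule: finite_ne_induct)
  case (singleton x)
  then show ?case by (simp add: permutes_sing)
next
  case (insert b A)
  have fin: "finite {p. p permutes B}" if "finite B" for B :: "'a set" using that by (rule finite_permutations)
  have "card {p. p permutes insert b A \<and> cyc p (insert b A) = 1} =
     (\<Sum>p | p permutes insert b A. if cyc p (insert b A) = 1 then 1 else 0)"
    using insert fin[of "insert b A"] by (simp add: sum.If_cases Int_def)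
  also have "\<dots> = (\<Sum>c\<in>insert b A. \<Sum>q | q permutes A. if cyc q A + (if c = b then 1 else 0) = 1 then 1 else 0)"
    unfolding sum_permutes_insert[OF insert(3,1)]
  proof (intro sum.cong refl)
    fix c q assume "c \<in> insert b A" "q \<in> {q. q permutes A}"
    then have "cyc (transpose b c \<circ> q) (insert b A) = cyc q A + (if c = b then 1 else 0)"
      using insert by (intro cyc_transpose_comp) auto
    then show "(if cyc (transpose b c \<circ> q) (insert b A) = 1 then 1 else (0::nat)) =
      (if cyc q A + (if c = b then 1 else 0) = 1 then 1 else 0)" by simp
  qed
  also have "\<dots> = (\<Sum>c\<in>A. \<Sum>q | q permutes A. if cyc q A = 1 then 1 else 0)"
  proof -
    have "(\<Sum>q | q permutes A. if cyc q A + 1 = 1 then 1 else (0::nat)) = 0"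
      using insert(1,2) by (intro sum.neutral) auto
    moreover have "(\<Sum>c\<in>A. \<Sum>q | q permutes A. if cyc q A + (if c = b then 1 else 0) = 1 then 1 else (0::nat))
      = (\<Sum>c\<in>A. \<Sum>q | q permutes A. if cyc q A = 1 then 1 else 0)"
      using insert by (intro sum.cong refl) auto
    ultimately show ?thesis using insert by (simp add: sum.insert)
  qed
  also have "\<dots> = card A * fact (card A - 1)"
    using insert.IH fin[OF insert(1)] by (simp add: sum.If_cases Int_def)
  also have "\<dots> = fact (card (insert b A) - 1)"
    using insert by (cases "card A") auto
  finally show ?case .
qed

section \<open>Shifted permutations and the product of decorations\<close>

definition shiftz :: "nat \<Rightarrow> nat \<Rightarrow> nat" where
  "shiftz a y = (if y = 0 then 0 else a + y)"

text \<open>\<open>hat a \<upsilon>\<close> acts as \<open>\<upsilon>\<close> on the letters \<open>a + 1, a + 2, \<dots>\<close> and keeps \<open>0\<close> as the root. With it, both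
\<open>\<sigma> \<oplus> \<sigma>'\<close> and \<open>\<tau> \<star> \<upsilon>\<close> become compositions of permutations whose supports overlap in at
most the root.\<close>

definition hat :: "nat \<Rightarrow> (nat \<Rightarrow> nat) \<Rightarrow> nat \<Rightarrow> nat" where
  "hat a \<upsilon> x = (if x = 0 then shiftz a (\<upsilon> 0) else if x \<le> a then x else shiftz a (\<upsilon> (x - a)))"

lemma shiftz_0 [simp]: "shiftz a 0 = 0" by (simp add: shiftz_def)

lemma shiftz_minus [simp]: "shiftz a y - a = y" by (simp add: shiftz_def)

lemma shiftz_inj: "inj_on (shiftz a) A"
  by (auto simp: inj_on_def shiftz_def)

lemma shiftz_image: "shiftz a ` {0..b} = insert 0 {a + 1..a + b}"
proof -
  have "x \<in> shiftz a ` {0..b}" if "x \<in> {a + 1..a + b}" for x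
    using that by (intro image_eqI[of _ _ "x - a"]) (auto simp: shiftz_def)
  then show ?thesis by (auto simp: shiftz_def)
qed

lemma shiftz_image': "shiftz a ` {1..b} = {a + 1..a + b}"
proof -
  have "x \<in> shiftz a ` {1..b}" if "x \<in> {a + 1..a + b}" for x
    using that by (intro image_eqI[of _ _ "x - a"]) (auto simp: shiftz_def)
  then show ?thesis by (auto simp: shiftz_def)
qed

lemma hat_shiftz: "hat a \<upsilon> (shiftz a y) = shiftz a (\<upsilon> y)"
  by (auto simp: hat_def shiftz_def)

lemma hat_le: "0 < x \<Longrightarrow> x \<le> a \<Longrightarrow> hat a \<upsilon> x = x"
  by (simp add: hat_def)

lemma hat_gt: "a < x \<Longrightarrow> hat a \<upsilon> x = shiftz a (\<upsilon> (x - a))"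
  by (simp add: hat_def)

lemma hat_permutes:
  assumes "\<upsilon> permutes {0..b}"
  shows "hat a \<upsilon> permutes insert 0 {a + 1..a + b}"
proof (rule bij_imp_permutes)
  have "bij_betw (hat a \<upsilon>) (shiftz a ` {0..b}) (shiftz a ` {0..b})"
  proof (rule bij_betwI')
    fix x y assume "x \<in> shiftz a ` {0..b}" "y \<in> shiftz a ` {0..b}"
    then obtain x' y' where xy: "x = shiftz a x'" "y = shiftz a y'" by blast
    show "(hat a \<upsilon> x = hat a \<upsilon> y) = (x = y)"
      unfolding xy hat_shiftz inj_eq[OF shiftz_inj] inj_eq[OF permutes_inj[OF assms]] ..
  next
    fix x assume "x \<in> shiftz a ` {0..b}"
    then obtain x' where x': "x' \<in> {0..b}" "x = shiftz a x'" by blast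
    then show "hat a \<upsilon> x \<in> shiftz a ` {0..b}"
      unfolding x'(2) hat_shiftz using permutes_in_image[OF assms] by (intro imageI) blast
  next
    fix y assume "y \<in> shiftz a ` {0..b}"
    then obtain z where z: "z \<in> {0..b}" "y = shiftz a z" by auto
    then obtain w where "w \<in> {0..b}" "\<upsilon> w = z" using permutes_image[OF assms] by (metis imageE)
    then show "\<exists>x\<in>shiftz a ` {0..b}. y = hat a \<upsilon> x" using z by (auto simp: hat_shiftz)
  qed
  then show "bij_betw (hat a \<upsilon>) (insert 0 {a + 1..a + b}) (insert 0 {a + 1..a + b})"
    by (simp only: shiftz_image)
  fix x assume x: "x \<notin> insert 0 {a + 1..a + b}"
  show "hat a \<upsilon> x = x"
  proof (cases "x \<le> a")
    case False
    then have "x - a \<notin> {0..b}" using x by auto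
    then have "\<upsilon> (x - a) = x - a" using assms by (simp add: permutes_not_in)
    then show ?thesis using False by (simp add: hat_def shiftz_def)
  qed (use x in \<open>auto simp: hat_def\<close>)
qed

lemma hat_permutes':
  assumes "\<upsilon> permutes {1..b}"
  shows "hat a \<upsilon> permutes {a + 1..a + b}"
proof (rule permutes_superset)
  show "hat a \<upsilon> permutes insert 0 {a + 1..a + b}"
    by (rule hat_permutes) (use assms in \<open>auto intro: permutes_subset\<close>)
  fix x assume "x \<in> insert 0 {a + 1..a + b} - {a + 1..a + b}"
  moreover have "\<upsilon> 0 = 0" using assms by (simp add: permutes_not_in)
  ultimately show "hat a \<upsilon> x = x" by (auto simp: hat_def)
qed

lemma cyc_hat: "\<upsilon> permutes {0..b} \<Longrightarrow> cyc (hat a \<upsilon>) (insert 0 {a + 1..a + b}) = cyc \<upsilon> {0..b}"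
  using cyc_conj[of \<upsilon> "{0..b}" "shiftz a" "hat a \<upsilon>"] by (simp only: shiftz_inj hat_shiftz shiftz_image)

lemma cyc_hat': "\<upsilon> permutes {1..b} \<Longrightarrow> cyc (hat a \<upsilon>) {a + 1..a + b} = cyc \<upsilon> {1..b}"
  using cyc_conj[of \<upsilon> "{1..b}" "shiftz a" "hat a \<upsilon>"] by (simp only: shiftz_inj hat_shiftz shiftz_image')

lemma star_eq_hat:
  assumes "\<tau> permutes {0..a}"
  shows "star a \<tau> \<upsilon> = hat a \<upsilon> \<circ> \<tau>"
proof
  fix x
  have "x \<le> a \<Longrightarrow> \<tau> x \<le> a" using permutes_in_image[OF assms, of x] by simp
  moreover have "\<not> x \<le> a \<Longrightarrow> \<tau> x = x" using assms by (simp add: permutes_not_in)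
  ultimately show "star a \<tau> \<upsilon> x = (hat a \<upsilon> \<circ> \<tau>) x"
    by (auto simp: star_def hat_def shiftz_def Let_def)
qed

lemma oplus_eq_hat:
  assumes "\<sigma> permutes {1..a}" "\<sigma>' permutes {1..b}"
  shows "oplus a \<sigma> \<sigma>' = hat a \<sigma>' \<circ> \<sigma>"
proof
  fix x
  have c1: "x \<le> a \<Longrightarrow> \<sigma> x \<le> a" using permutes_in_image[OF assms(1), of x] permutes_not_in[OF assms(1), of x]
    by (cases "x = 0") auto
  have c2: "\<not> x \<le> a \<Longrightarrow> \<sigma> x = x" using assms by (simp add: permutes_not_in)
  have "\<sigma>' 0 = 0" using assms by (simp add: permutes_not_in)
  moreover from this have "\<not> x \<le> a \<Longrightarrow> \<sigma>' (x - a) \<noteq> 0"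
    using inj_eq[OF permutes_inj[OF assms(2)], of "x - a" 0] by simp
  ultimately show "oplus a \<sigma> \<sigma>' x = (hat a \<sigma>' \<circ> \<sigma>) x" using c1 c2
    by (auto simp: oplus_def hat_def shiftz_def)
qed

lemma permutes_zero_fixed: "p permutes {0..b} \<Longrightarrow> p 0 = 0 \<Longrightarrow> p permutes {1..b :: nat}"
  by (rule permutes_superset[where S = "{0..b}"]) (auto simp: le_eq_less_or_eq Suc_le_eq)

lemma hat_surj:
  assumes p: "p permutes insert 0 {a + 1..a + b}"
  obtains \<upsilon> where "\<upsilon> permutes {0..b}" "p = hat a \<upsilon>"
proof
  let ?u = "\<lambda>y. p (shiftz a y) - a"
  have im: "p (shiftz a y) \<in> shiftz a ` {0..b}" if "y \<in> {0..b}" for y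
    using permutes_in_image[OF p] that unfolding shiftz_image[symmetric] by blast
  have bck: "shiftz a (?u y) = p (shiftz a y)" if "y \<in> {0..b}" for y
    using im[OF that] by auto
  have out: "?u y = y" if "y \<notin> {0..b}" for y
  proof -
    have "shiftz a y \<notin> insert 0 {a + 1..a + b}" using that by (auto simp: shiftz_def)
    then show ?thesis using permutes_not_in[OF p] by simp
  qed
  show "?u permutes {0..b}"
  proof (rule bij_imp_permutes[OF _ out])
    have "?u ` {0..b} \<subseteq> {0..b}" using im by fastforce
    moreover have "inj_on ?u {0..b}"
    proof (rule inj_onI)
      fix x y assume "x \<in> {0..b}" "y \<in> {0..b}" "?u x = ?u y"
      then have "p (shiftz a x) = p (shiftz a y)" using bck by metis
      then show "x = y" using inj_eq[OF permutes_inj[OF p]] inj_eq[OF shiftz_inj] by blast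
    qed
    ultimately show "bij_betw ?u {0..b} {0..b}"
      by (simp add: bij_betw_def endo_inj_surj)
  qed
  show "p = hat a ?u"
  proof
    fix x
    show "p x = hat a ?u x"
    proof (cases "x \<in> shiftz a ` {0..b}")
      case True
      then show ?thesis using bck by (auto simp: hat_shiftz)
    next
      case False
      then have x: "x \<notin> insert 0 {a + 1..a + b}" unfolding shiftz_image .
      then have px: "p x = x" using p by (simp add: permutes_not_in)
      show ?thesis
      proof (cases "x \<le> a")
        case True
        then show ?thesis using px x by (simp add: hat_def)
      next
        case False
        then have "?u (x - a) = x - a" using out x by auto
        then show ?thesis using px False by (simp add: hat_def shiftz_def)
      qed
    qed
  qed
qed

lemma hat_comp_notin:
  assumes "\<tau> permutes {0..a}" "a < x"
  shows "(hat a \<upsilon> \<circ> \<tau>) x \<notin> {1..a}"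
proof -
  have "\<tau> x = x" using assms by (simp add: permutes_not_in)
  then show ?thesis using assms by (auto simp: hat_def shiftz_def)
qed

text \<open>The left factor is obtained from \<open>\<rho>\<close> by sending to the root every letter that leaves \<open>{0..a}\<close>;
dividing it off leaves a permutation that fixes \<open>1, \<dots>, a\<close>, which is a shifted one.\<close>

lemma hat_comp_exists:
  assumes r: "\<rho> permutes {0..a + b}" and cut: "\<And>x. x \<in> {a + 1..a + b} \<Longrightarrow> \<rho> x \<notin> {1..a}"
  obtains \<tau> \<upsilon> where "\<tau> permutes {0..a}" "\<upsilon> permutes {0..b}" "\<rho> = hat a \<upsilon> \<circ> \<tau>"
proof -
  define \<tau> where "\<tau> x = (if x \<le> a then (if \<rho> x \<in> {1..a} then \<rho> x else 0) else x)" for x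
  have pre: "\<exists>x\<in>{0..a}. \<rho> x = y" if y: "y \<in> {1..a}" for y
  proof -
    have "y \<in> \<rho> ` {0..a + b}" using permutes_image[OF r] y by auto
    then obtain x where "x \<in> {0..a + b}" "\<rho> x = y" by auto
    moreover from this have "x \<notin> {a + 1..a + b}" using cut y by blast
    ultimately show ?thesis by auto
  qed
  have "\<tau> ` {0..a} = {0..a}"
  proof
    show "\<tau> ` {0..a} \<subseteq> {0..a}" by (auto simp: \<tau>_def)
    have "y \<in> \<tau> ` {0..a}" if ya: "y \<in> {0..a}" for y
    proof (cases "y = 0")
      case True
      have "\<not> \<rho> ` {0..a} \<subseteq> {1..a}"
      proof
        assume "\<rho> ` {0..a} \<subseteq> {1..a}"
        then have "card (\<rho> ` {0..a}) \<le> card {1..a}" by (intro card_mono) auto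
        moreover have "card (\<rho> ` {0..a}) = card {0..a}"
          using permutes_inj[OF r] by (intro card_image) (auto intro: inj_on_subset)
        ultimately show False by simp
      qed
      then obtain x where "x \<in> {0..a}" "\<rho> x \<notin> {1..a}" by blast
      then show ?thesis using True by (intro image_eqI[of _ _ x]) (simp_all add: \<tau>_def)
    next
      case False
      then have "y \<in> {1..a}" using ya by auto
      then obtain x where "x \<in> {0..a}" "\<rho> x = y" using pre by blast
      then show ?thesis using False ya by (intro image_eqI[of _ _ x]) (auto simp: \<tau>_def)
    qed
    then show "{0..a} \<subseteq> \<tau> ` {0..a}" by blast
  qed
  then have tau: "\<tau> permutes {0..a}"
    by (intro bij_imp_permutes) (auto simp: bij_betw_def \<tau>_def intro: eq_card_imp_inj_on)
  have rt: "\<rho> \<circ> inv \<tau> permutes {0..a + b}"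
    using r permutes_inv[OF tau] by (intro permutes_compose) (auto intro: permutes_subset)
  have "\<rho> \<circ> inv \<tau> permutes insert 0 {a + 1..a + b}"
  proof (rule permutes_superset[OF rt])
    fix y assume "y \<in> {0..a + b} - insert 0 {a + 1..a + b}"
    then have y: "y \<in> {1..a}" by auto
    let ?x = "inv \<tau> y"
    have "\<tau> ?x = y" using tau by (simp add: permutes_inverses)
    moreover have "?x \<in> {0..a}" using permutes_in_image[OF permutes_inv[OF tau], of y] y by simp
    ultimately have "\<rho> ?x = y" using y by (auto simp: \<tau>_def split: if_splits)
    then show "(\<rho> \<circ> inv \<tau>) y = y" by simp
  qed
  then obtain \<upsilon> where u: "\<upsilon> permutes {0..b}" "\<rho> \<circ> inv \<tau> = hat a \<upsilon>" by (rule hat_surj)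
  have "\<rho> = (\<rho> \<circ> inv \<tau>) \<circ> \<tau>" using tau by (simp add: comp_assoc permutes_inv_o)
  then show ?thesis using that[OF tau u(1)] u(2) by simp
qed

text \<open>On \<open>{0..a}\<close> the left factor is recovered by replacing images beyond \<open>a\<close> with \<open>0\<close>.\<close>

lemma hat_comp_inj:
  assumes t: "\<tau> permutes {0..a}" "\<tau>' permutes {0..a}"
    and eq: "hat a \<upsilon> \<circ> \<tau> = hat a \<upsilon>' \<circ> \<tau>'"
  shows "\<tau> = \<tau>'" "\<upsilon> = \<upsilon>'"
proof -
  have *: "\<tau> x = (if x \<le> a then (if (hat a \<upsilon> \<circ> \<tau>) x \<in> {1..a} then (hat a \<upsilon> \<circ> \<tau>) x else 0) else x)"
    if "\<tau> permutes {0..a}" for \<tau> \<upsilon> x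
  proof -
    have "x \<le> a \<Longrightarrow> \<tau> x \<le> a" using permutes_in_image[OF that, of x] by simp
    moreover have "\<not> x \<le> a \<Longrightarrow> \<tau> x = x" using that by (simp add: permutes_not_in)
    ultimately show ?thesis by (auto simp: hat_def shiftz_def)
  qed
  show tt: "\<tau> = \<tau>'" 
  proof
    fix x
    show "\<tau> x = \<tau>' x"
      by (rule trans[OF *[OF t(1), of x \<upsilon>, unfolded eq] *[OF t(2), of x \<upsilon>', symmetric]])
  qed
  have "hat a \<upsilon> = hat a \<upsilon>'"
  proof
    fix y
    have "\<tau>' (inv \<tau>' y) = y" using t by (simp add: permutes_inverses)
    then show "hat a \<upsilon> y = hat a \<upsilon>' y" using fun_cong[OF eq, of "inv \<tau>' y"] tt by simp
  qed
  then show "\<upsilon> = \<upsilon>'" 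
  proof (intro ext)
    fix y assume h: "hat a \<upsilon> = hat a \<upsilon>'"
    show "\<upsilon> y = \<upsilon>' y" using fun_cong[OF h, of "shiftz a y"] by (metis hat_shiftz shiftz_minus)
  qed
qed

lemma cyc_hat_comp:
  assumes "\<tau> permutes {0..a}" "\<upsilon> permutes {0..b}"
  shows "cyc (hat a \<upsilon> \<circ> \<tau>) {0..a + b} + 1 = cyc \<tau> {0..a} + cyc \<upsilon> {0..b}"
proof -
  have eq: "{0..a} \<inter> insert 0 {a + 1..a + b} = {0}" "{0..a} \<union> insert 0 {a + 1..a + b} = {0..a + b}"
    by auto
  show ?thesis
    using cyc_comp[OF assms(1) _ _ _ hat_permutes[OF assms(2), of a]] cyc_hat[OF assms(2), of a]
    unfolding eq by simp
qed

lemma cyc_hat_comp':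
  assumes "\<sigma> permutes {1..a}" "\<sigma>' permutes {1..b}"
  shows "cyc (hat a \<sigma>' \<circ> \<sigma>) {1..a + b} = cyc \<sigma> {1..a} + cyc \<sigma>' {1..b}"
proof -
  have eq: "{1..a} \<inter> {a + 1..a + b} = {}" "{1..a} \<union> {a + 1..a + b} = {1..a + b}"
    by auto
  show ?thesis
    using cyc_comp[OF assms(1) _ _ _ hat_permutes'[OF assms(2), of a]] cyc_hat'[OF assms(2), of a]
    unfolding eq by simp
qed

lemma hat_comp_permutes:
  assumes "\<tau> permutes {0..a}" "\<upsilon> permutes {0..b}"
  shows "hat a \<upsilon> \<circ> \<tau> permutes {0..a + b}"
  using assms(1) hat_permutes[OF assms(2), of a]
  by (intro permutes_compose) (auto intro: permutes_subset)

lemma hat_comp_permutes':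
  assumes "\<sigma> permutes {1..a}" "\<sigma>' permutes {1..b}"
  shows "hat a \<sigma>' \<circ> \<sigma> permutes {1..a + b}"
  using assms(1) hat_permutes'[OF assms(2), of a]
  by (intro permutes_compose) (auto intro: permutes_subset)

lemma hat_comp_exists':
  assumes r: "\<rho> permutes {1..a + b}" and cut: "\<And>x. x \<in> {a + 1..a + b} \<Longrightarrow> \<rho> x \<notin> {1..a}"
  obtains \<tau> \<upsilon> where "\<tau> permutes {1..a}" "\<upsilon> permutes {1..b}" "\<rho> = hat a \<upsilon> \<circ> \<tau>"
proof -
  have "\<rho> permutes {0..a + b}" using r by (rule permutes_subset) auto
  then obtain \<tau> \<upsilon> where h: "\<tau> permutes {0..a}" "\<upsilon> permutes {0..b}" "\<rho> = hat a \<upsilon> \<circ> \<tau>"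
    using hat_comp_exists[of \<rho> a b] cut by blast
  have r0: "hat a \<upsilon> (\<tau> 0) = 0" using r h(3) permutes_not_in[OF r, of 0] by simp
  have "\<tau> 0 \<le> a" using permutes_in_image[OF h(1), of 0] by simp
  then have t0: "\<tau> 0 = 0" using r0 hat_le[of "\<tau> 0" a \<upsilon>] by (cases "\<tau> 0 = 0") auto
  then have "\<upsilon> 0 = 0" using r0 by (simp add: hat_def shiftz_def split: if_splits)
  then show ?thesis using that h t0 by (blast intro: permutes_zero_fixed)
qed

section \<open>Factorization cuts as products\<close>

text \<open>The common form of the conditions (a) and (b) for a factorization cut: nothing behind the cut is
sent in front of it, except to the root.\<close>

definition uncrossed :: "nat \<Rightarrow> nat \<Rightarrow> (nat \<Rightarrow> nat) \<Rightarrow> bool" where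
  "uncrossed c s f \<longleftrightarrow> (\<forall>x\<in>{c + 1..s}. f x \<notin> {1..c})"

lemma image_initial_iff_uncrossed:
  assumes p: "\<sigma> permutes {1..s}" and c: "c \<le> s"
  shows "\<sigma> ` {1..c} = {1..c} \<longleftrightarrow> uncrossed c s \<sigma>"
proof
  assume eq: "\<sigma> ` {1..c} = {1..c}"
  show "uncrossed c s \<sigma>" unfolding uncrossed_def
  proof (intro ballI notI)
    fix x assume x: "x \<in> {c + 1..s}" "\<sigma> x \<in> {1..c}"
    then obtain y where "y \<in> {1..c}" "\<sigma> y = \<sigma> x" using eq by (metis imageE)
    then show False using x inj_eq[OF permutes_inj[OF p]] by auto
  qed
next
  assume u: "uncrossed c s \<sigma>"
  have "{1..c} \<subseteq> \<sigma> ` {1..c}"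
  proof
    fix y assume y: "y \<in> {1..c}"
    then have "y \<in> \<sigma> ` {1..s}" using permutes_image[OF p] c by auto
    then obtain x where x: "x \<in> {1..s}" "y = \<sigma> x" by blast
    then have "x \<notin> {c + 1..s}" using u y unfolding uncrossed_def by blast
    then show "y \<in> \<sigma> ` {1..c}" using x by auto
  qed
  moreover have "card (\<sigma> ` {1..c}) \<le> card {1..c}" by (rule card_image_le) simp
  ultimately show "\<sigma> ` {1..c} = {1..c}" using card_seteq[of "\<sigma> ` {1..c}" "{1..c}"] by simp
qed

lemma root_word_facts:
  assumes p: "\<tau> permutes {0..s}"
  defines "d \<equiv> card (orbit \<tau> 0)"
  shows "length (root_word \<tau>) = d - 1" "\<And>i. i < d - 1 \<Longrightarrow> root_word \<tau> ! i = (\<tau> ^^ Suc i) 0"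
    "\<And>i. 0 < i \<Longrightarrow> i < d \<Longrightarrow> (\<tau> ^^ i) 0 \<noteq> 0" "(\<tau> ^^ d) 0 = 0" "orbit \<tau> 0 = (\<lambda>i. (\<tau> ^^ i) 0) ` {0..<d}" "0 < d"
proof -
  have self: "0 \<in> orbit \<tau> 0" using p by (rule perm_self_in_orbit) simp
  let ?f = "funpow_dist1 \<tau> 0 0"
  have orb: "orbit \<tau> 0 = (\<lambda>i. (\<tau> ^^ i) 0) ` {0..<?f}" by (rule orbit_conv_funpow_dist1[OF self])
  have "inj_on (\<lambda>i. (\<tau> ^^ i) 0) {0..<?f}" using self by (rule inj_on_funpow_dist1)
  then have d: "d = ?f" unfolding d_def by (subst orb) (simp add: card_image)
  show "length (root_word \<tau>) = d - 1" by (simp add: root_word_def d_def)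
  show "root_word \<tau> ! i = (\<tau> ^^ Suc i) 0" if "i < d - 1" for i
    using that by (simp add: root_word_def d_def)
  show "(\<tau> ^^ i) 0 \<noteq> 0" if "0 < i" "i < d" for i
    using funpow_dist1_least[of i \<tau> 0 0] that unfolding d by blast
  show "(\<tau> ^^ d) 0 = 0" unfolding d using funpow_dist1_prop[OF self] .
  show "orbit \<tau> 0 = (\<lambda>i. (\<tau> ^^ i) 0) ` {0..<d}" unfolding d by (rule orb)
  show "0 < d" unfolding d by simp
qed

text \<open>A nonroot cycle that meets both sides of the cut must pass from the right side to the left
somewhere. In the root cycle such a step, with both ends different from the root, exists iff some
letter behind the cut precedes one in front of it.\<close>

lemma root_condition_iff_uncrossed:
  assumes p: "\<tau> permutes {0..s}"
  shows "(\<forall>C \<in> perm_cycles \<tau> {0..s}. 0 \<notin> C \<longrightarrow> C \<subseteq> {1..c} \<or> C \<subseteq> {c + 1..s}) \<and>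
     (\<forall>i j. i < length (root_word \<tau>) \<and> j < length (root_word \<tau>) \<and>
        root_word \<tau> ! i \<le> c \<and> c < root_word \<tau> ! j \<longrightarrow> i < j) \<longleftrightarrow> uncrossed c s \<tau>"
    (is "?A \<and> ?B \<longleftrightarrow> _")
proof
  note rw = root_word_facts[OF p]
  let ?d = "card (orbit \<tau> 0)"
  {
    assume AB: "?A \<and> ?B"
    show "uncrossed c s \<tau>" unfolding uncrossed_def
    proof (intro ballI notI)
      fix x assume x: "x \<in> {c + 1..s}" "\<tau> x \<in> {1..c}"
      have self: "x \<in> orbit \<tau> x" using p by (rule perm_self_in_orbit) simp
      show False
      proof (cases "0 \<in> orbit \<tau> x")
        case False
        have "orbit \<tau> x \<in> perm_cycles \<tau> {0..s}" unfolding perm_cycles_def using x by (intro imageI) auto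
        then have "orbit \<tau> x \<subseteq> {1..c} \<or> orbit \<tau> x \<subseteq> {c + 1..s}" using AB False by blast
        moreover have "\<tau> x \<in> orbit \<tau> x" by (rule orbit.base)
        ultimately show False using x self by (auto dest: subsetD)
      next
        case True
        then have "orbit \<tau> 0 = orbit \<tau> x" by (intro orbit_eq_perm[OF p]) auto
        then have "x \<in> (\<lambda>i. (\<tau> ^^ i) 0) ` {0..<?d}" using self rw(5) by simp
        then obtain m where m: "m < ?d" "x = (\<tau> ^^ m) 0" by auto
        have "m \<noteq> 0" using m x by (intro notI) auto
        have tx: "\<tau> x = (\<tau> ^^ Suc m) 0" using m by simp
        have "Suc m \<noteq> ?d" using rw(4) tx x by (intro notI) auto
        then have "m < ?d - 1" using m by simp
        have "root_word \<tau> ! m = \<tau> x" unfolding rw(2)[OF \<open>m < ?d - 1\<close>] tx ..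
        moreover have "root_word \<tau> ! (m - 1) = x"
        proof -
          have "m - 1 < ?d - 1" "Suc (m - 1) = m" using \<open>m < ?d - 1\<close> \<open>m \<noteq> 0\<close> by simp_all
          then show ?thesis using rw(2)[of "m - 1"] m(2) by argo
        qed
        moreover have "m < length (root_word \<tau>)" "m - 1 < length (root_word \<tau>)"
          using \<open>m < ?d - 1\<close> unfolding rw(1) by simp_all
        moreover have "\<tau> x \<le> c" "c < x" using x by simp_all
        ultimately have "m < m - 1" using conjunct2[OF AB, rule_format, of m "m - 1"] by argo
        then show False by simp
      qed
    qed
  next
    assume u: "uncrossed c s \<tau>"
    have step: "\<tau> x \<in> {c + 1..s}" if "x \<in> {c + 1..s}" "\<tau> x \<noteq> 0" for x
    proof -
      have "\<tau> x \<in> {0..s}" using permutes_in_image[OF p, of x] that by simp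
      moreover have "\<tau> x \<notin> {1..c}" using u that unfolding uncrossed_def by blast
      ultimately show ?thesis using that by auto
    qed
    show "?A \<and> ?B"
    proof (intro conjI ballI impI allI)
      fix C assume C: "C \<in> perm_cycles \<tau> {0..s}" "0 \<notin> C"
      then obtain y where y: "y \<in> {0..s}" "C = orbit \<tau> y" by (auto simp: perm_cycles_def)
      have Cs: "C \<subseteq> {0..s}" using y permutes_orbit_subset[OF p] by blast
      show "C \<subseteq> {1..c} \<or> C \<subseteq> {c + 1..s}"
      proof (cases "\<exists>x\<in>C. x > c")
        case True
        then obtain x where x: "x \<in> C" "x > c" by blast
        then have Cx: "C = orbit \<tau> x" using y orbit_eq_perm[OF p] by simp
        have "orbit \<tau> x \<subseteq> C \<inter> {c + 1..s}"
        proof (rule orbit_subset_closed)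
          show "x \<in> C \<inter> {c + 1..s}" using x Cs by auto
          fix z assume z: "z \<in> C \<inter> {c + 1..s}"
          then have "\<tau> z \<in> C" unfolding Cx by (blast intro: orbit.step)
          moreover from this have "\<tau> z \<noteq> 0" using C(2) by (intro notI) simp
          ultimately show "\<tau> z \<in> C \<inter> {c + 1..s}" using step z by blast
        qed
        then show ?thesis using Cx by blast
      next
        case False
        have "x \<in> {1..c}" if "x \<in> C" for x
        proof -
          have "x \<noteq> 0" using that C(2) by (intro notI) simp
          then show ?thesis using that False by (auto simp: not_less)
        qed
        then show ?thesis by blast
      qed
    next
      fix i j assume ij: "i < length (root_word \<tau>) \<and> j < length (root_word \<tau>) \<and>
        root_word \<tau> ! i \<le> c \<and> c < root_word \<tau> ! j"
      have in_s: "root_word \<tau> ! k \<in> {0..s}" if "k < length (root_word \<tau>)" for k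
      proof -
        have "(\<tau> ^^ Suc k) 0 \<in> orbit \<tau> 0" by (rule funpow_in_orbit[OF perm_self_in_orbit[OF p]]) simp
        then have "(\<tau> ^^ Suc k) 0 \<in> {0..s}" using permutes_orbit_subset[OF p, of 0] by (rule subsetD[rotated]) simp
        then show ?thesis using rw(2)[of k] that unfolding rw(1) by simp
      qed
      have "root_word \<tau> ! (j + k) > c" if "j + k < length (root_word \<tau>)" for k
        using that
      proof (induction k)
        case 0
        then show ?case using ij by simp
      next
        case (Suc k)
        have r: "root_word \<tau> ! (j + Suc k) = \<tau> (root_word \<tau> ! (j + k))"
          using rw(2)[of "j + k"] rw(2)[of "j + Suc k"] Suc.prems unfolding rw(1) by simp
        have "root_word \<tau> ! (j + Suc k) \<noteq> 0"
          using rw(2)[of "j + Suc k"] rw(3)[of "Suc (j + Suc k)"] Suc.prems unfolding rw(1) by simp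
        moreover have "root_word \<tau> ! (j + k) \<in> {c + 1..s}" using Suc in_s[of "j + k"] by simp
        ultimately show ?case using step[of "root_word \<tau> ! (j + k)"] r by simp
      qed
      note gt = this
      show "i < j"
      proof (rule ccontr)
        assume "\<not> i < j"
        then have "j + (i - j) = i" by simp
        then show False using gt[of "i - j"] ij by simp
      qed
    qed
  }
qed

lemma length_zigzag: "length (zigzag n) = (n + 1) div 2"
  by (cases "odd n") (auto simp: zigzag_def elim!: oddE)

lemma cuts_zigzag: "cuts (zigzag n) = {2 * m |m. 1 \<le> m \<and> 2 * m < n}"
proof -
  have "sum_list (take i (zigzag n)) = 2 * i" if "i < (n + 1) div 2" for i
  proof -
    have "i \<le> n div 2" using that by linarith
    then show ?thesis by (simp add: zigzag_def sum_list_replicate min_absorb1)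
  qed
  then have "cuts (zigzag n) = (\<lambda>i. 2 * i) ` {1..<(n + 1) div 2}"
    unfolding cuts_def length_zigzag by (intro image_cong) auto
  also have "\<dots> = {2 * m |m. 1 \<le> m \<and> 2 * m < n}" by (auto simp: image_iff)
  finally show ?thesis .
qed

text \<open>All conditions on a cut in the form in which they can be tested on a product.\<close>

lemma in_factor_cuts:
  assumes "\<theta> \<in> decos n"
  shows "y \<in> factor_cuts n \<theta> \<longleftrightarrow> even y \<and> 0 < y \<and> y < n \<and>
    uncrossed (y div 2) ((n + 1) div 2) (fst \<theta>) \<and> uncrossed (y div 2) (n div 2) (snd \<theta>)"
proof -
  have p: "fst \<theta> permutes {1..(n + 1) div 2}" "snd \<theta> permutes {0..n div 2}"
    using assms by (auto simp: decos_def)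
  have cz: "y \<in> cuts (zigzag n) \<longleftrightarrow> even y \<and> 0 < y \<and> y < n"
    unfolding cuts_zigzag by (auto elim!: evenE)
  show ?thesis
  proof (cases "even y \<and> 0 < y \<and> y < n")
    case True
    then have "(y + 1) div 2 = y div 2" "y div 2 \<le> (n + 1) div 2" by auto
    then show ?thesis
      unfolding factor_cuts_def mem_Collect_eq cz
      using root_condition_iff_uncrossed[OF p(2), of "y div 2"] image_initial_iff_uncrossed[OF p(1), of "y div 2"] True
      by simp
  next
    case False
    then show ?thesis unfolding factor_cuts_def mem_Collect_eq cz by blast
  qed
qed

abbreviation scyc :: "nat \<Rightarrow> deco \<Rightarrow> nat" where
  "scyc n \<theta> \<equiv> cyc (fst \<theta>) {1..(n + 1) div 2}"

lemma deco_prod_eq: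
  assumes "\<xi> \<in> decos (2 * c)" "\<xi>' \<in> decos m"
  shows "deco_prod (2 * c) \<xi> \<xi>' = (hat c (fst \<xi>') \<circ> fst \<xi>, hat c (snd \<xi>') \<circ> snd \<xi>)"
  using assms oplus_eq_hat[of "fst \<xi>" c "fst \<xi>'"] star_eq_hat[of "snd \<xi>" c]
  by (auto simp: deco_prod_def decos_def)

lemma half_add: "(2 * c + m + 1) div 2 = c + (m + 1) div 2" "(2 * c + m) div 2 = c + m div 2"
  "Suc (2 * c + m) div 2 = c + Suc m div 2"
  for c m :: nat by auto

lemma deco_prod_in:
  assumes "\<xi> \<in> decos (2 * c)" "\<xi>' \<in> decos m"
  shows "deco_prod (2 * c) \<xi> \<xi>' \<in> decos (2 * c + m)"
  using assms hat_comp_permutes'[of "fst \<xi>" c "fst \<xi>'" "(m + 1) div 2"]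
    hat_comp_permutes[of "snd \<xi>" c "snd \<xi>'" "m div 2"]
  unfolding deco_prod_eq[OF assms] by (auto simp: decos_def half_add)

text \<open>The size of the left factor must be known here: a decoration can have several factorizations.\<close>

lemma deco_prod_inj:
  assumes "\<xi> \<in> decos (2 * c)" "\<xi>' \<in> decos m" "\<zeta> \<in> decos (2 * c)" "\<zeta>' \<in> decos m'"
    and "deco_prod (2 * c) \<xi> \<xi>' = deco_prod (2 * c) \<zeta> \<zeta>'"
  shows "\<xi> = \<zeta>" "\<xi>' = \<zeta>'"
proof -
  have p: "fst \<xi> permutes {0..c}" "snd \<xi> permutes {0..c}" "fst \<zeta> permutes {0..c}" "snd \<zeta> permutes {0..c}"
    using assms(1,3) by (auto simp: decos_def intro: permutes_subset)
  have eq: "hat c (fst \<xi>') \<circ> fst \<xi> = hat c (fst \<zeta>') \<circ> fst \<zeta>" "hat c (snd \<xi>') \<circ> snd \<xi> = hat c (snd \<zeta>') \<circ> snd \<zeta>"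
    using assms(5) unfolding deco_prod_eq[OF assms(1,2)] deco_prod_eq[OF assms(3,4)] by auto
  show "\<xi> = \<zeta>" "\<xi>' = \<zeta>'"
    using hat_comp_inj[OF p(1,3) eq(1)] hat_comp_inj[OF p(2,4) eq(2)] by (auto intro: prod_eqI)
qed

lemma deco_prod_surj:
  assumes t: "\<theta> \<in> decos (2 * c + m)"
    and u: "uncrossed c (c + (m + 1) div 2) (fst \<theta>)" "uncrossed c (c + m div 2) (snd \<theta>)"
  obtains \<xi> \<xi>' where "\<xi> \<in> decos (2 * c)" "\<xi>' \<in> decos m" "\<theta> = deco_prod (2 * c) \<xi> \<xi>'"
proof -
  obtain \<sigma> \<sigma>' where s: "\<sigma> permutes {1..c}" "\<sigma>' permutes {1..(m + 1) div 2}" "fst \<theta> = hat c \<sigma>' \<circ> \<sigma>"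
  proof (rule hat_comp_exists')
    show "fst \<theta> permutes {1..c + (m + 1) div 2}" using t by (auto simp: decos_def half_add)
    show "\<And>x. x \<in> {c + 1..c + (m + 1) div 2} \<Longrightarrow> fst \<theta> x \<notin> {1..c}" using u(1) unfolding uncrossed_def by blast
  qed
  obtain \<tau> \<upsilon> where t: "\<tau> permutes {0..c}" "\<upsilon> permutes {0..m div 2}" "snd \<theta> = hat c \<upsilon> \<circ> \<tau>"
  proof (rule hat_comp_exists)
    show "snd \<theta> permutes {0..c + m div 2}" using t by (auto simp: decos_def half_add)
    show "\<And>x. x \<in> {c + 1..c + m div 2} \<Longrightarrow> snd \<theta> x \<notin> {1..c}" using u(2) unfolding uncrossed_def by blast
  qed
  have d: "(\<sigma>, \<tau>) \<in> decos (2 * c)" "(\<sigma>', \<upsilon>) \<in> decos m" using s t by (auto simp: decos_def)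
  show ?thesis by (rule that[OF d]) (use s t in \<open>simp add: deco_prod_eq[OF d] prod_eq_iff\<close>)
qed

lemma uncrossed_hat_comp:
  assumes "\<tau> permutes {0..c}"
  shows "uncrossed (c + d) (c + s) (hat c \<upsilon> \<circ> \<tau>) \<longleftrightarrow> uncrossed d s \<upsilon>"
proof -
  have *: "(hat c \<upsilon> \<circ> \<tau>) (c + y) \<in> {1..c + d} \<longleftrightarrow> \<upsilon> y \<in> {1..d}" if "y \<in> {d + 1..s}" for y
  proof -
    have "\<tau> (c + y) = c + y" using assms that by (simp add: permutes_not_in)
    then have "(hat c \<upsilon> \<circ> \<tau>) (c + y) = shiftz c (\<upsilon> y)" using that by (simp add: hat_gt)
    then show ?thesis by (auto simp: shiftz_def)
  qed
  have "{c + d + 1..c + s} = (+) c ` {d + 1..s}" by (simp add: add.assoc)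
  then show ?thesis unfolding uncrossed_def using * by (simp only: ball_simps) blast
qed

text \<open>Cuts behind the junction are seen by the right factor alone, because the left factor moves only
letters in front of the junction and the root.\<close>

lemma factor_cuts_deco_prod:
  assumes x: "\<xi> \<in> decos (2 * c)" "\<xi>' \<in> decos m" and y: "0 < y"
  shows "2 * c + y \<in> factor_cuts (2 * c + m) (deco_prod (2 * c) \<xi> \<xi>') \<longleftrightarrow> y \<in> factor_cuts m \<xi>'"
proof -
  have p: "fst \<xi> permutes {0..c}" "snd \<xi> permutes {0..c}"
    using x(1) by (auto simp: decos_def intro: permutes_subset)
  show ?thesis
    unfolding in_factor_cuts[OF deco_prod_in[OF x]] in_factor_cuts[OF x(2)]
    unfolding deco_prod_eq[OF x] fst_conv snd_conv half_add
      uncrossed_hat_comp[OF p(1)] uncrossed_hat_comp[OF p(2)] using y by auto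
qed

lemma factor_cuts_deco_prod_self:
  assumes x: "\<xi> \<in> decos (2 * c)" "\<xi>' \<in> decos m" and "0 < c" "0 < m"
  shows "2 * c \<in> factor_cuts (2 * c + m) (deco_prod (2 * c) \<xi> \<xi>')"
proof -
  have p: "fst \<xi> permutes {0..c}" "snd \<xi> permutes {0..c}"
    using x(1) by (auto simp: decos_def intro: permutes_subset)
  show ?thesis
    unfolding in_factor_cuts[OF deco_prod_in[OF x]]
    using assms hat_comp_notin[OF p(1)] hat_comp_notin[OF p(2)]
    by (auto simp: deco_prod_eq[OF x] uncrossed_def)
qed

lemma scyc_deco_prod:
  assumes x: "\<xi> \<in> decos (2 * c)" "\<xi>' \<in> decos m"
  shows "scyc (2 * c + m) (deco_prod (2 * c) \<xi> \<xi>') = scyc (2 * c) \<xi> + scyc m \<xi>'"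
  using assms cyc_hat_comp'[of "fst \<xi>" c "fst \<xi>'" "(m + 1) div 2"]
  unfolding deco_prod_eq[OF x] half_add by (auto simp: decos_def)

lemma scyc_le: "scyc n \<xi> \<le> (n + 1) div 2"
  using card_image_le[of "{1..(n + 1) div 2}" "orbit (fst \<xi>)"] by simp

lemma scyc_pos: "0 < n \<Longrightarrow> 0 < scyc n \<xi>"
  by (rule cyc_pos) auto

lemma deg_q_deco_prod:
  assumes x: "\<xi> \<in> decos (2 * c)" "\<xi>' \<in> decos m"
  shows "deg_q (2 * c + m) (deco_prod (2 * c) \<xi> \<xi>') = deg_q (2 * c) \<xi> + deg_q m \<xi>'"
  using scyc_deco_prod[OF x] scyc_le[where n = "2 * c" and \<xi> = \<xi>] scyc_le[where n = m and \<xi> = \<xi>']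
  unfolding deg_q_def perm_cycles_def half_add by simp

text \<open>The two root cycles fuse into one, which the summand \<open>-1\<close> in the degree compensates.\<close>

lemma deg_t_deco_prod:
  assumes x: "\<xi> \<in> decos (2 * c)" "\<xi>' \<in> decos m"
  shows "deg_t (2 * c + m) (deco_prod (2 * c) \<xi> \<xi>') = deg_t (2 * c) \<xi> + deg_t m \<xi>'"
proof -
  have p: "snd \<xi> permutes {0..c}" "snd \<xi>' permutes {0..m div 2}" using x by (auto simp: decos_def)
  have arith: "s = k + l \<Longrightarrow> x + 1 = u + v \<Longrightarrow> 0 < u \<Longrightarrow> 0 < v \<Longrightarrow> s + x - 1 = (k + u - 1) + (l + v - 1)"
    for s k l x u v :: nat by simp
  have pos: "cyc (snd \<xi>) {0..2 * c div 2} > 0" "cyc (snd \<xi>') {0..m div 2} > 0" by (rule cyc_pos; simp)+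
  have "cyc (snd (deco_prod (2 * c) \<xi> \<xi>')) {0..(2 * c + m) div 2} + 1 =
    cyc (snd \<xi>) {0..2 * c div 2} + cyc (snd \<xi>') {0..m div 2}"
    using cyc_hat_comp[OF p] unfolding deco_prod_eq[OF x] by (simp add: half_add)
  from arith[OF scyc_deco_prod[OF x] this pos] show ?thesis
    unfolding deg_t_def perm_cycles_def .
qed

lemma decos_0: "decos 0 = {(id, id)}"
  by (auto simp: decos_def permutes_sing)

lemma deco_prod_unit:
  assumes "\<xi> \<in> decos n"
  shows "deco_prod n \<xi> (id, id) = \<xi>"
proof -
  have p: "fst \<xi> permutes {1..(n + 1) div 2}" "snd \<xi> permutes {0..n div 2}"
    using assms by (auto simp: decos_def)
  have "hat a id = id" for a by (rule ext) (auto simp: hat_def shiftz_def)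
  then show ?thesis
    using oplus_eq_hat[OF p(1), of id 0] star_eq_hat[OF p(2), of id]
    by (simp add: deco_prod_def prod_eq_iff)
qed

section \<open>Compositions and their cuts\<close>

lemma composition_Cons [simp]: "composition n (b # bs) \<longleftrightarrow> 0 < b \<and> b \<le> n \<and> composition (n - b) bs"
  by (auto simp: composition_def)

lemma composition_Nil [simp]: "composition n [] \<longleftrightarrow> n = 0"
  by (auto simp: composition_def)

lemma cuts_single [simp]: "cuts [b] = {}" and cuts_Nil [simp]: "cuts [] = {}"
  by (auto simp: cuts_def)

lemma cuts_Cons:
  assumes "bs \<noteq> []"
  shows "cuts (b # bs) = insert b ((+) b ` cuts bs)"
proof -
  have "{1..<length (b # bs)} = insert 1 (Suc ` {1..<length bs})"
    using assms by (auto simp: image_iff)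
  then show ?thesis unfolding cuts_def by (simp only: image_insert image_image) simp
qed

lemma cuts_subset: "composition n \<alpha> \<Longrightarrow> cuts \<alpha> \<subseteq> {1..<n}"
proof (induction \<alpha> arbitrary: n)
  case (Cons b bs)
  show ?case
  proof (cases "bs = []")
    case False
    then have "n - b \<noteq> 0" using Cons.prems by (cases bs) auto
    then show ?thesis using Cons.IH[of "n - b"] Cons.prems False by (fastforce simp: cuts_Cons)
  qed simp
qed simp

lemma finite_cuts [simp]: "finite (cuts \<alpha>)"
  by (simp add: cuts_def)

lemma card_cuts: "composition n \<alpha> \<Longrightarrow> card (cuts \<alpha>) = length \<alpha> - 1"
proof (induction \<alpha> arbitrary: n)
  case (Cons b bs)
  show ?case
  proof (cases "bs = []")
    case False
    have "0 \<notin> cuts bs" using cuts_subset[of "n - b" bs] Cons.prems by auto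
    then have "b \<notin> (+) b ` cuts bs" by auto
    moreover have "length bs - 1 + 1 = length bs" using False by (cases bs) auto
    ultimately show ?thesis using Cons.IH[of "n - b"] Cons.prems False by (simp add: cuts_Cons card_image)
  qed simp
qed simp

lemma cuts_inject:
  "composition n \<alpha> \<Longrightarrow> composition n \<beta> \<Longrightarrow> cuts \<alpha> = cuts \<beta> \<Longrightarrow> \<alpha> = \<beta>"
proof (induction \<alpha> arbitrary: n \<beta>)
  case Nil
  then show ?case by (cases \<beta>) auto
next
  case (Cons a as)
  obtain b bs where b: "\<beta> = b # bs" using Cons.prems by (cases \<beta>) auto
  have e: "cs = [] \<longleftrightarrow> cuts (c # cs) = {}" for c cs by (cases "cs = []") (auto simp: cuts_Cons)
  show ?case
  proof (cases "as = []")
    case True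
    then have "bs = []" using e b Cons.prems(3) by metis
    then show ?thesis using True Cons.prems b by auto
  next
    case False
    then have bs: "bs \<noteq> []" using e b Cons.prems(3) by metis
    have pos: "\<forall>x\<in>cuts as. 0 < x" "\<forall>x\<in>cuts bs. 0 < x"
      using cuts_subset[of "n - a" as] cuts_subset[of "n - b" bs] Cons.prems b by auto
    have eq: "insert a ((+) a ` cuts as) = insert b ((+) b ` cuts bs)"
      using Cons.prems(3) False bs b by (simp add: cuts_Cons)
    have "a = b"
    proof (rule ccontr)
      assume "a \<noteq> b"
      then have "a \<in> (+) b ` cuts bs" "b \<in> (+) a ` cuts as"
        using eq by (metis insertE insertI1)+
      then show False using pos by fastforce
    qed
    moreover have "cuts as = cuts bs"
    proof -
      have "a \<notin> (+) a ` cuts as" "b \<notin> (+) b ` cuts bs" using pos by auto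
      then have "(+) a ` cuts as = (+) a ` cuts bs" using eq \<open>a = b\<close> by (metis insert_ident)
      then show ?thesis by (simp add: inj_image_eq_iff)
    qed
    ultimately show ?thesis using Cons.IH[of "n - a" bs] Cons.prems b by auto
  qed
qed

lemma composition_exists:
  assumes "S \<subseteq> {1..<n}"
  shows "\<exists>\<alpha>. composition n \<alpha> \<and> cuts \<alpha> = S"
  using assms
proof (induction n arbitrary: S rule: less_induct)
  case (less n)
  have fin: "finite S" using less.prems finite_subset by blast
  show ?case
  proof (cases "S = {}")
    case True
    then show ?thesis by (intro exI[of _ "if n = 0 then [] else [n]"]) auto
  next
    case False
    define a where "a = Min S"
    have a: "a \<in> S" "\<And>x. x \<in> S \<Longrightarrow> a \<le> x" using fin False by (auto simp: a_def)
    define S' where "S' = (\<lambda>x. x - a) ` (S - {a})"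
    have "S' \<subseteq> {1..<n - a}" using a less.prems by (force simp: S'_def subset_iff)
    moreover have an: "0 < a" "a < n" using a(1) less.prems by auto
    ultimately obtain \<alpha> where al: "composition (n - a) \<alpha>" "cuts \<alpha> = S'" using less.IH[of "n - a" S'] by auto
    have ne: "\<alpha> \<noteq> []" using al an by auto
    have "(+) a ` S' = S - {a}" using a(2) by (force simp: S'_def image_image image_iff)
    then have "cuts (a # \<alpha>) = S" using ne al a by (auto simp: cuts_Cons)
    then show ?thesis using al an by (intro exI[of _ "a # \<alpha>"]) auto
  qed
qed

lemma comp_of_cuts_cuts: "composition n \<alpha> \<Longrightarrow> comp_of_cuts n (cuts \<alpha>) = \<alpha>"
  unfolding comp_of_cuts_def by (rule the_equality) (auto intro: cuts_inject)

lemma bij_betw_cuts: "S \<subseteq> {1..<n} \<Longrightarrow> bij_betw cuts {\<gamma>. composition n \<gamma> \<and> cuts \<gamma> \<subseteq> S} (Pow S)"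
  unfolding bij_betw_def inj_on_def using cuts_inject composition_exists[of _ n]
  by (auto simp: image_iff) (metis subset_trans)

lemma finite_compositions: "finite {\<gamma>. composition n \<gamma>}"
proof -
  have "bij_betw cuts {\<gamma>. composition n \<gamma> \<and> cuts \<gamma> \<subseteq> {1..<n}} (Pow {1..<n})"
    by (rule bij_betw_cuts) simp
  moreover have "{\<gamma>. composition n \<gamma> \<and> cuts \<gamma> \<subseteq> {1..<n}} = {\<gamma>. composition n \<gamma>}" using cuts_subset by blast
  ultimately show ?thesis using bij_betw_finite by fastforce
qed

section \<open>Lists of decorations and defect zero\<close>

fun total :: "nat list \<Rightarrow> deco list \<Rightarrow> deco" where
  "total (b # bs) (x # xs) = deco_prod b x (total bs xs)"
| "total _ _ = (id, id)"

definition deco_lists :: "nat list \<Rightarrow> deco list set" where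
  "deco_lists \<beta> = {xs. list_all2 (\<lambda>b x. x \<in> decos b) \<beta> xs}"

lemma deco_lists_Nil [simp]: "deco_lists [] = {[]}"
  by (auto simp: deco_lists_def)

lemma deco_lists_Cons: "deco_lists (b # bs) = (\<lambda>(x, xs). x # xs) ` (decos b \<times> deco_lists bs)"
  by (auto simp: deco_lists_def list_all2_Cons1)

lemma finite_decos [simp]: "finite (decos n)"
proof -
  have "decos n = {\<sigma>. \<sigma> permutes {1..(n + 1) div 2}} \<times> {\<tau>. \<tau> permutes {0..n div 2}}"
    by (auto simp: decos_def)
  then show ?thesis by (simp add: finite_permutations)
qed

lemma finite_deco_lists [simp]: "finite (deco_lists \<beta>)"
  by (induction \<beta>) (auto simp: deco_lists_Cons)

lemma length_deco_lists: "xs \<in> deco_lists \<beta> \<Longrightarrow> length xs = length \<beta>"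
  by (auto simp: deco_lists_def list_all2_lengthD)

definition lsum :: "(nat \<Rightarrow> deco \<Rightarrow> nat) \<Rightarrow> nat list \<Rightarrow> deco list \<Rightarrow> nat" where
  "lsum f \<beta> xs = sum_list (map2 f \<beta> xs)"

lemma lsum_Cons [simp]: "lsum f (b # bs) (x # xs) = f b x + lsum f bs xs"
  by (simp add: lsum_def)

lemma lsum_Nil [simp]: "lsum f [] xs = 0"
  by (simp add: lsum_def)

lemma scyc_0 [simp]: "scyc 0 \<xi> = 0" by simp

lemma deg_q_0 [simp]: "deg_q 0 \<xi> = 0" by (simp add: deg_q_def)

lemma deg_t_0 [simp]: "deg_t 0 \<xi> = 0" by (simp add: deg_t_def perm_cycles_def)

text \<open>Being coarser than the zigzag composition means that all cuts are even, which is the same as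
all parts but the last being even (\<open>coarser_zigzag_iff\<close>).\<close>

abbreviation even_init :: "nat list \<Rightarrow> bool" where
  "even_init \<beta> \<equiv> \<forall>b\<in>set (butlast \<beta>). even b"

lemma total_degrees:
  assumes "composition n \<beta>" "even_init \<beta>" "xs \<in> deco_lists \<beta>"
  shows "total \<beta> xs \<in> decos n" "scyc n (total \<beta> xs) = lsum scyc \<beta> xs"
    "deg_t n (total \<beta> xs) = lsum deg_t \<beta> xs" "deg_q n (total \<beta> xs) = lsum deg_q \<beta> xs"
proof -
  have "total \<beta> xs \<in> decos n \<and> scyc n (total \<beta> xs) = lsum scyc \<beta> xs \<and>
    deg_t n (total \<beta> xs) = lsum deg_t \<beta> xs \<and> deg_q n (total \<beta> xs) = lsum deg_q \<beta> xs"
    using assms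
  proof (induction \<beta> arbitrary: n xs)
    case Nil
    then have "n = 0" by simp
    then show ?case by (simp add: decos_0 lsum_def del: One_nat_def)
  next
    case (Cons b bs)
    obtain x ys where x: "xs = x # ys" "x \<in> decos b" "ys \<in> deco_lists bs"
      using Cons.prems(3) by (auto simp: deco_lists_Cons)
    have c: "composition (n - b) bs" "b \<le> n" "0 < b" using Cons.prems(1) by auto
    show ?case
    proof (cases "bs = []")
      case True
      then have "n = b" using c by simp
      have "total (b # bs) xs = x" using x(1,2) True by (simp add: deco_prod_unit)
      then show ?thesis using x True \<open>n = b\<close> by simp
    next
      case False
      have e: "even b" "even_init bs" using Cons.prems(2) False by auto
      have IH: "total bs ys \<in> decos (n - b)" "scyc (n - b) (total bs ys) = lsum scyc bs ys"
        "deg_t (n - b) (total bs ys) = lsum deg_t bs ys" "deg_q (n - b) (total bs ys) = lsum deg_q bs ys"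
        using Cons.IH[OF c(1) e(2) x(3)] by blast+
      obtain d where d: "b = 2 * d" using e(1) by blast
      have nb: "b + (n - b) = n" using c by simp
      have xd: "x \<in> decos (2 * d)" using x d by simp
      have t: "total (b # bs) xs = deco_prod b x (total bs ys)" using x by simp
      note r = deco_prod_in[OF xd IH(1)] scyc_deco_prod[OF xd IH(1)] deg_t_deco_prod[OF xd IH(1)] deg_q_deco_prod[OF xd IH(1)]
      show ?thesis unfolding x(1) t[unfolded x(1)] lsum_Cons
        using r[folded d, unfolded nb IH(2-4)] by (intro conjI)
    qed
  qed
  then show "total \<beta> xs \<in> decos n" "scyc n (total \<beta> xs) = lsum scyc \<beta> xs"
    "deg_t n (total \<beta> xs) = lsum deg_t \<beta> xs" "deg_q n (total \<beta> xs) = lsum deg_q \<beta> xs" by auto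
qed

text \<open>By induction on the parts: a decoration with a cut at the first part splits off a unique first
factor, and the remaining cuts are cuts of the second factor.\<close>

lemma bij_betw_total:
  assumes "composition n \<beta>" "even_init \<beta>"
  shows "bij_betw (total \<beta>) (deco_lists \<beta>) {\<theta> \<in> decos n. cuts \<beta> \<subseteq> factor_cuts n \<theta>}"
  using assms
proof (induction \<beta> arbitrary: n)
  case Nil
  then show ?case by (auto simp: decos_0 bij_betw_def)
next
  case (Cons b bs)
  have c: "composition (n - b) bs" "b \<le> n" "0 < b" using Cons.prems(1) by auto
  show ?case
  proof (cases "bs = []")
    case True
    then have "n = b" using c by simp
    have "deco_lists (b # bs) = (\<lambda>x. [x]) ` decos b" using True by (auto simp: deco_lists_Cons)
    moreover have "bij_betw (total (b # bs) \<circ> (\<lambda>x. [x])) (decos b) (decos b)"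
    proof -
      have "(total (b # bs) \<circ> (\<lambda>x. [x])) x = x" if "x \<in> decos b" for x
        using that True by (simp add: deco_prod_unit)
      then show ?thesis using bij_betw_cong[of "decos b" "total (b # bs) \<circ> (\<lambda>x. [x])" id] by simp
    qed
    moreover have single: "bij_betw (\<lambda>x. [x]) (decos b) ((\<lambda>x. [x]) ` decos b)" by (auto simp: bij_betw_def inj_on_def)
    ultimately have "bij_betw (total (b # bs)) (deco_lists (b # bs)) (decos b)"
      using bij_betw_comp_iff[OF single, of "total (b # bs)" "decos b"] by simp
    then show ?thesis using True \<open>n = b\<close> by simp
  next
    case False
    have e: "even b" "even_init bs" using Cons.prems(2) False by auto
    obtain d where d: "b = 2 * d" using e(1) by blast
    define m where "m = n - b"
    have n: "n = 2 * d + m" "0 < d" using c d by (auto simp: m_def)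
    have m: "0 < m" using c False by (cases bs) (auto simp: m_def)
    have cm: "composition m bs" using c by (simp add: m_def)
    have IH: "bij_betw (total bs) (deco_lists bs) {\<theta> \<in> decos m. cuts bs \<subseteq> factor_cuts m \<theta>}"
      by (rule Cons.IH[OF cm e(2)])
    have cb: "cuts (b # bs) = insert b ((+) b ` cuts bs)" by (rule cuts_Cons[OF False])
    have pos: "0 < y" if "y \<in> cuts bs" for y using cuts_subset[OF cm] that by auto
    have iff: "cuts (b # bs) \<subseteq> factor_cuts n (deco_prod b x t) \<longleftrightarrow> cuts bs \<subseteq> factor_cuts m t"
      if "x \<in> decos b" "t \<in> decos m" for x t
      using factor_cuts_deco_prod[of x d t m] factor_cuts_deco_prod_self[of x d t m] that pos n m
      unfolding cb unfolding d by (auto simp: subset_iff)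
    let ?R = "{\<theta> \<in> decos m. cuts bs \<subseteq> factor_cuts m \<theta>}"
    have "bij_betw (\<lambda>(x, t). deco_prod b x t) (decos b \<times> ?R) {\<theta> \<in> decos n. cuts (b # bs) \<subseteq> factor_cuts n \<theta>}"
      unfolding bij_betw_def
    proof
      show "inj_on (\<lambda>(x, t). deco_prod b x t) (decos b \<times> ?R)"
        by (rule inj_onI) (auto simp: d dest: deco_prod_inj)
      show "(\<lambda>(x, t). deco_prod b x t) ` (decos b \<times> ?R) = {\<theta> \<in> decos n. cuts (b # bs) \<subseteq> factor_cuts n \<theta>}"
      proof (intro equalityI subsetI)
        fix \<theta> assume "\<theta> \<in> (\<lambda>(x, t). deco_prod b x t) ` (decos b \<times> ?R)"
        then obtain x t where x: "x \<in> decos b" "t \<in> decos m" "cuts bs \<subseteq> factor_cuts m t" "\<theta> = deco_prod b x t" by auto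
        then show "\<theta> \<in> {\<theta> \<in> decos n. cuts (b # bs) \<subseteq> factor_cuts n \<theta>}"
          using iff[of x t] deco_prod_in[of x d t m] n(1) d by simp
      next
        fix \<theta> assume t: "\<theta> \<in> {\<theta> \<in> decos n. cuts (b # bs) \<subseteq> factor_cuts n \<theta>}"
        then have "2 * d \<in> factor_cuts n \<theta>" "\<theta> \<in> decos n" unfolding cb unfolding d by auto
        then have "uncrossed d (d + (m + 1) div 2) (fst \<theta>)" "uncrossed d (d + m div 2) (snd \<theta>)" "\<theta> \<in> decos (2 * d + m)"
          using in_factor_cuts[of \<theta> n "2 * d"] unfolding n(1) by (simp_all add: half_add)
        then obtain x t' where x: "x \<in> decos (2 * d)" "t' \<in> decos m" "\<theta> = deco_prod (2 * d) x t'"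
          by (metis deco_prod_surj)
        then have "t' \<in> ?R" using iff[of x t'] t by (simp add: d)
        then show "\<theta> \<in> (\<lambda>(x, t). deco_prod b x t) ` (decos b \<times> ?R)" using x d by force
      qed
    qed
    moreover have "bij_betw (\<lambda>(x, xs). (x, total bs xs)) (decos b \<times> deco_lists bs) (decos b \<times> ?R)"
      using bij_betw_map_prod[OF bij_betw_id IH, of "decos b"] by (simp add: map_prod_def id_def)
    ultimately have "bij_betw ((\<lambda>(x, t). deco_prod b x t) \<circ> (\<lambda>(x, xs). (x, total bs xs)))
      (decos b \<times> deco_lists bs) {\<theta> \<in> decos n. cuts (b # bs) \<subseteq> factor_cuts n \<theta>}"
      using bij_betw_trans by blast
    moreover have "(\<lambda>(x, t). deco_prod b x t) \<circ> (\<lambda>(x, xs). (x, total bs xs)) = total (b # bs) \<circ> (\<lambda>(x, xs). x # xs)"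
      by auto
    ultimately have "bij_betw (total (b # bs) \<circ> (\<lambda>(x, xs). x # xs)) (decos b \<times> deco_lists bs)
      {\<theta> \<in> decos n. cuts (b # bs) \<subseteq> factor_cuts n \<theta>}" by simp
    moreover have Cons_bij: "bij_betw (\<lambda>(x, xs). x # xs) (decos b \<times> deco_lists bs) (deco_lists (b # bs))"
      unfolding deco_lists_Cons by (auto simp: bij_betw_def inj_on_def)
    ultimately show ?thesis using bij_betw_comp_iff[OF Cons_bij, of "total (b # bs)"] by blast
  qed
qed

lemma composition_pos: "composition n \<beta> \<Longrightarrow> b \<in> set \<beta> \<Longrightarrow> 0 < b"
  by (auto simp: composition_def)

lemma sum_list_zigzag: "sum_list (zigzag n) = n"
  by (cases "odd n") (auto simp: zigzag_def sum_list_replicate elim!: oddE)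

lemma cuts_even_iff: "composition n \<beta> \<Longrightarrow> (\<forall>y\<in>cuts \<beta>. even y) \<longleftrightarrow> even_init \<beta>"
proof (induction \<beta> arbitrary: n)
  case (Cons b bs)
  show ?case
  proof (cases "bs = []")
    case False
    have "(\<forall>y\<in>cuts bs. even y) \<longleftrightarrow> even_init bs" using Cons.IH[of "n - b"] Cons.prems by auto
    then show ?thesis using False by (auto simp: cuts_Cons)
  qed simp
qed simp

lemma coarser_zigzag_iff: "coarser \<beta> (zigzag n) \<longleftrightarrow> composition n \<beta> \<and> even_init \<beta>"
proof -
  have "cuts \<beta> \<subseteq> cuts (zigzag n) \<longleftrightarrow> (\<forall>y\<in>cuts \<beta>. even y)" if "composition n \<beta>"
    using cuts_subset[OF that] unfolding cuts_zigzag by (fastforce elim!: evenE)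
  then show ?thesis unfolding coarser_def sum_list_zigzag using cuts_even_iff[of n \<beta>] by blast
qed

lemma lsum_scyc_ge:
  assumes "composition n \<beta>" "xs \<in> deco_lists \<beta>"
  shows "length \<beta> \<le> lsum scyc \<beta> xs"
    "lsum scyc \<beta> xs = length \<beta> \<longleftrightarrow> list_all2 (\<lambda>b x. scyc b x = 1) \<beta> xs"
proof -
  have "length \<beta> \<le> lsum scyc \<beta> xs \<and> (lsum scyc \<beta> xs = length \<beta> \<longleftrightarrow> list_all2 (\<lambda>b x. scyc b x = 1) \<beta> xs)"
    using assms
  proof (induction \<beta> arbitrary: n xs)
    case (Cons b bs)
    obtain x ys where x: "xs = x # ys" "ys \<in> deco_lists bs" using Cons.prems(2) by (auto simp: deco_lists_Cons)
    have "length bs \<le> lsum scyc bs ys" "lsum scyc bs ys = length bs \<longleftrightarrow> list_all2 (\<lambda>b x. scyc b x = 1) bs ys"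
      using Cons.IH[of "n - b" ys] Cons.prems x by auto
    moreover have "0 < scyc b x" by (rule scyc_pos) (use Cons.prems in simp)
    ultimately show ?case using x(1) by (auto simp del: One_nat_def)
  qed (auto simp: deco_lists_def)
  then show "length \<beta> \<le> lsum scyc \<beta> xs"
    "lsum scyc \<beta> xs = length \<beta> \<longleftrightarrow> list_all2 (\<lambda>b x. scyc b x = 1) \<beta> xs" by auto
qed

definition cyclic_lists :: "nat list \<Rightarrow> deco list set" where
  "cyclic_lists \<beta> = {xs \<in> deco_lists \<beta>. list_all2 (\<lambda>b x. scyc b x = 1) \<beta> xs}"

lemma cyclic_lists_Nil [simp]: "cyclic_lists [] = {[]}"
  by (auto simp: cyclic_lists_def)

lemma cyclic_lists_Cons:
  "cyclic_lists (b # bs) = (\<lambda>(x, xs). x # xs) ` ({x \<in> decos b. scyc b x = 1} \<times> cyclic_lists bs)"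
  by (auto simp: cyclic_lists_def deco_lists_def list_all2_Cons1)

lemma factor_cuts_subset: "factor_cuts n \<theta> \<subseteq> cuts (zigzag n)"
  by (auto simp: factor_cuts_def)

text \<open>Splitting at all factorization cuts gives one factor more than there are cuts, and every factor
has at least one cycle in its \<open>\<sigma>\<close>-part.\<close>

lemma card_factor_cuts:
  assumes "\<theta> \<in> decos n" "0 < n"
  shows "card (factor_cuts n \<theta>) + 1 \<le> scyc n \<theta>"
    "fact_defect n \<theta> = 0 \<longleftrightarrow> scyc n \<theta> = card (factor_cuts n \<theta>) + 1"
proof -
  have "factor_cuts n \<theta> \<subseteq> {1..<n}" using factor_cuts_subset[of n \<theta>] by (auto simp: cuts_zigzag)
  then obtain \<beta> where b: "composition n \<beta>" "cuts \<beta> = factor_cuts n \<theta>" using composition_exists by blast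
  then have "even_init \<beta>" using factor_cuts_subset[of n \<theta>] cuts_even_iff[of n \<beta>] by (auto simp: cuts_zigzag)
  then have "\<theta> \<in> total \<beta> ` deco_lists \<beta>"
    using bij_betw_imp_surj_on[OF bij_betw_total[OF b(1)]] b(2) assms(1) by simp
  then obtain xs where xs: "xs \<in> deco_lists \<beta>" "\<theta> = total \<beta> xs" by blast
  have "\<beta> \<noteq> []" using b assms by auto
  then have "length \<beta> = card (factor_cuts n \<theta>) + 1" using card_cuts[OF b(1)] b(2) by (cases \<beta>) auto
  then show "card (factor_cuts n \<theta>) + 1 \<le> scyc n \<theta>"
    using lsum_scyc_ge(1)[OF b(1) xs(1)] total_degrees(2)[OF b(1) \<open>even_init \<beta>\<close> xs(1)] xs(2) by simp
  show "fact_defect n \<theta> = 0 \<longleftrightarrow> scyc n \<theta> = card (factor_cuts n \<theta>) + 1"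
    unfolding fact_defect_def perm_cycles_def by linarith
qed

text \<open>If all factors have a single \<open>\<sigma>\<close>-cycle, then there is no room for a further cut: it would need
a further cycle. Conversely defect zero leaves exactly one cycle per factor.\<close>

lemma bij_betw_total_cyclic:
  assumes "composition n \<beta>" "even_init \<beta>" "0 < n"
  shows "bij_betw (total \<beta>) (cyclic_lists \<beta>) {\<theta> \<in> decos n. fact_defect n \<theta> = 0 \<and> factor_cuts n \<theta> = cuts \<beta>}"
proof -
  have ne: "\<beta> \<noteq> []" using assms by auto
  have len: "length \<beta> = card (cuts \<beta>) + 1" using card_cuts[OF assms(1)] ne by (cases \<beta>) auto
  have fin: "finite (factor_cuts n \<theta>)" for \<theta>
    by (rule finite_subset[OF factor_cuts_subset finite_cuts])
  have iff: "xs \<in> cyclic_lists \<beta> \<longleftrightarrow> fact_defect n (total \<beta> xs) = 0 \<and> factor_cuts n (total \<beta> xs) = cuts \<beta>"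
    if xs: "xs \<in> deco_lists \<beta>" for xs
  proof -
    let ?t = "total \<beta> xs"
    have t: "?t \<in> decos n" "scyc n ?t = lsum scyc \<beta> xs" using total_degrees[OF assms(1,2) xs] by auto
    have sub: "cuts \<beta> \<subseteq> factor_cuts n ?t" using bij_betw_total[OF assms(1,2)] xs by (auto simp: bij_betw_def)
    have "xs \<in> cyclic_lists \<beta> \<longleftrightarrow> scyc n ?t = card (cuts \<beta>) + 1"
      unfolding cyclic_lists_def using xs lsum_scyc_ge(2)[OF assms(1) xs] t(2) len by auto
    also have "\<dots> \<longleftrightarrow> fact_defect n ?t = 0 \<and> factor_cuts n ?t = cuts \<beta>"
    proof
      assume s: "scyc n ?t = card (cuts \<beta>) + 1"
      then have "card (factor_cuts n ?t) \<le> card (cuts \<beta>)" using card_factor_cuts(1)[OF t(1) assms(3)] by linarith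
      then have "cuts \<beta> = factor_cuts n ?t" using sub fin card_seteq by blast
      then show "fact_defect n ?t = 0 \<and> factor_cuts n ?t = cuts \<beta>"
        using s card_factor_cuts(2)[OF t(1) assms(3)] by simp
    qed (use card_factor_cuts(2)[OF t(1) assms(3)] in simp)
    finally show ?thesis .
  qed
  have restrict: "bij_betw g A B \<Longrightarrow> bij_betw g {x \<in> A. P (g x)} {y \<in> B. P y}"
    for g :: "deco list \<Rightarrow> deco" and A B P
    by (auto simp: bij_betw_def inj_on_def)
  have "bij_betw (total \<beta>) {xs \<in> deco_lists \<beta>. fact_defect n (total \<beta> xs) = 0 \<and> factor_cuts n (total \<beta> xs) = cuts \<beta>}
    {\<theta> \<in> {\<theta> \<in> decos n. cuts \<beta> \<subseteq> factor_cuts n \<theta>}. fact_defect n \<theta> = 0 \<and> factor_cuts n \<theta> = cuts \<beta>}"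
    by (rule restrict[OF bij_betw_total[OF assms(1,2)]])
  moreover have "{xs \<in> deco_lists \<beta>. fact_defect n (total \<beta> xs) = 0 \<and> factor_cuts n (total \<beta> xs) = cuts \<beta>} = cyclic_lists \<beta>"
    using iff by (auto simp: cyclic_lists_def)
  moreover have "{\<theta> \<in> {\<theta> \<in> decos n. cuts \<beta> \<subseteq> factor_cuts n \<theta>}. fact_defect n \<theta> = 0 \<and> factor_cuts n \<theta> = cuts \<beta>}
    = {\<theta> \<in> decos n. fact_defect n \<theta> = 0 \<and> factor_cuts n \<theta> = cuts \<beta>}" by auto
  ultimately show ?thesis by simp
qed

text \<open>Grouping the decorations of defect zero by their set of factorization cuts.\<close>

lemma sum_defect_zero:
  fixes f :: "deco \<Rightarrow> nat list \<Rightarrow> 'b::comm_monoid_add"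
  assumes "0 < n"
  shows "(\<Sum>\<theta> | \<theta> \<in> decos n \<and> fact_defect n \<theta> = 0. f \<theta> (comp_of_cuts n (factor_cuts n \<theta>))) =
    (\<Sum>\<beta> | coarser \<beta> (zigzag n). \<Sum>xs\<in>cyclic_lists \<beta>. f (total \<beta> xs) \<beta>)"
proof -
  let ?Z = "{\<theta> \<in> decos n. fact_defect n \<theta> = 0}"
  let ?g = "\<lambda>\<theta>. comp_of_cuts n (factor_cuts n \<theta>)"
  have g: "coarser (?g \<theta>) (zigzag n) \<and> cuts (?g \<theta>) = factor_cuts n \<theta>" if "\<theta> \<in> decos n" for \<theta>
  proof -
    have "factor_cuts n \<theta> \<subseteq> {1..<n}" using factor_cuts_subset[of n \<theta>] by (auto simp: cuts_zigzag)
    then obtain \<beta> where b: "composition n \<beta>" "cuts \<beta> = factor_cuts n \<theta>" using composition_exists by blast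
    then have "?g \<theta> = \<beta>" using comp_of_cuts_cuts by metis
    then show ?thesis using b factor_cuts_subset[of n \<theta>] unfolding coarser_def sum_list_zigzag by simp
  qed
  have fin: "finite {\<beta>. coarser \<beta> (zigzag n)}"
    by (rule finite_subset[OF _ finite_compositions[of n]]) (auto simp: coarser_zigzag_iff)
  have "(\<Sum>\<theta>\<in>?Z. f \<theta> (?g \<theta>)) = (\<Sum>\<beta> | coarser \<beta> (zigzag n). \<Sum>\<theta> | \<theta> \<in> ?Z \<and> ?g \<theta> = \<beta>. f \<theta> (?g \<theta>))"
    using g by (intro sum.group[symmetric] fin) auto
  also have "\<dots> = (\<Sum>\<beta> | coarser \<beta> (zigzag n). \<Sum>xs\<in>cyclic_lists \<beta>. f (total \<beta> xs) \<beta>)"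
  proof (rule sum.cong[OF refl])
    fix \<beta> assume "\<beta> \<in> {\<beta>. coarser \<beta> (zigzag n)}"
    then have b: "composition n \<beta>" "even_init \<beta>" by (auto simp: coarser_zigzag_iff)
    have "{\<theta>. \<theta> \<in> ?Z \<and> ?g \<theta> = \<beta>} = {\<theta> \<in> decos n. fact_defect n \<theta> = 0 \<and> factor_cuts n \<theta> = cuts \<beta>}"
      using g comp_of_cuts_cuts[OF b(1)] by auto
    then have "(\<Sum>\<theta> | \<theta> \<in> ?Z \<and> ?g \<theta> = \<beta>. f \<theta> (?g \<theta>)) =
      (\<Sum>\<theta> | \<theta> \<in> decos n \<and> fact_defect n \<theta> = 0 \<and> factor_cuts n \<theta> = cuts \<beta>. f \<theta> \<beta>)"
      using comp_of_cuts_cuts[OF b(1)] by (intro sum.cong) auto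
    also have "\<dots> = (\<Sum>xs\<in>cyclic_lists \<beta>. f (total \<beta> xs) \<beta>)"
      by (rule sum.reindex_bij_betw[OF bij_betw_total_cyclic[OF b assms], symmetric])
    finally show "(\<Sum>\<theta> | \<theta> \<in> ?Z \<and> ?g \<theta> = \<beta>. f \<theta> (?g \<theta>)) = (\<Sum>xs\<in>cyclic_lists \<beta>. f (total \<beta> xs) \<beta>)" .
  qed
  finally show ?thesis by simp
qed

text \<open>The \<open>q\<close>-degree of a decoration is defined as the deficit of its number of \<open>\<sigma>\<close>-cycles.\<close>

lemma lsum_degrees_cyclic:
  assumes "composition n \<beta>" "even_init \<beta>" "xs \<in> deco_lists \<beta>"
  shows "lsum deg_q \<beta> xs + lsum scyc \<beta> xs = (n + 1) div 2"
  using total_degrees(2,4)[OF assms] scyc_le[where n = n and \<xi> = "total \<beta> xs"]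
  unfolding deg_q_def perm_cycles_def by simp

section \<open>The defect-zero series\<close>

definition cyclic_weight :: "nat \<Rightarrow> 'a::comm_ring_1 mps poly poly" where
  "cyclic_weight b = (\<Sum>x | x \<in> decos b \<and> scyc b x = 1. tvar ^ deg_t b x * uvar ^ deg_q b x)"

text \<open>The \<open>\<sigma>\<close>-part is one of the full cycles and contributes \<open>t\<close>-degree one, which cancels the \<open>-1\<close>
of the degree; the \<open>\<tau>\<close>-part is an arbitrary permutation of \<open>\<lfloor>b/2\<rfloor> + 1\<close> letters, weighted by its cycles.\<close>

lemma cyclic_weight_eq:
  assumes "0 < b"
  shows "(cyclic_weight b :: 'a::comm_ring_1 mps poly poly) =
    of_nat (fact ((b + 1) div 2 - 1)) * uvar ^ ((b + 1) div 2 - 1) * pochhammer tvar (b div 2 + 1)"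
proof -
  let ?S = "{\<sigma>. \<sigma> permutes {1..(b + 1) div 2} \<and> cyc \<sigma> {1..(b + 1) div 2} = 1}"
  let ?T = "{\<tau>. \<tau> permutes {0..b div 2}}"
  have eq: "{x. x \<in> decos b \<and> scyc b x = 1} = ?S \<times> ?T"
    by (auto simp: decos_def)
  have "(cyclic_weight b :: 'a mps poly poly) =
    (\<Sum>(\<sigma>, \<tau>)\<in>?S \<times> ?T. tvar ^ cyc \<tau> {0..b div 2} * uvar ^ ((b + 1) div 2 - 1))"
    unfolding cyclic_weight_def eq by (intro sum.cong refl) (auto simp: deg_t_def deg_q_def perm_cycles_def)
  also have "\<dots> = (\<Sum>\<sigma>\<in>?S. \<Sum>\<tau>\<in>?T. tvar ^ cyc \<tau> {0..b div 2} * uvar ^ ((b + 1) div 2 - 1))"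
    by (simp only: sum.cartesian_product)
  also have "\<dots> = of_nat (card ?S) * ((\<Sum>\<tau>\<in>?T. tvar ^ cyc \<tau> {0..b div 2}) * uvar ^ ((b + 1) div 2 - 1))"
    by (simp only: sum_constant sum_distrib_right)
  also have "card ?S = fact ((b + 1) div 2 - 1)"
    using card_single_cycle[of "{1..(b + 1) div 2}"] assms by simp
  also have "(\<Sum>\<tau>\<in>?T. tvar ^ cyc \<tau> {0..b div 2}) = (pochhammer tvar (b div 2 + 1) :: 'a mps poly poly)"
    using sum_permutes_cyc_pochhammer[of "{0..b div 2}" "tvar :: 'a mps poly poly"] by simp
  finally show ?thesis by (simp only: mult_ac)
qed

lemma defect_zero_series:
  assumes "0 < n"
  shows "(defect_series n 0 :: 'a::comm_ring_1 mps poly poly) =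
    (\<Sum>\<beta> | coarser \<beta> (zigzag n). \<Sum>xs\<in>cyclic_lists \<beta>.
      tvar ^ lsum deg_t \<beta> xs * uvar ^ lsum deg_q \<beta> xs * symc (ribbon \<beta>))"
proof -
  have "(defect_series n 0 :: 'a mps poly poly) =
    (\<Sum>\<beta> | coarser \<beta> (zigzag n). \<Sum>xs\<in>cyclic_lists \<beta>.
      tvar ^ deg_t n (total \<beta> xs) * uvar ^ deg_q n (total \<beta> xs) * symc (ribbon \<beta>))"
    unfolding defect_series_def of_nat_0
    by (rule sum_defect_zero[OF assms, of "\<lambda>\<theta> \<beta>. tvar ^ deg_t n \<theta> * uvar ^ deg_q n \<theta> * symc (ribbon \<beta>)"])
  also have "\<dots> = (\<Sum>\<beta> | coarser \<beta> (zigzag n). \<Sum>xs\<in>cyclic_lists \<beta>.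
      tvar ^ lsum deg_t \<beta> xs * uvar ^ lsum deg_q \<beta> xs * symc (ribbon \<beta>))"
  proof (intro sum.cong refl)
    fix \<beta> xs assume "\<beta> \<in> {\<beta>. coarser \<beta> (zigzag n)}" "xs \<in> cyclic_lists \<beta>"
    then have "composition n \<beta>" "even_init \<beta>" "xs \<in> deco_lists \<beta>"
      by (auto simp: coarser_zigzag_iff cyclic_lists_def)
    from total_degrees(3,4)[OF this]
    show "tvar ^ deg_t n (total \<beta> xs) * uvar ^ deg_q n (total \<beta> xs) * symc (ribbon \<beta>) =
      tvar ^ lsum deg_t \<beta> xs * uvar ^ lsum deg_q \<beta> xs * (symc (ribbon \<beta>) :: 'a mps poly poly)" by simp
  qed
  finally show ?thesis .
qed

lemma sum_cyclic_lists:
  "(\<Sum>xs\<in>cyclic_lists \<beta>. tvar ^ lsum deg_t \<beta> xs * uvar ^ lsum deg_q \<beta> xs) =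
    (prod_list (map cyclic_weight \<beta>) :: 'a::comm_ring_1 mps poly poly)"
proof (induction \<beta>)
  case (Cons b bs)
  have "inj_on (\<lambda>(x, xs). x # xs) A" for A :: "(deco \<times> deco list) set" by (auto simp: inj_on_def)
  then have "(\<Sum>xs\<in>cyclic_lists (b # bs). tvar ^ lsum deg_t (b # bs) xs * uvar ^ lsum deg_q (b # bs) xs) =
    (\<Sum>(x, xs)\<in>{x \<in> decos b. scyc b x = 1} \<times> cyclic_lists bs.
      (tvar ^ deg_t b x * uvar ^ deg_q b x) * (tvar ^ lsum deg_t bs xs * uvar ^ lsum deg_q bs xs :: 'a mps poly poly))"
    unfolding cyclic_lists_Cons
    by (subst sum.reindex) (auto simp: o_def power_add mult_ac intro!: sum.cong)
  also have "\<dots> = cyclic_weight b * prod_list (map cyclic_weight bs)"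
    unfolding Cons.IH[symmetric] unfolding cyclic_weight_def sum_product sum.cartesian_product ..
  finally show ?case by simp
qed simp

lemma defect_zero_product:
  assumes "0 < n"
  shows "(defect_series n 0 :: 'a::comm_ring_1 mps poly poly) =
    (\<Sum>\<beta> | coarser \<beta> (zigzag n). prod_list (map cyclic_weight \<beta>) * symc (ribbon \<beta>))"
  unfolding defect_zero_series[OF assms] sum_cyclic_lists[symmetric] sum_distrib_right ..

lemma even_list_eq_dbl: "\<forall>b\<in>set bs. even b \<Longrightarrow> \<exists>\<mu>. bs = dbl \<mu>"
proof (induction bs)
  case (Cons b bs)
  then obtain \<mu> c where "bs = dbl \<mu>" "b = 2 * c" by auto
  then show ?case by (intro exI[of _ "c # \<mu>"]) (simp add: dbl_def)
qed (simp add: dbl_def)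

lemma sum_list_dbl [simp]: "sum_list (dbl \<mu>) = 2 * sum_list \<mu>"
  by (induction \<mu>) (auto simp: dbl_def)

lemma composition_snoc: "composition n (bs @ [b]) \<longleftrightarrow> 0 < b \<and> b \<le> n \<and> composition (n - b) bs"
  by (auto simp: composition_def)

lemma composition_dbl: "composition (2 * N) (dbl \<mu>) \<longleftrightarrow> composition N \<mu>"
  unfolding composition_def sum_list_dbl by (auto simp: dbl_def)

lemma inj_dbl: "inj dbl"
  unfolding dbl_def by (intro inj_mapI) (auto simp: inj_def)

lemma coarser_zigzag_even: "{\<beta>. coarser \<beta> (zigzag (2 * N))} = dbl ` {\<mu>. composition N \<mu>}"
proof (intro equalityI subsetI)
  fix \<beta> assume "\<beta> \<in> {\<beta>. coarser \<beta> (zigzag (2 * N))}"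
  then have b: "composition (2 * N) \<beta>" "even_init \<beta>" by (auto simp: coarser_zigzag_iff)
  have "\<forall>b\<in>set \<beta>. even b"
  proof (cases \<beta> rule: rev_cases)
    case (snoc bs b)
    have "\<forall>b\<in>set bs. even b" using b(2) snoc by simp
    then obtain \<mu> where "bs = dbl \<mu>" using even_list_eq_dbl by blast
    then have "2 * sum_list \<mu> + b = 2 * N" using b(1) snoc by (simp add: composition_def)
    then have "even b" by presburger
    then show ?thesis using b(2) snoc by simp
  qed simp
  then obtain \<mu> where "\<beta> = dbl \<mu>" using even_list_eq_dbl by blast
  then show "\<beta> \<in> dbl ` {\<mu>. composition N \<mu>}" using b(1) composition_dbl by blast
next
  fix \<beta> assume "\<beta> \<in> dbl ` {\<mu>. composition N \<mu>}"
  then obtain \<mu> where "\<beta> = dbl \<mu>" "composition N \<mu>" by auto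
  moreover have "\<forall>b\<in>set (dbl \<mu>). even b" by (auto simp: dbl_def)
  ultimately show "\<beta> \<in> {\<beta>. coarser \<beta> (zigzag (2 * N))}"
    using composition_dbl by (auto simp: coarser_zigzag_iff dest: in_set_butlastD)
qed

lemma dbl_dec_snoc: "dbl_dec (bs @ [b]) = dbl bs @ [2 * b - 1]"
  by (simp add: dbl_dec_def dbl_def)

lemma coarser_zigzag_odd: "{\<beta>. coarser \<beta> (zigzag (2 * N + 1))} = dbl_dec ` {\<mu>. composition (N + 1) \<mu>}"
proof (intro equalityI subsetI)
  fix \<beta> assume "\<beta> \<in> {\<beta>. coarser \<beta> (zigzag (2 * N + 1))}"
  then have b: "composition (2 * N + 1) \<beta>" "even_init \<beta>" by (auto simp: coarser_zigzag_iff)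
  then obtain bs b' where s: "\<beta> = bs @ [b']" by (cases \<beta> rule: rev_cases) auto
  then have "\<forall>b\<in>set bs. even b" using b(2) by simp
  then obtain \<mu> where m: "bs = dbl \<mu>" using even_list_eq_dbl by blast
  have sum: "2 * sum_list \<mu> + b' = 2 * N + 1" using b(1) m s by (simp add: composition_def)
  then have "odd b'" by presburger
  then obtain c where c: "b' = 2 * c + 1" by (elim oddE)
  have pos: "\<forall>a\<in>set \<mu>. 0 < a" using b(1) s m by (auto simp: composition_def dbl_def)
  have "composition (N + 1) (\<mu> @ [c + 1])" using pos sum c by (auto simp: composition_def)
  moreover have "\<beta> = dbl_dec (\<mu> @ [c + 1])" unfolding dbl_dec_snoc using s m c by simp
  ultimately show "\<beta> \<in> dbl_dec ` {\<mu>. composition (N + 1) \<mu>}" by blast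
next
  fix \<beta> assume "\<beta> \<in> dbl_dec ` {\<mu>. composition (N + 1) \<mu>}"
  then obtain \<nu> where \<nu>: "\<beta> = dbl_dec \<nu>" "composition (N + 1) \<nu>" by auto
  then obtain \<mu> c where c: "\<nu> = \<mu> @ [c]" by (cases \<nu> rule: rev_cases) auto
  have pos: "\<forall>a\<in>set \<mu>. 0 < a" "0 < c" "sum_list \<mu> + c = N + 1" using \<nu>(2) c by (auto simp: composition_def)
  have "sum_list (dbl \<mu> @ [2 * c - 1]) = 2 * N + 1" using pos by simp
  moreover have "\<forall>a\<in>set (dbl \<mu> @ [2 * c - 1]). 0 < a" using pos by (auto simp: dbl_def)
  ultimately have "composition (2 * N + 1) (dbl \<mu> @ [2 * c - 1])" unfolding composition_def by blast
  moreover have "\<forall>b\<in>set (dbl \<mu>). even b" by (auto simp: dbl_def)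
  ultimately show "\<beta> \<in> {\<beta>. coarser \<beta> (zigzag (2 * N + 1))}"
    unfolding \<nu>(1) c dbl_dec_snoc by (simp add: coarser_zigzag_iff)
qed

lemma inj_on_dbl_dec: "inj_on dbl_dec {\<mu>. composition (N + 1) \<mu>}"
proof (rule inj_onI)
  fix \<mu> \<nu> assume *: "\<mu> \<in> {\<mu>. composition (N + 1) \<mu>}" "\<nu> \<in> {\<mu>. composition (N + 1) \<mu>}" "dbl_dec \<mu> = dbl_dec \<nu>"
  obtain ms m where m: "\<mu> = ms @ [m]" using *(1) by (cases \<mu> rule: rev_cases) auto
  obtain ns k where k: "\<nu> = ns @ [k]" using *(2) by (cases \<nu> rule: rev_cases) auto
  have "0 < m" "0 < k" using * m k by (auto simp: composition_snoc)
  moreover have "dbl ms = dbl ns" "2 * m - 1 = 2 * k - 1" using *(3) unfolding m k dbl_dec_snoc by auto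
  ultimately show "\<mu> = \<nu>" using m k injD[OF inj_dbl] by auto
qed

lemma prod_pred_power:
  fixes u :: "'a::comm_monoid_mult"
  shows "composition n \<mu> \<Longrightarrow> (\<Prod>a\<leftarrow>\<mu>. u ^ (a - 1)) = u ^ (n - length \<mu>)"
proof (induction \<mu> arbitrary: n)
  case (Cons b bs)
  have "length bs \<le> n - b" 
  proof -
    have "length bs \<le> sum_list bs" if "\<forall>a\<in>set bs. 0 < a" for bs :: "nat list"
      using that by (induction bs) auto
    from this[of bs] show ?thesis using Cons.prems by (auto simp: composition_def)
  qed
  then show ?case using Cons.IH[of "n - b"] Cons.prems by (auto simp flip: power_add)
qed simp

lemma prod_list_nth: "(\<Prod>a\<leftarrow>xs. f a) = (\<Prod>i<length xs. (f (xs ! i) :: 'a::comm_monoid_mult))"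
  by (simp add: prod.list_conv_set_nth atLeast0LessThan)

lemma defect_zero_even:
  assumes "0 < N"
  shows "(defect_series (2 * N) 0 :: 'a::comm_ring_1 mps poly poly) =
    (\<Sum>\<mu> | composition N \<mu>. uvar ^ (N - length \<mu>) *
      (\<Prod>a<length \<mu>. of_nat (fact (\<mu> ! a - 1)) * pochhammer tvar (\<mu> ! a + 1)) * symc (ribbon (dbl \<mu>)))"
proof -
  have "(defect_series (2 * N) 0 :: 'a mps poly poly) =
    (\<Sum>\<mu> | composition N \<mu>. prod_list (map cyclic_weight (dbl \<mu>)) * symc (ribbon (dbl \<mu>)))"
    unfolding defect_zero_product[of "2 * N", OF mult_pos_pos[OF zero_less_numeral assms]] coarser_zigzag_even
    by (subst sum.reindex) (auto intro: inj_on_subset[OF inj_dbl])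
  also have "\<dots> = (\<Sum>\<mu> | composition N \<mu>. uvar ^ (N - length \<mu>) *
      (\<Prod>a<length \<mu>. of_nat (fact (\<mu> ! a - 1)) * pochhammer tvar (\<mu> ! a + 1)) * symc (ribbon (dbl \<mu>)))"
  proof (intro sum.cong refl)
    fix \<mu> assume "\<mu> \<in> {\<mu>. composition N \<mu>}"
    then have c: "composition N \<mu>" by simp
    have "prod_list (map cyclic_weight (dbl \<mu>)) =
      (\<Prod>a\<leftarrow>\<mu>. uvar ^ (a - 1) * (of_nat (fact (a - 1)) * pochhammer tvar (a + 1)) :: 'a mps poly poly)"
      unfolding dbl_def map_map
      using composition_pos[OF c] by (intro arg_cong[where f = prod_list] map_cong) (auto simp: cyclic_weight_eq mult_ac)
    also have "\<dots> = (\<Prod>a\<leftarrow>\<mu>. uvar ^ (a - 1)) * (\<Prod>a\<leftarrow>\<mu>. of_nat (fact (a - 1)) * pochhammer tvar (a + 1))"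
      by (simp only: prod_list_nth prod.distrib)
    finally show "prod_list (map cyclic_weight (dbl \<mu>)) * symc (ribbon (dbl \<mu>)) = uvar ^ (N - length \<mu>) *
      (\<Prod>a<length \<mu>. of_nat (fact (\<mu> ! a - 1)) * pochhammer tvar (\<mu> ! a + 1)) * (symc (ribbon (dbl \<mu>)) :: 'a mps poly poly)"
      unfolding prod_pred_power[OF c] by (simp only: prod_list_nth)
  qed
  finally show ?thesis .
qed

lemma defect_zero_odd:
  "(defect_series (2 * N + 1) 0 :: 'a::comm_ring_1 mps poly poly) =
    (\<Sum>\<mu> | composition (N + 1) \<mu>. uvar ^ (N + 1 - length \<mu>) *
      (\<Prod>a<length \<mu>. of_nat (fact (\<mu> ! a - 1))) * (\<Prod>a<length \<mu> - 1. pochhammer tvar (\<mu> ! a + 1)) *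
      pochhammer tvar (last \<mu>) * symc (ribbon (dbl_dec \<mu>)))"
proof -
  have "(defect_series (2 * N + 1) 0 :: 'a mps poly poly) =
    (\<Sum>\<mu> | composition (N + 1) \<mu>. prod_list (map cyclic_weight (dbl_dec \<mu>)) * symc (ribbon (dbl_dec \<mu>)))"
    unfolding defect_zero_product[of "2 * N + 1", OF add_nonneg_pos[OF le0 zero_less_one]] coarser_zigzag_odd
    by (subst sum.reindex[OF inj_on_dbl_dec]) simp
  also have "\<dots> = (\<Sum>\<mu> | composition (N + 1) \<mu>. uvar ^ (N + 1 - length \<mu>) *
      (\<Prod>a<length \<mu>. of_nat (fact (\<mu> ! a - 1))) * (\<Prod>a<length \<mu> - 1. pochhammer tvar (\<mu> ! a + 1)) *
      pochhammer tvar (last \<mu>) * symc (ribbon (dbl_dec \<mu>)))"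
  proof (intro sum.cong refl)
    fix \<nu> assume "\<nu> \<in> {\<mu>. composition (N + 1) \<mu>}"
    then have c: "composition (N + 1) \<nu>" by simp
    then obtain \<mu> m where m: "\<nu> = \<mu> @ [m]" by (cases \<nu> rule: rev_cases) auto
    have pos: "0 < m" "\<And>a. a \<in> set \<mu> \<Longrightarrow> 0 < a" using c m by (auto simp: composition_def)
    have "prod_list (map cyclic_weight (dbl_dec \<nu>)) =
      (\<Prod>a\<leftarrow>\<mu>. uvar ^ (a - 1) * of_nat (fact (a - 1)) * pochhammer tvar (a + 1)) *
      (uvar ^ (m - 1) * of_nat (fact (m - 1)) * pochhammer tvar m :: 'a mps poly poly)"
    proof -
      have "map cyclic_weight (dbl \<mu>) =
        map (\<lambda>a. uvar ^ (a - 1) * of_nat (fact (a - 1)) * pochhammer tvar (a + 1) :: 'a mps poly poly) \<mu>"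
        unfolding dbl_def map_map using pos(2) by (intro map_cong) (auto simp: cyclic_weight_eq mult_ac)
      moreover have "(2 * m - 1 + 1) div 2 = m" "(2 * m - 1) div 2 + 1 = m" "0 < 2 * m - 1" using pos(1) by auto
      then have "(cyclic_weight (2 * m - 1) :: 'a mps poly poly) = uvar ^ (m - 1) * of_nat (fact (m - 1)) * pochhammer tvar m"
        by (simp only: cyclic_weight_eq mult_ac)
      ultimately show ?thesis unfolding m dbl_dec_snoc by simp
    qed
    also have "\<dots> = (\<Prod>a\<leftarrow>\<nu>. uvar ^ (a - 1)) * (\<Prod>a\<leftarrow>\<nu>. of_nat (fact (a - 1))) *
      (\<Prod>a\<leftarrow>\<mu>. pochhammer tvar (a + 1)) * pochhammer tvar m"
    proof -
      have "(\<Prod>a\<leftarrow>xs. f a * g a * h a) = (\<Prod>a\<leftarrow>xs. f a) * (\<Prod>a\<leftarrow>xs. g a) * (\<Prod>a\<leftarrow>xs. (h a :: 'a mps poly poly))"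
        for xs :: "nat list" and f g h by (simp only: prod_list_nth prod.distrib)
      then show ?thesis unfolding m by (simp add: mult_ac)
    qed
    also have "(\<Prod>a\<leftarrow>\<mu>. pochhammer tvar (a + 1)) = (\<Prod>a<length \<nu> - 1. pochhammer tvar (\<nu> ! a + 1) :: 'a mps poly poly)"
      unfolding prod_list_nth m by (simp add: nth_append)
    also have "pochhammer tvar m = (pochhammer tvar (last \<nu>) :: 'a mps poly poly)" using m by simp
    finally show "prod_list (map cyclic_weight (dbl_dec \<nu>)) * symc (ribbon (dbl_dec \<nu>)) = uvar ^ (N + 1 - length \<nu>) *
      (\<Prod>a<length \<nu>. of_nat (fact (\<nu> ! a - 1))) * (\<Prod>a<length \<nu> - 1. pochhammer tvar (\<nu> ! a + 1)) *
      pochhammer tvar (last \<nu>) * (symc (ribbon (dbl_dec \<nu>)) :: 'a mps poly poly)"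
      unfolding prod_pred_power[OF c] by (simp only: prod_list_nth)
  qed
  finally show ?thesis .
qed

lemma coeff_tvar_uvar_symc:
  "coeff (coeff (tvar ^ a * uvar ^ b * symc r) j) i = (if a = i \<and> b = j then r else (0 :: 'a::comm_ring_1 mps))"
proof -
  have "(tvar :: 'a mps poly poly) ^ a = [:monom 1 a:]"
    by (simp add: tvar_def poly_const_pow monom_altdef)
  moreover have "(uvar :: 'a mps poly poly) ^ b = monom 1 b"
    by (simp add: uvar_def monom_altdef)
  ultimately have "tvar ^ a * uvar ^ b * symc r = monom (monom r a) b"
    by (simp add: symc_def smult_monom mult.commute[of _ "[:[:r:]:]"])
  then show ?thesis by simp
qed

lemma coeff_defect_zero:
  assumes "0 < n"
  shows "coeff (coeff (defect_series n 0 :: 'a::comm_ring_1 mps poly poly) j) i =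
    (\<Sum>\<beta> | coarser \<beta> (zigzag n). \<Sum>xs | xs \<in> cyclic_lists \<beta> \<and> lsum deg_t \<beta> xs = i \<and> lsum deg_q \<beta> xs = j. ribbon \<beta>)"
  unfolding defect_zero_series[OF assms] coeff_sum coeff_tvar_uvar_symc
  by (intro sum.cong refl sum.inter_filter[symmetric, THEN trans])
     (auto simp: cyclic_lists_def intro!: sum.mono_neutral_cong_right)

section \<open>Traces in characteristic zero\<close>

text \<open>Characteristic zero enters twice: group averages need division by the group order, and the
trace of an idempotent determines its rank because distinct multiples of one are distinct.\<close>

locale char0_vector_space = vector_space scale
  for scale :: "'a::field_char_0 \<Rightarrow> 'b::ab_group_add \<Rightarrow> 'b" (infixr "*s" 75)
begin

sublocale vector_space_pair scale scale ..

abbreviation lin :: "('b \<Rightarrow> 'b) \<Rightarrow> bool" where "lin \<equiv> Vector_Spaces.linear scale scale"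

lemma lin_add: "lin T \<Longrightarrow> T (x + y) = T x + T y" and lin_scale: "lin T \<Longrightarrow> T (c *s x) = c *s T x"
  and lin_0: "lin T \<Longrightarrow> T 0 = 0" and lin_diff: "lin T \<Longrightarrow> T (x - y) = T x - T y"
  by (simp_all add: linear_add linear_scale linear_0 linear_diff)

lemma lin_sum: "lin T \<Longrightarrow> T (\<Sum>i\<in>I. f i) = (\<Sum>i\<in>I. T (f i))"
  by (rule linear_sum)

lemma linI: "(\<And>x y. T (x + y) = T x + T y) \<Longrightarrow> (\<And>c x. T (c *s x) = c *s T x) \<Longrightarrow> lin T"
  unfolding Vector_Spaces.linear_iff using vector_space_axioms by blast

lemma lin_span_image: "lin T \<Longrightarrow> T ` span B = span (T ` B)"
  by (rule linear_span_image[symmetric])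

lemma lin_span_subset: "lin T \<Longrightarrow> T ` B \<subseteq> span C \<Longrightarrow> T ` span B \<subseteq> span C"
  using span_minimal[of "T ` B" "span C"] by (simp add: lin_span_image)

definition tr :: "'b set \<Rightarrow> ('b \<Rightarrow> 'b) \<Rightarrow> 'a" where
  "tr B T = (\<Sum>b\<in>B. representation B (T b) b)"

text \<open>Expanding the elements of either basis in the other one and interchanging the sums.\<close>

lemma tr_basis_independent:
  assumes B: "finite B" "independent B" and B': "finite B'" "independent B'"
    and span: "span B = span B'" and T: "lin T" "T ` span B \<subseteq> span B"
  shows "tr B T = tr B' T"
proof -
  let ?R = "representation B" and ?R' = "representation B'"
  have bs: "b \<in> span B" if "b \<in> B \<or> b \<in> B'" for b using that span span_base by blast
  have Tb: "T b \<in> span B" "T b \<in> span B'" if "b \<in> B \<or> b \<in> B'" for b using bs[OF that] T(2) span by auto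
  have 1: "?R (T b) b = (\<Sum>b'\<in>B'. ?R' (T b) b' * ?R b' b)" if b: "b \<in> B" for b
  proof -
    have "?R (T b) b = ?R (\<Sum>b'\<in>B'. ?R' (T b) b' *s b') b"
      using sum_representation_eq[OF B'(2) Tb(2) B'(1) order_refl, of b] b by simp
    also have "\<dots> = (\<Sum>b'\<in>B'. ?R (?R' (T b) b' *s b') b)"
      using bs by (subst representation_sum[OF B(2)]) (auto intro: span_scale)
    also have "\<dots> = (\<Sum>b'\<in>B'. ?R' (T b) b' * ?R b' b)"
      using bs by (intro sum.cong refl) (simp add: representation_scale[OF B(2)])
    finally show ?thesis .
  qed
  have 2: "?R' (T b') b' = (\<Sum>b\<in>B. ?R' (T b) b' * ?R b' b)" if b': "b' \<in> B'" for b'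
  proof -
    have "?R' (T b') b' = ?R' (T (\<Sum>b\<in>B. ?R b' b *s b)) b'"
      using sum_representation_eq[OF B(2) bs B(1) order_refl, of b'] b' by simp
    also have "\<dots> = ?R' (\<Sum>b\<in>B. ?R b' b *s T b) b'" by (simp add: lin_sum[OF T(1)] lin_scale[OF T(1)])
    also have "\<dots> = (\<Sum>b\<in>B. ?R' (?R b' b *s T b) b')"
      using Tb by (subst representation_sum[OF B'(2)]) (auto intro: span_scale)
    also have "\<dots> = (\<Sum>b\<in>B. ?R' (T b) b' * ?R b' b)"
      using Tb by (intro sum.cong refl) (simp add: representation_scale[OF B'(2)])
    finally show ?thesis .
  qed
  have "tr B T = (\<Sum>b\<in>B. \<Sum>b'\<in>B'. ?R' (T b) b' * ?R b' b)" unfolding tr_def using 1 by simp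
  also have "\<dots> = (\<Sum>b'\<in>B'. \<Sum>b\<in>B. ?R' (T b) b' * ?R b' b)" by (rule sum.swap)
  also have "\<dots> = tr B' T" unfolding tr_def using 2 by simp
  finally show ?thesis .
qed

lemma representation_subset:
  "independent B \<Longrightarrow> C \<subseteq> B \<Longrightarrow> v \<in> span C \<Longrightarrow> representation B v = representation C v"
  by (rule representation_extend)

text \<open>With respect to a basis adapted to two invariant subspaces there are no mixed diagonal terms.\<close>

lemma tr_union:
  assumes "finite B" "finite C" "independent (B \<union> C)" "B \<inter> C = {}"
    and "T ` B \<subseteq> span B" "T ` C \<subseteq> span C"
  shows "tr (B \<union> C) T = tr B T + tr C T"
  unfolding tr_def sum.union_disjoint[OF assms(1,2,4)] using assms(5,6)
  by (intro arg_cong2[where f = "(+)"] sum.cong refl fun_cong[OF representation_subset[OF assms(3)]]) auto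

lemma tr_ident: "finite B \<Longrightarrow> independent B \<Longrightarrow> (\<And>b. b \<in> B \<Longrightarrow> T b = b) \<Longrightarrow> tr B T = of_nat (card B)"
  by (simp add: tr_def representation_basis)

lemma tr_zero: "(\<And>b. b \<in> B \<Longrightarrow> T b = 0) \<Longrightarrow> tr B T = 0"
  by (simp add: tr_def representation_zero)

lemma independent_image: "lin f \<Longrightarrow> independent B \<Longrightarrow> inj_on f (span B) \<Longrightarrow> independent (f ` B)"
  by (rule linear_independent_injective_image)

lemma tr_image:
  assumes B: "finite B" "independent B" and f: "lin f" "inj_on f (span B)"
    and T: "T ` B \<subseteq> span B" and eq: "\<And>b. b \<in> B \<Longrightarrow> T' (f b) = f (T b)"
  shows "tr (f ` B) T' = tr B T"
proof -
  have fB: "independent (f ` B)" using f B by (intro independent_image)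
  have injB: "inj_on f B" using f(2) span_superset inj_on_subset by blast
  have rep: "representation (f ` B) (f v) (f b) = representation B v b" if v: "v \<in> span B" and b: "b \<in> B" for v b
  proof -
    have "f v = (\<Sum>c\<in>B. representation B v c *s f c)"
      using sum_representation_eq[OF B(2) v B(1) order_refl]
      by (metis (mono_tags, lifting) lin_sum[OF f(1)] lin_scale[OF f(1)] sum.cong)
    then have "representation (f ` B) (f v) (f b) = (\<Sum>c\<in>B. representation (f ` B) (representation B v c *s f c) (f b))"
      by (simp add: representation_sum[OF fB] span_base span_scale)
    also have "\<dots> = (\<Sum>c\<in>B. if c = b then representation B v c else 0)"
      using injB b by (intro sum.cong refl)
        (auto simp: representation_scale[OF fB] representation_basis[OF fB] span_base inj_on_def)
    also have "\<dots> = representation B v b" using B b by simp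
    finally show ?thesis .
  qed
  show ?thesis unfolding tr_def sum.reindex[OF injB] o_def
    using T eq rep by (intro sum.cong refl) auto
qed

lemma finite_basis_exists:
  assumes "subspace U" "U \<subseteq> span B" "finite B"
  obtains C where "finite C" "independent C" "span C = U"
proof -
  obtain C where C: "C \<subseteq> U" "independent C" "U \<subseteq> span C" using maximal_independent_subset by blast
  have "finite C" using independent_span_bound[OF assms(3) C(2)] C(1) assms(2) by auto
  moreover have "span C = U" using C assms(1) span_minimal by blast
  ultimately show ?thesis using that C by blast
qed

lemma direct_sum_basis:
  assumes B: "finite B" "independent B" and C: "finite C" "independent C" and "span B \<inter> span C = {0}"
  shows "independent (B \<union> C)" "B \<inter> C = {}"
proof -
  show BC: "B \<inter> C = {}"
  proof (rule ccontr)
    assume "B \<inter> C \<noteq> {}"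
    then obtain x where "x \<in> B" "x \<in> C" by blast
    then have "x = 0" using assms(5) span_base by blast
    then show False using \<open>x \<in> B\<close> B(2) dependent_zero by blast
  qed
  show "independent (B \<union> C)"
  proof (rule independent_if_scalars_zero)
    fix f x assume sum: "(\<Sum>x\<in>B \<union> C. f x *s x) = 0" and x: "x \<in> B \<union> C"
    have eq: "(\<Sum>x\<in>B. f x *s x) = - (\<Sum>x\<in>C. f x *s x)"
      using sum unfolding sum.union_disjoint[OF B(1) C(1) BC] by (simp add: eq_neg_iff_add_eq_0)
    have "(\<Sum>x\<in>B. f x *s x) \<in> span B" "(\<Sum>x\<in>C. f x *s x) \<in> span C"
      by (rule span_sum, rule span_scale, rule span_base, assumption)+
    then have "(\<Sum>x\<in>B. f x *s x) = 0" using eq assms(5) span_neg[of _ C] by (metis IntI singletonD)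
    moreover from this have "(\<Sum>x\<in>C. f x *s x) = 0" using eq by simp
    ultimately show "f x = 0" using x B C dependent_finite by blast
  qed (use B C in simp)
qed

text \<open>The trace of an idempotent is the dimension of its image, as a multiple of one: use a basis made of
the image and of the kernel.\<close>

lemma idempotent_trace:
  assumes B: "finite B" "independent B" and T: "lin T" "T ` span B \<subseteq> span B"
    and idem: "\<And>x. x \<in> span B \<Longrightarrow> T (T x) = T x" and tr0: "tr B T = 0" and x: "x \<in> span B"
  shows "T x = 0"
proof -
  let ?I = "T ` span B" and ?K = "{x \<in> span B. T x = 0}"
  have subI: "subspace ?I" using linear_subspace_image[OF T(1)] by simp
  have subK: "subspace ?K"
    by (rule subspaceI) (auto simp: lin_0[OF T(1)] lin_add[OF T(1)] lin_scale[OF T(1)] span_zero span_add span_scale)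
  obtain C where C: "finite C" "independent C" "span C = ?I" using finite_basis_exists[OF subI T(2) B(1)] .
  obtain D where D: "finite D" "independent D" "span D = ?K" using finite_basis_exists[OF subK _ B(1)] by blast
  have TI: "T y = y" if "y \<in> ?I" for y using that idem by auto
  have int: "span C \<inter> span D = {0}"
  proof
    show "span C \<inter> span D \<subseteq> {0}"
    proof
      fix y assume "y \<in> span C \<inter> span D"
      then have "y \<in> ?I" "T y = 0" unfolding C D by blast+
      then have "y = 0" using TI[of y] by argo
      then show "y \<in> {0}" by blast
    qed
  qed (simp add: span_zero)
  note CD = direct_sum_basis[OF C(1,2) D(1,2) int]
  have "span (C \<union> D) = span B"
  proof
    have "C \<union> D \<subseteq> span B" using C(3) D(3) span_superset[of C] span_superset[of D] T(2) by blast
    then show "span (C \<union> D) \<subseteq> span B" by (intro span_minimal) auto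
    show "span B \<subseteq> span (C \<union> D)"
    proof
      fix y assume y: "y \<in> span B"
      have "T y \<in> span C" using y C(3) by blast
      moreover have "y - T y \<in> span D" unfolding D(3) using y T idem by (auto simp: lin_diff intro: span_diff)
      ultimately have "T y + (y - T y) \<in> span (C \<union> D)" using span_mono[of C "C \<union> D"] span_mono[of D "C \<union> D"]
        by (intro span_add) auto
      then show "y \<in> span (C \<union> D)" by simp
    qed
  qed
  then have "0 = tr (C \<union> D) T"
    using tr_basis_independent[OF B _ CD(1) _ T] tr0 C(1) D(1) by simp
  also have "\<dots> = tr C T + tr D T"
  proof (rule tr_union[OF C(1) D(1) CD])
    have "T x \<in> span C" if "x \<in> C" for x
    proof -
      have "x \<in> ?I" unfolding C(3)[symmetric] using that by (rule span_base)
      from TI[OF this] show ?thesis using span_base[OF that] by argo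
    qed
    then show "T ` C \<subseteq> span C" by blast
    have "T x \<in> span D" if "x \<in> D" for x
    proof -
      have "x \<in> ?K" unfolding D(3)[symmetric] using that by (rule span_base)
      then have "T x = 0" by blast
      then show ?thesis using span_zero[of D] by argo
    qed
    then show "T ` D \<subseteq> span D" by blast
  qed
  also have "tr C T = of_nat (card C)"
    by (rule tr_ident[OF C(1,2)], rule TI) (unfold C(3)[symmetric], rule span_base)
  also have "tr D T = 0"
  proof (rule tr_zero)
    fix x assume "x \<in> D"
    then have "x \<in> ?K" unfolding D(3)[symmetric] by (rule span_base)
    then show "T x = 0" by blast
  qed
  finally have "C = {}" using C(1) by simp
  then have "?I = {0}" using C(3) by simp
  then show ?thesis using x by blast
qed

end

lemma lookup_pm_scale [simp]: "lookup (pm_scale c v) x = c * lookup v x"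
  by (simp add: pm_scale_def Poly_Mapping.map.rep_eq when_def)

lemma vector_space_pm: "vector_space (pm_scale :: 'k::field \<Rightarrow> ('i \<Rightarrow>\<^sub>0 'k) \<Rightarrow> _)"
  by unfold_locales (auto intro!: poly_mapping_eqI simp: lookup_add algebra_simps)

interpretation pm: char0_vector_space "pm_scale :: 'k::field_char_0 \<Rightarrow> ('i \<Rightarrow>\<^sub>0 'k) \<Rightarrow> _"
  by (simp add: char0_vector_space_def vector_space_pm)

section \<open>Averaging over the symmetric group\<close>

abbreviation perms :: "nat \<Rightarrow> (nat \<Rightarrow> nat) set" where
  "perms n \<equiv> {p. p permutes {1..n}}"

lemma finite_perms [simp]: "finite (perms n)"
  by (simp add: finite_permutations)

lemma id_perms [simp]: "id \<in> perms n" by (simp add: permutes_id)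

lemma card_perms: "card (perms n) = fact n"
  using card_permutations[of "{1..n}" n] by simp

lemma comp_perms: "p \<in> perms n \<Longrightarrow> q \<in> perms n \<Longrightarrow> p \<circ> q \<in> perms n"
  by (simp add: permutes_compose)

lemma inv_perms: "p \<in> perms n \<Longrightarrow> inv p \<in> perms n"
  by (simp add: permutes_inv)

lemma sum_perms_comp_right: "h \<in> perms n \<Longrightarrow> (\<Sum>g\<in>perms n. f (g \<circ> h)) = (\<Sum>g\<in>perms n. f g)"
  using sum_permutations_compose_right[of h "{1..n}" f] by simp

context char0_vector_space begin

definition rep :: "nat \<Rightarrow> ((nat \<Rightarrow> nat) \<Rightarrow> 'b \<Rightarrow> 'b) \<Rightarrow> 'b set \<Rightarrow> bool" where
  "rep n a U \<longleftrightarrow> (\<forall>g\<in>perms n. lin (a g) \<and> a g ` U \<subseteq> U) \<and> (\<forall>x\<in>U. a id x = x) \<and>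
     (\<forall>g\<in>perms n. \<forall>h\<in>perms n. \<forall>x\<in>U. a (g \<circ> h) x = a g (a h x))"

lemma repD:
  assumes "rep n a U"
  shows "g \<in> perms n \<Longrightarrow> lin (a g)" "g \<in> perms n \<Longrightarrow> x \<in> U \<Longrightarrow> a g x \<in> U" "x \<in> U \<Longrightarrow> a id x = x"
    "g \<in> perms n \<Longrightarrow> h \<in> perms n \<Longrightarrow> x \<in> U \<Longrightarrow> a (g \<circ> h) x = a g (a h x)"
  using assms unfolding rep_def by blast+

lemma rep_subset:
  assumes "rep n a U" "W \<subseteq> U" "\<And>g x. g \<in> perms n \<Longrightarrow> x \<in> W \<Longrightarrow> a g x \<in> W"
  shows "rep n a W"
  unfolding rep_def using repD(1)[OF assms(1)] assms(3) repD(3)[OF assms(1) subsetD[OF assms(2)]]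
    repD(4)[OF assms(1) _ _ subsetD[OF assms(2)]] by blast

lemma rep_inv:
  assumes "rep n a U" "g \<in> perms n" "x \<in> U"
  shows "a (inv g) (a g x) = x"
proof -
  have "inv g \<circ> g = id" using assms(2) permutes_inv_o(2) by blast
  then show ?thesis using repD(4)[OF assms(1) inv_perms[OF assms(2)] assms(2,3)] repD(3)[OF assms(1,3)] by simp
qed

definition equivariant :: "nat \<Rightarrow> ((nat \<Rightarrow> nat) \<Rightarrow> 'b \<Rightarrow> 'b) \<Rightarrow> ((nat \<Rightarrow> nat) \<Rightarrow> 'b \<Rightarrow> 'b) \<Rightarrow> 'b set \<Rightarrow> ('b \<Rightarrow> 'b) \<Rightarrow> bool" where
  "equivariant n a a' U T \<longleftrightarrow> (\<forall>g\<in>perms n. \<forall>x\<in>U. T (a g x) = a' g (T x))"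

text \<open>The mean over the group of the conjugates of \<open>\<phi>\<close>, which is a projection onto equivariant maps.\<close>

definition avg :: "nat \<Rightarrow> ((nat \<Rightarrow> nat) \<Rightarrow> 'b \<Rightarrow> 'b) \<Rightarrow> ((nat \<Rightarrow> nat) \<Rightarrow> 'b \<Rightarrow> 'b) \<Rightarrow> ('b \<Rightarrow> 'b) \<Rightarrow> 'b \<Rightarrow> 'b" where
  "avg n a a' \<phi> x = inverse (of_nat (card (perms n))) *s (\<Sum>g\<in>perms n. a' (inv g) (\<phi> (a g x)))"

lemma card_perms_nonzero: "(of_nat (card (perms n)) :: 'a) \<noteq> 0"
  unfolding card_perms by simp

lemma avg_lin:
  assumes "rep n a U" "rep n a' U'" "lin \<phi>"
  shows "lin (avg n a a' \<phi>)"
proof (rule linI)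
  note L = repD(1)[OF assms(1)] repD(1)[OF assms(2) inv_perms] assms(3)
  show "avg n a a' \<phi> (x + y) = avg n a a' \<phi> x + avg n a a' \<phi> y" for x y
    unfolding avg_def scale_right_distrib[symmetric] sum.distrib[symmetric]
    using L by (intro arg_cong2[where f = scale] sum.cong refl) (simp only: lin_add)
  show "avg n a a' \<phi> (c *s x) = c *s avg n a a' \<phi> x" for c x
  proof -
    have "(\<Sum>g\<in>perms n. a' (inv g) (\<phi> (a g (c *s x)))) = c *s (\<Sum>g\<in>perms n. a' (inv g) (\<phi> (a g x)))"
      unfolding scale_sum_right using L by (intro sum.cong refl) (simp only: lin_scale)
    then show ?thesis unfolding avg_def by (simp add: mult.commute)
  qed
qed

lemma avg_in:
  assumes "rep n a U" "rep n a' U'" "subspace U'" "\<phi> ` U \<subseteq> U'" "x \<in> U"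
  shows "avg n a a' \<phi> x \<in> U'"
proof -
  have "a' (inv g) (\<phi> (a g x)) \<in> U'" if "g \<in> perms n" for g
    using repD(2)[OF assms(2) inv_perms[OF that]] repD(2)[OF assms(1) that assms(5)] assms(4) by blast
  then show ?thesis unfolding avg_def by (intro subspace_scale[OF assms(3)] subspace_sum[OF assms(3)])
qed

lemma avg_equivariant:
  assumes r: "rep n a U" "rep n a' U'" and \<phi>: "\<phi> ` U \<subseteq> U'"
  shows "equivariant n a a' U (avg n a a' \<phi>)"
  unfolding equivariant_def
proof (intro ballI)
  fix h x assume h: "h \<in> perms n" and x: "x \<in> U"
  let ?c = "inverse (of_nat (card (perms n)))"
  let ?f = "\<lambda>g. a' (h \<circ> inv g) (\<phi> (a g x))"
  have L: "lin (a' h)" using repD(1)[OF r(2) h] .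
  have "a' h (avg n a a' \<phi> x) = ?c *s (\<Sum>g\<in>perms n. a' h (a' (inv g) (\<phi> (a g x))))"
    unfolding avg_def by (simp only: lin_scale[OF L] lin_sum[OF L])
  also have "(\<Sum>g\<in>perms n. a' h (a' (inv g) (\<phi> (a g x)))) = (\<Sum>g\<in>perms n. ?f g)"
  proof (rule sum.cong[OF refl])
    fix g assume g: "g \<in> perms n"
    have "\<phi> (a g x) \<in> U'" using \<phi> repD(2)[OF r(1) g x] by blast
    then show "a' h (a' (inv g) (\<phi> (a g x))) = ?f g" using repD(4)[OF r(2) h inv_perms[OF g]] by simp
  qed
  also have "\<dots> = (\<Sum>g\<in>perms n. ?f (g \<circ> h))" by (rule sum_perms_comp_right[OF h, symmetric])
  also have "\<dots> = (\<Sum>g\<in>perms n. a' (inv g) (\<phi> (a g (a h x))))"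
  proof (rule sum.cong[OF refl])
    fix g assume g: "g \<in> perms n"
    have "bij g" "bij h" using g h permutes_bij by blast+
    then have "h \<circ> inv (g \<circ> h) = inv g"
      by (simp add: o_inv_distrib o_assoc bij_is_surj surj_iff[THEN iffD1])
    then show "?f (g \<circ> h) = a' (inv g) (\<phi> (a g (a h x)))" using repD(4)[OF r(1) g h x] by simp
  qed
  finally show "avg n a a' \<phi> (a h x) = a' h (avg n a a' \<phi> x)" unfolding avg_def by simp
qed

text \<open>The complement is the kernel of the average of a linear projection onto \<open>U\<close>.\<close>

lemma maschke:
  assumes r: "rep n a V" and V: "subspace V" and U: "subspace U" "U \<subseteq> V" and inv: "\<And>g x. g \<in> perms n \<Longrightarrow> x \<in> U \<Longrightarrow> a g x \<in> U"
  obtains W where "subspace W" "W \<subseteq> V" "rep n a W" "U \<inter> W = {0}" "\<And>v. v \<in> V \<Longrightarrow> \<exists>u\<in>U. v - u \<in> W"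
proof -
  have rU: "rep n a U" by (rule rep_subset[OF r U(2) inv])
  obtain \<phi> where \<phi>: "range \<phi> \<subseteq> U" "lin \<phi>" "\<forall>v\<in>U. \<phi> v = v"
  proof -
    have "lin id" by (rule linI) simp_all
    from linear_exists_left_inverse_on[OF this U(1)] show ?thesis using that by auto
  qed
  define P where "P = avg n a a \<phi>"
  have P: "lin P" unfolding P_def by (rule avg_lin[OF r r \<phi>(2)])
  have PV: "P x \<in> U" if "x \<in> V" for x unfolding P_def
    using \<phi>(1) that by (intro avg_in[OF r rU U(1)]) auto
  have PU: "P x = x" if x: "x \<in> U" for x
  proof -
    have "a (inv g) (\<phi> (a g x)) = x" if g: "g \<in> perms n" for g
      using rep_inv[OF rU g x] \<phi>(3) inv[OF g x] by simp
    then have "(\<Sum>g\<in>perms n. a (inv g) (\<phi> (a g x))) = of_nat (card (perms n)) *s x"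
      using sum_constant_scale[of x "perms n"] by simp
    then show ?thesis unfolding P_def avg_def using card_perms_nonzero by simp
  qed
  have Peq: "P (a g x) = a g (P x)" if "g \<in> perms n" "x \<in> V" for g x
    using avg_equivariant[OF r rU, of \<phi>] \<phi>(1) that unfolding P_def equivariant_def by blast
  define W where "W = {x \<in> V. P x = 0}"
  have sub: "subspace W" unfolding W_def
    using subspace_0[OF V] subspace_add[OF V] subspace_scale[OF V]
    by (intro subspaceI) (auto simp: lin_0[OF P] lin_add[OF P] lin_scale[OF P])
  have "rep n a W"
  proof (rule rep_subset[OF r])
    show "W \<subseteq> V" by (auto simp: W_def)
    fix g x assume "g \<in> perms n" "x \<in> W"
    then show "a g x \<in> W" using Peq[of g x] repD(1,2)[OF r] by (simp add: W_def lin_0)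
  qed
  moreover have "U \<inter> W = {0}" using PU subspace_0[OF U(1)] subspace_0[OF sub] unfolding W_def by force
  moreover have "\<exists>u\<in>U. v - u \<in> W" if "v \<in> V" for v
  proof (rule bexI[OF _ PV[OF that]])
    have "v - P v \<in> V" using PV[OF that] U(2) that subspace_diff[OF V] by blast
    moreover have "P (v - P v) = 0" using lin_diff[OF P, of v "P v"] PU[OF PV[OF that]] by simp
    ultimately show "v - P v \<in> W" by (simp add: W_def)
  qed
  ultimately show ?thesis using that sub W_def by blast
qed

end

text \<open>\<open>idempotent_trace\<close> for a matrix over an arbitrary finite index set, acting on finitely supported
functions.\<close>

lemma idempotent_matrix_trace:
  fixes E :: "'x \<Rightarrow> 'x \<Rightarrow> 'k::field_char_0"
  assumes X: "finite X" and idem: "\<And>x z. x \<in> X \<Longrightarrow> z \<in> X \<Longrightarrow> (\<Sum>y\<in>X. E x y * E y z) = E x z"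
    and tr0: "(\<Sum>x\<in>X. E x x) = 0" and xy: "x \<in> X" "y \<in> X"
  shows "E x y = 0"
proof -
  define D :: "('x \<Rightarrow>\<^sub>0 'k) set" where "D = (\<lambda>x. single x 1) ` X"
  define T :: "('x \<Rightarrow>\<^sub>0 'k) \<Rightarrow> ('x \<Rightarrow>\<^sub>0 'k)" where
    "T v = (\<Sum>x\<in>X. single x (\<Sum>y\<in>X. E x y * lookup v y))" for v
  have lookup_sum: "lookup (\<Sum>i\<in>I. f i) z = (\<Sum>i\<in>I. lookup (f i) z)"
    for I and f :: "'i \<Rightarrow> 'x \<Rightarrow>\<^sub>0 'k" and z by (induction I rule: infinite_finite_induct) (auto simp: lookup_add)
  have T: "lookup (T v) z = (if z \<in> X then \<Sum>y\<in>X. E z y * lookup v y else 0)" for v z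
    unfolding T_def lookup_sum using X by (simp add: lookup_single when_def)
  have inj: "inj_on (\<lambda>x. single x (1::'k)) X" by (rule inj_onI) (metis lookup_single_eq lookup_single_not_eq zero_neq_one)
  have D: "finite D" using X by (simp add: D_def)
  have comb: "lookup (\<Sum>d\<in>D. pm_scale (f d) d) z = (if z \<in> X then f (single z 1) else 0)" for f z
    unfolding lookup_sum D_def sum.reindex[OF inj] using X by (simp add: lookup_single when_def if_distrib cong: if_cong)
  have indep: "pm.independent D"
  proof (rule pm.independent_if_scalars_zero[OF D])
    fix f d assume "(\<Sum>x\<in>D. pm_scale (f x) x) = 0" "d \<in> D"
    then obtain z where "z \<in> X" "d = single z 1" by (auto simp: D_def)
    then show "f d = 0" using comb[of f z] \<open>(\<Sum>x\<in>D. pm_scale (f x) x) = 0\<close> by simp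
  qed
  have span: "v \<in> pm.span D" if "keys v \<subseteq> X" for v
  proof -
    have "v = (\<Sum>x\<in>X. pm_scale (lookup v x) (single x 1))"
    proof (rule poly_mapping_eqI)
      fix z
      have "z \<notin> X \<Longrightarrow> lookup v z = 0" using that by (auto simp: in_keys_iff)
      then show "lookup v z = lookup (\<Sum>x\<in>X. pm_scale (lookup v x) (single x 1)) z"
        unfolding lookup_sum using X by (auto simp: lookup_single when_def if_distrib cong: if_cong)
    qed
    also have "\<dots> \<in> pm.span D" by (rule pm.span_sum, rule pm.span_scale, rule pm.span_base) (simp add: D_def)
    finally show ?thesis .
  qed
  have Tspan: "T v \<in> pm.span D" for v by (rule span) (auto simp: in_keys_iff T split: if_splits)
  have lin: "pm.lin T"
    by (rule pm.linI; rule poly_mapping_eqI)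
       (auto simp: T lookup_add algebra_simps sum.distrib sum_distrib_left)
  have Ts: "lookup (T (single z 1)) w = (if w \<in> X then E w z else 0)" if "z \<in> X" for z w
    unfolding T using that X by (simp add: lookup_single when_def if_distrib cong: if_cong)
  have idemT: "T (T v) = T v" for v
  proof (rule poly_mapping_eqI)
    fix z
    show "lookup (T (T v)) z = lookup (T v) z"
    proof (cases "z \<in> X")
      case True
      have "(\<Sum>y\<in>X. E z y * (\<Sum>w\<in>X. E y w * lookup v w)) = (\<Sum>w\<in>X. (\<Sum>y\<in>X. E z y * E y w) * lookup v w)"
        unfolding sum_distrib_left sum_distrib_right by (subst sum.swap) (simp add: mult.assoc)
      also have "\<dots> = (\<Sum>w\<in>X. E z w * lookup v w)" using idem[OF True] by (intro sum.cong) auto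
      finally show ?thesis using True by (simp add: T)
    qed (simp add: T)
  qed
  have repr: "pm.representation D v (single z 1) = lookup v z" if "v \<in> pm.span D" "z \<in> X" for v z
    using comb[of "pm.representation D v" z] pm.sum_representation_eq[OF indep that(1) D order_refl] that(2) by simp
  have "pm.tr D T = (\<Sum>x\<in>X. lookup (T (single x 1)) x)"
    unfolding pm.tr_def D_def sum.reindex[OF inj] o_def using repr[OF Tspan] by (simp add: D_def)
  also have "\<dots> = 0" using tr0 by (simp add: Ts)
  finally have "T (single y 1) = 0"
    using idemT Tspan xy by (intro pm.idempotent_trace[OF D indep lin]) (auto simp: D_def intro: pm.span_base)
  then show ?thesis using Ts[OF xy(2), of x] xy(1) by simp
qed

section \<open>Traces determine representations\<close>

context char0_vector_space begin

text \<open>Up to the group order, the scalar product of the two characters.\<close>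

definition char_pairing :: "nat \<Rightarrow> 'b set \<Rightarrow> ((nat \<Rightarrow> nat) \<Rightarrow> 'b \<Rightarrow> 'b) \<Rightarrow> 'b set \<Rightarrow> ((nat \<Rightarrow> nat) \<Rightarrow> 'b \<Rightarrow> 'b) \<Rightarrow> 'a" where
  "char_pairing n B a B' a' = (\<Sum>g\<in>perms n. tr B (a g) * tr B' (a' (inv g)))"

text \<open>The pairing is a sum of matrix entries of averages of elementary maps from \<open>span B\<close> to
\<open>span B'\<close>, and those averages are equivariant.\<close>

lemma char_pairing_zero:
  assumes B: "finite B" "independent B" and B': "finite B'" "independent B'"
    and r: "rep n a (span B)" "rep n a' (span B')"
    and none: "\<And>T. lin T \<Longrightarrow> T ` span B \<subseteq> span B' \<Longrightarrow> equivariant n a a' (span B) T \<Longrightarrow> \<forall>x\<in>span B. T x = 0"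
  shows "char_pairing n B a B' a' = 0"
proof -
  have entry: "(\<Sum>g\<in>perms n. representation B (a g b) b * representation B' (a' (inv g) b') b') = 0"
    if b: "b \<in> B" "b' \<in> B'" for b b'
  proof -
    define \<phi> where "\<phi> = construct B (\<lambda>c. if c = b then b' else 0)"
    have \<phi>: "lin \<phi>" unfolding \<phi>_def by (rule linear_construct[OF B(2)])
    have phi: "\<phi> v = representation B v b *s b'" if v: "v \<in> span B" for v
    proof -
      have "\<phi> v = \<phi> (\<Sum>c\<in>B. representation B v c *s c)" using sum_representation_eq[OF B(2) v B(1) order_refl] by simp
      also have "\<dots> = (\<Sum>c\<in>B. representation B v c *s \<phi> c)" by (simp only: lin_sum[OF \<phi>] lin_scale[OF \<phi>])
      also have "\<dots> = (\<Sum>c\<in>B. if c = b then representation B v c *s b' else 0)"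
        unfolding \<phi>_def using construct_basis[OF B(2)] by (intro sum.cong refl) auto
      also have "\<dots> = representation B v b *s b'" using B(1) b by simp
      finally show ?thesis .
    qed
    have im: "\<phi> ` span B \<subseteq> span B'" using phi b(2) by (auto intro: span_scale span_base)
    have "\<forall>x\<in>span B. avg n a a' \<phi> x = 0"
    proof (rule none)
      show "lin (avg n a a' \<phi>)" by (rule avg_lin[OF r \<phi>])
      show "avg n a a' \<phi> ` span B \<subseteq> span B'" using avg_in[OF r _ im] by blast
      show "equivariant n a a' (span B) (avg n a a' \<phi>)" by (rule avg_equivariant[OF r im])
    qed
    then have "avg n a a' \<phi> b = 0" using b(1) span_base by blast
    then have "(\<Sum>g\<in>perms n. a' (inv g) (\<phi> (a g b))) = 0"
      unfolding avg_def scale_eq_0_iff inverse_nonzero_iff_nonzero using card_perms_nonzero by blast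
    moreover have "a' (inv g) (\<phi> (a g b)) = representation B (a g b) b *s a' (inv g) b'" if g: "g \<in> perms n" for g
      using phi[OF repD(2)[OF r(1) g span_base[OF b(1)]]] lin_scale[OF repD(1)[OF r(2) inv_perms[OF g]]] by simp
    ultimately have "(\<Sum>g\<in>perms n. representation B (a g b) b *s a' (inv g) b') = 0" by simp
    then have "representation B' (\<Sum>g\<in>perms n. representation B (a g b) b *s a' (inv g) b') b' = 0"
      by (simp add: representation_zero)
    moreover have sp: "a' (inv g) b' \<in> span B'" if "g \<in> perms n" for g
      using repD(2)[OF r(2) inv_perms[OF that] span_base[OF b(2)]] .
    have "representation B' (\<Sum>g\<in>perms n. representation B (a g b) b *s a' (inv g) b') b' =
      (\<Sum>g\<in>perms n. representation B' (representation B (a g b) b *s a' (inv g) b') b')"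
      by (subst representation_sum[OF B'(2)], rule span_scale, erule sp, rule refl)
    moreover have "\<dots> = (\<Sum>g\<in>perms n. representation B (a g b) b * representation B' (a' (inv g) b') b')"
      by (intro sum.cong refl) (simp only: representation_scale[OF B'(2) sp])
    ultimately show ?thesis by simp
  qed
  have "char_pairing n B a B' a' = (\<Sum>b\<in>B. \<Sum>b'\<in>B'. \<Sum>g\<in>perms n. representation B (a g b) b * representation B' (a' (inv g) b') b')"
    unfolding char_pairing_def tr_def sum_product
    by (subst sum.swap, intro sum.cong refl, subst sum.swap) simp
  also have "\<dots> = 0" using entry by simp
  finally show ?thesis .
qed

lemma rep_matrix_mult:
  assumes B: "finite B" "independent B" and r: "rep n a (span B)" and g: "g \<in> perms n" "h \<in> perms n" and b: "b \<in> B"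
  shows "representation B (a (g \<circ> h) b) c = (\<Sum>d\<in>B. representation B (a h b) d * representation B (a g d) c)"
proof -
  have hb: "a h b \<in> span B" using repD(2)[OF r g(2) span_base[OF b]] .
  have gd: "a g d \<in> span B" if "d \<in> B" for d using repD(2)[OF r g(1) span_base[OF that]] .
  note L = repD(1)[OF r g(1)]
  have "a (g \<circ> h) b = a g (\<Sum>d\<in>B. representation B (a h b) d *s d)"
    using repD(4)[OF r g span_base[OF b]] sum_representation_eq[OF B(2) hb B(1) order_refl] by simp
  also have "\<dots> = (\<Sum>d\<in>B. representation B (a h b) d *s a g d)" by (simp only: lin_sum[OF L] lin_scale[OF L])
  finally have "representation B (a (g \<circ> h) b) c = (\<Sum>d\<in>B. representation B (representation B (a h b) d *s a g d) c)"
    by (simp add: representation_sum[OF B(2)] span_scale gd)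
  also have "\<dots> = (\<Sum>d\<in>B. representation B (a h b) d * representation B (a g d) c)"
    by (intro sum.cong refl) (simp only: representation_scale[OF B(2) gd])
  finally show ?thesis .
qed

text \<open>Up to the group order the pairing is the trace of averaging, regarded as an idempotent on
endomorphisms. If it were zero, averaging would annihilate the identity, which it fixes.\<close>

lemma char_pairing_self_nonzero:
  assumes B: "finite B" "independent B" "B \<noteq> {}" and r: "rep n a (span B)"
  shows "char_pairing n B a B a \<noteq> 0"
proof
  assume pair0: "char_pairing n B a B a = 0"
  let ?R = "representation B" and ?N = "of_nat (card (perms n)) :: 'a"
  note mult = rep_matrix_mult[OF B(1,2) r]
  \<comment> \<open>the matrix of \<open>\<phi> \<mapsto> avg \<phi>\<close> on the endomorphisms of the representation\<close>
  define E where "E = (\<lambda>(i, j) (k, l). inverse ?N * (\<Sum>g\<in>perms n. ?R (a g i) k * ?R (a (inv g) l) j))"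
  have idem: "(\<Sum>y\<in>B \<times> B. E x y * E y z) = E x z" if "x \<in> B \<times> B" "z \<in> B \<times> B" for x z
  proof -
    obtain i j k l where x: "x = (i, j)" "z = (k, l)" by (cases x; cases z)
    have ij: "i \<in> B" "j \<in> B" "k \<in> B" "l \<in> B" using that x by auto
    have "(\<Sum>y\<in>B \<times> B. E x y * E y z) = (\<Sum>(p, q)\<in>B \<times> B. inverse ?N * inverse ?N *
       (\<Sum>g\<in>perms n. \<Sum>h\<in>perms n. (?R (a g i) p * ?R (a h p) k) * (?R (a (inv h) l) q * ?R (a (inv g) q) j)))"
    proof (rule sum.cong[OF refl])
      fix y assume "y \<in> B \<times> B"
      obtain p q where y: "y = (p, q)" by (cases y)
      have m: "(u * s) * (u * t) = u * u * (s * t)" for u s t :: 'a by (simp only: mult_ac)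
      show "E x y * E y z = (case y of (p, q) \<Rightarrow> inverse ?N * inverse ?N *
        (\<Sum>g\<in>perms n. \<Sum>h\<in>perms n. (?R (a g i) p * ?R (a h p) k) * (?R (a (inv h) l) q * ?R (a (inv g) q) j)))"
        unfolding x y E_def prod.case m sum_product
        by (rule arg_cong2[where f = times, OF refl], intro sum.cong refl) (simp only: mult_ac)
    qed
    also have "\<dots> = inverse ?N * inverse ?N * (\<Sum>g\<in>perms n. \<Sum>h\<in>perms n. \<Sum>(p, q)\<in>B \<times> B.
       (?R (a g i) p * ?R (a h p) k) * (?R (a (inv h) l) q * ?R (a (inv g) q) j))"
      unfolding case_prod_unfold sum_distrib_left[symmetric]
      by (subst sum.swap, intro arg_cong2[where f = times] sum.cong refl, subst sum.swap) simp
    also have "(\<Sum>g\<in>perms n. \<Sum>h\<in>perms n. \<Sum>(p, q)\<in>B \<times> B.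
       (?R (a g i) p * ?R (a h p) k) * (?R (a (inv h) l) q * ?R (a (inv g) q) j)) =
       (\<Sum>g\<in>perms n. \<Sum>h\<in>perms n. ?R (a (h \<circ> g) i) k * ?R (a (inv (h \<circ> g)) l) j)"
    proof (intro sum.cong refl)
      fix g h assume g: "g \<in> perms n" and h: "h \<in> perms n"
      have "bij g" "bij h" using g h permutes_bij by blast+
      then have i: "inv (h \<circ> g) = inv g \<circ> inv h" by (rule o_inv_distrib[rotated])
      have "(\<Sum>(p, q)\<in>B \<times> B. (?R (a g i) p * ?R (a h p) k) * (?R (a (inv h) l) q * ?R (a (inv g) q) j)) =
        (\<Sum>p\<in>B. ?R (a g i) p * ?R (a h p) k) * (\<Sum>q\<in>B. ?R (a (inv h) l) q * ?R (a (inv g) q) j)"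
        by (simp only: sum_product sum.cartesian_product)
      also have "\<dots> = ?R (a (h \<circ> g) i) k * ?R (a (inv (h \<circ> g)) l) j"
        unfolding i mult[OF h g ij(1)] mult[OF inv_perms[OF g] inv_perms[OF h] ij(4)] ..
      finally show "(\<Sum>(p, q)\<in>B \<times> B. (?R (a g i) p * ?R (a h p) k) * (?R (a (inv h) l) q * ?R (a (inv g) q) j)) =
        ?R (a (h \<circ> g) i) k * ?R (a (inv (h \<circ> g)) l) j" .
    qed
    also have "\<dots> = (\<Sum>g\<in>perms n. \<Sum>h\<in>perms n. ?R (a h i) k * ?R (a (inv h) l) j)"
      by (rule sum.cong[OF refl]) (rule sum_perms_comp_right[where f = "\<lambda>h. ?R (a h i) k * ?R (a (inv h) l) j"])
    also have "inverse ?N * inverse ?N * \<dots> = E x z"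
      unfolding x E_def sum_constant using card_perms_nonzero[of n] by (simp add: field_simps)
    finally show ?thesis .
  qed
  have "(\<Sum>x\<in>B \<times> B. E x x) = inverse ?N * (\<Sum>g\<in>perms n. \<Sum>(i, j)\<in>B \<times> B. ?R (a g i) i * ?R (a (inv g) j) j)"
    unfolding E_def case_prod_unfold sum_distrib_left[symmetric]
    by (subst sum.swap) simp
  also have "(\<Sum>g\<in>perms n. \<Sum>(i, j)\<in>B \<times> B. ?R (a g i) i * ?R (a (inv g) j) j) = char_pairing n B a B a"
    unfolding char_pairing_def tr_def by (simp only: sum_product sum.cartesian_product)
  finally have tr0: "(\<Sum>x\<in>B \<times> B. E x x) = 0" using pair0 by simp
  have E0: "E x y = 0" if "x \<in> B \<times> B" "y \<in> B \<times> B" for x y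
    using idempotent_matrix_trace[of "B \<times> B" E, OF _ idem tr0 that] B(1) by simp
  obtain b where b: "b \<in> B" using B(3) by blast
  \<comment> \<open>the average of the identity is the identity\<close>
  have "0 = (\<Sum>k\<in>B. E (b, b) (k, k))" using E0 b by simp
  also have "\<dots> = inverse ?N * (\<Sum>g\<in>perms n. \<Sum>k\<in>B. ?R (a g b) k * ?R (a (inv g) k) b)"
    unfolding E_def prod.case sum_distrib_left[symmetric] by (subst sum.swap) simp
  also have "(\<Sum>g\<in>perms n. \<Sum>k\<in>B. ?R (a g b) k * ?R (a (inv g) k) b) = (\<Sum>g\<in>perms n. 1)"
  proof (rule sum.cong[OF refl])
    fix g assume g: "g \<in> perms n"
    have "inv g \<circ> g = id" using g permutes_inv_o(2) by blast
    then have "(\<Sum>k\<in>B. ?R (a g b) k * ?R (a (inv g) k) b) = ?R (a id b) b"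
      using mult[OF inv_perms[OF g] g b, of b] by simp
    also have "\<dots> = 1" using repD(3)[OF r span_base[OF b]] b by (simp add: representation_basis[OF B(2) b])
    finally show "(\<Sum>k\<in>B. ?R (a g b) k * ?R (a (inv g) k) b) = 1" .
  qed
  also have "inverse ?N * (\<Sum>g\<in>perms n. 1) = 1" using card_perms_nonzero[of n] by simp
  finally show False by simp
qed

text \<open>By induction on the dimension. Equal traces turn the self-pairing of one representation into the
pairing of both, so there is a nonzero equivariant map between them. It restricts to an isomorphism from an invariant
complement of its kernel onto its image. The kernel and an invariant complement of the image again
have equal traces.\<close>

lemma equal_traces_imp_iso:
  assumes "finite B" "independent B" "finite B'" "independent B'"
    and "rep n a (span B)" "rep n a' (span B')"
    and "\<And>g. g \<in> perms n \<Longrightarrow> tr B (a g) = tr B' (a' g)"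
  shows "\<exists>T. lin T \<and> bij_betw T (span B) (span B') \<and> equivariant n a a' (span B) T"
  using assms
proof (induction "card B" arbitrary: B B' rule: less_induct)
  case less
  note B = less.prems(1,2) and B' = less.prems(3,4) and r = less.prems(5,6) and chi = less.prems(7)
  show ?case
  proof (cases "B = {}")
    case True
    have "tr B' (a' id) = of_nat (card B')"
      using repD(3)[OF r(2)] by (intro tr_ident B') (simp add: span_base)
    moreover have "tr B (a id) = 0" using True by (simp add: tr_def)
    ultimately have "B' = {}" using chi[of id] B'(1) by simp
    moreover have "lin id" by (rule linI) simp_all
    moreover have "a' g 0 = 0" "a g 0 = 0" if "g \<in> perms n" for g
      using repD(1)[OF r(2) that] repD(1)[OF r(1) that] by (simp_all add: lin_0)
    ultimately show ?thesis using True by (intro exI[of _ id]) (auto simp: equivariant_def)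
  next
    case False
    have "char_pairing n B a B' a' = char_pairing n B a B a"
      unfolding char_pairing_def using chi inv_perms by (intro sum.cong refl) simp
    then have "char_pairing n B a B' a' \<noteq> 0" using char_pairing_self_nonzero[OF B False r(1)] by simp
    then obtain T x where T: "lin T" "T ` span B \<subseteq> span B'" "equivariant n a a' (span B) T"
      and x: "x \<in> span B" "T x \<noteq> 0"
      using char_pairing_zero[OF B B' r] by blast
    have Teq: "T (a g y) = a' g (T y)" if "g \<in> perms n" "y \<in> span B" for g y
      using T(3) that unfolding equivariant_def by blast
    let ?K = "{y \<in> span B. T y = 0}" and ?I = "T ` span B"
    have subK: "subspace ?K"
      by (rule subspaceI) (auto simp: lin_0[OF T(1)] lin_add[OF T(1)] lin_scale[OF T(1)] span_zero span_add span_scale)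
    have subI: "subspace ?I" using linear_subspace_image[OF T(1)] by simp
    have "a g y \<in> ?K" if "g \<in> perms n" "y \<in> ?K" for g y
      using that repD(2)[OF r(1)] Teq repD(1)[OF r(2)] by (simp add: lin_0)
    note stabK = this
    from maschke[OF r(1) _ subK _ stabK]
    obtain C where C: "subspace C" "C \<subseteq> span B" "rep n a C" "?K \<inter> C = {0}" "\<And>v. v \<in> span B \<Longrightarrow> \<exists>u\<in>?K. v - u \<in> C"
      by auto
    have stabI: "a' g y \<in> ?I" if gy: "g \<in> perms n" "y \<in> ?I" for g y
    proof -
      obtain v where "v \<in> span B" "y = T v" using gy(2) by blast
      then show ?thesis using Teq[OF gy(1)] repD(2)[OF r(1) gy(1)] by (intro image_eqI[of _ _ "a g v"]) simp_all
    qed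
    from maschke[OF r(2) _ subI T(2) stabI]
    obtain C' where C': "subspace C'" "C' \<subseteq> span B'" "rep n a' C'" "?I \<inter> C' = {0}" "\<And>v. v \<in> span B' \<Longrightarrow> \<exists>u\<in>?I. v - u \<in> C'"
      by auto
    obtain BK where BK: "finite BK" "independent BK" "span BK = ?K" using finite_basis_exists[OF subK _ B(1)] by blast
    obtain BC where BC: "finite BC" "independent BC" "span BC = C" using finite_basis_exists[OF C(1,2) B(1)] by blast
    obtain BC' where BC': "finite BC'" "independent BC'" "span BC' = C'" using finite_basis_exists[OF C'(1,2) B'(1)] by blast
    have "span BK \<inter> span BC = {0}" unfolding BK BC by (rule C(4))
    note KC = direct_sum_basis[OF BK(1,2) BC(1,2) this]
    have injC: "inj_on T C"
    proof (rule inj_onI)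
      fix y z assume yz: "y \<in> C" "z \<in> C" "T y = T z"
      then have "y - z \<in> C" using C(1) subspace_diff by blast
      moreover have "T (y - z) = 0" using yz lin_diff[OF T(1)] by simp
      ultimately have "y - z \<in> ?K \<inter> C" using C(2) by auto
      then show "y = z" using C(4) by simp
    qed
    have spanKC: "span (BK \<union> BC) = span B"
    proof
      have "BK \<subseteq> span B" using span_superset[of BK] unfolding BK(3) by blast
      moreover have "BC \<subseteq> span B" using span_superset[of BC] unfolding BC(3) using C(2) by (rule subset_trans)
      ultimately show "span (BK \<union> BC) \<subseteq> span B" by (intro span_minimal) auto
      show "span B \<subseteq> span (BK \<union> BC)"
      proof
        fix v assume "v \<in> span B"
        then obtain u where "u \<in> span BK" "v - u \<in> span BC" using C(5) BK(3) BC(3) by blast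
        then have "u + (v - u) \<in> span (BK \<union> BC)"
          using span_mono[of BK "BK \<union> BC"] span_mono[of BC "BK \<union> BC"] by (intro span_add) auto
        then show "v \<in> span (BK \<union> BC)" by simp
      qed
    qed
    have TC: "T ` C = ?I"
    proof (intro equalityI subsetI)
      fix y assume "y \<in> ?I"
      then obtain v where v: "v \<in> span B" "y = T v" by blast
      then obtain u where "u \<in> ?K" "v - u \<in> C" using C(5) by blast
      then have "T (v - u) = y" using v lin_diff[OF T(1), of v u] by simp
      then show "y \<in> T ` C" using \<open>v - u \<in> C\<close> by blast
    qed (use C(2) in blast)
    have injBC: "inj_on T (span BC)" using injC BC(3) by simp
    have TB: "finite (T ` BC)" "independent (T ` BC)" "span (T ` BC) = ?I"
      using BC independent_image[OF T(1) BC(2) injBC] lin_span_image[OF T(1), of BC] TC by auto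
    have "span (T ` BC) \<inter> span BC' = {0}" unfolding TB BC' by (rule C'(4))
    note IC = direct_sum_basis[OF TB(1,2) BC'(1,2) this]
    have spanIC: "span (T ` BC \<union> BC') = span B'"
    proof
      have "T ` BC \<subseteq> span B'" using span_superset[of "T ` BC"] unfolding TB(3) using T(2) by (rule subset_trans)
      moreover have "BC' \<subseteq> span B'" using span_superset[of BC'] unfolding BC'(3) using C'(2) by (rule subset_trans)
      ultimately show "span (T ` BC \<union> BC') \<subseteq> span B'" by (intro span_minimal) auto
      show "span B' \<subseteq> span (T ` BC \<union> BC')"
      proof
        fix v assume "v \<in> span B'"
        then obtain u where "u \<in> span (T ` BC)" "v - u \<in> span BC'" using C'(5) TB(3) BC'(3) by blast
        then have "u + (v - u) \<in> span (T ` BC \<union> BC')"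
          using span_mono[of "T ` BC" "T ` BC \<union> BC'"] span_mono[of BC' "T ` BC \<union> BC'"] by (intro span_add) auto
        then show "v \<in> span (T ` BC \<union> BC')" by simp
      qed
    qed
    have rK: "rep n a (span BK)" unfolding BK by (rule rep_subset[OF r(1) _ stabK]) auto
    have rC: "rep n a (span BC)" unfolding BC by (rule C(3))
    have rI: "rep n a' (span (T ` BC))" unfolding TB by (rule rep_subset[OF r(2) T(2) stabI])
    have rC': "rep n a' (span BC')" unfolding BC' by (rule C'(3))
    have stab: "a g ` D \<subseteq> span D" if "rep n a (span D)" "g \<in> perms n" for a g D
    proof
      fix y assume "y \<in> a g ` D"
      then obtain d where "d \<in> D" "y = a g d" by blast
      then show "y \<in> span D" using repD(2)[OF that, of d] span_base[of d D] by simp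
    qed
    have chiKC: "tr BK (a g) = tr BC' (a' g)" if g: "g \<in> perms n" for g
    proof -
      have "tr B (a g) = tr (BK \<union> BC) (a g)"
        by (rule tr_basis_independent[OF B _ KC(1) spanKC[symmetric] repD(1)[OF r(1) g]])
          (use BK(1) BC(1) repD(2)[OF r(1) g] in auto)
      also have "\<dots> = tr BK (a g) + tr BC (a g)"
        by (rule tr_union[OF BK(1) BC(1) KC stab[OF rK g] stab[OF rC g]])
      finally have 1: "tr B (a g) = tr BK (a g) + tr BC (a g)" .
      have "tr B' (a' g) = tr (T ` BC \<union> BC') (a' g)"
        by (rule tr_basis_independent[OF B' _ IC(1) spanIC[symmetric] repD(1)[OF r(2) g]])
          (use TB(1) BC'(1) repD(2)[OF r(2) g] in auto)
      also have "\<dots> = tr (T ` BC) (a' g) + tr BC' (a' g)"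
        by (rule tr_union[OF TB(1) BC'(1) IC stab[OF rI g] stab[OF rC' g]])
      also have "tr (T ` BC) (a' g) = tr BC (a g)"
      proof (rule tr_image[OF BC(1,2) T(1) injBC])
        show "a g ` BC \<subseteq> span BC" by (rule stab[OF rC g])
        fix b assume "b \<in> BC"
        then have "b \<in> span B" using C(2) BC(3) span_base by blast
        then show "a' g (T b) = T (a g b)" using Teq[OF g] by simp
      qed
      finally show ?thesis using 1 chi[OF g] by simp
    qed
    have "BC \<noteq> {}"
    proof
      assume "BC = {}"
      then have "C = {0}" using BC(3) by simp
      then show False using TC x lin_0[OF T(1)] by (metis image_eqI image_insert image_empty singletonD)
    qed
    moreover have "card (BK \<union> BC) = card B"
      using KC BK(1) BC(1) spanKC B dim_span_eq_card_independent by metis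
    ultimately have "card BK + card BC = card B" "0 < card BC"
      using BK(1) BC(1) KC(2) by (simp_all add: card_Un_disjoint card_gt_0_iff)
    then have "card BK < card B" by linarith
    from less.hyps[OF this BK(1,2) BC'(1,2) rK rC' chiKC]
    obtain S where S: "lin S" "bij_betw S (span BK) (span BC')" "equivariant n a a' (span BK) S" by blast
    define F where "F = construct (BK \<union> BC) (\<lambda>b. if b \<in> BK then S b else T b)"
    have F: "lin F" unfolding F_def by (rule linear_construct[OF KC(1)])
    have FK: "F y = S y" if "y \<in> span BK" for y
      by (rule linear_eq_on[OF F S(1) that]) (simp add: F_def construct_basis[OF KC(1)])
    have FC: "F y = T y" if "y \<in> span BC" for y
      by (rule linear_eq_on[OF F T(1) that]) (use KC(2) in \<open>auto simp: F_def construct_basis[OF KC(1)]\<close>)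
    have dec: "\<exists>k c. k \<in> span BK \<and> c \<in> span BC \<and> y = k + c" if y: "y \<in> span B" for y
    proof -
      obtain u where "u \<in> span BK" "y - u \<in> span BC" using C(5)[OF y] BK(3) BC(3) by blast
      then show ?thesis by (intro exI[of _ u] exI[of _ "y - u"]) simp
    qed
    have Sim: "S k \<in> span BC'" if "k \<in> span BK" for k using S(2) that by (auto simp: bij_betw_def)
    have TCim: "T c \<in> ?I" if "c \<in> span BC" for c using TC BC(3) that by blast
    have inj: "inj_on F (span B)"
    proof (subst linear_inj_on_iff_eq_0[OF F], simp, intro ballI impI)
      fix y assume y: "y \<in> span B" "F y = 0"
      obtain k c where kc: "k \<in> span BK" "c \<in> span BC" "y = k + c" using dec[OF y(1)] by blast
      have sum0: "S k + T c = 0" using y(2) kc lin_add[OF F] FK FC by simp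
      have "T c = - S k" using sum0 by (simp add: eq_neg_iff_add_eq_0 add.commute)
      then have "T c \<in> ?I \<inter> C'" using TCim[OF kc(2)] Sim[OF kc(1)] BC'(3) span_neg by auto
      then have "T c = 0" using C'(4) by blast
      then have c0: "c = 0" using injBC kc(2) lin_0[OF T(1)] span_zero[of BC] by (metis inj_onD)
      have "S k = 0" using sum0 \<open>T c = 0\<close> by simp
      then have "k = 0" using bij_betw_imp_inj_on[OF S(2)] kc(1) lin_0[OF S(1)] span_zero[of BK] by (metis inj_onD)
      then show "y = 0" using c0 kc by simp
    qed
    have surj: "F ` span B = span B'"
    proof (intro equalityI subsetI)
      fix z assume "z \<in> F ` span B"
      then obtain y where y: "y \<in> span B" "z = F y" by blast
      obtain k c where kc: "k \<in> span BK" "c \<in> span BC" "y = k + c" using dec[OF y(1)] by blast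
      have "z = S k + T c" using y(2) kc lin_add[OF F] FK FC by simp
      moreover have "S k \<in> span B'" using Sim[OF kc(1)] BC'(3) C'(2) by blast
      moreover have "T c \<in> span B'" using TCim[OF kc(2)] T(2) by blast
      ultimately show "z \<in> span B'" by (simp add: span_add)
    next
      fix z assume z: "z \<in> span B'"
      obtain u where u: "u \<in> ?I" "z - u \<in> C'" using C'(5)[OF z] by blast
      obtain c where c: "c \<in> span BC" "u = T c" using u(1) TC BC(3) by blast
      obtain k where k: "k \<in> span BK" "z - u = S k" using S(2) u(2) BC'(3) by (metis bij_betw_imp_surj_on imageE)
      have "F (k + c) = z" using c k lin_add[OF F] FK FC by (simp add: algebra_simps)
      moreover have "k + c \<in> span B" using k(1) c(1) spanKC span_mono[of BK "BK \<union> BC"] span_mono[of BC "BK \<union> BC"]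
        by (metis span_add subsetD sup.cobounded1 sup.cobounded2)
      ultimately show "z \<in> F ` span B" by blast
    qed
    have "equivariant n a a' (span B) F"
      unfolding equivariant_def
    proof (intro ballI)
      fix g y assume g: "g \<in> perms n" and y: "y \<in> span B"
      obtain k c where kc: "k \<in> span BK" "c \<in> span BC" "y = k + c" using dec[OF y] by blast
      note La = repD(1)[OF r(1) g] and La' = repD(1)[OF r(2) g]
      have "F (a g y) = S (a g k) + T (a g c)"
        unfolding kc(3) lin_add[OF La] lin_add[OF F] FK[OF repD(2)[OF rK g kc(1)]] FC[OF repD(2)[OF rC g kc(2)]] ..
      also have "S (a g k) = a' g (S k)" using S(3) g kc(1) unfolding equivariant_def by blast
      also have "T (a g c) = a' g (T c)" using Teq[OF g] kc(2) BC(3) C(2) by blast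
      also have "a' g (S k) + a' g (T c) = a' g (F y)"
        unfolding kc(3) lin_add[OF F] lin_add[OF La'] FK[OF kc(1)] FC[OF kc(2)] ..
      finally show "F (a g y) = a' g (F y)" .
    qed
    then show ?thesis using F inj surj by (intro exI[of _ F]) (auto simp: bij_betw_def)
  qed
qed

end

section \<open>Fixed words and power sums\<close>

text \<open>The exponent vector of the monomial \<open>\<Prod>i\<in>A. x (f i)\<close>.\<close>

definition content :: "nat set \<Rightarrow> (nat \<Rightarrow> nat) \<Rightarrow> nat \<Rightarrow>\<^sub>0 nat" where
  "content A f = (\<Sum>i\<in>A. single (f i) 1)"

definition fixed_words :: "nat \<Rightarrow> (nat \<Rightarrow> nat) \<Rightarrow> (nat \<Rightarrow>\<^sub>0 nat) \<Rightarrow> (nat \<Rightarrow> nat) set" where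
  "fixed_words n p m = {f \<in> extensional {1..n}. f \<circ> p = f \<and> content {1..n} f = m}"

lemma mcoeff_0 [simp]: "mcoeff 0 m = 0" by (simp add: zero_mps_def)
lemma mcoeff_1: "mcoeff 1 m = (if m = 0 then 1 else 0)" by (simp add: one_mps_def)
lemma mcoeff_add [simp]: "mcoeff (f + g) m = mcoeff f m + mcoeff g m" by (simp add: plus_mps_def)
lemma mcoeff_diff [simp]: "mcoeff (f - g) m = mcoeff f m - mcoeff g m" by (simp add: minus_mps_def)
lemma mcoeff_uminus [simp]: "mcoeff (- f) m = - mcoeff f m" by (simp add: uminus_mps_def)
lemma mcoeff_mult: "mcoeff (f * g) m = (\<Sum>(a, b)\<in>splits m. mcoeff f a * mcoeff g b)" by (simp add: times_mps_def)
lemma mcoeff_sum [simp]: "mcoeff (\<Sum>i\<in>I. f i) m = (\<Sum>i\<in>I. mcoeff (f i) m)"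
  by (induction I rule: infinite_finite_induct) auto

lemma mcoeff_mconst_mult [simp]: "mcoeff (mconst c * f) m = c * mcoeff f m"
proof -
  have "(0, m) \<in> splits m" by (simp add: splits_def)
  have "mcoeff (mconst c * f) m = (\<Sum>p\<in>splits m. if p = (0, m) then c * mcoeff f m else 0)"
    unfolding mcoeff_mult mconst_def by (intro sum.cong refl) (auto simp: splits_def split: if_splits)
  then show ?thesis using \<open>(0, m) \<in> splits m\<close> by (simp add: sum.delta)
qed

lemma mconst_mult: "mconst (a * b) = mconst a * mconst b"
  by (rule mps_eqI) (simp only: mcoeff_mconst_mult, simp add: mconst_def)

lemma mconst_1 [simp]: "mconst 1 = 1"
  by (rule mps_eqI) (simp add: mconst_def mcoeff_1)

lemma single_inj: "0 < d \<Longrightarrow> single x d = single y d \<longleftrightarrow> x = (y::nat)" for d :: nat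
  by (metis lookup_single_eq lookup_single_not_eq less_irrefl)

lemma mcoeff_prod_psym:
  assumes "finite I" "\<And>C. C \<in> I \<Longrightarrow> 0 < d C"
  shows "finite {g \<in> extensional I. (\<Sum>C\<in>I. single (g C) (d C)) = m} \<and>
    mcoeff (\<Prod>C\<in>I. psym (d C)) m =
    (of_nat (card {g \<in> extensional I. (\<Sum>C\<in>I. single (g C) (d C)) = m}) :: 'a::comm_ring_1)"
  using assms
proof (induction I arbitrary: m rule: finite_induct)
  case empty
  have "{g \<in> extensional {} :: ('b \<Rightarrow> nat) set. (\<Sum>C\<in>{}. single (g C) (d C)) = m} = (if m = 0 then {\<lambda>_. undefined} else {})"
    by (auto simp: extensional_def)
  then show ?case by (simp add: mcoeff_1)
next
  case (insert c I)
  let ?G = "\<lambda>I m. {g \<in> extensional I. (\<Sum>C\<in>I. single (g C) (d C)) = m}"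
  let ?S = "{p \<in> splits m. \<exists>x. fst p = single x (d c)}"
  have dc: "0 < d c" using insert by simp
  let ?h = "\<lambda>g. ((single (g c) (d c), \<Sum>C\<in>I. single (g C) (d C)), restrict g I)"
  have "bij_betw ?h (?G (insert c I) m) (SIGMA p:?S. ?G I (snd p))"
  proof (rule bij_betwI')
    fix g g' assume g: "g \<in> ?G (insert c I) m" "g' \<in> ?G (insert c I) m"
    show "(?h g = ?h g') = (g = g')"
    proof
      assume eq: "?h g = ?h g'"
      show "g = g'"
      proof
        fix x
        have "g c = g' c" using eq single_inj[OF dc] by simp
        moreover have "g x = g' x" if "x \<in> I"
        proof -
          have r: "restrict g I = restrict g' I" using eq by blast
          show ?thesis using fun_cong[OF r, of x] \<open>x \<in> I\<close> by simp
        qed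
        moreover have "g x = g' x" if "x \<notin> insert c I" using g that by (simp add: extensional_def)
        ultimately show "g x = g' x" by blast
      qed
    qed simp
  next
    fix g assume "g \<in> ?G (insert c I) m"
    then show "?h g \<in> (SIGMA p:?S. ?G I (snd p))" using insert(1,2) by (auto simp: splits_def)
  next
    fix y assume "y \<in> (SIGMA p:?S. ?G I (snd p))"
    then obtain a b g x where y: "y = ((a, b), g)" "a + b = m" "a = single x (d c)"
      "g \<in> extensional I" "(\<Sum>C\<in>I. single (g C) (d C)) = b" by (auto simp: splits_def)
    have sum: "(\<Sum>C\<in>I. single ((g(c := x)) C) (d C)) = b"
      using y(5) insert(2) by (metis (mono_tags, lifting) fun_upd_apply sum.cong)
    have r: "restrict (g(c := x)) I = g" using y(4) insert(2) by (auto simp: restrict_def extensional_def)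
    have "g(c := x) \<in> ?G (insert c I) m" using y sum insert(1,2) by (auto simp: extensional_def)
    moreover have "y = ?h (g(c := x))" using y sum r by simp
    ultimately show "\<exists>g\<in>?G (insert c I) m. y = ?h g" by blast
  qed
  note bij = this
  have fin: "finite (SIGMA p:?S. ?G I (snd p))" using insert.IH insert.prems by (intro finite_SigmaI) auto
  have card: "card (?G (insert c I) m) = (\<Sum>p\<in>?S. card (?G I (snd p)))"
    using bij_betw_same_card[OF bij] insert.IH insert.prems by (simp add: card_SigmaI)
  have "mcoeff (\<Prod>C\<in>insert c I. psym (d C)) m = (\<Sum>p\<in>splits m. (if \<exists>x. fst p = single x (d c) then 1 else 0) *
      mcoeff (\<Prod>C\<in>I. psym (d C)) (snd p) :: 'a)"
    using insert(1,2) by (simp add: mcoeff_mult psym_def case_prod_unfold)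
  also have "\<dots> = (\<Sum>p\<in>?S. mcoeff (\<Prod>C\<in>I. psym (d C)) (snd p))"
    by (intro sum.mono_neutral_cong_right) auto
  also have "\<dots> = (\<Sum>p\<in>?S. of_nat (card (?G I (snd p))))"
    using insert.IH insert.prems by (intro sum.cong refl) blast
  finally show ?case using bij_betw_finite[OF bij] fin card by simp
qed

lemma orbit_eq_perms:
  assumes "p \<in> perms n" "i \<in> {1..n}"
  shows "i \<in> orbit p i" "orbit p i \<subseteq> {1..n}" "finite (orbit p i)" "j \<in> orbit p i \<Longrightarrow> orbit p j = orbit p i"
proof -
  have p: "p permutes {1..n}" using assms by simp
  then have P: "permutation p" using permutation_permutes by blast
  show "i \<in> orbit p i" using permutation_self_in_orbit[OF P] .
  show s: "orbit p i \<subseteq> {1..n}" using permutes_orbit_subset[OF p assms(2)] .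
  show "finite (orbit p i)" using s finite_subset by blast
  show "j \<in> orbit p i \<Longrightarrow> orbit p j = orbit p i"
    using orbit_cyclic_eq3[OF cyclic_on_orbit[OF p]] by simp
qed

lemma fixed_word_orbit:
  assumes "f \<circ> p = f" "j \<in> orbit p i"
  shows "f j = f i"
  using assms(2) by induction (metis assms(1) comp_apply)+

text \<open>To expand the product, choose a variable for every cycle; this is a word that is constant on
cycles.\<close>

lemma mcoeff_cycle_psym:
  assumes p: "p \<in> perms n"
  shows "finite (fixed_words n p m)"
    "mcoeff (\<Prod>C\<in>perm_cycles p {1..n}. psym (card C)) m = (of_nat (card (fixed_words n p m)) :: 'a::comm_ring_1)"
proof -
  let ?A = "{1..n}" let ?I = "orbit p ` ?A"
  note o = orbit_eq_perms[OF p]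
  let ?G = "{g \<in> extensional ?I. (\<Sum>C\<in>?I. single (g C) (card C)) = m}"
  have pos: "0 < card C" if C: "C \<in> ?I" for C
  proof -
    obtain i where i: "i \<in> ?A" "C = orbit p i" using C by blast
    then show ?thesis using o(1)[OF i(1)] o(3)[OF i(1)] by (auto simp: card_gt_0_iff)
  qed
  have cont: "content ?A f = (\<Sum>C\<in>?I. single (g C) (card C))"
    if g: "\<And>i. i \<in> ?A \<Longrightarrow> f i = g (orbit p i)" for f g
  proof -
    have "content ?A f = (\<Sum>C\<in>?I. \<Sum>i | i \<in> ?A \<and> orbit p i = C. single (f i) 1)"
      unfolding content_def by (rule sum.image_gen) simp
    also have "\<dots> = (\<Sum>C\<in>?I. single (g C) (card C))"
    proof (rule sum.cong[OF refl])
      fix C assume C: "C \<in> ?I"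
      have eq: "{i \<in> ?A. orbit p i = C} = C"
      proof
        show "{i \<in> ?A. orbit p i = C} \<subseteq> C" using o(1) by blast
        show "C \<subseteq> {i \<in> ?A. orbit p i = C}"
        proof
          fix j assume j: "j \<in> C"
          obtain i where i: "i \<in> ?A" "C = orbit p i" using C by blast
          then show "j \<in> {i \<in> ?A. orbit p i = C}" using o(2)[OF i(1)] o(4)[OF i(1), of j] j by blast
        qed
      qed
      have fC: "finite C" using C o(3) by blast
      have s: "(\<Sum>i\<in>D. single x (1::nat)) = single x (card D)" if "finite D" for D :: "nat set" and x :: nat
        using that by (induction D rule: finite_induct) (simp_all del: sum_constant flip: single_add)
      have "(\<Sum>i | i \<in> ?A \<and> orbit p i = C. single (f i) 1) = (\<Sum>i | i \<in> ?A \<and> orbit p i = C. single (g C) (1::nat))"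
        using g by (intro sum.cong) auto
      also have "\<dots> = single (g C) (card C)" unfolding eq by (rule s[OF fC])
      finally show "(\<Sum>i | i \<in> ?A \<and> orbit p i = C. single (f i) 1) = single (g C) (card C)" .
    qed
    finally show ?thesis .
  qed
  let ?h = "\<lambda>g. restrict (\<lambda>i. g (orbit p i)) ?A"
  have "bij_betw ?h ?G (fixed_words n p m)"
  proof (rule bij_betwI')
    fix g g' assume g: "g \<in> ?G" "g' \<in> ?G"
    show "(?h g = ?h g') = (g = g')"
    proof
      assume eq: "?h g = ?h g'"
      show "g = g'"
      proof
        fix C
        show "g C = g' C"
        proof (cases "C \<in> ?I")
          case True
          then obtain i where "i \<in> ?A" "C = orbit p i" by blast
          then show ?thesis using fun_cong[OF eq, of i] by simp
        qed (use g in \<open>simp add: extensional_def\<close>)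
      qed
    qed simp
  next
    fix g assume g: "g \<in> ?G"
    have hp: "?h g (p i) = ?h g i" for i
    proof (cases "i \<in> ?A")
      case True
      have "p i \<in> orbit p i" by (rule orbit.base)
      then have "p i \<in> ?A" "orbit p (p i) = orbit p i" using o(2,4)[OF True] by blast+
      then show ?thesis using True by simp
    next
      case False
      have "p i = i" using p False by (simp add: permutes_not_in)
      then show ?thesis by simp
    qed
    have "?h g \<circ> p = ?h g" by (rule ext) (simp only: comp_apply hp)
    moreover have "content ?A (?h g) = m" using cont[of "?h g" g] g by simp
    ultimately show "?h g \<in> fixed_words n p m" unfolding fixed_words_def by simp
  next
    fix f assume f: "f \<in> fixed_words n p m"
    let ?g = "restrict (\<lambda>C. f (SOME j. j \<in> C)) ?I"
    have g: "f i = ?g (orbit p i)" if i: "i \<in> ?A" for i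
    proof -
      have "(SOME j. j \<in> orbit p i) \<in> orbit p i" using o(1)[OF i] by (rule someI)
      then have "f (SOME j. j \<in> orbit p i) = f i" using f fixed_word_orbit[of f p] by (simp add: fixed_words_def)
      then show ?thesis using i by simp
    qed
    have "?g \<in> ?G" using cont[of f ?g] g f by (simp add: fixed_words_def)
    moreover have "f = ?h ?g"
    proof
      fix i
      show "f i = ?h ?g i"
      proof (cases "i \<in> ?A")
        case True
        then show ?thesis using g by simp
      next
        case False
        then show ?thesis using f by (auto simp: fixed_words_def extensional_def)
      qed
    qed
    ultimately show "\<exists>g\<in>?G. f = ?h g" by blast
  qed
  note bij = this
  have "finite ?I" by simp
  note main = mcoeff_prod_psym[of ?I card m, OF this pos]
  show "finite (fixed_words n p m)" using bij_betw_finite[OF bij] main by blast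
  show "mcoeff (\<Prod>C\<in>perm_cycles p {1..n}. psym (card C)) m = (of_nat (card (fixed_words n p m)) :: 'a)"
    unfolding perm_cycles_def bij_betw_same_card[OF bij, symmetric]
    by (rule conjunct2[OF mcoeff_prod_psym[OF \<open>finite ?I\<close> pos]])
qed

text \<open>The Cauchy--Frobenius count of orbits, with \<open>key\<close> a complete invariant of the orbits.\<close>

lemma burnside_words:
  fixes W :: "(nat \<Rightarrow> 'c) set"
  assumes W: "finite W" and closed: "\<And>F p. F \<in> W \<Longrightarrow> p \<in> perms n \<Longrightarrow> F \<circ> p \<in> W"
    and key: "\<And>F F'. F \<in> W \<Longrightarrow> F' \<in> W \<Longrightarrow> key F = key F' \<longleftrightarrow> (\<exists>p\<in>perms n. F' = F \<circ> p)"
  shows "(\<Sum>p\<in>perms n. card {F \<in> W. F \<circ> p = F}) = fact n * card (key ` W)"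
proof -
  have "(\<Sum>p\<in>perms n. card {F \<in> W. F \<circ> p = F}) = (\<Sum>p\<in>perms n. \<Sum>F\<in>W. if F \<circ> p = F then 1 else 0)"
    using W by (intro sum.cong refl) (simp add: sum.If_cases Int_def)
  also have "\<dots> = (\<Sum>F\<in>W. \<Sum>p\<in>perms n. if F \<circ> p = F then 1 else 0)" by (rule sum.swap)
  also have "\<dots> = (\<Sum>k\<in>key ` W. \<Sum>F | F \<in> W \<and> key F = k. \<Sum>p\<in>perms n. if F \<circ> p = F then 1 else 0)"
    by (rule sum.image_gen[OF W])
  also have "\<dots> = (\<Sum>k\<in>key ` W. fact n)"
  proof (rule sum.cong[OF refl])
    fix k assume "k \<in> key ` W"
    then obtain F0 where F0: "F0 \<in> W" "k = key F0" by blast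
    have "(\<Sum>F | F \<in> W \<and> key F = k. \<Sum>p\<in>perms n. if F \<circ> p = F then 1 else 0) =
      (\<Sum>F | F \<in> W \<and> key F = k. card {q \<in> perms n. F0 \<circ> q = F})"
    proof (rule sum.cong[OF refl])
      fix F assume "F \<in> {F. F \<in> W \<and> key F = k}"
      then obtain p0 where p0: "p0 \<in> perms n" "F = F0 \<circ> p0" using key[of F0 F] F0 by auto
      have "bij_betw ((\<circ>) p0) {p \<in> perms n. F \<circ> p = F} {q \<in> perms n. F0 \<circ> q = F}"
      proof (rule bij_betwI[where g = "(\<circ>) (inv p0)"])
        have inv: "p0 \<circ> inv p0 = id" "inv p0 \<circ> p0 = id" using p0(1) permutes_inv_o by blast+
        show "(\<circ>) p0 \<in> {p \<in> perms n. F \<circ> p = F} \<rightarrow> {q \<in> perms n. F0 \<circ> q = F}"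
          using comp_perms[OF p0(1)] p0(2) by (auto simp: o_assoc)
        show "(\<circ>) (inv p0) \<in> {q \<in> perms n. F0 \<circ> q = F} \<rightarrow> {p \<in> perms n. F \<circ> p = F}"
        proof
          fix q assume q: "q \<in> {q \<in> perms n. F0 \<circ> q = F}"
          have "F \<circ> (inv p0 \<circ> q) = F0 \<circ> (p0 \<circ> inv p0) \<circ> q" unfolding p0(2) by (simp only: o_assoc)
          also have "\<dots> = F" using q inv by simp
          finally show "inv p0 \<circ> q \<in> {p \<in> perms n. F \<circ> p = F}"
            using comp_perms[OF inv_perms[OF p0(1)]] q by blast
        qed
        show "\<And>x. x \<in> {p \<in> perms n. F \<circ> p = F} \<Longrightarrow> inv p0 \<circ> (p0 \<circ> x) = x"
          "\<And>y. y \<in> {q \<in> perms n. F0 \<circ> q = F} \<Longrightarrow> p0 \<circ> (inv p0 \<circ> y) = y"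
          using inv by (simp_all add: o_assoc)
      qed
      then have "card {p \<in> perms n. F \<circ> p = F} = card {q \<in> perms n. F0 \<circ> q = F}" by (rule bij_betw_same_card)
      moreover have "(\<Sum>p\<in>perms n. if F \<circ> p = F then 1 else 0) = card {p \<in> perms n. F \<circ> p = F}"
        using finite_perms[of n] by (simp add: sum.If_cases Int_def)
      ultimately show "(\<Sum>p\<in>perms n. if F \<circ> p = F then 1 else 0) = card {q \<in> perms n. F0 \<circ> q = F}" by simp
    qed
    also have "\<dots> = (\<Sum>F | F \<in> W \<and> key F = k. \<Sum>q | q \<in> perms n \<and> F0 \<circ> q = F. 1)" by simp
    also have "\<dots> = (\<Sum>q\<in>perms n. 1)"
    proof (rule sum.group)
      show "finite {F. F \<in> W \<and> key F = k}" using W by simp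
      show "(\<lambda>q. F0 \<circ> q) ` perms n \<subseteq> {F. F \<in> W \<and> key F = k}"
      proof
        fix F assume "F \<in> (\<lambda>q. F0 \<circ> q) ` perms n"
        then obtain q where q: "q \<in> perms n" "F = F0 \<circ> q" by blast
        then have FW: "F \<in> W" using closed F0 by blast
        then have "key F0 = key F" using key[OF F0(1) FW] q by blast
        then show "F \<in> {F. F \<in> W \<and> key F = k}" using FW F0(2) by simp
      qed
    qed (simp add: finite_permutations)
    also have "\<dots> = fact n" using card_perms[of n] by simp
    finally show "(\<Sum>F | F \<in> W \<and> key F = k. \<Sum>p\<in>perms n. if F \<circ> p = F then 1 else 0) = (fact n :: nat)" .
  qed
  also have "\<dots> = fact n * card (key ` W)" by simp
  finally show ?thesis .
qed

section \<open>The characteristic of a permutation module on words\<close>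

definition mdeg :: "(nat \<Rightarrow>\<^sub>0 nat) \<Rightarrow> nat" where
  "mdeg a = (\<Sum>x\<in>keys a. lookup a x)"

text \<open>The ways to write the monomial \<open>m\<close> as a product of monomials of the degrees prescribed by
\<open>\<gamma>\<close>; these are what the coefficient of \<open>m\<close> in the product of complete homogeneous functions
counts.\<close>

definition content_lists :: "nat list \<Rightarrow> (nat \<Rightarrow>\<^sub>0 nat) \<Rightarrow> (nat \<Rightarrow>\<^sub>0 nat) list set" where
  "content_lists \<gamma> m = {ms. map mdeg ms = \<gamma> \<and> sum_list ms = m}"

lemma content_lists_Cons: "content_lists (g # \<gamma>) m =
  (\<lambda>(p, ms). fst p # ms) ` (SIGMA p:{p \<in> splits m. mdeg (fst p) = g}. content_lists \<gamma> (snd p))"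
proof (intro equalityI subsetI)
  fix ms assume "ms \<in> content_lists (g # \<gamma>) m"
  then obtain a bs where a: "ms = a # bs" "mdeg a = g" "map mdeg bs = \<gamma>" "a + sum_list bs = m"
    by (cases ms) (auto simp: content_lists_def)
  then have "((a, sum_list bs), bs) \<in> (SIGMA p:{p \<in> splits m. mdeg (fst p) = g}. content_lists \<gamma> (snd p))"
    by (auto simp: splits_def content_lists_def)
  then show "ms \<in> (\<lambda>(p, ms). fst p # ms) ` (SIGMA p:{p \<in> splits m. mdeg (fst p) = g}. content_lists \<gamma> (snd p))"
    using a(1) by (intro image_eqI) auto
qed (auto simp: splits_def content_lists_def)

lemma mcoeff_prod_hsym:
  "finite (content_lists \<gamma> m) \<and> mcoeff (prod_list (map hsym \<gamma>)) m = (of_nat (card (content_lists \<gamma> m)) :: 'a::comm_ring_1)"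
proof (induction \<gamma> arbitrary: m)
  case Nil
  have "content_lists [] m = (if m = 0 then {[]} else {})" by (auto simp: content_lists_def)
  then show ?case by (simp add: mcoeff_1)
next
  case (Cons g \<gamma>)
  let ?S = "{p \<in> splits m. mdeg (fst p) = g}"
  have inj: "inj_on (\<lambda>(p, ms). fst p # ms) (SIGMA p:?S. content_lists \<gamma> (snd p))"
    by (rule inj_onI) (auto simp: splits_def)
  have fin: "finite (SIGMA p:?S. content_lists \<gamma> (snd p))" using Cons.IH by (intro finite_SigmaI) auto
  have "card (content_lists (g # \<gamma>) m) = (\<Sum>p\<in>?S. card (content_lists \<gamma> (snd p)))"
    unfolding content_lists_Cons using Cons.IH by (simp add: card_image[OF inj] card_SigmaI)
  moreover have "mcoeff (prod_list (map hsym (g # \<gamma>))) m = (\<Sum>p\<in>splits m. (if mdeg (fst p) = g then 1 else 0) *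
      mcoeff (prod_list (map hsym \<gamma>)) (snd p) :: 'a)"
    by (simp add: mcoeff_mult hsym_def case_prod_unfold mdeg_def)
  moreover have "\<dots> = (\<Sum>p\<in>?S. mcoeff (prod_list (map hsym \<gamma>)) (snd p))"
    by (intro sum.mono_neutral_cong_right) auto
  moreover have "\<dots> = (\<Sum>p\<in>?S. of_nat (card (content_lists \<gamma> (snd p))))"
    using Cons.IH by (intro sum.cong refl) blast
  ultimately show ?case using fin unfolding content_lists_Cons[of g] by simp
qed

lemma lookup_sum: "lookup (\<Sum>i\<in>I. f i) x = (\<Sum>i\<in>I. lookup (f i) x)"
  by (induction I rule: infinite_finite_induct) (auto simp: lookup_add)

lemma lookup_content: "finite A \<Longrightarrow> lookup (content A f) x = card {i \<in> A. f i = x}"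
  unfolding content_def lookup_sum by (simp add: lookup_single when_def sum.If_cases Int_def)

lemma mdeg_content: "finite A \<Longrightarrow> mdeg (content A f) = card A"
proof -
  assume A: "finite A"
  have k: "keys (content A f) = f ` A"
    using A by (auto simp: in_keys_iff lookup_content card_eq_0_iff)
  have "mdeg (content A f) = (\<Sum>x\<in>f ` A. card {i \<in> A. f i = x})"
    unfolding mdeg_def k lookup_content[OF A] ..
  also have "\<dots> = card A" using sum.image_gen[OF A, of "\<lambda>_. 1::nat" f] by simp
  finally show ?thesis .
qed

lemma content_list_exists: "\<exists>l. (\<Sum>x\<leftarrow>l. single x 1) = (a :: nat \<Rightarrow>\<^sub>0 nat) \<and> length l = mdeg a"
proof -
  obtain ks where ks: "set ks = keys a" "distinct ks" using finite_distinct_list[OF finite_keys] by metis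
  let ?l = "concat (map (\<lambda>x. replicate (lookup a x) x) ks)"
  have r: "(\<Sum>x\<leftarrow>replicate k y. single x (1::nat)) = single y k" for k and y :: nat
    by (induction k) (auto simp flip: single_add)
  have "(\<Sum>x\<leftarrow>?l. single x 1) = (\<Sum>x\<leftarrow>ks. single x (lookup a x))"
    using r by (induction ks) auto
  also have "\<dots> = (\<Sum>x\<in>keys a. single x (lookup a x))"
    using ks by (simp add: sum_list_distinct_conv_sum_set)
  also have "\<dots> = a"
    by (rule poly_mapping_eqI) (auto simp: lookup_sum lookup_single when_def in_keys_iff)
  finally have "(\<Sum>x\<leftarrow>?l. single x 1) = a" .
  moreover have "length ?l = (\<Sum>x\<leftarrow>ks. lookup a x)" by (induction ks) auto
  then have "length ?l = mdeg a" using ks by (simp add: mdeg_def sum_list_distinct_conv_sum_set)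
  ultimately show ?thesis by blast
qed

text \<open>An ordered set partition of \<open>{1..n}\<close> with block sizes \<open>\<gamma>\<close>, as the map from an element to the
position of its block.\<close>

definition block_words :: "nat \<Rightarrow> nat list \<Rightarrow> (nat \<Rightarrow> nat) set" where
  "block_words n \<gamma> = {u \<in> extensional {1..n}. u ` {1..n} \<subseteq> {..<length \<gamma>} \<and>
     (\<forall>v<length \<gamma>. card {i \<in> {1..n}. u i = v} = \<gamma> ! v)}"

lemma image_mset_words_permutes:
  assumes "F \<in> extensional {1..n}" "F' \<in> extensional {1..n}"
    "\<And>y. card {i \<in> {1..n}. F i = y} = card {i \<in> {1..n}. F' i = y}"
  shows "\<exists>p\<in>perms n. F' = F \<circ> p"
proof -
  have count: "count (image_mset G (mset_set {1..n})) y = card {i \<in> {1..n}. G i = y}" for G :: "nat \<Rightarrow> 'a" and y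
    by (simp add: count_image_mset vimage_def Int_def conj_commute)
  have "image_mset F' (mset_set {1..n}) = image_mset F (mset_set {1..n})"
    by (rule multiset_eqI) (simp only: count assms(3))
  then obtain p where p: "p permutes {1..n}" "\<forall>x\<in>{1..n}. F' x = F (p x)"
    using image_mset_eq_implies_permutes[of "{1..n}" F' F] by auto
  have "F' = F \<circ> p"
  proof
    fix x
    show "F' x = (F \<circ> p) x"
    proof (cases "x \<in> {1..n}")
      case False
      then have "p x = x" using p by (simp add: permutes_not_in)
      then show ?thesis using False assms by (simp add: extensional_def)
    qed (use p in simp)
  qed
  then show ?thesis using p by blast
qed

lemma card_comp_perm:
  assumes "p \<in> perms n"
  shows "card {i \<in> {1..n}. P (F (p i))} = card {i \<in> {1..n}. P (F i)}"
proof -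
  have p: "p permutes {1..n}" using assms by simp
  have "p ` {i \<in> {1..n}. P (F (p i))} = {i \<in> {1..n}. P (F i)}"
  proof (intro equalityI subsetI)
    fix i assume i: "i \<in> {i \<in> {1..n}. P (F i)}"
    then obtain j where "j \<in> {1..n}" "i = p j" using permutes_image[OF p] by blast
    then show "i \<in> p ` {i \<in> {1..n}. P (F (p i))}" using i by blast
  next
    fix i assume "i \<in> p ` {i \<in> {1..n}. P (F (p i))}"
    then show "i \<in> {i \<in> {1..n}. P (F i)}" using permutes_in_image[OF p] by auto
  qed
  moreover have "inj_on p {i \<in> {1..n}. P (F (p i))}" using permutes_inj[OF p] inj_on_subset by blast
  ultimately show ?thesis using card_image[of p "{i \<in> {1..n}. P (F (p i))}"] by argo
qed

lemma content_comp_perm: "p \<in> perms n \<Longrightarrow> content {1..n} (f \<circ> p) = content {1..n} f"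
  using card_comp_perm[of p n "\<lambda>y. y = _" f] by (intro poly_mapping_eqI) (simp only: lookup_content finite_atLeastAtMost comp_apply)

lemma ext_comp_perm: "p \<in> perms n \<Longrightarrow> F \<in> extensional {1..n} \<Longrightarrow> F \<circ> p \<in> extensional {1..n}"
  by (auto simp: extensional_def permutes_not_in)

text \<open>Orbit counting for pairs of a block word and a word of content \<open>m\<close>: the orbit of a pair is
determined by the contents of the second word on the blocks of the first.\<close>

lemma sum_fixed_block_words:
  assumes c: "composition n \<gamma>"
  shows "(\<Sum>p\<in>perms n. card {u \<in> block_words n \<gamma>. u \<circ> p = u} * card (fixed_words n p m)) =
    fact n * card (content_lists \<gamma> m)"
proof -
  let ?A = "{1..n}" and ?r = "length \<gamma>"
  define W where "W = {F \<in> extensional ?A. restrict (snd \<circ> F) ?A \<in> block_words n \<gamma> \<and> content ?A (fst \<circ> F) = m}"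
  define key where "key F = map (\<lambda>v. content {i \<in> ?A. snd (F i) = v} (fst \<circ> F)) [0..<?r]" for F :: "nat \<Rightarrow> nat \<times> nat"
  define pair where "pair = (\<lambda>(u, f). restrict (\<lambda>i. (f i :: nat, u i :: nat)) ?A)"
  have bw: "finite (block_words n \<gamma>)"
  proof (rule finite_subset)
    show "block_words n \<gamma> \<subseteq> {1..n} \<rightarrow>\<^sub>E {..<?r}" by (auto simp: block_words_def PiE_def)
    show "finite ({1..n} \<rightarrow>\<^sub>E {..<?r})" by (intro finite_PiE) auto
  qed
  \<comment> \<open>pairs of words are words of pairs\<close>
  have pairbij: "bij_betw pair {(u, f). u \<in> block_words n \<gamma> \<and> f \<in> extensional ?A \<and> content ?A f = m \<and> P u f} {F \<in> W. P (restrict (snd \<circ> F) ?A) (restrict (fst \<circ> F) ?A)}" for P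
  proof (rule bij_betwI[where g = "\<lambda>F. (restrict (snd \<circ> F) ?A, restrict (fst \<circ> F) ?A)"])
    have c1: "content ?A (restrict f ?A) = content ?A f" for f unfolding content_def by (intro sum.cong) auto
    have r: "restrict (snd \<circ> pair (u, f)) ?A = u" "restrict (fst \<circ> pair (u, f)) ?A = f"
      if "u \<in> extensional ?A" "f \<in> extensional ?A" for u f
      using that by (auto simp: pair_def restrict_def extensional_def)
    have r': "content ?A (fst \<circ> pair (u, f)) = content ?A f" for u f
      unfolding content_def pair_def by (intro sum.cong) auto
    show "pair \<in> {(u, f). u \<in> block_words n \<gamma> \<and> f \<in> extensional ?A \<and> content ?A f = m \<and> P u f} \<rightarrow> {F \<in> W. P (restrict (snd \<circ> F) ?A) (restrict (fst \<circ> F) ?A)}"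
    proof (intro funcsetI, clarify)
      fix u f assume h: "u \<in> block_words n \<gamma>" "f \<in> extensional ?A" "m = content ?A f" "P u f"
      then have "u \<in> extensional ?A" by (simp add: block_words_def)
      note r[OF this h(2)]
      moreover have "pair (u, f) \<in> extensional ?A" by (simp add: pair_def)
      ultimately show "pair (u, f) \<in> W \<and> P (restrict (snd \<circ> pair (u, f)) ?A) (restrict (fst \<circ> pair (u, f)) ?A)"
        unfolding W_def using h r' by simp
    qed
    show "(\<lambda>F. (restrict (snd \<circ> F) ?A, restrict (fst \<circ> F) ?A)) \<in> {F \<in> W. P (restrict (snd \<circ> F) ?A) (restrict (fst \<circ> F) ?A)} \<rightarrow>
      {(u, f). u \<in> block_words n \<gamma> \<and> f \<in> extensional ?A \<and> content ?A f = m \<and> P u f}"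
      by (auto simp: W_def c1 simp del: One_nat_def)
    show "(restrict (snd \<circ> pair x) ?A, restrict (fst \<circ> pair x) ?A) = x"
      if "x \<in> {(u, f). u \<in> block_words n \<gamma> \<and> f \<in> extensional ?A \<and> content ?A f = m \<and> P u f}" for x
      using that r by (auto simp: block_words_def simp del: One_nat_def)
    show "pair (restrict (snd \<circ> F) ?A, restrict (fst \<circ> F) ?A) = F" if "F \<in> {F \<in> W. P (restrict (snd \<circ> F) ?A) (restrict (fst \<circ> F) ?A)}" for F
      using that by (auto simp: W_def pair_def restrict_def extensional_def)
  qed
  have fixed: "card {u \<in> block_words n \<gamma>. u \<circ> p = u} * card (fixed_words n p m) = card {F \<in> W. F \<circ> p = F}" if p: "p \<in> perms n" for p
  proof -
    have iff: "F \<circ> p = F \<longleftrightarrow> restrict (snd \<circ> F) ?A \<circ> p = restrict (snd \<circ> F) ?A \<and> restrict (fst \<circ> F) ?A \<circ> p = restrict (fst \<circ> F) ?A"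
      if F: "F \<in> extensional ?A" for F :: "nat \<Rightarrow> nat \<times> nat"
    proof -
      have pin: "p i \<in> ?A \<longleftrightarrow> i \<in> ?A" for i using permutes_in_image[of p "{1..n}"] p by blast
      have "restrict (g \<circ> F) ?A \<circ> p = restrict (g \<circ> F) ?A \<longleftrightarrow> (\<forall>i\<in>?A. g (F (p i)) = g (F i))" for g :: "nat \<times> nat \<Rightarrow> nat"
        by (simp only: fun_eq_iff comp_apply restrict_apply pin) metis
      moreover have "F \<circ> p = F \<longleftrightarrow> (\<forall>i\<in>?A. F (p i) = F i)"
      proof -
        have "p i = i" if "i \<notin> ?A" for i using p that by (auto simp: permutes_not_in)
        then show ?thesis unfolding fun_eq_iff comp_apply by metis
      qed
      ultimately show ?thesis by (auto simp: prod_eq_iff)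
    qed
    let ?P = "\<lambda>u f. u \<circ> p = u \<and> f \<circ> p = f"
    have "{F \<in> W. F \<circ> p = F} = {F \<in> W. ?P (restrict (snd \<circ> F) ?A) (restrict (fst \<circ> F) ?A)}"
      using iff by (auto simp: W_def simp del: One_nat_def)
    moreover have "{(u, f). u \<in> block_words n \<gamma> \<and> f \<in> extensional ?A \<and> content ?A f = m \<and> ?P u f} =
      {u \<in> block_words n \<gamma>. u \<circ> p = u} \<times> fixed_words n p m"
      by (auto simp: fixed_words_def)
    ultimately show ?thesis using bij_betw_same_card[OF pairbij[of ?P]] by (simp add: card_cartesian_product)
  qed
  have finW: "finite W"
  proof -
    let ?D = "{(u, f). u \<in> block_words n \<gamma> \<and> f \<in> extensional ?A \<and> content ?A f = m \<and> True}"
    have "?D \<subseteq> block_words n \<gamma> \<times> fixed_words n id m" by (auto simp: fixed_words_def)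
    then have "finite ?D" using bw mcoeff_cycle_psym(1)[OF id_perms, of n m] by (rule finite_subset[OF _ finite_cartesian_product])
    then have "finite {F \<in> W. True}" using bij_betw_finite[OF pairbij[of "\<lambda>_ _. True"]] by blast
    then show ?thesis by simp
  qed
  have keycount: "lookup (key F ! v) x = card {i \<in> ?A. F i = (x, v)}" if "v < ?r" for F v x
  proof -
    have "{i \<in> {i \<in> ?A. snd (F i) = v}. (fst \<circ> F) i = x} = {i \<in> ?A. F i = (x, v)}" by (auto simp: prod_eq_iff)
    then show ?thesis using that unfolding key_def by (simp add: lookup_content del: One_nat_def)
  qed
  have Wsnd: "snd (F i) < ?r" if "F \<in> W" "i \<in> ?A" for F i
    using that unfolding W_def block_words_def by (auto simp: subset_iff)
  have Wclosed: "F \<circ> p \<in> W" if F: "F \<in> W" and p: "p \<in> perms n" for F p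
  proof -
    have pin: "p i \<in> ?A \<longleftrightarrow> i \<in> ?A" for i using permutes_in_image[of p "{1..n}"] p by blast
    have "content ?A (fst \<circ> (F \<circ> p)) = m" using content_comp_perm[OF p, of "fst \<circ> F"] F by (simp add: W_def o_assoc)
    moreover have "restrict (snd \<circ> (F \<circ> p)) ?A \<in> block_words n \<gamma>"
    proof -
      have "card {i \<in> ?A. restrict (snd \<circ> (F \<circ> p)) ?A i = v} = card {i \<in> ?A. restrict (snd \<circ> F) ?A i = v}" for v
      proof -
        have "{i \<in> ?A. restrict (snd \<circ> (F \<circ> p)) ?A i = v} = {i \<in> ?A. snd (F (p i)) = v}"
          "{i \<in> ?A. restrict (snd \<circ> F) ?A i = v} = {i \<in> ?A. snd (F i) = v}" by auto
        then show ?thesis using card_comp_perm[OF p, of "\<lambda>y. snd y = v" F] by simp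
      qed
      then show ?thesis using F Wsnd[OF F] pin unfolding W_def block_words_def by (auto simp del: One_nat_def)
    qed
    ultimately show ?thesis using ext_comp_perm[OF p, of F] F by (simp add: W_def)
  qed
  have keyeq: "key F = key F' \<longleftrightarrow> (\<exists>p\<in>perms n. F' = F \<circ> p)" if F: "F \<in> W" "F' \<in> W" for F F'
  proof
    assume k: "key F = key F'"
    have "card {i \<in> ?A. F i = y} = card {i \<in> ?A. F' i = y}" for y
    proof (cases "snd y < ?r")
      case True
      then show ?thesis using keycount[of "snd y" F "fst y"] keycount[of "snd y" F' "fst y"] k by simp
    next
      case False
      then have "{i \<in> ?A. F i = y} = {}" "{i \<in> ?A. F' i = y} = {}" using Wsnd F by fastforce+
      then show ?thesis by (simp only:)
    qed
    then show "\<exists>p\<in>perms n. F' = F \<circ> p" using F by (intro image_mset_words_permutes) (auto simp: W_def)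
  next
    assume "\<exists>p\<in>perms n. F' = F \<circ> p"
    then obtain p where p: "p \<in> perms n" "F' = F \<circ> p" by blast
    show "key F = key F'"
    proof (rule nth_equalityI)
      show "length (key F) = length (key F')" by (simp add: key_def)
      fix v assume "v < length (key F)"
      then have v: "v < ?r" by (simp add: key_def)
      show "key F ! v = key F' ! v"
      proof (rule poly_mapping_eqI)
        fix x
        show "lookup (key F ! v) x = lookup (key F' ! v) x"
          unfolding keycount[OF v] p(2) using card_comp_perm[OF p(1), of "\<lambda>y. y = (x, v)" F] by simp
      qed
    qed
  qed
  have "key ` W = content_lists \<gamma> m"
  proof (intro equalityI subsetI)
    fix ms assume "ms \<in> key ` W"
    then obtain F where F: "F \<in> W" "ms = key F" by blast
    have "mdeg (ms ! v) = \<gamma> ! v" if v: "v < ?r" for v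
    proof -
      have "mdeg (ms ! v) = card {i \<in> ?A. snd (F i) = v}" using v F by (simp add: key_def mdeg_content del: One_nat_def)
      also have "{i \<in> ?A. snd (F i) = v} = {i \<in> ?A. restrict (snd \<circ> F) ?A i = v}" by auto
      also have "card \<dots> = \<gamma> ! v" using F v unfolding W_def block_words_def by blast
      finally show ?thesis .
    qed
    then have "map mdeg ms = \<gamma>" using F by (intro nth_equalityI) (auto simp: key_def simp del: One_nat_def)
    moreover have "sum_list ms = m"
    proof -
      have "sum_list ms = (\<Sum>v\<in>{0..<?r}. content {i \<in> ?A. snd (F i) = v} (fst \<circ> F))"
        unfolding F(2) key_def by (simp add: interv_sum_list_conv_sum_set_nat del: One_nat_def)
      also have "\<dots> = content ?A (fst \<circ> F)"
        unfolding content_def using Wsnd[OF F(1)] by (intro sum.group) auto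
      finally show ?thesis using F by (simp add: W_def)
    qed
    ultimately show "ms \<in> content_lists \<gamma> m" by (simp add: content_lists_def)
  next
    fix ms assume "ms \<in> content_lists \<gamma> m"
    then have ms: "map mdeg ms = \<gamma>" "sum_list ms = m" by (auto simp: content_lists_def)
    then have len: "length ms = ?r" by auto
    have "\<forall>a. \<exists>l. (\<Sum>x\<leftarrow>l. single x 1) = (a :: nat \<Rightarrow>\<^sub>0 nat) \<and> length l = mdeg a" using content_list_exists by blast
    then obtain L where L: "\<And>a :: nat \<Rightarrow>\<^sub>0 nat. (\<Sum>x\<leftarrow>L a. single x 1) = a" "\<And>a. length (L a) = mdeg a" by metis
    define xs where "xs = concat (map (\<lambda>v. map (\<lambda>x. (x, v)) (L (ms ! v))) [0..<?r])"
    have "length xs = sum_list (map (\<lambda>v. mdeg (ms ! v)) [0..<?r])"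
      unfolding xs_def by (simp add: length_concat o_def L(2))
    also have "map (\<lambda>v. mdeg (ms ! v)) [0..<?r] = \<gamma>" using ms(1) len by (intro nth_equalityI) auto
    also have "sum_list \<gamma> = n" using c by (simp add: composition_def)
    finally have lxs: "length xs = n" .
    define F where "F = restrict (\<lambda>i. xs ! (i - 1)) ?A"
    have sumF: "(\<Sum>i\<in>?A. g (F i)) = (\<Sum>y\<leftarrow>xs. g y)" for g :: "nat \<times> nat \<Rightarrow> 'z::comm_monoid_add"
    proof -
      have "(\<Sum>i\<in>?A. g (F i)) = (\<Sum>i\<in>{0..<n}. g (xs ! i))"
        by (rule sum.reindex_bij_witness[of _ Suc "\<lambda>i. i - 1"]) (auto simp: F_def)
      then show ?thesis using lxs by (simp add: sum_list_sum_nth)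
    qed
    have sumxs: "(\<Sum>y\<leftarrow>xs. g y) = (\<Sum>v\<in>{0..<?r}. \<Sum>x\<leftarrow>L (ms ! v). g (x, v))" for g :: "nat \<times> nat \<Rightarrow> 'z::comm_monoid_add"
    proof -
      have "(\<Sum>y\<leftarrow>concat (map (\<lambda>v. map (\<lambda>x. (x, v)) (L (ms ! v))) vs). g y) = (\<Sum>v\<leftarrow>vs. \<Sum>x\<leftarrow>L (ms ! v). g (x, v))" for vs
        by (induction vs) (auto simp: o_def)
      then show ?thesis unfolding xs_def by (simp add: interv_sum_list_conv_sum_set_nat)
    qed
    have part: "(\<Sum>i | i \<in> ?A \<and> snd (F i) = v. h (fst (F i))) = (\<Sum>x\<leftarrow>L (ms ! v). h x)" if v: "v < ?r" for v and h :: "nat \<Rightarrow> 'z::comm_monoid_add"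
    proof -
      have "(\<Sum>i | i \<in> ?A \<and> snd (F i) = v. h (fst (F i))) = (\<Sum>i\<in>?A. if snd (F i) = v then h (fst (F i)) else 0)"
        by (rule sum.inter_filter) simp
      also have "\<dots> = (\<Sum>w\<in>{0..<?r}. \<Sum>x\<leftarrow>L (ms ! w). if w = v then h x else 0)"
        unfolding sumF[of "\<lambda>y. if snd y = v then h (fst y) else 0"] sumxs snd_conv fst_conv ..
      also have "\<dots> = (\<Sum>w\<in>{0..<?r}. if w = v then (\<Sum>x\<leftarrow>L (ms ! w). h x) else 0)" by (intro sum.cong) auto
      also have "\<dots> = (\<Sum>x\<leftarrow>L (ms ! v). h x)" using v by simp
      finally show ?thesis .
    qed
    have snd_lt: "snd (F i) < ?r" if "i \<in> ?A" for i
    proof -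
      have "F i = xs ! (i - 1)" "i - 1 < length xs" using that lxs by (auto simp: F_def)
      then have "F i \<in> set xs" by simp
      then show ?thesis unfolding xs_def by auto
    qed
    have keyF: "key F ! v = ms ! v" if v: "v < ?r" for v
      using part[OF v, of "\<lambda>x. single x (1::nat)"] v L(1) unfolding key_def content_def by simp
    have "F \<in> W"
    proof -
      have "content ?A (fst \<circ> F) = (\<Sum>v\<in>{0..<?r}. ms ! v)"
        unfolding content_def o_def sumF[of "\<lambda>y. single (fst y) 1"] sumxs using L(1) by simp
      also have "\<dots> = m" using ms(2) len by (simp add: sum_list_sum_nth)
      finally have "content ?A (fst \<circ> F) = m" .
      moreover have "card {i \<in> ?A. restrict (snd \<circ> F) ?A i = v} = \<gamma> ! v" if v: "v < ?r" for v
      proof -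
        have "{i \<in> ?A. restrict (snd \<circ> F) ?A i = v} = {i. i \<in> ?A \<and> snd (F i) = v}" by auto
        then have "card {i \<in> ?A. restrict (snd \<circ> F) ?A i = v} = (\<Sum>i | i \<in> ?A \<and> snd (F i) = v. 1)" by simp
        also have "\<dots> = (\<Sum>x\<leftarrow>L (ms ! v). 1)" by (rule part[OF v, of "\<lambda>_. 1"])
        also have "\<dots> = mdeg (ms ! v)" using L(2) by (simp add: sum_list_triv)
        also have "\<dots> = \<gamma> ! v" using ms(1) v len by (metis nth_map)
        finally show ?thesis .
      qed
      moreover have "F \<in> extensional ?A" by (simp add: F_def)
      ultimately show ?thesis using snd_lt unfolding W_def block_words_def by auto
    qed
    moreover have "key F = ms" using keyF len by (intro nth_equalityI) (auto simp: key_def)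
    ultimately show "ms \<in> key ` W" by blast
  qed
  then have "(\<Sum>p\<in>perms n. card {F \<in> W. F \<circ> p = F}) = fact n * card (content_lists \<gamma> m)"
    using burnside_words[OF finW Wclosed keyeq] by simp
  then show ?thesis using fixed by simp
qed

text \<open>The Frobenius characteristic of the permutation module on ordered set partitions of shape
\<open>\<gamma>\<close> is \<open>h\<^sub>\<gamma>\<close>; compare coefficients.\<close>

lemma frob_block_words:
  assumes "composition n \<gamma>"
  shows "(\<Sum>p\<in>perms n. mconst (of_nat (card {u \<in> block_words n \<gamma>. u \<circ> p = u})) * (\<Prod>C\<in>perm_cycles p {1..n}. psym (card C))) =
    mconst (of_nat (fact n)) * (prod_list (map hsym \<gamma>) :: 'a::comm_ring_1 mps)"
proof (rule mps_eqI)
  fix m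
  have "mcoeff (\<Sum>p\<in>perms n. mconst (of_nat (card {u \<in> block_words n \<gamma>. u \<circ> p = u})) * (\<Prod>C\<in>perm_cycles p {1..n}. psym (card C))) m
    = (\<Sum>p\<in>perms n. of_nat (card {u \<in> block_words n \<gamma>. u \<circ> p = u}) * (of_nat (card (fixed_words n p m)) :: 'a))"
    unfolding mcoeff_sum mcoeff_mconst_mult by (intro sum.cong refl) (simp only: mcoeff_cycle_psym(2))
  also have "\<dots> = of_nat (fact n * card (content_lists \<gamma> m))"
    unfolding sum_fixed_block_words[OF assms, symmetric] by simp
  also have "\<dots> = mcoeff (mconst (of_nat (fact n)) * prod_list (map hsym \<gamma>)) m"
    using mcoeff_prod_hsym[where 'a = 'a, of \<gamma> m] by simp
  finally show "mcoeff (\<Sum>p\<in>perms n. mconst (of_nat (card {u \<in> block_words n \<gamma>. u \<circ> p = u})) * (\<Prod>C\<in>perm_cycles p {1..n}. psym (card C))) m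
    = (mcoeff (mconst (of_nat (fact n)) * prod_list (map hsym \<gamma>)) m :: 'a)" .
qed

section \<open>Power sums separate class functions\<close>

lemma funpow_eq_iff:
  assumes "x \<in> orbit f x"
  shows "(f ^^ k) x = (f ^^ l) x \<longleftrightarrow> k mod card (orbit f x) = l mod card (orbit f x)"
proof -
  let ?d = "funpow_dist1 f x x"
  have orb: "orbit f x = (\<lambda>i. (f ^^ i) x) ` {0..<?d}" by (rule orbit_conv_funpow_dist1[OF assms])
  have inj: "inj_on (\<lambda>i. (f ^^ i) x) {0..<?d}" using assms by (rule inj_on_funpow_dist1)
  have d: "card (orbit f x) = ?d" by (subst orb) (simp add: card_image[OF inj])
  have p: "(f ^^ ?d) x = x" using funpow_dist1_prop[OF assms] .
  have "(f ^^ k) x = (f ^^ (k mod ?d)) x" "(f ^^ l) x = (f ^^ (l mod ?d)) x" using funpow_mod_eq[OF p] by metis+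
  moreover have "k mod ?d \<in> {0..<?d}" "l mod ?d \<in> {0..<?d}" by auto
  ultimately show ?thesis unfolding d using inj_on_eq_iff[OF inj] by metis
qed

text \<open>Match the two cyclic orders on every common cycle, starting both at its minimum.\<close>

lemma same_orbits_conj:
  assumes p: "p \<in> perms n" and q: "q \<in> perms n" and orb: "\<And>i. i \<in> {1..n} \<Longrightarrow> orbit p i = orbit q i"
  shows "\<exists>h\<in>perms n. q \<circ> h = h \<circ> p"
proof -
  let ?A = "{1..n}"
  note op = orbit_eq_perms[OF p] and oq = orbit_eq_perms[OF q]
  define r where "r i = Min (orbit p i)" for i
  have r: "r i \<in> orbit p i" if "i \<in> ?A" for i
    unfolding r_def using op(1,3)[OF that] by (intro Min_in) auto
  have rA: "r i \<in> ?A" if "i \<in> ?A" for i using r[OF that] op(2)[OF that] by blast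
  have orb_r: "orbit p (r i) = orbit p i" if "i \<in> ?A" for i using op(4)[OF that r[OF that]] .
  have ex: "\<exists>k. (p ^^ k) (r i) = i" if i: "i \<in> ?A" for i
  proof -
    have "i \<in> orbit p (r i)" unfolding orb_r[OF i] by (rule op(1)[OF i])
    then obtain k where "i = (p ^^ k) (r i)" unfolding orbit_altdef by blast
    then show ?thesis by (intro exI[of _ k]) (rule sym)
  qed
  define h where "h i = (if i \<in> ?A then (q ^^ (SOME k. (p ^^ k) (r i) = i)) (r i) else i)" for i
  have iff: "(p ^^ k) (r i) = (p ^^ l) (r i) \<longleftrightarrow> (q ^^ k) (r i) = (q ^^ l) (r i)" if i: "i \<in> ?A" for i k l
    using funpow_eq_iff[OF op(1)[OF rA[OF i]], of k l] funpow_eq_iff[OF oq(1)[OF rA[OF i]], of k l] orb[OF rA[OF i]] by simp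
  have h: "h i = (q ^^ k) (r i)" if i: "i \<in> ?A" and k: "(p ^^ k) (r i) = i" for i k
  proof -
    have "(p ^^ (SOME k. (p ^^ k) (r i) = i)) (r i) = (p ^^ k) (r i)" using someI_ex[OF ex[OF i]] k by simp
    then show ?thesis using iff[OF i] i by (simp add: h_def)
  qed
  have h_orb: "h i \<in> orbit q (r i)" if i: "i \<in> ?A" for i
  proof -
    obtain k where "(p ^^ k) (r i) = i" using ex[OF i] by blast
    then show ?thesis using h[OF i] funpow_in_orbit[OF oq(1)[OF rA[OF i]]] by simp
  qed
  have hA: "h i \<in> ?A" if "i \<in> ?A" for i using h_orb[OF that] oq(2)[OF rA[OF that]] by blast
  have inj: "inj_on h ?A"
  proof (rule inj_onI)
    fix i j assume ij: "i \<in> ?A" "j \<in> ?A" "h i = h j"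
    have "orbit q (r i) = orbit q (r j)"
      using oq(4)[OF rA[OF ij(1)] h_orb[OF ij(1)]] oq(4)[OF rA[OF ij(2)] h_orb[OF ij(2)]] ij(3) by simp
    then have "orbit p i = orbit p j" using orb[OF rA] orb_r ij by metis
    then have rr: "r i = r j" by (simp add: r_def)
    obtain k l where kl: "(p ^^ k) (r i) = i" "(p ^^ l) (r j) = j" using ex ij by blast
    have "(q ^^ k) (r i) = (q ^^ l) (r i)" using h[OF ij(1) kl(1)] h[OF ij(2) kl(2)] ij(3) rr by simp
    then have "(p ^^ k) (r i) = (p ^^ l) (r i)" unfolding iff[OF ij(1)] .
    then show "i = j" unfolding kl(1) unfolding rr kl(2) .
  qed
  have "h ` ?A = ?A" using hA inj by (intro endo_inj_surj) auto
  then have hperm: "h permutes ?A" using inj by (intro bij_imp_permutes) (auto simp: bij_betw_def h_def)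
  have "q (h i) = h (p i)" for i
  proof (cases "i \<in> ?A")
    case True
    have pi: "p i \<in> orbit p i" by (rule orbit.base)
    then have piA: "p i \<in> ?A" using op(2)[OF True] by blast
    have "r (p i) = r i" unfolding r_def op(4)[OF True pi] ..
    obtain k where k: "(p ^^ k) (r i) = i" using ex[OF True] by blast
    then have "(p ^^ Suc k) (r (p i)) = p i" using \<open>r (p i) = r i\<close> by simp
    then have "h (p i) = (q ^^ Suc k) (r i)" using h[OF piA] \<open>r (p i) = r i\<close> by metis
    then show ?thesis using h[OF True k] by simp
  next
    case False
    then have "p i = i" "q i = i" using p q by (simp_all add: permutes_not_in)
    then show ?thesis using False by (simp only: h_def if_False)
  qed
  then show ?thesis using hperm by (intro bexI[of _ h]) (auto simp: fun_eq_iff)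
qed

text \<open>A word fixed by \<open>q\<close> is constant on the cycles of \<open>q\<close>. If \<open>q\<close> has no more cycles than the word has
values, then distinct cycles carry distinct values.\<close>

lemma orbits_eq_fibres:
  assumes q: "q \<in> perms n" and f: "f \<circ> q = f" and le: "cyc q {1..n} \<le> card (f ` {1..n})" and i: "i \<in> {1..n}"
  shows "orbit q i = {j \<in> {1..n}. f j = f i}" "cyc q {1..n} = card (f ` {1..n})"
proof -
  let ?A = "{1..n}"
  note o = orbit_eq_perms[OF q]
  define g where "g C = f (SOME j. j \<in> C)" for C
  have g: "g (orbit q j) = f j" if "j \<in> ?A" for j
  proof -
    have "(SOME k. k \<in> orbit q j) \<in> orbit q j" using o(1)[OF that] by (rule someI)
    then show ?thesis unfolding g_def using fixed_word_orbit[OF f] by blast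
  qed
  have im: "g ` orbit q ` ?A = f ` ?A" using g by (auto simp: image_image)
  have card: "card (g ` orbit q ` ?A) = cyc q ?A"
    using le im card_image_le[of "orbit q ` ?A" g] by simp
  then have inj: "inj_on g (orbit q ` ?A)" by (intro eq_card_imp_inj_on) auto
  show "cyc q ?A = card (f ` ?A)" using card im by simp
  show "orbit q i = {j \<in> ?A. f j = f i}"
  proof (intro equalityI subsetI)
    fix j assume "j \<in> orbit q i"
    then show "j \<in> {j \<in> ?A. f j = f i}" using fixed_word_orbit[OF f] o(2)[OF i] by blast
  next
    fix j assume j: "j \<in> {j \<in> ?A. f j = f i}"
    then have "g (orbit q j) = g (orbit q i)" using g i by simp
    then have "orbit q j = orbit q i" using inj i j by (auto simp: inj_on_def)
    then show "j \<in> orbit q i" using o(1)[of j] j by simp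
  qed
qed

text \<open>Among the permutations where \<open>\<psi>\<close> does not vanish take one, \<open>p0\<close>, with the most cycles, and
look at the coefficient of the monomial of the word that names its cycles. A permutation in the
support contributes to it only if it fixes a word of the same content, and having no more cycles than
that word has values, it is conjugate to \<open>p0\<close>. So the coefficient is a positive multiple of
\<open>\<psi> p0\<close>.\<close>

lemma class_function_zero:
  fixes \<psi> :: "(nat \<Rightarrow> nat) \<Rightarrow> 'k::field_char_0"
  assumes cls: "\<And>p h. p \<in> perms n \<Longrightarrow> h \<in> perms n \<Longrightarrow> \<psi> (h \<circ> p \<circ> inv h) = \<psi> p"
    and zero: "(\<Sum>p\<in>perms n. mconst (\<psi> p) * (\<Prod>C\<in>perm_cycles p {1..n}. psym (card C))) = 0"
    and p: "p \<in> perms n"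
  shows "\<psi> p = 0"
proof (rule ccontr)
  let ?A = "{1..n}" and ?S = "{p \<in> perms n. \<psi> p \<noteq> 0}"
  assume "\<psi> p \<noteq> 0"
  then have S: "?S \<noteq> {}" "finite ?S" using p finite_perms[of n] by auto
  define c where "c = Max ((\<lambda>p. cyc p ?A) ` ?S)"
  have "c \<in> (\<lambda>p. cyc p ?A) ` ?S" unfolding c_def using S by (intro Max_in) auto
  then obtain p0 where p0: "p0 \<in> perms n" "\<psi> p0 \<noteq> 0" "cyc p0 ?A = c" by blast
  have max: "cyc q ?A \<le> c" if "q \<in> perms n" "\<psi> q \<noteq> 0" for q
    unfolding c_def using S that by (intro Max_ge) auto
  note o = orbit_eq_perms[OF p0(1)]
  \<comment> \<open>the word that names the cycles of \<open>p0\<close>\<close>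
  define f0 where "f0 = restrict (\<lambda>i. Min (orbit p0 i)) ?A"
  define m where "m = content ?A f0"
  have f0min: "f0 i \<in> orbit p0 i" if "i \<in> ?A" for i
  proof -
    have "Min (orbit p0 i) \<in> orbit p0 i" using o(1,3)[OF that] by (intro Min_in) auto
    then show ?thesis using that by (simp only: f0_def restrict_apply if_True)
  qed
  have f0p: "f0 \<circ> p0 = f0"
  proof
    fix i
    show "(f0 \<circ> p0) i = f0 i"
    proof (cases "i \<in> ?A")
      case True
      have pi: "p0 i \<in> orbit p0 i" by (rule orbit.base)
      then have "p0 i \<in> ?A" "orbit p0 (p0 i) = orbit p0 i" using o(2,4)[OF True] by blast+
      then show ?thesis using True by (simp add: f0_def)
    next
      case False
      then have "p0 i = i" using p0(1) by (simp add: permutes_not_in)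
      then show ?thesis by simp
    qed
  qed
  then have f0w: "f0 \<in> fixed_words n p0 m" by (simp add: fixed_words_def m_def f0_def)
  have cf0: "card (f0 ` ?A) = c"
  proof -
    have "f0 ` ?A = Min ` orbit p0 ` ?A" by (auto simp: f0_def image_image)
    moreover have "inj_on Min (orbit p0 ` ?A)"
    proof (rule inj_onI)
      fix C C' assume "C \<in> orbit p0 ` ?A" "C' \<in> orbit p0 ` ?A" "Min C = Min C'"
      then obtain i j where ij: "i \<in> ?A" "j \<in> ?A" "C = orbit p0 i" "C' = orbit p0 j" by blast
      have "Min C \<in> orbit p0 i" "Min C \<in> orbit p0 j"
        using f0min[OF ij(1)] f0min[OF ij(2)] ij \<open>Min C = Min C'\<close> by (simp_all add: f0_def)
      then show "C = C'" using o(4)[OF ij(1)] o(4)[OF ij(2)] ij by metis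
    qed
    ultimately show ?thesis using p0(3) by (simp add: card_image)
  qed
  have same: "\<psi> q = \<psi> p0" if q: "q \<in> perms n" "\<psi> q \<noteq> 0" and f: "f \<in> fixed_words n q m" for q f
  proof -
    have fq: "f \<circ> q = f" "f \<in> extensional ?A" "content ?A f = content ?A f0" using f by (auto simp: fixed_words_def m_def)
    have "card {i \<in> ?A. f0 i = y} = card {i \<in> ?A. f i = y}" for y
      using lookup_content[of ?A f y] lookup_content[of ?A f0 y] fq(3) by simp
    moreover have "f0 \<in> extensional ?A" by (simp add: f0_def)
    ultimately obtain \<pi> where \<pi>: "\<pi> \<in> perms n" "f = f0 \<circ> \<pi>"
      using image_mset_words_permutes[of f0 n f] fq(2) by blast
    have bij: "bij \<pi>" using \<pi>(1) permutes_bij by blast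
    have inv: "\<pi> \<circ> inv \<pi> = id" "inv \<pi> \<circ> \<pi> = id" using \<pi>(1) permutes_inv_o by blast+
    have "f ` ?A = f0 ` ?A" unfolding \<pi>(2) image_comp[symmetric] using \<pi>(1) permutes_image by fastforce
    then have cf: "card (f ` ?A) = c" using cf0 by simp
    define p' where "p' = inv \<pi> \<circ> p0 \<circ> \<pi>"
    have p': "p' \<in> perms n" unfolding p'_def by (intro comp_perms inv_perms \<pi>(1) p0(1))
    have fp': "f \<circ> p' = f"
    proof -
      have "f \<circ> p' = f0 \<circ> (\<pi> \<circ> inv \<pi>) \<circ> p0 \<circ> \<pi>" unfolding \<pi>(2) p'_def by (simp only: o_assoc)
      also have "\<dots> = f" using inv f0p \<pi>(2) by simp
      finally show ?thesis .
    qed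
    have "cyc p' ?A = c"
    proof -
      have "inv \<pi> ` ?A = ?A" using inv_perms[OF \<pi>(1)] permutes_image by blast
      moreover have "inj_on (inv \<pi>) ?A" using inv_perms[OF \<pi>(1)] permutes_inj inj_on_subset by blast
      moreover have "p' (inv \<pi> x) = inv \<pi> (p0 x)" for x unfolding p'_def using fun_cong[OF inv(1), of x] by simp
      ultimately show ?thesis using cyc_conj[of p0 ?A "inv \<pi>" p'] p0 by simp
    qed
    then have "orbit p' i = orbit q i" if "i \<in> ?A" for i
      using orbits_eq_fibres(1)[OF p' fp' _ that] orbits_eq_fibres(1)[OF q(1) fq(1) _ that] max[OF q] cf by simp
    then obtain h where h: "h \<in> perms n" "q \<circ> h = h \<circ> p'" using same_orbits_conj[OF p' q(1)] by blast
    have "h \<circ> inv h = id" using h(1) permutes_inv_o by blast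
    then have "q = q \<circ> (h \<circ> inv h)" by simp
    also have "\<dots> = h \<circ> p' \<circ> inv h" using h(2) by (simp only: o_assoc)
    finally have "\<psi> q = \<psi> p'" using cls[OF p' h(1)] by simp
    also have "inv (inv \<pi>) = \<pi>" using bij by (rule inv_inv_eq)
    then have "\<psi> p' = \<psi> p0" using cls[OF p0(1) inv_perms[OF \<pi>(1)]] by (simp add: p'_def)
    finally show ?thesis .
  qed
  have "0 = mcoeff (\<Sum>p\<in>perms n. mconst (\<psi> p) * (\<Prod>C\<in>perm_cycles p ?A. psym (card C))) m" using zero by simp
  also have "\<dots> = (\<Sum>q\<in>perms n. \<psi> q * of_nat (card (fixed_words n q m)))"
    unfolding mcoeff_sum mcoeff_mconst_mult by (intro sum.cong refl) (simp only: mcoeff_cycle_psym(2))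
  also have "\<dots> = (\<Sum>q\<in>?S. \<psi> q * of_nat (card (fixed_words n q m)))"
    using finite_perms[of n] by (intro sum.mono_neutral_right) auto
  also have "\<dots> = (\<Sum>q\<in>?S. \<psi> p0 * of_nat (card (fixed_words n q m)))"
  proof (rule sum.cong[OF refl])
    fix q assume q: "q \<in> ?S"
    show "\<psi> q * of_nat (card (fixed_words n q m)) = \<psi> p0 * of_nat (card (fixed_words n q m))"
      using same[of q] q by (cases "fixed_words n q m = {}") auto
  qed
  also have "\<dots> = \<psi> p0 * of_nat (\<Sum>q\<in>?S. card (fixed_words n q m))" by (simp add: sum_distrib_left)
  finally have "\<psi> p0 * of_nat (\<Sum>q\<in>?S. card (fixed_words n q m)) = 0" by (rule sym)
  then have "(of_nat (\<Sum>q\<in>?S. card (fixed_words n q m)) :: 'k) = 0" using p0(2) unfolding mult_eq_0_iff by blast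
  then have "(\<Sum>q\<in>?S. card (fixed_words n q m)) = 0" by (rule of_nat_eq_0_iff[THEN iffD1])
  then have "card (fixed_words n p0 m) = 0" using S(2) p0 by simp
  then show False using f0w mcoeff_cycle_psym(1)[OF p0(1), of m] by auto
qed

section \<open>The kernel of a family of fibre sums\<close>

context char0_vector_space begin

text \<open>Exchange: an independent set that is at least as large as a generating set generates.\<close>

lemma span_eq_of_card:
  assumes "finite S" "independent B" "B \<subseteq> span S" "card S \<le> card B"
  shows "span B = span S" "finite B"
proof -
  show fin: "finite B" using independent_span_bound[OF assms(1-3)] by blast
  have "v \<in> span B" if v: "v \<in> span S" for v
  proof (rule ccontr)
    assume nv: "v \<notin> span B"
    then have "independent (insert v B)" using assms(2) by (rule independent_insertI)
    then have "card (insert v B) \<le> card S" using independent_span_bound[OF assms(1)] assms(3) v by blast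
    moreover have "v \<notin> B" using nv span_base by blast
    ultimately show False using fin assms(4) by simp
  qed
  then show "span B = span S" using span_minimal[OF assms(3)] by blast
qed

end

lemma moebius_sum:
  assumes "finite M" "S \<subseteq> M"
  shows "(\<Sum>T | S \<subseteq> T \<and> T \<subseteq> M. (- 1) ^ card (M - T)) = (if S = M then 1 else (0 :: 'a::comm_ring_1))"
proof -
  have fin: "finite (M - S)" using assms by simp
  have "(\<Sum>T | S \<subseteq> T \<and> T \<subseteq> M. (- 1) ^ card (M - T)) = (\<Sum>U\<in>Pow (M - S). (- 1) ^ card U :: 'a)"
    by (rule sum.reindex_bij_witness[of _ "\<lambda>U. M - U" "\<lambda>T. M - T"]) (use assms in \<open>auto simp: double_diff\<close>)
  also have "\<dots> = (\<Sum>U\<in>Pow (M - S). (\<Prod>x\<in>U. - 1) * (\<Prod>x\<in>(M - S) - U. 1))" by simp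
  also have "\<dots> = (\<Prod>x\<in>M - S. - 1 + (1 :: 'a))" by (rule prod_add[OF fin, symmetric])
  also have "\<dots> = (if S = M then 1 else 0)" using assms fin by (auto simp: card_gt_0_iff prod_constant power_0_left)
  finally show ?thesis .
qed

text \<open>Moebius inversion on the Boolean lattice: the elements of full \<open>D\<close> from those of \<open>D\<close> below
each \<open>T\<close>.\<close>

lemma moebius_top:
  fixes f :: "'x \<Rightarrow> 'a::comm_ring_1"
  assumes "finite X" "finite M" "\<And>x. x \<in> X \<Longrightarrow> D x \<subseteq> M"
  shows "(\<Sum>x | x \<in> X \<and> D x = M. f x) = (\<Sum>T\<in>Pow M. (- 1) ^ card (M - T) * (\<Sum>x | x \<in> X \<and> D x \<subseteq> T. f x))"
proof -
  have "(\<Sum>T\<in>Pow M. (- 1) ^ card (M - T) * (\<Sum>x | x \<in> X \<and> D x \<subseteq> T. f x)) =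
    (\<Sum>T\<in>Pow M. \<Sum>x\<in>X. if D x \<subseteq> T then (- 1) ^ card (M - T) * f x else 0)"
    using assms(1) by (intro sum.cong refl) (simp add: sum_distrib_left sum.If_cases Int_def)
  also have "\<dots> = (\<Sum>x\<in>X. \<Sum>T\<in>Pow M. if D x \<subseteq> T then (- 1) ^ card (M - T) * f x else 0)" by (rule sum.swap)
  also have "\<dots> = (\<Sum>x\<in>X. if D x = M then f x else 0)"
  proof (rule sum.cong[OF refl])
    fix x assume x: "x \<in> X"
    have "(\<Sum>T\<in>Pow M. if D x \<subseteq> T then (- 1) ^ card (M - T) * f x else 0) =
      (\<Sum>T | D x \<subseteq> T \<and> T \<subseteq> M. (- 1) ^ card (M - T)) * f x"
      unfolding sum_distrib_right using assms(2) by (intro sum.mono_neutral_cong_right) auto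
    then show "(\<Sum>T\<in>Pow M. if D x \<subseteq> T then (- 1) ^ card (M - T) * f x else 0) = (if D x = M then f x else 0)"
      using moebius_sum[OF assms(2) assms(3)[OF x], where 'a = 'a] by simp
  qed
  also have "\<dots> = (\<Sum>x | x \<in> X \<and> D x = M. f x)" using assms(1) by (simp add: sum.If_cases Int_def)
  finally show ?thesis by simp
qed

text \<open>A finite set \<open>X\<close> with equivalence relations, one for each subset \<open>T\<close> of \<open>M\<close>, the classes of \<open>T\<close>
being the fibres of \<open>\<kappa> T\<close>; they get finer when \<open>T\<close> grows. The set \<open>D x\<close> plays the role of the
descents of \<open>x\<close>: every class of \<open>T\<close> has a representative with \<open>D x \<subseteq> T\<close>, and \<open>x\<close> is the least
element of its class for \<open>T = D x\<close>. The parameter \<open>K\<close> only carries the field of coefficients.\<close>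

locale sorted_fibres =
  fixes X :: "'x set" and M :: "'m set" and D :: "'x \<Rightarrow> 'm set" and \<kappa> :: "'m set \<Rightarrow> 'x \<Rightarrow> 'c"
    and less :: "'x \<Rightarrow> 'x \<Rightarrow> bool" and K :: "'k::field_char_0 itself"
  assumes finX: "finite X" and finM: "finite M" and DM: "x \<in> X \<Longrightarrow> D x \<subseteq> M"
    and mono: "T \<subseteq> T' \<Longrightarrow> T' \<subseteq> M \<Longrightarrow> x \<in> X \<Longrightarrow> y \<in> X \<Longrightarrow> \<kappa> T' x = \<kappa> T' y \<Longrightarrow> \<kappa> T x = \<kappa> T y"
    and sorted_rep: "x \<in> X \<Longrightarrow> T \<subseteq> M \<Longrightarrow> \<exists>y\<in>X. D y \<subseteq> T \<and> \<kappa> T y = \<kappa> T x"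
    and less_fibre: "x \<in> X \<Longrightarrow> y \<in> X \<Longrightarrow> \<kappa> (D x) x = \<kappa> (D x) y \<Longrightarrow> x \<noteq> y \<Longrightarrow> less x y"
    and less_asym: "asymp_on X less" and less_trans: "transp_on X less"
begin

definition fibre :: "'m set \<Rightarrow> 'x \<Rightarrow> 'x \<Rightarrow>\<^sub>0 'k" where
  "fibre T x = (\<Sum>y | y \<in> X \<and> \<kappa> T y = \<kappa> T x. single y 1)"

lemma lookup_fibre: "lookup (fibre T x) y = (if y \<in> X \<and> \<kappa> T y = \<kappa> T x then 1 else 0)"
  unfolding fibre_def lookup_sum using finX by (simp add: lookup_single when_def)

lemma fibre_cong: "\<kappa> T x = \<kappa> T y \<Longrightarrow> fibre T x = fibre T y"
  by (simp add: fibre_def)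

lemma fibre_eq_iff:
  assumes "x \<in> X" "y \<in> X"
  shows "fibre T x = fibre T y \<longleftrightarrow> \<kappa> T x = \<kappa> T y"
proof
  assume eq: "fibre T x = fibre T y"
  have "lookup (fibre T y) x = 1" unfolding eq[symmetric] lookup_fibre using assms by simp
  then show "\<kappa> T x = \<kappa> T y" by (simp add: lookup_fibre split: if_splits)
qed (rule fibre_cong)

text \<open>The sorted representative of a class is unique, because each of two of them would be less than
the other.\<close>

lemma sorted_unique:
  assumes "x \<in> X" "y \<in> X" "T \<subseteq> M" "D x \<subseteq> T" "D y \<subseteq> T" "\<kappa> T x = \<kappa> T y"
  shows "x = y"
proof (rule ccontr)
  assume "x \<noteq> y"
  have "\<kappa> (D x) x = \<kappa> (D x) y" "\<kappa> (D y) y = \<kappa> (D y) x"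
    using mono[of "D x" T x y] mono[of "D y" T y x] assms by auto
  then have "less x y" "less y x" using less_fibre assms \<open>x \<noteq> y\<close> by auto
  then show False using less_asym assms by (auto dest: asymp_onD)
qed

text \<open>The indicator of the class of \<open>x\<close> at its own descent set.\<close>

definition base :: "'x \<Rightarrow> 'x \<Rightarrow>\<^sub>0 'k" where
  "base x = fibre (D x) x"

lemma inj_on_base: "inj_on (base :: _ \<Rightarrow> _ \<Rightarrow>\<^sub>0 'k) X"
proof (rule inj_onI, rule ccontr)
  fix x y assume xy: "x \<in> X" "y \<in> X" "(base x :: 'x \<Rightarrow>\<^sub>0 'k) = base y" "x \<noteq> y"
  have "\<kappa> (D x) y = \<kappa> (D x) x"
    using lookup_fibre[of "D x" x y] lookup_fibre[of "D y" y y] xy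
    unfolding base_def by (auto split: if_splits)
  moreover have "\<kappa> (D y) x = \<kappa> (D y) y"
    using lookup_fibre[of "D x" x x] lookup_fibre[of "D y" y x] xy
    unfolding base_def by (auto split: if_splits)
  ultimately have "less x y" "less y x" using less_fibre xy by auto
  then show False using less_asym xy by (auto dest: asymp_onD)
qed

text \<open>Every \<open>x\<close> is the least element in the support of \<open>base x\<close>, so the family is triangular.\<close>

lemma base_independent: "pm.independent ((base :: _ \<Rightarrow> _ \<Rightarrow>\<^sub>0 'k) ` X)"
proof (rule pm.independent_if_scalars_zero)
  show "finite ((base :: _ \<Rightarrow> _ \<Rightarrow>\<^sub>0 'k) ` X)" using finX by simp
  fix f :: "('x \<Rightarrow>\<^sub>0 'k) \<Rightarrow> 'k" and v
  assume sum0: "(\<Sum>v\<in>base ` X. pm_scale (f v) v) = 0" and v: "v \<in> base ` X"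
  let ?S = "{x \<in> X. f (base x) \<noteq> 0}"
  have "?S = {}"
  proof (rule ccontr)
    assume "?S \<noteq> {}"
    moreover have "asymp_on ?S less" "transp_on ?S less"
      using less_asym less_trans by (auto intro: asymp_on_subset transp_on_subset)
    ultimately obtain x where x: "x \<in> ?S" "\<And>y. y \<in> ?S \<Longrightarrow> y \<noteq> x \<Longrightarrow> \<not> less y x"
      using Finite_Set.bex_min_element[of ?S less] finX by auto
    have "0 = (\<Sum>z\<in>X. f (base z) * lookup (base z) x)"
      using arg_cong[OF sum0, of "\<lambda>v. lookup v x"]
      unfolding lookup_sum sum.reindex[OF inj_on_base] by simp
    also have "\<dots> = (\<Sum>z\<in>X. if z = x then f (base x) else 0)"
    proof (rule sum.cong[OF refl])
      fix z assume z: "z \<in> X"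
      show "f (base z) * lookup (base z) x = (if z = x then f (base x) else 0)"
      proof (cases "z = x")
        case True
        then show ?thesis using z by (simp add: base_def lookup_fibre)
      next
        case False
        have "f (base z) = 0 \<or> \<kappa> (D z) x \<noteq> \<kappa> (D z) z"
          using x(2)[of z] less_fibre[of z x] z x(1) False by auto
        then show ?thesis using False by (auto simp: base_def lookup_fibre)
      qed
    qed
    also have "\<dots> = f (base x)" using x finX by simp
    finally show False using x by simp
  qed
  then show "f v = 0" using v by blast
qed

definition sorted_set :: "'m set \<Rightarrow> 'x set" where
  "sorted_set T = {x \<in> X. D x \<subseteq> T}"

lemma finite_sorted_set [simp]: "finite (sorted_set T)"
  using finX by (simp add: sorted_set_def)

lemma inj_on_fibre: "T \<subseteq> M \<Longrightarrow> inj_on (fibre T :: _ \<Rightarrow> _ \<Rightarrow>\<^sub>0 'k) (sorted_set T)"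
  by (rule inj_onI) (auto simp: sorted_set_def fibre_eq_iff intro: sorted_unique)

lemma lookup_fibre_comb:
  fixes c :: "'x \<Rightarrow> 'k"
  assumes "T \<subseteq> M" "z \<in> sorted_set T" "y \<in> X" "\<kappa> T y = \<kappa> T z"
  shows "lookup (\<Sum>x\<in>sorted_set T. pm_scale (c x) (fibre T x)) y = c z"
proof -
  have "lookup (\<Sum>x\<in>sorted_set T. pm_scale (c x) (fibre T x)) y = (\<Sum>x\<in>sorted_set T. if x = z then c z else 0)"
    unfolding lookup_sum
    using assms sorted_unique[of _ z T] by (intro sum.cong) (auto simp: lookup_fibre sorted_set_def)
  then show ?thesis using assms(2) by simp
qed

lemma fibre_independent:
  assumes T: "T \<subseteq> M"
  shows "pm.independent ((fibre T :: _ \<Rightarrow> _ \<Rightarrow>\<^sub>0 'k) ` sorted_set T)"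
proof (rule pm.independent_if_scalars_zero)
  fix f :: "('x \<Rightarrow>\<^sub>0 'k) \<Rightarrow> 'k" and v
  assume sum0: "(\<Sum>v\<in>fibre T ` sorted_set T. pm_scale (f v) v) = 0" and v: "v \<in> fibre T ` sorted_set T"
  then obtain z where z: "z \<in> sorted_set T" "v = fibre T z" by blast
  have "f (fibre T z) = lookup (\<Sum>x\<in>sorted_set T. pm_scale (f (fibre T x)) (fibre T x)) z"
    using z by (intro lookup_fibre_comb[OF T z(1), symmetric]) (auto simp: sorted_set_def)
  also have "\<dots> = 0" using sum0 unfolding sum.reindex[OF inj_on_fibre[OF T]] by simp
  finally show "f v = 0" using z by simp
qed simp

lemma rep_exists: "x \<in> X \<Longrightarrow> T \<subseteq> M \<Longrightarrow> \<exists>z\<in>sorted_set T. \<kappa> T z = \<kappa> T x"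
  using sorted_rep[of x T] by (auto simp: sorted_set_def)

lemma fibre_in_span:
  "x \<in> X \<Longrightarrow> T \<subseteq> M \<Longrightarrow> (fibre T x :: _ \<Rightarrow>\<^sub>0 'k) \<in> pm.span (fibre T ` sorted_set T)"
  using rep_exists fibre_cong by (metis imageI pm.span_base)

text \<open>A class for \<open>D x \<subseteq> T\<close> is a union of classes for \<open>T\<close>.\<close>

lemma base_in_span:
  assumes T: "T \<subseteq> M" and x: "x \<in> sorted_set T"
  shows "(base x :: _ \<Rightarrow>\<^sub>0 'k) \<in> pm.span (fibre T ` sorted_set T)"
proof -
  let ?c = "\<lambda>z. if \<kappa> (D x) z = \<kappa> (D x) x then 1 else 0 :: 'k"
  have "base x = (\<Sum>z\<in>sorted_set T. pm_scale (?c z) (fibre T z))"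
  proof (rule poly_mapping_eqI)
    fix y
    show "lookup (base x) y = lookup (\<Sum>z\<in>sorted_set T. pm_scale (?c z) (fibre T z)) y"
    proof (cases "y \<in> X")
      case True
      then obtain z where z: "z \<in> sorted_set T" "\<kappa> T z = \<kappa> T y" using rep_exists T by blast
      then have "\<kappa> (D x) z = \<kappa> (D x) y" using mono[of "D x" T z y] x T True by (auto simp: sorted_set_def)
      then show ?thesis using lookup_fibre_comb[OF T z(1) True, of ?c] z True by (simp add: base_def lookup_fibre)
    next
      case False
      then show ?thesis unfolding lookup_sum by (simp add: base_def lookup_fibre)
    qed
  qed
  also have "\<dots> \<in> pm.span (fibre T ` sorted_set T)"
    by (rule pm.span_sum, rule pm.span_scale, rule pm.span_base, rule imageI)
  finally show ?thesis .
qed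

lemma sorted_subset: "sorted_set T \<subseteq> X" by (auto simp: sorted_set_def)

lemma base_sorted_independent: "pm.independent ((base :: _ \<Rightarrow> _ \<Rightarrow>\<^sub>0 'k) ` sorted_set T)"
  using base_independent by (rule pm.independent_mono) (use sorted_subset in blast)

text \<open>For every \<open>T\<close> at once, the \<open>base x\<close> with \<open>D x \<subseteq> T\<close> form a basis of the functions constant on
the classes of \<open>T\<close>: independence and the number of elements decide.\<close>

lemma span_base_sorted:
  assumes T: "T \<subseteq> M"
  shows "pm.span ((base :: _ \<Rightarrow> _ \<Rightarrow>\<^sub>0 'k) ` sorted_set T) = pm.span (fibre T ` sorted_set T)"
proof (rule pm.span_eq_of_card(1))
  show "base ` sorted_set T \<subseteq> pm.span (fibre T ` sorted_set T)" using base_in_span[OF T] by blast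
  have "card ((base :: _ \<Rightarrow> _ \<Rightarrow>\<^sub>0 'k) ` sorted_set T) = card (sorted_set T)"
    by (rule card_image[OF inj_on_subset[OF inj_on_base sorted_subset]])
  then show "card ((fibre T :: _ \<Rightarrow> _ \<Rightarrow>\<^sub>0 'k) ` sorted_set T) \<le> card ((base :: _ \<Rightarrow> _ \<Rightarrow>\<^sub>0 'k) ` sorted_set T)"
    by (simp add: card_image_le)
qed (simp_all add: base_sorted_independent)

lemma sorted_set_M: "sorted_set M = X"
  using DM by (auto simp: sorted_set_def)

lemma fibre_M: "x \<in> X \<Longrightarrow> fibre M x = single x 1"
  using sorted_unique[of _ x M] DM
  by (intro poly_mapping_eqI) (auto simp: lookup_fibre lookup_single when_def)

lemma expand_single:
  assumes "keys v \<subseteq> X"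
  shows "v = (\<Sum>x\<in>X. pm_scale (lookup v x) (single x 1))"
proof (rule poly_mapping_eqI)
  fix z
  have "z \<notin> X \<Longrightarrow> lookup v z = 0" using assms by (auto simp: in_keys_iff)
  then show "lookup v z = lookup (\<Sum>x\<in>X. pm_scale (lookup v x) (single x 1)) z"
    unfolding lookup_sum using finX by (auto simp: lookup_single when_def if_distrib cong: if_cong)
qed

lemma single_in_span_base: "x \<in> X \<Longrightarrow> single x 1 \<in> pm.span ((base :: _ \<Rightarrow> _ \<Rightarrow>\<^sub>0 'k) ` X)"
  using span_base_sorted[of M] fibre_in_span[of x M] fibre_M[of x]
  by (simp add: sorted_set_M)

abbreviation coord :: "('x \<Rightarrow>\<^sub>0 'k) \<Rightarrow> 'x \<Rightarrow> 'k" where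
  "coord v x \<equiv> pm.representation (base ` X) v (base x)"

text \<open>The basis dual to \<open>base\<close> under \<open>pairing\<close>.\<close>

definition dual :: "'x \<Rightarrow> 'x \<Rightarrow>\<^sub>0 'k" where
  "dual x = (\<Sum>y\<in>X. single y (coord (single y 1) x))"

definition pairing :: "('x \<Rightarrow>\<^sub>0 'k) \<Rightarrow> ('x \<Rightarrow>\<^sub>0 'k) \<Rightarrow> 'k" where
  "pairing f g = (\<Sum>y\<in>X. lookup f y * lookup g y)"

lemma lookup_dual: "lookup (dual x) y = (if y \<in> X then coord (single y 1) x else 0)"
  unfolding dual_def lookup_sum using finX by (simp add: lookup_single when_def)

lemma coord_sum:
  assumes "\<And>i. i \<in> I \<Longrightarrow> f i \<in> pm.span (base ` X)"
  shows "coord (\<Sum>i\<in>I. pm_scale (c i) (f i)) x = (\<Sum>i\<in>I. c i * coord (f i) x)"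
  using assms by (simp add: pm.representation_sum[OF base_independent] pm.span_scale pm.representation_scale[OF base_independent])

lemma pairing_dual:
  assumes "keys v \<subseteq> X"
  shows "pairing (dual x) v = coord v x"
proof -
  have "coord v x = coord (\<Sum>y\<in>X. pm_scale (lookup v y) (single y 1)) x"
    using expand_single[OF assms] by simp
  also have "\<dots> = (\<Sum>y\<in>X. lookup v y * coord (single y 1) x)"
    by (rule coord_sum) (rule single_in_span_base)
  also have "\<dots> = pairing (dual x) v" unfolding pairing_def by (intro sum.cong) (auto simp: lookup_dual)
  finally show ?thesis by simp
qed

lemma coord_base: "x \<in> X \<Longrightarrow> z \<in> X \<Longrightarrow> coord (base z) x = (if x = z then 1 else 0)"
  using inj_on_base by (auto simp: pm.representation_basis[OF base_independent] inj_on_def)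

lemma keys_base: "keys (base x) \<subseteq> X"
  by (auto simp: in_keys_iff base_def lookup_fibre split: if_splits)

lemma keys_dual: "keys (dual x) \<subseteq> X"
  by (auto simp: in_keys_iff lookup_dual split: if_splits)

lemma expand_dual:
  assumes v: "keys v \<subseteq> X"
  shows "v = (\<Sum>x\<in>X. pm_scale (pairing v (base x)) (dual x))"
proof (rule poly_mapping_eqI)
  fix y
  show "lookup v y = lookup (\<Sum>x\<in>X. pm_scale (pairing v (base x)) (dual x)) y"
  proof (cases "y \<in> X")
    case True
    have s: "single y 1 = (\<Sum>x\<in>X. pm_scale (coord (single y 1) x) (base x))"
      using pm.sum_representation_eq[OF base_independent single_in_span_base[OF True] _ order_refl] finX
      unfolding sum.reindex[OF inj_on_base] by simp
    have "lookup (\<Sum>x\<in>X. pm_scale (pairing v (base x)) (dual x)) y =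
      (\<Sum>x\<in>X. (\<Sum>z\<in>X. lookup v z * lookup (base x) z) * coord (single y 1) x)"
      unfolding lookup_sum using True by (simp add: lookup_dual pairing_def)
    also have "\<dots> = (\<Sum>x\<in>X. \<Sum>z\<in>X. lookup v z * (coord (single y 1) x * lookup (base x) z))"
      unfolding sum_distrib_right by (intro sum.cong refl) (simp only: mult_ac)
    also have "\<dots> = (\<Sum>z\<in>X. lookup v z * (\<Sum>x\<in>X. coord (single y 1) x * lookup (base x) z))"
      unfolding sum_distrib_left by (rule sum.swap)
    also have "\<dots> = (\<Sum>z\<in>X. lookup v z * lookup (single y 1) z)"
      by (subst (2) s) (simp add: lookup_sum)
    also have "\<dots> = lookup v y" using True finX by (simp add: lookup_single when_def if_distrib cong: if_cong)
    finally show ?thesis by simp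
  next
    case False
    then have "lookup v y = 0" using v by (auto simp: in_keys_iff)
    then show ?thesis using False unfolding lookup_sum by (simp add: lookup_dual)
  qed
qed

text \<open>The functions whose sums over all classes for all \<open>M - {m}\<close> vanish, which is the orthogonal
complement of the functions constant on such classes.\<close>

definition kernel :: "('x \<Rightarrow>\<^sub>0 'k) set" where
  "kernel = {v. keys v \<subseteq> X \<and>
     (\<forall>m\<in>M. \<forall>x\<in>X. (\<Sum>y | y \<in> X \<and> \<kappa> (M - {m}) y = \<kappa> (M - {m}) x. lookup v y) = 0)}"

lemma pairing_fibre: "pairing v (fibre T x) = (\<Sum>y | y \<in> X \<and> \<kappa> T y = \<kappa> T x. lookup v y)"
  unfolding pairing_def using finX by (intro sum.mono_neutral_cong_right) (auto simp: lookup_fibre)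

lemma pairing_sum_right: "pairing v (\<Sum>i\<in>I. pm_scale (c i) (f i)) = (\<Sum>i\<in>I. c i * pairing v (f i))"
  unfolding pairing_def lookup_sum sum_distrib_left lookup_pm_scale
  by (subst sum.swap, intro sum.cong refl) (simp only: mult_ac)

lemma pairing_sum_left: "pairing (\<Sum>i\<in>I. pm_scale (c i) (f i)) v = (\<Sum>i\<in>I. c i * pairing (f i) v)"
  unfolding pairing_def lookup_sum sum_distrib_left sum_distrib_right lookup_pm_scale
  by (subst sum.swap, intro sum.cong refl) (simp only: mult_ac)

text \<open>If \<open>D x\<close> misses some \<open>m\<close>, then the class of \<open>x\<close> at \<open>D x\<close> is a union of classes for \<open>M - {m}\<close>.\<close>

lemma kernel_pairing_base:
  assumes v: "v \<in> kernel" and x: "x \<in> X" "D x \<noteq> M"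
  shows "pairing v (base x) = 0"
proof -
  obtain m where m: "m \<in> M" "m \<notin> D x" using DM[OF x(1)] x(2) by blast
  have xm: "x \<in> sorted_set (M - {m})" using m x DM by (auto simp: sorted_set_def)
  let ?F = "fibre (M - {m}) ` sorted_set (M - {m})"
  have "base x = (\<Sum>b\<in>?F. pm_scale (pm.representation ?F (base x) b) b)"
    using pm.sum_representation_eq[OF fibre_independent base_in_span[OF _ xm] _ order_refl] by simp
  from arg_cong[OF this, of "pairing v"]
  have "pairing v (base x) = (\<Sum>b\<in>?F. pm.representation ?F (base x) b * pairing v b)"
    unfolding pairing_sum_right .
  also have "\<dots> = 0"
  proof (rule sum.neutral, rule ballI)
    fix b assume "b \<in> ?F"
    then obtain z where z: "z \<in> sorted_set (M - {m})" "b = fibre (M - {m}) z" by blast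
    then have "pairing v b = 0" using v m(1) sorted_subset unfolding z(2) pairing_fibre kernel_def by blast
    then show "pm.representation ?F (base x) b * pairing v b = 0" by simp
  qed
  finally show ?thesis .
qed

abbreviation top_set :: "'x set" where "top_set \<equiv> {x \<in> X. D x = M}"

text \<open>The indicator of a class for \<open>M - {m}\<close> is a combination of \<open>base z\<close> with \<open>D z \<noteq> M\<close>.\<close>

lemma dual_in_kernel:
  assumes x: "x \<in> top_set"
  shows "dual x \<in> kernel"
  unfolding kernel_def
proof (intro CollectI conjI keys_dual ballI)
  fix m y assume m: "m \<in> M" and y: "y \<in> X"
  let ?T = "M - {m}"
  have "(\<Sum>z | z \<in> X \<and> \<kappa> ?T z = \<kappa> ?T y. lookup (dual x) z) = pairing (dual x) (fibre ?T y)"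
    by (rule pairing_fibre[symmetric])
  also have "\<dots> = coord (fibre ?T y) x"
    by (rule pairing_dual) (auto simp: in_keys_iff lookup_fibre split: if_splits)
  also have "\<dots> = pm.representation (base ` sorted_set ?T) (fibre ?T y) (base x)"
  proof (rule fun_cong[OF pm.representation_extend[OF base_independent]])
    show "fibre ?T y \<in> pm.span (base ` sorted_set ?T)" using fibre_in_span[OF y, of ?T] span_base_sorted[of ?T] by auto
  qed (use sorted_subset in blast)
  also have "\<dots> = 0"
  proof (rule ccontr)
    assume "\<not> ?thesis"
    then have "base x \<in> (base ` sorted_set ?T :: (_ \<Rightarrow>\<^sub>0 'k) set)" using pm.representation_ne_zero by blast
    then have "x \<in> sorted_set ?T" using inj_on_base x sorted_subset[of ?T] by (auto simp: inj_on_def)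
    then show False using x m by (auto simp: sorted_set_def)
  qed
  finally show "(\<Sum>z | z \<in> X \<and> \<kappa> ?T z = \<kappa> ?T y. lookup (dual x) z) = (0::'k)" .
qed

lemma inj_on_dual: "inj_on (dual :: _ \<Rightarrow> _ \<Rightarrow>\<^sub>0 'k) X"
proof (rule inj_onI)
  fix x y assume xy: "x \<in> X" "y \<in> X" "(dual x :: _ \<Rightarrow>\<^sub>0 'k) = dual y"
  have "coord (base x) x = coord (base x) y"
    using pairing_dual[OF keys_base, of x x] pairing_dual[OF keys_base, of y x] xy(3) by simp
  then show "x = y" using coord_base[OF xy(1,1)] coord_base[OF xy(2,1)] by (simp split: if_splits)
qed

lemma dual_independent: "pm.independent ((dual :: _ \<Rightarrow> _ \<Rightarrow>\<^sub>0 'k) ` top_set)"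
proof (rule pm.independent_if_scalars_zero)
  show "finite ((dual :: _ \<Rightarrow> _ \<Rightarrow>\<^sub>0 'k) ` top_set)" using finX by simp
  fix f :: "('x \<Rightarrow>\<^sub>0 'k) \<Rightarrow> 'k" and v
  assume sum0: "(\<Sum>v\<in>dual ` top_set. pm_scale (f v) v) = 0" and "v \<in> dual ` top_set"
  then obtain z where z: "z \<in> top_set" "v = dual z" by blast
  have inj: "inj_on (dual :: _ \<Rightarrow> _ \<Rightarrow>\<^sub>0 'k) top_set" by (rule inj_on_subset[OF inj_on_dual]) auto
  have "0 = pairing (\<Sum>x\<in>top_set. pm_scale (f (dual x)) (dual x)) (base z)"
    using sum0 unfolding sum.reindex[OF inj] by (simp add: pairing_def)
  also have "\<dots> = (\<Sum>x\<in>top_set. if x = z then f (dual z) else 0)"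
    unfolding pairing_sum_left using z by (intro sum.cong refl) (auto simp: pairing_dual[OF keys_base] coord_base)
  also have "\<dots> = f (dual z)" using z finX by simp
  finally show "f v = 0" using z by simp
qed

lemma kernel_expand:
  assumes "v \<in> kernel"
  shows "v = (\<Sum>x\<in>top_set. pm_scale (pairing v (base x)) (dual x))"
proof -
  have "v = (\<Sum>x\<in>X. pm_scale (pairing v (base x)) (dual x))" using expand_dual assms unfolding kernel_def by blast
  also have "\<dots> = (\<Sum>x\<in>top_set. pm_scale (pairing v (base x)) (dual x))"
    using finX kernel_pairing_base[OF assms] by (intro sum.mono_neutral_right) auto
  finally show ?thesis .
qed

lemma kernel_subspace: "pm.subspace (kernel :: (_ \<Rightarrow>\<^sub>0 'k) set)"
proof (rule pm.subspaceI)
  fix v w :: "'x \<Rightarrow>\<^sub>0 'k" assume "v \<in> kernel" "w \<in> kernel"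
  then show "v + w \<in> kernel" unfolding kernel_def using keys_add[of v w] by (auto simp: lookup_add sum.distrib)
next
  fix c and v :: "'x \<Rightarrow>\<^sub>0 'k" assume "v \<in> kernel"
  then show "pm_scale c v \<in> kernel" unfolding kernel_def
    by (auto simp: in_keys_iff sum_distrib_left[symmetric] subset_iff)
qed (simp add: kernel_def)

lemma span_dual: "pm.span (dual ` top_set) = (kernel :: (_ \<Rightarrow>\<^sub>0 'k) set)"
proof
  show "pm.span (dual ` top_set) \<subseteq> (kernel :: (_ \<Rightarrow>\<^sub>0 'k) set)"
    using dual_in_kernel kernel_subspace by (intro pm.span_minimal) auto
  show "kernel \<subseteq> pm.span (dual ` top_set :: (_ \<Rightarrow>\<^sub>0 'k) set)"
  proof
    fix v :: "'x \<Rightarrow>\<^sub>0 'k" assume "v \<in> kernel"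
    then have "v = (\<Sum>x\<in>top_set. pm_scale (pairing v (base x)) (dual x))" by (rule kernel_expand)
    also have "\<dots> \<in> pm.span (dual ` top_set)"
      by (rule pm.span_sum, rule pm.span_scale, rule pm.span_base, rule imageI)
    finally show "v \<in> pm.span (dual ` top_set)" .
  qed
qed

end

text \<open>A permutation \<open>a\<close> of \<open>X\<close> that preserves all the equivalence relations, and the induced linear map.\<close>

locale fibre_action = sorted_fibres X M D \<kappa> less K
  for X :: "'x set" and M :: "'m set" and D :: "'x \<Rightarrow> 'm set" and \<kappa> :: "'m set \<Rightarrow> 'x \<Rightarrow> 'c"
    and less :: "'x \<Rightarrow> 'x \<Rightarrow> bool" and K :: "'k::field_char_0 itself" +
  fixes a a' :: "'x \<Rightarrow> 'x" and A :: "('x \<Rightarrow>\<^sub>0 'k) \<Rightarrow> ('x \<Rightarrow>\<^sub>0 'k)"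
  assumes aX: "x \<in> X \<Longrightarrow> a x \<in> X" "x \<in> X \<Longrightarrow> a' x \<in> X"
    and inv: "x \<in> X \<Longrightarrow> a (a' x) = x" "x \<in> X \<Longrightarrow> a' (a x) = x"
    and act: "T \<subseteq> M \<Longrightarrow> x \<in> X \<Longrightarrow> y \<in> X \<Longrightarrow> \<kappa> T (a x) = \<kappa> T (a y) \<longleftrightarrow> \<kappa> T x = \<kappa> T y"
    and A: "pm.lin A" "x \<in> X \<Longrightarrow> A (single x 1) = single (a x) 1"
begin

lemma lookup_act:
  assumes v: "keys v \<subseteq> X"
  shows "lookup (A v) y = (if y \<in> X then lookup v (a' y) else 0)"
proof -
  have "A v = (\<Sum>x\<in>X. pm_scale (lookup v x) (single (a x) 1))"
    by (subst expand_single[OF v]) (simp add: pm.lin_sum[OF A(1)] pm.lin_scale[OF A(1)] A(2))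
  then have "lookup (A v) y = (\<Sum>x\<in>X. if a x = y then lookup v x else 0)"
    by (simp add: lookup_sum lookup_single when_def if_distrib cong: if_cong)
  also have "\<dots> = (if y \<in> X then lookup v (a' y) else 0)"
  proof (cases "y \<in> X")
    case True
    have "(\<Sum>x\<in>X. if a x = y then lookup v x else 0) = (\<Sum>x\<in>X. if x = a' y then lookup v (a' y) else 0)"
      using inv True aX by (intro sum.cong refl) auto
    then show ?thesis using True aX finX by simp
  qed (use aX in \<open>auto intro!: sum.neutral\<close>)
  finally show ?thesis .
qed

lemma act_fibre:
  assumes "x \<in> X" "T \<subseteq> M"
  shows "A (fibre T x) = fibre T (a x)"
proof (rule poly_mapping_eqI)
  fix y
  have k: "keys (fibre T x :: _ \<Rightarrow>\<^sub>0 'k) \<subseteq> X" by (auto simp: in_keys_iff lookup_fibre split: if_splits)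
  have "\<kappa> T (a' y) = \<kappa> T x \<longleftrightarrow> \<kappa> T y = \<kappa> T (a x)" if "y \<in> X"
    using act[OF assms(2), of "a' y" x] aX inv that assms(1) by simp
  then show "lookup (A (fibre T x)) y = lookup (fibre T (a x)) y"
    unfolding lookup_act[OF k] using aX by (auto simp: lookup_fibre)
qed

lemma act_base_in_span:
  assumes T: "T \<subseteq> M" and x: "x \<in> sorted_set T"
  shows "A (base x) \<in> pm.span (base ` sorted_set T)"
proof -
  have "A ` pm.span (fibre T ` sorted_set T) \<subseteq> pm.span (fibre T ` sorted_set T)"
  proof (rule pm.lin_span_subset[OF A(1)], safe)
    fix z assume "z \<in> sorted_set T"
    then have z: "z \<in> X" using sorted_subset by blast
    show "A (fibre T z) \<in> pm.span (fibre T ` sorted_set T)"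
      unfolding act_fibre[OF z T] by (rule fibre_in_span[OF aX(1)[OF z] T])
  qed
  then show ?thesis using base_in_span[OF T x] span_base_sorted[OF T] by auto
qed

text \<open>The left side is the trace of the action on the functions constant on classes of \<open>T\<close>, computed in
the basis \<open>base\<close>; in the basis of indicators of classes it is the number of fixed classes, each
counted through its sorted representative.\<close>

lemma sum_coord_act:
  assumes T: "T \<subseteq> M"
  shows "(\<Sum>x\<in>sorted_set T. coord (A (base x)) x) = of_nat (card {x \<in> sorted_set T. \<kappa> T (a x) = \<kappa> T x})"
proof -
  have inj: "inj_on (base :: _ \<Rightarrow> _ \<Rightarrow>\<^sub>0 'k) (sorted_set T)" by (rule inj_on_subset[OF inj_on_base sorted_subset])
  have "(\<Sum>x\<in>sorted_set T. coord (A (base x)) x) = pm.tr (base ` sorted_set T) A"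
    unfolding pm.tr_def sum.reindex[OF inj] o_def
    by (intro sum.cong refl fun_cong[OF pm.representation_extend[OF base_independent]] act_base_in_span[OF T])
       (use sorted_subset in auto)
  also have "\<dots> = pm.tr (fibre T ` sorted_set T) A"
  proof (rule pm.tr_basis_independent)
    have "A ` base ` sorted_set T \<subseteq> pm.span (base ` sorted_set T)" using act_base_in_span[OF T] by blast
    then show "A ` pm.span (base ` sorted_set T) \<subseteq> pm.span (base ` sorted_set T)" by (rule pm.lin_span_subset[OF A(1)])
  qed (simp_all add: base_sorted_independent fibre_independent[OF T] span_base_sorted[OF T] A(1))
  also have "\<dots> = (\<Sum>x\<in>sorted_set T. if \<kappa> T (a x) = \<kappa> T x then 1 else 0)"
    unfolding pm.tr_def sum.reindex[OF inj_on_fibre[OF T]] o_def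
  proof (rule sum.cong[OF refl])
    fix x assume x: "x \<in> sorted_set T"
    then have xX: "x \<in> X" using sorted_subset by blast
    obtain z where z: "z \<in> sorted_set T" "\<kappa> T z = \<kappa> T (a x)" using rep_exists[OF aX(1)[OF xX] T] by blast
    have zX: "z \<in> X" using z sorted_subset by blast
    have "A (fibre T x) = fibre T z" using act_fibre[OF xX T] fibre_cong[OF z(2)] by simp
    then have "pm.representation (fibre T ` sorted_set T) (A (fibre T x)) (fibre T x) = (if (fibre T x :: _ \<Rightarrow>\<^sub>0 'k) = fibre T z then 1 else 0)"
      using pm.representation_basis[OF fibre_independent[OF T], of "fibre T z"] z(1) by simp
    then show "pm.representation (fibre T ` sorted_set T) (A (fibre T x)) (fibre T x) = (if \<kappa> T (a x) = \<kappa> T x then 1 else 0)"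
      unfolding fibre_eq_iff[OF xX zX] z(2) by (simp add: eq_commute)
  qed
  also have "\<dots> = of_nat (card {x \<in> sorted_set T. \<kappa> T (a x) = \<kappa> T x})" by (simp add: sum.If_cases Int_def)
  finally show ?thesis .
qed

lemma sum_coord_top:
  "(\<Sum>x\<in>top_set. coord (A (base x)) x) =
    (\<Sum>T\<in>Pow M. (- 1) ^ card (M - T) * of_nat (card {x \<in> sorted_set T. \<kappa> T (a x) = \<kappa> T x}))"
  using moebius_top[OF finX finM DM, where f = "\<lambda>x. coord (A (base x)) x"] sum_coord_act by (simp add: sorted_set_def)

lemma act_kernel:
  assumes v: "v \<in> kernel"
  shows "A v \<in> kernel"
proof -
  have k: "keys v \<subseteq> X" using v by (simp add: kernel_def)
  have "(\<Sum>y | y \<in> X \<and> \<kappa> (M - {m}) y = \<kappa> (M - {m}) x. lookup (A v) y) = 0" if m: "m \<in> M" and x: "x \<in> X" for m x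
  proof -
    have "(\<Sum>y | y \<in> X \<and> \<kappa> (M - {m}) y = \<kappa> (M - {m}) x. lookup (A v) y) =
      (\<Sum>y | y \<in> X \<and> \<kappa> (M - {m}) y = \<kappa> (M - {m}) (a' x). lookup v y)"
    proof (rule sum.reindex_bij_witness[of _ a a'])
      fix y assume y: "y \<in> {y \<in> X. \<kappa> (M - {m}) y = \<kappa> (M - {m}) x}"
      then show "a (a' y) = y" using inv by simp
      show "a' y \<in> {y \<in> X. \<kappa> (M - {m}) y = \<kappa> (M - {m}) (a' x)}"
        using y act[of "M - {m}" "a' y" "a' x"] aX inv x by auto
      show "lookup v (a' y) = lookup (A v) y" using y lookup_act[OF k] by simp
    next
      fix y assume y: "y \<in> {y \<in> X. \<kappa> (M - {m}) y = \<kappa> (M - {m}) (a' x)}"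
      then show "a' (a y) = y" using inv by simp
      show "a y \<in> {y \<in> X. \<kappa> (M - {m}) y = \<kappa> (M - {m}) x}"
        using y act[of "M - {m}" y "a' x"] aX inv x by auto
    qed
    also have "\<dots> = 0" using v m aX(2)[OF x] by (simp add: kernel_def)
    finally show ?thesis .
  qed
  moreover have "keys (A v) \<subseteq> X" by (auto simp: in_keys_iff lookup_act[OF k] split: if_splits)
  ultimately show ?thesis by (simp add: kernel_def)
qed

lemma trace_kernel_coord:
  assumes A': "\<And>v. keys v \<subseteq> X \<Longrightarrow> keys (A' v) \<subseteq> X"
    "\<And>v y. keys v \<subseteq> X \<Longrightarrow> y \<in> X \<Longrightarrow> lookup (A' v) y = lookup v (a y)"
  shows "pm.tr (dual ` top_set) A = (\<Sum>x\<in>top_set. coord (A' (base x)) x)"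
proof -
  have inj: "inj_on (dual :: _ \<Rightarrow> _ \<Rightarrow>\<^sub>0 'k) top_set" by (rule inj_on_subset[OF inj_on_dual]) auto
  show ?thesis unfolding pm.tr_def sum.reindex[OF inj] o_def
  proof (rule sum.cong[OF refl])
    fix x assume x: "x \<in> top_set"
    have "A (dual x) = (\<Sum>z\<in>top_set. pm_scale (pairing (A (dual x)) (base z)) (dual z))"
      by (rule kernel_expand[OF act_kernel[OF dual_in_kernel[OF x]]])
    then have "pm.representation (dual ` top_set) (A (dual x)) (dual x) =
      (\<Sum>z\<in>top_set. pairing (A (dual x)) (base z) * pm.representation (dual ` top_set) (dual z) (dual x))"
      by (smt (verit) pm.representation_sum[OF dual_independent] pm.representation_scale[OF dual_independent] imageI pm.span_base pm.span_scale sum.cong)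
    also have "\<dots> = (\<Sum>z\<in>top_set. if z = x then pairing (A (dual x)) (base x) else 0)"
      using x inj by (intro sum.cong refl) (auto simp: pm.representation_basis[OF dual_independent] inj_on_def)
    also have "\<dots> = pairing (A (dual x)) (base x)" using x finX by simp
    also have "\<dots> = (\<Sum>y\<in>X. lookup (dual x) (a' y) * lookup (base x) y)"
      unfolding pairing_def by (intro sum.cong refl) (simp add: lookup_act[OF keys_dual])
    also have "\<dots> = (\<Sum>y\<in>X. lookup (dual x) y * lookup (A' (base x)) y)"
      by (rule sum.reindex_bij_witness[of _ a a']) (auto simp: inv aX A'(2)[OF keys_base])
    also have "\<dots> = pairing (dual x) (A' (base x))" by (simp add: pairing_def)
    also have "\<dots> = coord (A' (base x)) x" by (rule pairing_dual[OF A'(1)[OF keys_base]])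
    finally show "pm.representation (dual ` top_set) (A (dual x)) (dual x) = coord (A' (base x)) x" .
  qed
qed

text \<open>The kernel has the basis dual to the \<open>base x\<close> with \<open>D x = M\<close>, so the trace is a sum of diagonal
coordinates of the inverse action over those \<open>x\<close>. Moebius inversion replaces them by the \<open>x\<close>
with \<open>D x \<subseteq> T\<close>, where \<open>sum_coord_act\<close> counts fixed classes; \<open>a\<close> and \<open>a'\<close> fix the same ones.\<close>

theorem kernel_trace:
  fixes A' :: "('x \<Rightarrow>\<^sub>0 'k) \<Rightarrow> ('x \<Rightarrow>\<^sub>0 'k)"
  assumes A': "pm.lin A'" "\<And>x. x \<in> X \<Longrightarrow> A' (single x 1) = single (a' x) 1"
  shows "pm.tr (dual ` top_set) A =
    (\<Sum>T\<in>Pow M. (- 1) ^ card (M - T) * of_nat (card {x \<in> X. D x \<subseteq> T \<and> \<kappa> T (a x) = \<kappa> T x}))"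
proof -
  have act': "\<kappa> T (a' x) = \<kappa> T (a' y) \<longleftrightarrow> \<kappa> T x = \<kappa> T y" if "T \<subseteq> M" "x \<in> X" "y \<in> X" for T x y
    using act[OF that(1), of "a' x" "a' y"] aX inv that by simp
  interpret i: fibre_action X M D \<kappa> less K a' a A'
    by (intro fibre_action.intro sorted_fibres_axioms fibre_action_axioms.intro aX inv act' A')
  have "pm.tr (dual ` top_set) A = (\<Sum>x\<in>top_set. coord (A' (base x)) x)"
  proof (rule trace_kernel_coord)
    fix v :: "'x \<Rightarrow>\<^sub>0 'k" assume v: "keys v \<subseteq> X"
    show "keys (A' v) \<subseteq> X" by (auto simp: in_keys_iff i.lookup_act[OF v] split: if_splits)
    show "lookup (A' v) y = lookup v (a y)" if "y \<in> X" for y using i.lookup_act[OF v] that by simp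
  qed
  also have "\<dots> = (\<Sum>T\<in>Pow M. (- 1) ^ card (M - T) * of_nat (card {x \<in> sorted_set T. \<kappa> T (a' x) = \<kappa> T x}))"
    by (rule i.sum_coord_top)
  also have "\<dots> = (\<Sum>T\<in>Pow M. (- 1) ^ card (M - T) * of_nat (card {x \<in> X. D x \<subseteq> T \<and> \<kappa> T (a x) = \<kappa> T x}))"
  proof (intro sum.cong refl arg_cong2[where f = times] arg_cong[where f = of_nat] arg_cong[where f = card])
    fix T assume T: "T \<in> Pow M"
    have "\<kappa> T (a' x) = \<kappa> T x \<longleftrightarrow> \<kappa> T (a x) = \<kappa> T x" if "x \<in> X" for x
      using act[of T "a' x" x] aX inv that T by auto
    then show "{x \<in> sorted_set T. \<kappa> T (a' x) = \<kappa> T x} = {x \<in> X. D x \<subseteq> T \<and> \<kappa> T (a x) = \<kappa> T x}"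
      by (auto simp: sorted_set_def)
  qed
  finally show ?thesis .
qed

end

section \<open>Coarsening of words\<close>

text \<open>The index of the coarse block that contains block \<open>i\<close> when only the separations in \<open>T\<close> are kept;
the separation \<open>m\<close> lies between the blocks \<open>m\<close> and \<open>m + 1\<close>.\<close>

definition block_of :: "nat set \<Rightarrow> nat \<Rightarrow> nat" where
  "block_of T i = card {m \<in> T. m < i}"

lemma block_of_mono: "finite T \<Longrightarrow> i \<le> j \<Longrightarrow> block_of T i \<le> block_of T j"
  unfolding block_of_def by (rule card_mono) auto

lemma block_of_eq_iff:
  assumes "finite T" "i \<le> j"
  shows "block_of T i = block_of T j \<longleftrightarrow> (\<forall>m\<in>T. \<not> (i \<le> m \<and> m < j))"
proof
  assume eq: "block_of T i = block_of T j"
  have "{m \<in> T. m < i} = {m \<in> T. m < j}"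
  proof (rule card_subset_eq)
    show "finite {m \<in> T. m < j}" using assms(1) by simp
    show "{m \<in> T. m < i} \<subseteq> {m \<in> T. m < j}" using assms(2) by (auto intro: less_le_trans)
    show "card {m \<in> T. m < i} = card {m \<in> T. m < j}" using eq by (simp only: block_of_def)
  qed
  then show "\<forall>m\<in>T. \<not> (i \<le> m \<and> m < j)" by (auto simp: set_eq_iff not_le)
next
  assume h: "\<forall>m\<in>T. \<not> (i \<le> m \<and> m < j)"
  have "{m \<in> T. m < i} = {m \<in> T. m < j}" using h assms(2) by force
  then show "block_of T i = block_of T j" by (simp add: block_of_def)
qed

lemma block_of_refine:
  assumes "finite T'" "T \<subseteq> T'" "block_of T' i = block_of T' j"
  shows "block_of T i = block_of T j"
proof -
  have fin: "finite T" using assms finite_subset by blast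
  show ?thesis
  proof (cases "i \<le> j")
    case True
    then show ?thesis using block_of_eq_iff[OF assms(1), of i j] block_of_eq_iff[OF fin, of i j] assms by blast
  next
    case False
    then show ?thesis using block_of_eq_iff[OF assms(1), of j i] block_of_eq_iff[OF fin, of j i] assms
      by (metis nat_le_linear subsetD)
  qed
qed

lemma block_of_Suc: "finite T \<Longrightarrow> block_of T (Suc m) = block_of T m + (if m \<in> T then 1 else 0)"
proof -
  assume "finite T"
  moreover have "{k \<in> T. k < Suc m} = (if m \<in> T then insert m {k \<in> T. k < m} else {k \<in> T. k < m})"
    by (auto simp: less_Suc_eq)
  ultimately show ?thesis by (simp add: block_of_def)
qed

lemma block_of_image: "finite T \<Longrightarrow> block_of T ` T = {..<card T}"
proof (rule card_subset_eq)
  assume T: "finite T"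
  show "block_of T ` T \<subseteq> {..<card T}"
    unfolding block_of_def using T by (auto intro!: psubset_card_mono)
  have "inj_on (block_of T) T"
  proof (rule inj_onI, rule ccontr)
    fix i j assume ij: "i \<in> T" "j \<in> T" "block_of T i = block_of T j" "i \<noteq> j"
    then show False using block_of_eq_iff[OF T, of i j] block_of_eq_iff[OF T, of j i] by (cases "i < j") auto
  qed
  then show "card (block_of T ` T) = card {..<card T}" by (simp add: card_image)
qed simp

definition merge_blocks :: "nat set \<Rightarrow> nat list \<Rightarrow> nat list" where
  "merge_blocks T \<beta> = map (\<lambda>v. \<Sum>i | i < length \<beta> \<and> block_of T i = v. \<beta> ! i) [0..<card T + 1]"

definition partial_sum :: "nat list \<Rightarrow> nat \<Rightarrow> nat" where
  "partial_sum \<beta> m = (\<Sum>i\<le>m. \<beta> ! i)"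

lemma cuts_partial_sum: "cuts \<beta> = partial_sum \<beta> ` {..<length \<beta> - 1}"
proof -
  have "sum_list (take (Suc m) \<beta>) = partial_sum \<beta> m" if "m < length \<beta> - 1" for m
    using that by (simp add: partial_sum_def sum_list_sum_nth atLeast0LessThan lessThan_Suc_atMost)
  moreover have "{1..<length \<beta>} = Suc ` {..<length \<beta> - 1}"
    by (cases "length \<beta>") (auto simp: atLeast0LessThan[symmetric] image_Suc_atLeastLessThan)
  ultimately show ?thesis unfolding cuts_def by (simp add: image_image)
qed

context
  fixes n :: nat and \<beta> :: "nat list"
  assumes comp: "composition n \<beta>" and n: "0 < n"
begin

lemma blocks_nonempty: "\<beta> \<noteq> []" using comp n by auto

lemma entry_pos: "i < length \<beta> \<Longrightarrow> 0 < \<beta> ! i"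
  using comp by (auto simp: composition_def)

lemma length_merge: "length (merge_blocks T \<beta>) = card T + 1"
  by (simp add: merge_blocks_def)

lemma merge_nth: "v < card T + 1 \<Longrightarrow> merge_blocks T \<beta> ! v = (\<Sum>i | i < length \<beta> \<and> block_of T i = v. \<beta> ! i)"
  unfolding merge_blocks_def by (subst nth_map) (auto simp del: upt_Suc)

lemma block_of_le: "finite T \<Longrightarrow> block_of T i \<le> card T"
  unfolding block_of_def by (rule card_mono) auto

lemma merge_composition:
  assumes T: "T \<subseteq> {..<length \<beta> - 1}"
  shows "composition n (merge_blocks T \<beta>)"
proof -
  have fin: "finite T" using T finite_subset by blast
  have "0 < merge_blocks T \<beta> ! v" if v: "v < card T + 1" for v
  proof -
    have "\<exists>i<length \<beta>. block_of T i = v"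
    proof (cases "v < card T")
      case True
      then obtain m where "m \<in> T" "block_of T m = v" using block_of_image[OF fin] by (metis imageE lessThan_iff)
      moreover have "m < length \<beta>" using T \<open>m \<in> T\<close> by fastforce
      ultimately show ?thesis by blast
    next
      case False
      have "{m \<in> T. m < length \<beta> - 1} = T" using T by auto
      then have "block_of T (length \<beta> - 1) = v" using False v by (simp add: block_of_def)
      then show ?thesis using blocks_nonempty by (intro exI[of _ "length \<beta> - 1"]) auto
    qed
    then obtain i where i: "i < length \<beta>" "block_of T i = v" by blast
    have "\<beta> ! i \<le> (\<Sum>i | i < length \<beta> \<and> block_of T i = v. \<beta> ! i)"
      using i by (intro member_le_sum) auto
    then show ?thesis using merge_nth[OF v] entry_pos[OF i(1)] by simp
  qed
  moreover have "sum_list (merge_blocks T \<beta>) = n"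
  proof -
    have "sum_list (merge_blocks T \<beta>) = (\<Sum>v\<in>{..<card T + 1}. \<Sum>i | i \<in> {..<length \<beta>} \<and> block_of T i = v. \<beta> ! i)"
      unfolding sum_list_sum_nth length_merge atLeast0LessThan by (intro sum.cong refl) (simp add: merge_nth)
    also have "\<dots> = (\<Sum>i\<in>{..<length \<beta>}. \<beta> ! i)"
      using block_of_le[OF fin] by (intro sum.group) (auto simp: less_Suc_eq_le)
    also have "\<dots> = n" using comp by (simp add: composition_def sum_list_sum_nth atLeast0LessThan)
    finally show ?thesis .
  qed
  ultimately show ?thesis unfolding composition_def by (auto simp: in_set_conv_nth length_merge)
qed

lemma cuts_merge:
  assumes T: "T \<subseteq> {..<length \<beta> - 1}"
  shows "cuts (merge_blocks T \<beta>) = partial_sum \<beta> ` T"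
proof -
  have fin: "finite T" using T finite_subset by blast
  have "partial_sum (merge_blocks T \<beta>) (block_of T m) = partial_sum \<beta> m" if m: "m \<in> T" for m
  proof -
    have bm: "block_of T m < card T" using m block_of_image[OF fin] by blast
    have iff: "i \<le> m \<longleftrightarrow> block_of T i \<le> block_of T m" for i
      using block_of_mono[OF fin, of i m] block_of_mono[OF fin, of "Suc m" i] block_of_Suc[OF fin, of m] m
      by (cases "i \<le> m") auto
    have "m < length \<beta>" using T m by fastforce
    then have set: "{i \<in> {..<length \<beta>}. block_of T i \<le> block_of T m} = {..m}" unfolding iff[symmetric] by auto
    have "partial_sum (merge_blocks T \<beta>) (block_of T m) =
      (\<Sum>v\<in>{..block_of T m}. \<Sum>i | i \<in> {i \<in> {..<length \<beta>}. block_of T i \<le> block_of T m} \<and> block_of T i = v. \<beta> ! i)"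
      unfolding partial_sum_def
    proof (rule sum.cong[OF refl])
      fix v assume v: "v \<in> {..block_of T m}"
      then have eq: "{i. i < length \<beta> \<and> block_of T i = v} = {i. i \<in> {i \<in> {..<length \<beta>}. block_of T i \<le> block_of T m} \<and> block_of T i = v}" by auto
      show "merge_blocks T \<beta> ! v = (\<Sum>i | i \<in> {i \<in> {..<length \<beta>}. block_of T i \<le> block_of T m} \<and> block_of T i = v. \<beta> ! i)"
        unfolding eq[symmetric] using bm v by (intro merge_nth) auto
    qed
    also have "\<dots> = (\<Sum>i\<in>{i \<in> {..<length \<beta>}. block_of T i \<le> block_of T m}. \<beta> ! i)"
      by (rule sum.group) auto
    also have "\<dots> = partial_sum \<beta> m" unfolding set partial_sum_def ..
    finally show ?thesis .
  qed
  moreover have "{..<length (merge_blocks T \<beta>) - 1} = block_of T ` T"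
    using block_of_image[OF fin] by (simp add: length_merge)
  ultimately show ?thesis unfolding cuts_partial_sum[of "merge_blocks T \<beta>"] by (simp add: image_image)
qed

lemma partial_sum_inj: "inj_on (partial_sum \<beta>) {..<length \<beta> - 1}"
proof (rule eq_card_imp_inj_on)
  show "card (partial_sum \<beta> ` {..<length \<beta> - 1}) = card {..<length \<beta> - 1}"
    using card_cuts[OF comp] unfolding cuts_partial_sum by simp
qed simp

text \<open>The compositions coarser than \<open>\<beta>\<close> are its coarsenings along the subsets \<open>T\<close> of its separations.\<close>

lemma ribbon_merge_sum:
  "ribbon \<beta> = (\<Sum>T\<in>Pow {..<length \<beta> - 1}. (- 1) ^ card ({..<length \<beta> - 1} - T) * (prod_list (map hsym (merge_blocks T \<beta>)) :: 'a::comm_ring_1 mps))"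
proof -
  let ?M = "{..<length \<beta> - 1}"
  have sum: "sum_list \<beta> = n" using comp by (simp add: composition_def)
  have bij: "bij_betw (\<lambda>T. merge_blocks T \<beta>) (Pow ?M) {\<gamma>. coarser \<gamma> \<beta>}"
    unfolding bij_betw_def
  proof
    show "inj_on (\<lambda>T. merge_blocks T \<beta>) (Pow ?M)"
    proof (rule inj_onI)
      fix S T assume "S \<in> Pow ?M" "T \<in> Pow ?M" "merge_blocks S \<beta> = merge_blocks T \<beta>"
      then have "partial_sum \<beta> ` S = partial_sum \<beta> ` T" "S \<subseteq> ?M" "T \<subseteq> ?M" using cuts_merge[of S] cuts_merge[of T] by simp_all
      then show "S = T" using inj_on_image_eq_iff[OF partial_sum_inj] by blast
    qed
    show "(\<lambda>T. merge_blocks T \<beta>) ` Pow ?M = {\<gamma>. coarser \<gamma> \<beta>}"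
    proof (intro equalityI subsetI)
      fix \<gamma> assume "\<gamma> \<in> (\<lambda>T. merge_blocks T \<beta>) ` Pow ?M"
      then obtain T where T: "T \<subseteq> ?M" "\<gamma> = merge_blocks T \<beta>" by blast
      then show "\<gamma> \<in> {\<gamma>. coarser \<gamma> \<beta>}"
        unfolding coarser_def sum using merge_composition[OF T(1)] cuts_merge[OF T(1)] cuts_partial_sum[of \<beta>] by auto
    next
      fix \<gamma> assume "\<gamma> \<in> {\<gamma>. coarser \<gamma> \<beta>}"
      then have g: "composition n \<gamma>" "cuts \<gamma> \<subseteq> partial_sum \<beta> ` ?M" unfolding coarser_def sum cuts_partial_sum[of \<beta>] by auto
      define T where "T = {m \<in> ?M. partial_sum \<beta> m \<in> cuts \<gamma>}"
      have T: "T \<subseteq> ?M" by (auto simp: T_def)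
      have "partial_sum \<beta> ` T = cuts \<gamma>" using g(2) by (auto simp: T_def)
      then have "merge_blocks T \<beta> = \<gamma>" using cuts_inject[OF merge_composition[OF T] g(1)] cuts_merge[OF T] by simp
      then show "\<gamma> \<in> (\<lambda>T. merge_blocks T \<beta>) ` Pow ?M" using T by blast
    qed
  qed
  have "ribbon \<beta> = (\<Sum>T\<in>Pow ?M. (- 1) ^ (length \<beta> - length (merge_blocks T \<beta>)) * (prod_list (map hsym (merge_blocks T \<beta>)) :: 'a mps))"
    unfolding ribbon_def by (rule sum.reindex_bij_betw[OF bij, symmetric])
  also have "\<dots> = (\<Sum>T\<in>Pow ?M. (- 1) ^ card (?M - T) * prod_list (map hsym (merge_blocks T \<beta>)))"
  proof (intro sum.cong refl)
    fix T assume T: "T \<in> Pow ?M"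
    then have "length \<beta> - length (merge_blocks T \<beta>) = card (?M - T)"
      using card_Diff_subset[of T ?M] finite_subset[of T ?M] by (simp add: length_merge)
    then show "(- 1) ^ (length \<beta> - length (merge_blocks T \<beta>)) * (prod_list (map hsym (merge_blocks T \<beta>)) :: 'a mps) =
      (- 1) ^ card (?M - T) * prod_list (map hsym (merge_blocks T \<beta>))" by simp
  qed
  finally show ?thesis .
qed

end

definition coarsen :: "nat \<Rightarrow> nat set \<Rightarrow> (nat \<Rightarrow> nat) \<Rightarrow> nat \<Rightarrow> nat" where
  "coarsen n T u = restrict (\<lambda>e. block_of T (u e)) {1..n}"

text \<open>The separations \<open>m\<close> at which merging blocks \<open>m\<close> and \<open>m + 1\<close> and cutting the union again, with
all smaller elements in block \<open>m\<close>, would change the word.\<close>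

definition descents :: "nat \<Rightarrow> (nat \<Rightarrow> nat) \<Rightarrow> nat set" where
  "descents n u = {m. \<exists>e e'. e \<in> {1..n} \<and> e' \<in> {1..n} \<and> u e = m \<and> u e' = Suc m \<and> e' < e}"

definition lex_less :: "nat \<Rightarrow> (nat \<Rightarrow> nat) \<Rightarrow> (nat \<Rightarrow> nat) \<Rightarrow> bool" where
  "lex_less n u w \<longleftrightarrow> (\<exists>i\<in>{1..n}. u i < w i \<and> (\<forall>j\<in>{1..n}. j < i \<longrightarrow> u j = w j))"

lemma lex_less_irrefl: "\<not> lex_less n u u" by (auto simp: lex_less_def)

lemma lex_less_trans: "lex_less n u v \<Longrightarrow> lex_less n v w \<Longrightarrow> lex_less n u w"
proof -
  assume "lex_less n u v" "lex_less n v w"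
  then obtain i j where i: "i \<in> {1..n}" "u i < v i" "\<And>k. k \<in> {1..n} \<Longrightarrow> k < i \<Longrightarrow> u k = v k"
    and j: "j \<in> {1..n}" "v j < w j" "\<And>k. k \<in> {1..n} \<Longrightarrow> k < j \<Longrightarrow> v k = w k" unfolding lex_less_def by metis
  have "u (min i j) < w (min i j)"
  proof (cases i j rule: linorder_cases)
    case less then show ?thesis using i j(3)[of i] by (simp add: min_def)
  next
    case equal then show ?thesis using i j by simp
  next
    case greater then show ?thesis using j i(3)[of j] by (simp add: min_def)
  qed
  moreover have "min i j \<in> {1..n}" using i j by (simp add: min_def)
  moreover have "u k = w k" if "k \<in> {1..n}" "k < min i j" for k using i(3) j(3) that by simp
  ultimately show ?thesis unfolding lex_less_def by blast
qed

lemma block_wordsD: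
  assumes "u \<in> block_words n \<beta>"
  shows "u \<in> extensional {1..n}" "e \<in> {1..n} \<Longrightarrow> u e < length \<beta>" "v < length \<beta> \<Longrightarrow> card {i \<in> {1..n}. u i = v} = \<beta> ! v"
  using assms unfolding block_words_def by blast+

lemma block_words_comp: "u \<in> block_words n \<beta> \<Longrightarrow> p \<in> perms n \<Longrightarrow> u \<circ> p \<in> block_words n \<beta>"
proof -
  assume u: "u \<in> block_words n \<beta>" and p: "p \<in> perms n"
  have "u (p e) < length \<beta>" if "e \<in> {1..n}" for e
    using block_wordsD(2)[OF u, of "p e"] permutes_in_image[of p "{1..n}" e] p that by blast
  moreover have "card {i \<in> {1..n}. (u \<circ> p) i = v} = \<beta> ! v" if "v < length \<beta>" for v
    using card_comp_perm[OF p, of "\<lambda>y. y = v" u] block_wordsD(3)[OF u that] by simp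
  ultimately show ?thesis unfolding block_words_def using ext_comp_perm[OF p block_wordsD(1)[OF u]] by auto
qed

lemma descents_subset:
  assumes "u \<in> block_words n \<beta>"
  shows "descents n u \<subseteq> {..<length \<beta> - 1}"
proof
  fix m assume "m \<in> descents n u"
  then obtain e' where "e' \<in> {1..n}" "u e' = Suc m" unfolding descents_def by blast
  then show "m \<in> {..<length \<beta> - 1}" using block_wordsD(2)[OF assms, of e'] by simp
qed

text \<open>Consecutive blocks in between are nonempty, so increasing chains can be run through them.\<close>

lemma no_descent_sorted:
  assumes u: "u \<in> block_words n \<beta>" and pos: "\<And>i. i < length \<beta> \<Longrightarrow> 0 < \<beta> ! i"
    and ij: "i \<in> {1..n}" "j \<in> {1..n}" "u i < u j" "block_of (descents n u) (u i) = block_of (descents n u) (u j)"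
  shows "i < j"
proof -
  have fin: "finite (descents n u)" using descents_subset[OF u] finite_subset by blast
  have nod: "m \<notin> descents n u" if "u i \<le> m" "m < u j" for m
    using ij(3,4) block_of_eq_iff[OF fin, of "u i" "u j"] that by auto
  have "\<forall>j\<in>{1..n}. u j = u i + k \<longrightarrow> i < j" if "0 < k" "u i + k \<le> u j" for k
    using that
  proof (induction k)
    case (Suc k)
    show ?case
    proof (intro ballI impI)
      fix j' assume j': "j' \<in> {1..n}" "u j' = u i + Suc k"
      have nd: "u i + k \<notin> descents n u" using nod Suc.prems by simp
      show "i < j'"
      proof (cases "k = 0")
        case True
        then have "\<not> j' < i" using nd ij(1) j' unfolding descents_def by auto
        moreover have "j' \<noteq> i" using j' by (intro notI) simp
        ultimately show ?thesis by simp
      next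
        case False
        have lt: "u i + k < length \<beta>" using Suc.prems block_wordsD(2)[OF u ij(2)] by simp
        have "0 < card {e \<in> {1..n}. u e = u i + k}" using block_wordsD(3)[OF u lt] pos[OF lt] by simp
        then obtain e where e: "e \<in> {1..n}" "u e = u i + k" by (auto simp: card_gt_0_iff)
        have "i < e" using Suc.IH False Suc.prems e by simp
        moreover have "\<not> j' < e" using nd e j' unfolding descents_def by auto
        ultimately show ?thesis by simp
      qed
    qed
  qed simp
  from this[of "u j - u i"] show ?thesis using ij by simp
qed

lemma coarsen_eq_iff: "coarsen n T u = coarsen n T w \<longleftrightarrow> (\<forall>e\<in>{1..n}. block_of T (u e) = block_of T (w e))"
proof
  assume eq: "coarsen n T u = coarsen n T w"
  show "\<forall>e\<in>{1..n}. block_of T (u e) = block_of T (w e)"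
  proof
    fix e assume "e \<in> {1..n}"
    then show "block_of T (u e) = block_of T (w e)" using fun_cong[OF eq, of e] by (simp only: coarsen_def restrict_apply if_True)
  qed
next
  assume h: "\<forall>e\<in>{1..n}. block_of T (u e) = block_of T (w e)"
  show "coarsen n T u = coarsen n T w" unfolding coarsen_def by (rule restrict_ext) (use h in blast)
qed

text \<open>At the first position where the words differ, a smaller letter of \<open>w\<close> would have to occur later in
\<open>u\<close>, against the sorting of \<open>u\<close> inside its coarse blocks.\<close>

lemma lex_less_fibre:
  assumes u: "u \<in> block_words n \<beta>" and w: "w \<in> block_words n \<beta>" and pos: "\<And>i. i < length \<beta> \<Longrightarrow> 0 < \<beta> ! i"
    and eq: "coarsen n (descents n u) u = coarsen n (descents n u) w" and ne: "u \<noteq> w"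
  shows "lex_less n u w"
proof -
  have "\<exists>i. i \<in> {1..n} \<and> u i \<noteq> w i"
  proof (rule ccontr)
    assume "\<not> ?thesis"
    then have "u = w" using block_wordsD(1)[OF u] block_wordsD(1)[OF w] by (intro extensionalityI) auto
    then show False using ne by simp
  qed
  then obtain i where i: "i \<in> {1..n} \<and> u i \<noteq> w i" "\<And>j. j < i \<Longrightarrow> \<not> (j \<in> {1..n} \<and> u j \<noteq> w j)"
    using exists_least_iff[of "\<lambda>i. i \<in> {1..n} \<and> u i \<noteq> w i"] by blast
  have "\<not> w i < u i"
  proof
    assume lt: "w i < u i"
    let ?v = "w i"
    have v: "?v < length \<beta>" using block_wordsD(2)[OF w] i by blast
    have "\<exists>i'\<in>{1..n}. i < i' \<and> u i' = ?v"
    proof (rule ccontr)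
      assume "\<not> ?thesis"
      then have "{e \<in> {1..n}. u e = ?v} \<subseteq> {e \<in> {1..n}. w e = ?v} - {i}"
        using i lt by (auto simp: not_less) (metis atLeastAtMost_iff le_neq_implies_less One_nat_def)+
      then have "card {e \<in> {1..n}. u e = ?v} \<le> card ({e \<in> {1..n}. w e = ?v} - {i})" by (intro card_mono) auto
      also have "\<dots> < card {e \<in> {1..n}. w e = ?v}" using i by (intro card_Diff1_less) auto
      finally show False using block_wordsD(3)[OF u v] block_wordsD(3)[OF w v] by simp
    qed
    then obtain i' where i': "i' \<in> {1..n}" "i < i'" "u i' = ?v" by blast
    have "block_of (descents n u) (u i) = block_of (descents n u) ?v" using eq i unfolding coarsen_eq_iff by blast
    then have "i' < i" using no_descent_sorted[OF u pos i'(1), of i] i' i lt by simp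
    then show False using i'(2) by simp
  qed
  then show ?thesis unfolding lex_less_def using i by (intro bexI[of _ i]) auto
qed

lemma finite_block_words [simp]: "finite (block_words n \<beta>)"
proof (rule finite_subset)
  show "block_words n \<beta> \<subseteq> {1..n} \<rightarrow>\<^sub>E {..<length \<beta>}" by (auto simp: block_words_def PiE_def)
  show "finite ({1..n} \<rightarrow>\<^sub>E {..<length \<beta>})" by (intro finite_PiE) auto
qed

text \<open>A lexicographically least word in the class: at a descent outside \<open>T\<close> an exchange of two letters
would give a smaller word in the same class.\<close>

lemma sorted_word_exists:
  assumes u: "u \<in> block_words n \<beta>" and T: "finite T"
  shows "\<exists>w\<in>block_words n \<beta>. descents n w \<subseteq> T \<and> coarsen n T w = coarsen n T u"
proof -
  let ?S = "{w \<in> block_words n \<beta>. coarsen n T w = coarsen n T u}"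
  have S: "finite ?S" "?S \<noteq> {}" using u by auto
  have ord: "asymp_on ?S (lex_less n)" "transp_on ?S (lex_less n)"
    using lex_less_irrefl lex_less_trans by (auto intro!: asymp_onI transp_onI) blast+
  then obtain w where w: "w \<in> ?S" "\<And>x. x \<in> ?S \<Longrightarrow> x \<noteq> w \<Longrightarrow> \<not> lex_less n x w"
    using Finite_Set.bex_min_element[OF S(1) ord S(2)] by blast
  have "descents n w \<subseteq> T"
  proof
    fix m assume "m \<in> descents n w"
    then obtain e e' where e: "e \<in> {1..n}" "e' \<in> {1..n}" "w e = m" "w e' = Suc m" "e' < e"
      unfolding descents_def by blast
    show "m \<in> T"
    proof (rule ccontr)
      assume "m \<notin> T"
      then have bm: "block_of T (Suc m) = block_of T m" using block_of_Suc[OF T, of m] by simp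
      let ?t = "transpose e e'"
      have t: "?t \<in> perms n" using e by (simp add: permutes_swap_id)
      have "w \<circ> ?t \<in> block_words n \<beta>" using block_words_comp[OF _ t] w by blast
      moreover have "coarsen n T (w \<circ> ?t) = coarsen n T w"
        unfolding coarsen_eq_iff using e(3,4) bm by (auto simp: transpose_def)
      ultimately have "w \<circ> ?t \<in> ?S" using w by simp
      moreover have lt: "lex_less n (w \<circ> ?t) w"
        unfolding lex_less_def using e by (intro bexI[of _ e']) (auto simp: transpose_def)
      moreover have "w \<circ> ?t \<noteq> w" using lt lex_less_irrefl[of n w] by (intro notI) simp
      ultimately show False using w(2) by blast
    qed
  qed
  then show ?thesis using w by blast
qed

lemma block_words_nonempty: "composition n \<gamma> \<Longrightarrow> block_words n \<gamma> \<noteq> {}"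
proof
  assume c: "composition n \<gamma>" and e: "block_words n \<gamma> = {}"
  define ms :: "(nat \<Rightarrow>\<^sub>0 nat) list" where "ms = map (single 0) \<gamma>"
  have "mdeg (single 0 g) = g" for g by (cases "g = 0") (auto simp: mdeg_def)
  then have "ms \<in> content_lists \<gamma> (sum_list ms)" by (simp add: content_lists_def ms_def o_def)
  then have "0 < card (content_lists \<gamma> (sum_list ms))" using mcoeff_prod_hsym[where 'a = int, of \<gamma> "sum_list ms"] by (auto simp: card_gt_0_iff)
  then show False using sum_fixed_block_words[OF c, of "sum_list ms"] e by simp
qed

lemma coarsen_comp: "p \<in> perms n \<Longrightarrow> coarsen n T (u \<circ> p) = coarsen n T u \<circ> p"
proof
  fix e assume p: "p \<in> perms n"
  have "p e \<in> {1..n} \<longleftrightarrow> e \<in> {1..n}" using permutes_in_image[of p "{1..n}"] p by blast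
  then show "coarsen n T (u \<circ> p) e = (coarsen n T u \<circ> p) e" by (simp only: coarsen_def comp_apply restrict_apply)
qed

lemma coarsen_block_words:
  assumes c: "composition n \<beta>" "0 < n" and T: "T \<subseteq> {..<length \<beta> - 1}" and u: "u \<in> block_words n \<beta>"
  shows "coarsen n T u \<in> block_words n (merge_blocks T \<beta>)"
proof -
  have fin: "finite T" using T finite_subset by blast
  have "card {e \<in> {1..n}. coarsen n T u e = v} = merge_blocks T \<beta> ! v" if v: "v < card T + 1" for v
  proof -
    have "{e \<in> {1..n}. coarsen n T u e = v} = (\<Union>i\<in>{i. i < length \<beta> \<and> block_of T i = v}. {e \<in> {1..n}. u e = i})"
      using block_wordsD(2)[OF u] by (auto simp: coarsen_def)
    then have "card {e \<in> {1..n}. coarsen n T u e = v} = (\<Sum>i | i < length \<beta> \<and> block_of T i = v. card {e \<in> {1..n}. u e = i})"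
      by (simp only:) (rule card_UN_disjoint; auto)
    also have "\<dots> = (\<Sum>i | i < length \<beta> \<and> block_of T i = v. \<beta> ! i)" using block_wordsD(3)[OF u] by (intro sum.cong) auto
    finally show ?thesis using merge_nth[OF c v] by simp
  qed
  moreover have "coarsen n T u e < card T + 1" if "e \<in> {1..n}" for e
    using block_of_le[OF c fin, of "u e"] that by (simp add: coarsen_def)
  ultimately show ?thesis unfolding block_words_def length_merge[OF c] by (auto simp: coarsen_def)
qed

text \<open>Coarsening maps the words sorted with respect to \<open>T\<close> bijectively onto all words of the coarsened
shape, and it commutes with permutations.\<close>

lemma card_fixed_sorted:
  assumes c: "composition n \<beta>" "0 < n" and T: "T \<subseteq> {..<length \<beta> - 1}" and p: "p \<in> perms n"
  shows "card {u \<in> block_words n \<beta>. descents n u \<subseteq> T \<and> coarsen n T (u \<circ> p) = coarsen n T u} =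
    card {w \<in> block_words n (merge_blocks T \<beta>). w \<circ> p = w}"
proof (rule bij_betw_same_card[of "coarsen n T"], unfold bij_betw_def, intro conjI)
  let ?L = "{u \<in> block_words n \<beta>. descents n u \<subseteq> T \<and> coarsen n T (u \<circ> p) = coarsen n T u}"
  have fin: "finite T" using T finite_subset by blast
  note pos = entry_pos[OF c]
  show "inj_on (coarsen n T) ?L"
  proof (rule inj_onI, rule ccontr)
    fix u w assume uw: "u \<in> ?L" "w \<in> ?L" "coarsen n T u = coarsen n T w" "u \<noteq> w"
    have "coarsen n S u = coarsen n S w" if "S \<subseteq> T" for S
      using uw(3) block_of_refine[OF fin that] unfolding coarsen_eq_iff by blast
    then have "lex_less n u w" "lex_less n w u"
      using lex_less_fibre[of u n \<beta> w] lex_less_fibre[of w n \<beta> u] uw pos by auto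
    then show False using lex_less_trans lex_less_irrefl by blast
  qed
  show "coarsen n T ` ?L = {w \<in> block_words n (merge_blocks T \<beta>). w \<circ> p = w}"
  proof (intro equalityI subsetI)
    fix w assume "w \<in> coarsen n T ` ?L"
    then show "w \<in> {w \<in> block_words n (merge_blocks T \<beta>). w \<circ> p = w}"
      using coarsen_block_words[OF c T] coarsen_comp[OF p, of T] by auto
  next
    fix w assume w: "w \<in> {w \<in> block_words n (merge_blocks T \<beta>). w \<circ> p = w}"
    obtain u0 where u0: "u0 \<in> block_words n \<beta>" using block_words_nonempty[OF c(1)] by blast
    have w0: "coarsen n T u0 \<in> block_words n (merge_blocks T \<beta>)" by (rule coarsen_block_words[OF c T u0])
    have "card {i \<in> {1..n}. coarsen n T u0 i = y} = card {i \<in> {1..n}. w i = y}" for y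
    proof (cases "y < length (merge_blocks T \<beta>)")
      case True
      then show ?thesis using block_wordsD(3)[OF w0 True] block_wordsD(3)[of w n "merge_blocks T \<beta>" y] w by simp
    next
      case False
      then have "{i \<in> {1..n}. coarsen n T u0 i = y} = {}" "{i \<in> {1..n}. w i = y} = {}"
        using block_wordsD(2)[OF w0] block_wordsD(2)[of w n "merge_blocks T \<beta>"] w by blast+
      then show ?thesis by (simp only:)
    qed
    then obtain q where q: "q \<in> perms n" "w = coarsen n T u0 \<circ> q"
      using image_mset_words_permutes[OF block_wordsD(1)[OF w0], of w] block_wordsD(1)[of w n "merge_blocks T \<beta>"] w by blast
    then have "w = coarsen n T (u0 \<circ> q)" using coarsen_comp by metis
    moreover obtain u where u: "u \<in> block_words n \<beta>" "descents n u \<subseteq> T" "coarsen n T u = coarsen n T (u0 \<circ> q)"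
      using sorted_word_exists[OF block_words_comp[OF u0 q(1)] fin] by blast
    ultimately have "coarsen n T u = w" by simp
    moreover from this have "u \<in> ?L" using u w coarsen_comp[OF p, of T u] by simp
    ultimately show "w \<in> coarsen n T ` ?L" by blast
  qed
qed

section \<open>Isomorphism of subquotients\<close>

lemma pm_single_basis:
  fixes d :: nat
  defines "E \<equiv> (\<lambda>i. single i (1::'k::field_char_0)) ` {..<d}"
  shows "finite E" "pm.independent E" "v \<in> pm.span E \<longleftrightarrow> keys v \<subseteq> {..<d}"
    "v \<in> pm.span E \<Longrightarrow> i < d \<Longrightarrow> pm.representation E v (single i 1) = lookup v i"
    "pm.tr E T = (\<Sum>i<d. pm.representation E (T (single i 1)) (single i 1))"
    "v \<in> pm.span E \<Longrightarrow> v = (\<Sum>i<d. pm_scale (lookup v i) (single i 1))"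
proof -
  have ls: "lookup (\<Sum>i\<in>I. f i) z = (\<Sum>i\<in>I. lookup (f i) z)"
    for I and f :: "'i \<Rightarrow> nat \<Rightarrow>\<^sub>0 'k" and z by (induction I rule: infinite_finite_induct) (auto simp: lookup_add)
  have inj: "inj_on (\<lambda>i. single i (1::'k)) {..<d}"
    by (rule inj_onI) (metis lookup_single_eq lookup_single_not_eq zero_neq_one)
  show fin: "finite E" by (simp add: E_def)
  have comb: "lookup (\<Sum>x\<in>E. pm_scale (f x) x) z = (if z < d then f (single z 1) else 0)" for f z
    unfolding ls E_def sum.reindex[OF inj] by (simp add: lookup_single when_def if_distrib cong: if_cong)
  show indep: "pm.independent E"
  proof (rule pm.independent_if_scalars_zero[OF fin])
    fix f x assume h: "(\<Sum>x\<in>E. pm_scale (f x) x) = 0" "x \<in> E"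
    then obtain z where "z < d" "x = single z 1" by (auto simp: E_def)
    then show "f x = 0" using comb[of f z] h(1) by simp
  qed
  have expand: "v = (\<Sum>i<d. pm_scale (lookup v i) (single i 1))" if "keys v \<subseteq> {..<d}" for v :: "nat \<Rightarrow>\<^sub>0 'k"
  proof (rule poly_mapping_eqI)
    fix z
    have "\<not> z < d \<Longrightarrow> lookup v z = 0" using that by (auto simp: in_keys_iff)
    then show "lookup v z = lookup (\<Sum>i<d. pm_scale (lookup v i) (single i 1)) z"
      unfolding ls by (simp add: lookup_single when_def if_distrib cong: if_cong)
  qed
  show span: "v \<in> pm.span E \<longleftrightarrow> keys v \<subseteq> {..<d}" for v
  proof
    assume "keys v \<subseteq> {..<d}"
    then show "v \<in> pm.span E"
      by (subst expand, assumption, intro pm.span_sum pm.span_scale pm.span_base) (simp add: E_def)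
  next
    assume "v \<in> pm.span E"
    then have "v = (\<Sum>x\<in>E. pm_scale (pm.representation E v x) x)"
      using pm.sum_representation_eq[OF indep _ fin order_refl] by simp
    then have "lookup v z = 0" if "\<not> z < d" for z using comb[of "pm.representation E v" z] that by simp
    then show "keys v \<subseteq> {..<d}" by (auto simp: in_keys_iff)
  qed
  show "pm.representation E v (single i 1) = lookup v i" if "v \<in> pm.span E" "i < d"
    using comb[of "pm.representation E v" i] pm.sum_representation_eq[OF indep that(1) fin order_refl] that(2) by simp
  show "pm.tr E T = (\<Sum>i<d. pm.representation E (T (single i 1)) (single i 1))"
    unfolding pm.tr_def by (subst E_def) (simp add: sum.reindex[OF inj])
  show "v \<in> pm.span E \<Longrightarrow> v = (\<Sum>i<d. pm_scale (lookup v i) (single i 1))"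
    using expand span by blast
qed

abbreviation std_basis :: "nat \<Rightarrow> (nat \<Rightarrow>\<^sub>0 'k::field_char_0) set" where
  "std_basis d \<equiv> (\<lambda>i. single i 1) ` {..<d}"

text \<open>Coordinates identify \<open>num V / den V\<close> with a space of finitely supported functions on \<open>nat\<close>, where
the laws of a representation hold exactly. This allows representations on different types to be
compared.\<close>

definition coordinatisation :: "nat \<Rightarrow> ('k::field_char_0, 'v::ab_group_add) subquot \<Rightarrow> nat \<Rightarrow> ('v \<Rightarrow> nat \<Rightarrow>\<^sub>0 'k) \<Rightarrow>
    ((nat \<Rightarrow>\<^sub>0 'k) \<Rightarrow> 'v) \<Rightarrow> ((nat \<Rightarrow> nat) \<Rightarrow> (nat \<Rightarrow>\<^sub>0 'k) \<Rightarrow> (nat \<Rightarrow>\<^sub>0 'k)) \<Rightarrow> bool" where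
  "coordinatisation n V d \<Phi> \<Psi> a \<longleftrightarrow>
     (\<forall>x\<in>num V. \<Phi> x \<in> pm.span (std_basis d)) \<and>
     (\<forall>x\<in>num V. \<forall>y\<in>num V. \<Phi> (x + y) = \<Phi> x + \<Phi> y) \<and>
     (\<forall>c. \<forall>x\<in>num V. \<Phi> (scal V c x) = pm_scale c (\<Phi> x)) \<and>
     (\<forall>x\<in>num V. \<Phi> x = 0 \<longleftrightarrow> x \<in> den V) \<and>
     (\<forall>v\<in>pm.span (std_basis d). \<Psi> v \<in> num V \<and> \<Phi> (\<Psi> v) = v) \<and>
     pm.rep n a (pm.span (std_basis d)) \<and>
     (\<forall>p\<in>perms n. \<forall>x\<in>num V. \<Phi> (act V p x) = a p (\<Phi> x)) \<and>
     (\<forall>p\<in>perms n. quot_trace V (act V p) = pm.tr (std_basis d) (a p))"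

lemma coordinatisation_exists:
  assumes V: "sn_rep n (V :: ('k::field_char_0, 'v::ab_group_add) subquot)"
  shows "\<exists>d \<Phi> \<Psi> a. coordinatisation n V d \<Phi> \<Psi> a"
proof -
  let ?s = "scal V"
  interpret v: vector_space ?s using V unfolding sn_rep_def by blast
  note V' = V[unfolded sn_rep_def]
  have subN: "v.subspace (num V)" and subD: "v.subspace (den V)" and DN: "den V \<subseteq> num V" using V' by blast+
  have actN: "act V p x \<in> num V" if "p \<in> perms n" "x \<in> num V" for p x using V' that by blast
  have actD: "act V p x \<in> den V" if "p \<in> perms n" "x \<in> den V" for p x using V' that by blast
  have act_add: "act V p (x + y) - (act V p x + act V p y) \<in> den V" if "p \<in> perms n" "x \<in> num V" "y \<in> num V" for p x y
    using V' that by blast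
  have act_scale: "act V p (?s c x) - ?s c (act V p x) \<in> den V" if "p \<in> perms n" "x \<in> num V" for p c x
    using V' that by blast
  have act_id: "act V id x - x \<in> den V" if "x \<in> num V" for x using V' that by blast
  have act_comp: "act V (p \<circ> q) x - act V p (act V q x) \<in> den V" if "p \<in> perms n" "q \<in> perms n" "x \<in> num V" for p q x
    using V' that by blast
  define S where "S = (SOME S. quot_basis V S)"
  have "quot_basis V S" unfolding S_def using V' by (intro someI_ex[where P = "quot_basis V"]) blast
  then have S: "finite S" "S \<subseteq> num V" "\<And>x. x \<in> num V \<Longrightarrow> \<exists>!c. quot_coords V S x c" unfolding quot_basis_def by blast+
  define cf where "cf x = (THE c. quot_coords V S x c)" for x
  have cf: "quot_coords V S x (cf x)" if "x \<in> num V" for x unfolding cf_def using theI'[OF S(3)[OF that]] .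
  have cf_eq: "cf x = c" if "x \<in> num V" "quot_coords V S x c" for x c
    using S(3)[OF that(1)] cf[OF that(1)] that(2) by blast
  have zeroD: "0 \<in> den V" using v.subspace_0[OF subD] .
  define comb where "comb c = (\<Sum>y\<in>S. ?s (c y) y)" for c
  have combN: "comb c \<in> num V" for c
    unfolding comb_def using S(2) by (intro v.subspace_sum[OF subN] v.subspace_scale[OF subN]) auto
  have coordsI: "quot_coords V S x c" if "\<forall>y. y \<notin> S \<longrightarrow> c y = 0" "x - comb c \<in> den V" for x c
    using that unfolding quot_coords_def comb_def by blast
  have cfD: "x - comb (cf x) \<in> den V" "y \<notin> S \<Longrightarrow> cf x y = 0" if "x \<in> num V" for x y
    using cf[OF that] unfolding quot_coords_def comb_def by blast+
  have cf_add: "cf (x + y) = (\<lambda>z. cf x z + cf y z)" if "x \<in> num V" "y \<in> num V" for x y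
  proof (rule cf_eq[OF v.subspace_add[OF subN that] coordsI])
    have "(x - comb (cf x)) + (y - comb (cf y)) \<in> den V" using cfD that by (intro v.subspace_add[OF subD]) auto
    moreover have "comb (\<lambda>z. cf x z + cf y z) = comb (cf x) + comb (cf y)"
      unfolding comb_def by (simp add: v.scale_left_distrib sum.distrib)
    ultimately show "x + y - comb (\<lambda>z. cf x z + cf y z) \<in> den V" by (simp add: algebra_simps)
  qed (use cfD that in simp)
  have cf_scale: "cf (?s c x) = (\<lambda>z. c * cf x z)" if "x \<in> num V" for c x
  proof (rule cf_eq[OF v.subspace_scale[OF subN that] coordsI])
    have "?s c (x - comb (cf x)) \<in> den V" using cfD that by (intro v.subspace_scale[OF subD]) auto
    moreover have "comb (\<lambda>z. c * cf x z) = ?s c (comb (cf x))"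
      unfolding comb_def by (simp add: v.scale_sum_right)
    ultimately show "?s c x - comb (\<lambda>z. c * cf x z) \<in> den V" by (simp add: v.scale_right_diff_distrib)
  qed (use cfD that in simp)
  have cf_den: "cf x = (\<lambda>_. 0)" if "x \<in> den V" for x
    using DN that by (intro cf_eq coordsI) (auto simp: comb_def)
  have cf_zero: "x \<in> den V" if "x \<in> num V" "cf x = (\<lambda>_. 0)" for x
    using cfD(1)[OF that(1)] unfolding that(2) comb_def by simp
  have cf_comb: "cf (comb c) = c" if "\<forall>y. y \<notin> S \<longrightarrow> c y = 0" for c
    using that zeroD by (intro cf_eq combN coordsI) auto
  define d where "d = card S"
  obtain e where e: "bij_betw e {..<d} S" using ex_bij_betw_nat_finite[OF S(1)] by (auto simp: d_def atLeast0LessThan)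
  have eS: "e i \<in> S" if "i < d" for i using e that by (auto simp: bij_betw_def)
  have einj: "e i = e j \<longleftrightarrow> i = j" if "i < d" "j < d" for i j using e that by (auto simp: bij_betw_def inj_on_def)
  define \<Phi> where "\<Phi> x = (\<Sum>i<d. single i (cf x (e i)))" for x
  have lookup_\<Phi>: "lookup (\<Phi> x) i = (if i < d then cf x (e i) else 0)" for x i
  proof -
    have "lookup (\<Sum>i\<in>I. single i (cf x (e i))) z = (\<Sum>i\<in>I. lookup (single i (cf x (e i))) z)" for I z
      by (induction I rule: infinite_finite_induct) (auto simp: lookup_add)
    then show ?thesis unfolding \<Phi>_def by (simp add: lookup_single when_def)
  qed
  define \<Psi> where "\<Psi> v = (\<Sum>i<d. ?s (lookup v i) (e i))" for v
  let ?E = "std_basis d :: (nat \<Rightarrow>\<^sub>0 'k) set" and ?U = "pm.span (std_basis d) :: (nat \<Rightarrow>\<^sub>0 'k) set"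
  note E = pm_single_basis[where d = d and 'k = 'k]
  have \<Phi>U: "\<Phi> x \<in> ?U" for x unfolding E(3) by (auto simp: in_keys_iff lookup_\<Phi> split: if_splits)
  have \<Phi>_add: "\<Phi> (x + y) = \<Phi> x + \<Phi> y" if "x \<in> num V" "y \<in> num V" for x y
    by (rule poly_mapping_eqI) (simp add: lookup_\<Phi> lookup_add cf_add[OF that])
  have \<Phi>_scale: "\<Phi> (?s c x) = pm_scale c (\<Phi> x)" if "x \<in> num V" for c x
    by (rule poly_mapping_eqI) (simp add: lookup_\<Phi> cf_scale[OF that])
  have \<Phi>_zero: "\<Phi> x = 0 \<longleftrightarrow> x \<in> den V" if x: "x \<in> num V" for x
  proof
    assume "\<Phi> x = 0"
    then have z: "cf x (e i) = 0" if "i < d" for i using lookup_\<Phi>[of x i] that by simp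
    have "cf x y = 0" for y
    proof (cases "y \<in> S")
      case True
      then obtain i where "i < d" "y = e i" using e by (auto simp: bij_betw_def)
      then show ?thesis using z by simp
    qed (use cfD(2)[OF x] in simp)
    then show "x \<in> den V" using cf_zero[OF x] by blast
  next
    assume "x \<in> den V"
    then show "\<Phi> x = 0" by (intro poly_mapping_eqI) (simp add: lookup_\<Phi> cf_den)
  qed
  have \<Psi>_comb: "\<exists>c. (\<forall>y. y \<notin> S \<longrightarrow> c y = 0) \<and> \<Psi> v = comb c \<and> (\<forall>i<d. c (e i) = lookup v i)" for v
  proof (intro exI[of _ "\<lambda>y. if y \<in> S then lookup v (inv_into {..<d} e y) else 0"] conjI)
    have inv: "inv_into {..<d} e (e i) = i" if "i < d" for i using e that by (intro inv_into_f_f) (auto simp: bij_betw_def)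
    show "\<Psi> v = comb (\<lambda>y. if y \<in> S then lookup v (inv_into {..<d} e y) else 0)"
      unfolding \<Psi>_def comb_def sum.reindex_bij_betw[OF e, symmetric] using eS inv by (intro sum.cong) auto
    show "\<forall>i<d. (if e i \<in> S then lookup v (inv_into {..<d} e (e i)) else 0) = lookup v i"
      using eS inv by simp
  qed simp
  have \<Psi>N: "\<Psi> v \<in> num V" for v using \<Psi>_comb[of v] combN by metis
  have \<Phi>\<Psi>: "\<Phi> (\<Psi> v) = v" if v: "v \<in> ?U" for v
  proof (rule poly_mapping_eqI)
    fix i
    obtain c where c: "\<forall>y. y \<notin> S \<longrightarrow> c y = 0" "\<Psi> v = comb c" "\<forall>i<d. c (e i) = lookup v i" using \<Psi>_comb by blast
    have "\<not> i < d \<Longrightarrow> lookup v i = 0" using v unfolding E(3) by (auto simp: in_keys_iff)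
    then show "lookup (\<Phi> (\<Psi> v)) i = lookup v i"
      using cf_comb[OF c(1)] c(2,3) by (simp add: lookup_\<Phi>)
  qed
  have \<Phi>_diff: "\<Phi> (x - y) = \<Phi> x - \<Phi> y" if "x \<in> num V" "y \<in> num V" for x y
  proof -
    have "\<Phi> (x - y) + \<Phi> y = \<Phi> x" using \<Phi>_add[of "x - y" y] v.subspace_diff[OF subN that] that(2) by simp
    then show ?thesis by (simp add: algebra_simps)
  qed
  have \<Phi>_eq: "\<Phi> x = \<Phi> y" if "x \<in> num V" "y \<in> num V" "x - y \<in> den V" for x y
    using \<Phi>_diff[OF that(1,2)] \<Phi>_zero[of "x - y"] DN that(3) by auto
  define a where "a p = pm.construct ?E (\<lambda>b. \<Phi> (act V p (\<Psi> b)))" for p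
  have a_lin: "pm.lin (a p)" for p unfolding a_def by (rule pm.linear_construct[OF E(2)])
  have a_eq: "\<Phi> (act V p x) = a p (\<Phi> x)" if p: "p \<in> perms n" and x: "x \<in> num V" for p x
  proof -
    have single: "a p (single i 1) = \<Phi> (act V p (e i))" if i: "i < d" for i
    proof -
      have "a p (single i 1) = \<Phi> (act V p (\<Psi> (single i 1)))"
        unfolding a_def using i by (intro pm.construct_basis[OF E(2)]) auto
      also have "\<Psi> (single i 1) = e i"
      proof -
        have "\<Psi> (single i 1) = (\<Sum>k<d. if k = i then e i else 0)"
          unfolding \<Psi>_def by (intro sum.cong) (auto simp: lookup_single when_def)
        then show ?thesis using i by simp
      qed
      finally show ?thesis .
    qed
    have sumN: "(\<Sum>i\<in>I. ?s (f i) (e i)) \<in> num V" if "I \<subseteq> {..<d}" for I f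
      using that eS S(2) by (intro v.subspace_sum[OF subN] v.subspace_scale[OF subN]) auto
    have sum: "\<Phi> (act V p (\<Sum>i\<in>I. ?s (f i) (e i))) = (\<Sum>i\<in>I. pm_scale (f i) (\<Phi> (act V p (e i))))" if "finite I" "I \<subseteq> {..<d}" for I f
      using that
    proof (induction I rule: finite_induct)
      case empty
      have "act V p 0 \<in> den V" using actD[OF p zeroD] .
      then show ?case using \<Phi>_zero[of "act V p 0"] DN by auto
    next
      case (insert i I)
      have i: "e i \<in> num V" using insert.prems eS S(2) by auto
      have si: "?s (f i) (e i) \<in> num V" using i v.subspace_scale[OF subN] by blast
      have sI: "(\<Sum>i\<in>I. ?s (f i) (e i)) \<in> num V" using sumN insert.prems by blast
      have "\<Phi> (act V p (\<Sum>i\<in>insert i I. ?s (f i) (e i))) = \<Phi> (act V p (?s (f i) (e i) + (\<Sum>i\<in>I. ?s (f i) (e i))))"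
        using insert by simp
      also have "\<dots> = \<Phi> (act V p (?s (f i) (e i)) + act V p (\<Sum>i\<in>I. ?s (f i) (e i)))"
        using act_add[OF p si sI] actN[OF p] si sI by (intro \<Phi>_eq) (auto intro: v.subspace_add[OF subN])
      also have "\<dots> = \<Phi> (act V p (?s (f i) (e i))) + \<Phi> (act V p (\<Sum>i\<in>I. ?s (f i) (e i)))"
        using actN[OF p] si sI by (intro \<Phi>_add)
      also have "\<Phi> (act V p (?s (f i) (e i))) = \<Phi> (?s (f i) (act V p (e i)))"
        using act_scale[OF p i] actN[OF p] si i by (intro \<Phi>_eq) (auto intro: v.subspace_scale[OF subN])
      also have "\<dots> = pm_scale (f i) (\<Phi> (act V p (e i)))" by (rule \<Phi>_scale[OF actN[OF p i]])
      finally show ?case using insert by simp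
    qed
    have "x - \<Psi> (\<Phi> x) \<in> den V"
      using \<Phi>_zero[of "x - \<Psi> (\<Phi> x)"] \<Phi>_diff[OF x \<Psi>N] \<Phi>\<Psi>[OF \<Phi>U] v.subspace_diff[OF subN x \<Psi>N] by simp
    then have xd: "act V p (x - \<Psi> (\<Phi> x)) \<in> den V" by (rule actD[OF p])
    have "act V p x - (act V p (x - \<Psi> (\<Phi> x)) + act V p (\<Psi> (\<Phi> x))) \<in> den V"
      using act_add[OF p v.subspace_diff[OF subN x \<Psi>N] \<Psi>N, of "\<Phi> x" "\<Phi> x"] by simp
    from v.subspace_add[OF subD this xd] have "act V p x - act V p (\<Psi> (\<Phi> x)) \<in> den V" by simp
    then have "\<Phi> (act V p x) = \<Phi> (act V p (\<Psi> (\<Phi> x)))" using actN[OF p] x \<Psi>N by (intro \<Phi>_eq) auto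
    also have "\<dots> = (\<Sum>i<d. pm_scale (lookup (\<Phi> x) i) (\<Phi> (act V p (e i))))"
      unfolding \<Psi>_def by (rule sum) auto
    also have "\<dots> = (\<Sum>i<d. pm_scale (lookup (\<Phi> x) i) (a p (single i 1)))"
      using single by simp
    also have "\<dots> = a p (\<Sum>i<d. pm_scale (lookup (\<Phi> x) i) (single i 1))"
      by (simp add: pm.lin_sum[OF a_lin] pm.lin_scale[OF a_lin])
    also have "\<dots> = a p (\<Phi> x)" using E(6)[OF \<Phi>U, of x] by simp
    finally show ?thesis .
  qed
  have a_\<Psi>: "a p v = \<Phi> (act V p (\<Psi> v))" if "p \<in> perms n" "v \<in> ?U" for p v
    using a_eq[OF that(1) \<Psi>N, of v] \<Phi>\<Psi>[OF that(2)] by simp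
  have rep: "pm.rep n a ?U"
    unfolding pm.rep_def
  proof (intro conjI ballI)
    fix g assume g: "g \<in> perms n"
    show "pm.lin (a g)" by (rule a_lin)
    show "a g ` ?U \<subseteq> ?U" using a_\<Psi>[OF g] \<Phi>U by auto
    fix h v assume h: "h \<in> perms n" and v: "v \<in> ?U"
    have "a (g \<circ> h) v = \<Phi> (act V (g \<circ> h) (\<Psi> v))" by (rule a_\<Psi>[OF comp_perms[OF g h] v])
    also have "\<dots> = \<Phi> (act V g (act V h (\<Psi> v)))"
      using act_comp[OF g h \<Psi>N] actN \<Psi>N g h comp_perms[OF g h] by (intro \<Phi>_eq) blast+
    also have "\<dots> = a g (a h v)" using a_eq[OF g actN[OF h \<Psi>N]] a_\<Psi>[OF h v] by simp
    finally show "a (g \<circ> h) v = a g (a h v)" .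
  next
    fix v assume v: "v \<in> ?U"
    have "a id v = \<Phi> (act V id (\<Psi> v))" by (rule a_\<Psi>[OF id_perms v])
    also have "\<dots> = \<Phi> (\<Psi> v)" using act_id[OF \<Psi>N] actN[OF id_perms \<Psi>N] \<Psi>N by (intro \<Phi>_eq) blast+
    finally show "a id v = v" using \<Phi>\<Psi>[OF v] by simp
  qed
  have trace: "quot_trace V (act V p) = pm.tr ?E (a p)" if p: "p \<in> perms n" for p
  proof -
    have "quot_trace V (act V p) = (\<Sum>y\<in>S. cf (act V p y) y)"
      unfolding quot_trace_def Let_def S_def[symmetric] cf_def ..
    also have "\<dots> = (\<Sum>i<d. cf (act V p (e i)) (e i))" by (rule sum.reindex_bij_betw[OF e, symmetric])
    also have "\<dots> = (\<Sum>i<d. pm.representation ?E (a p (single i 1)) (single i 1))"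
    proof (rule sum.cong[OF refl])
      fix i assume i: "i \<in> {..<d}"
      have eN: "e i \<in> num V" using i eS S(2) by auto
      have "\<Phi> (e i) = single i 1"
      proof (rule poly_mapping_eqI)
        fix k
        have "cf (e i) = (\<lambda>y. if y = e i then 1 else 0)"
        proof (rule cf_eq[OF eN coordsI])
          have "comb (\<lambda>y. if y = e i then 1 else 0) = (\<Sum>y\<in>S. if y = e i then e i else 0)"
            unfolding comb_def by (intro sum.cong) auto
          also have "\<dots> = e i" using S(1) eS i by simp
          finally show "e i - comb (\<lambda>y. if y = e i then 1 else 0) \<in> den V" using zeroD by simp
        qed (use eS i in auto)
        then show "lookup (\<Phi> (e i)) k = lookup (single i 1) k"
          using i einj[of k i] by (auto simp: lookup_\<Phi> lookup_single when_def)
      qed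
      then have "a p (single i 1) = \<Phi> (act V p (e i))" using a_eq[OF p eN] by simp
      then show "cf (act V p (e i)) (e i) = pm.representation ?E (a p (single i 1)) (single i 1)"
        using E(4)[OF \<Phi>U, of i "act V p (e i)"] i by (simp add: lookup_\<Phi>)
    qed
    also have "\<dots> = pm.tr ?E (a p)" by (rule E(5)[symmetric])
    finally show ?thesis .
  qed
  have "coordinatisation n V d \<Phi> \<Psi> a"
    unfolding coordinatisation_def using \<Phi>U \<Phi>_add \<Phi>_scale \<Phi>_zero \<Psi>N \<Phi>\<Psi> rep a_eq trace by blast
  then show ?thesis by blast
qed

lemma coordinatisationD:
  assumes "coordinatisation n V d \<Phi> \<Psi> a"
  shows "x \<in> num V \<Longrightarrow> \<Phi> x \<in> pm.span (std_basis d)"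
    "x \<in> num V \<Longrightarrow> y \<in> num V \<Longrightarrow> \<Phi> (x + y) = \<Phi> x + \<Phi> y"
    "x \<in> num V \<Longrightarrow> \<Phi> (scal V c x) = pm_scale c (\<Phi> x)"
    "x \<in> num V \<Longrightarrow> \<Phi> x = 0 \<longleftrightarrow> x \<in> den V"
    "v \<in> pm.span (std_basis d) \<Longrightarrow> \<Psi> v \<in> num V" "v \<in> pm.span (std_basis d) \<Longrightarrow> \<Phi> (\<Psi> v) = v"
    "pm.rep n a (pm.span (std_basis d))"
    "p \<in> perms n \<Longrightarrow> x \<in> num V \<Longrightarrow> \<Phi> (act V p x) = a p (\<Phi> x)"
    "p \<in> perms n \<Longrightarrow> quot_trace V (act V p) = pm.tr (std_basis d) (a p)"
  using assms unfolding coordinatisation_def by blast+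

lemma coordinatisation_diff:
  assumes "coordinatisation n V d \<Phi> \<Psi> a" "sn_rep n V" "x \<in> num V" "y \<in> num V"
  shows "x - y \<in> num V" "\<Phi> (x - y) = \<Phi> x - \<Phi> y"
proof -
  interpret v: vector_space "scal V" using assms(2) unfolding sn_rep_def by blast
  have sub: "v.subspace (num V)" using assms(2) unfolding sn_rep_def by blast
  show d: "x - y \<in> num V" using v.subspace_diff[OF sub assms(3,4)] .
  have "\<Phi> (x - y) + \<Phi> y = \<Phi> x" using coordinatisationD(2)[OF assms(1) d assms(4)] by simp
  then show "\<Phi> (x - y) = \<Phi> x - \<Phi> y" by (simp add: algebra_simps)
qed

lemma sn_rep_add: "sn_rep n V \<Longrightarrow> x \<in> num V \<Longrightarrow> y \<in> num V \<Longrightarrow> x + y \<in> num V"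
  and sn_rep_scale: "sn_rep n V \<Longrightarrow> x \<in> num V \<Longrightarrow> scal V c x \<in> num V"
  and sn_rep_act: "sn_rep n V \<Longrightarrow> p \<in> perms n \<Longrightarrow> x \<in> num V \<Longrightarrow> act V p x \<in> num V"
proof -
  assume V: "sn_rep n V"
  then interpret v: vector_space "scal V" unfolding sn_rep_def by blast
  have sub: "v.subspace (num V)" using V unfolding sn_rep_def by blast
  show "x \<in> num V \<Longrightarrow> y \<in> num V \<Longrightarrow> x + y \<in> num V" "x \<in> num V \<Longrightarrow> scal V c x \<in> num V"
    using v.subspace_add[OF sub] v.subspace_scale[OF sub] by auto
  show "p \<in> perms n \<Longrightarrow> x \<in> num V \<Longrightarrow> act V p x \<in> num V" using V unfolding sn_rep_def by blast
qed

text \<open>Both representations are transported to coordinates; there \<open>equal_traces_imp_iso\<close> applies in one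
direction and invariance of the trace under isomorphism in the other.\<close>

theorem sn_iso_iff_traces:
  assumes V: "sn_rep n (V :: ('k::field_char_0, 'v::ab_group_add) subquot)" and W: "sn_rep n (W :: ('k, 'w::ab_group_add) subquot)"
  shows "sn_iso n V W \<longleftrightarrow> (\<forall>p\<in>perms n. quot_trace V (act V p) = quot_trace W (act W p))"
proof -
  obtain d \<Phi> \<Psi> a where cV: "coordinatisation n V d \<Phi> \<Psi> a" using coordinatisation_exists[OF V] by blast
  obtain d' \<Phi>' \<Psi>' a' where cW: "coordinatisation n W d' \<Phi>' \<Psi>' a'" using coordinatisation_exists[OF W] by blast
  note v = coordinatisationD[OF cV] and w = coordinatisationD[OF cW]
  note vd = coordinatisation_diff[OF cV V] and wd = coordinatisation_diff[OF cW W]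
  let ?E = "std_basis d :: (nat \<Rightarrow>\<^sub>0 'k) set" and ?E' = "std_basis d' :: (nat \<Rightarrow>\<^sub>0 'k) set"
  note E = pm_single_basis[where d = d and 'k = 'k] and E' = pm_single_basis[where d = d' and 'k = 'k]
  show ?thesis
  proof
    assume "\<forall>p\<in>perms n. quot_trace V (act V p) = quot_trace W (act W p)"
    then have "pm.tr ?E (a p) = pm.tr ?E' (a' p)" if "p \<in> perms n" for p using v(9) w(9) that by simp
    then obtain T where T: "pm.lin T" "bij_betw T (pm.span ?E) (pm.span ?E')" "pm.equivariant n a a' (pm.span ?E) T"
      using pm.equal_traces_imp_iso[OF E(1,2) E'(1,2) v(7) w(7)] by blast
    have TU: "T u \<in> pm.span ?E'" if "u \<in> pm.span ?E" for u using T(2) that by (auto simp: bij_betw_def)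
    define f where "f x = \<Psi>' (T (\<Phi> x))" for x
    have fN: "f x \<in> num W" if "x \<in> num V" for x unfolding f_def by (rule w(5)[OF TU[OF v(1)[OF that]]])
    have \<Phi>f: "\<Phi>' (f x) = T (\<Phi> x)" if "x \<in> num V" for x unfolding f_def by (rule w(6)[OF TU[OF v(1)[OF that]]])
    have denI: "x - y \<in> den W" if "x \<in> num W" "y \<in> num W" "\<Phi>' x = \<Phi>' y" for x y
      using w(4)[OF wd(1)[OF that(1,2)]] wd(2)[OF that(1,2)] that(3) by simp
    show "sn_iso n V W"
      unfolding sn_iso_def
    proof (intro exI[of _ f] conjI ballI allI impI)
      show "f ` num V \<subseteq> num W" using fN by blast
      show "f (x + y) - (f x + f y) \<in> den W" if "x \<in> num V" "y \<in> num V" for x y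
      proof (rule denI)
        show "\<Phi>' (f (x + y)) = \<Phi>' (f x + f y)"
          using that sn_rep_add[OF V that] by (simp add: \<Phi>f v(2) w(2) fN pm.lin_add[OF T(1)])
      qed (use that fN sn_rep_add[OF V] sn_rep_add[OF W] in auto)
      show "f (scal V c x) - scal W c (f x) \<in> den W" if "x \<in> num V" for c x
      proof (rule denI)
        show "\<Phi>' (f (scal V c x)) = \<Phi>' (scal W c (f x))"
          using that sn_rep_scale[OF V that] by (simp add: \<Phi>f v(3) w(3) fN pm.lin_scale[OF T(1)])
      qed (use that fN sn_rep_scale[OF V] sn_rep_scale[OF W] in auto)
      show "(f x \<in> den W) = (x \<in> den V)" if x: "x \<in> num V" for x
      proof -
        have "f x \<in> den W \<longleftrightarrow> T (\<Phi> x) = 0" using w(4)[OF fN[OF x]] \<Phi>f[OF x] by simp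
        also have "\<dots> \<longleftrightarrow> \<Phi> x = 0"
          using inj_on_eq_iff[OF bij_betw_imp_inj_on[OF T(2)] v(1)[OF x] pm.span_zero] pm.lin_0[OF T(1)] by simp
        also have "\<dots> \<longleftrightarrow> x \<in> den V" by (rule v(4)[OF x])
        finally show ?thesis .
      qed
      show "\<exists>x\<in>num V. y - f x \<in> den W" if y: "y \<in> num W" for y
      proof -
        obtain u where u: "u \<in> pm.span ?E" "\<Phi>' y = T u" using T(2) w(1)[OF y] by (auto simp: bij_betw_def)
        have N: "\<Psi> u \<in> num V" by (rule v(5)[OF u(1)])
        have "y - f (\<Psi> u) \<in> den W" by (rule denI[OF y fN[OF N]]) (simp add: \<Phi>f[OF N] v(6)[OF u(1)] u(2))
        then show ?thesis using N by blast
      qed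
      show "f (act V p x) - act W p (f x) \<in> den W" if p: "p permutes {1..n}" and x: "x \<in> num V" for p x
      proof (rule denI)
        have pp: "p \<in> perms n" using p by simp
        show "f (act V p x) \<in> num W" by (rule fN[OF sn_rep_act[OF V pp x]])
        show "act W p (f x) \<in> num W" by (rule sn_rep_act[OF W pp fN[OF x]])
        have "T (a p (\<Phi> x)) = a' p (T (\<Phi> x))" using T(3) pp v(1)[OF x] unfolding pm.equivariant_def by blast
        then show "\<Phi>' (f (act V p x)) = \<Phi>' (act W p (f x))"
          unfolding \<Phi>f[OF sn_rep_act[OF V pp x]] w(8)[OF pp fN[OF x]] \<Phi>f[OF x] v(8)[OF pp x] .
      qed
    qed
  next
    assume "sn_iso n V W"
    then obtain f where F: "f ` num V \<subseteq> num W"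
      "\<forall>x\<in>num V. \<forall>y\<in>num V. f (x + y) - (f x + f y) \<in> den W"
      "\<forall>c. \<forall>x\<in>num V. f (scal V c x) - scal W c (f x) \<in> den W"
      "\<forall>x\<in>num V. f x \<in> den W \<longleftrightarrow> x \<in> den V"
      "\<forall>y\<in>num W. \<exists>x\<in>num V. y - f x \<in> den W"
      "\<forall>p. p permutes {1..n} \<longrightarrow> (\<forall>x\<in>num V. f (act V p x) - act W p (f x) \<in> den W)"
      unfolding sn_iso_def by (elim exE conjE)
    have f: "\<And>x. x \<in> num V \<Longrightarrow> f x \<in> num W"
      "\<And>x y. x \<in> num V \<Longrightarrow> y \<in> num V \<Longrightarrow> f (x + y) - (f x + f y) \<in> den W"
      "\<And>c x. x \<in> num V \<Longrightarrow> f (scal V c x) - scal W c (f x) \<in> den W"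
      "\<And>x. x \<in> num V \<Longrightarrow> f x \<in> den W \<longleftrightarrow> x \<in> den V"
      "\<And>y. y \<in> num W \<Longrightarrow> \<exists>x\<in>num V. y - f x \<in> den W"
      "\<And>p x. p \<in> perms n \<Longrightarrow> x \<in> num V \<Longrightarrow> f (act V p x) - act W p (f x) \<in> den W"
      using F(1) apply blast
      using F(2) apply blast
      using F(3) apply blast
      using F(4) apply blast
      using F(5) apply blast
      using F(6) unfolding mem_Collect_eq by blast
    have eqI: "\<Phi>' x = \<Phi>' y" if "x \<in> num W" "y \<in> num W" "x - y \<in> den W" for x y
      using w(4)[OF wd(1)[OF that(1,2)]] wd(2)[OF that(1,2)] that(3) by simp
    define F where "F x = \<Phi>' (f x)" for x
    have F_add: "F (x + y) = F x + F y" if "x \<in> num V" "y \<in> num V" for x y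
      unfolding F_def w(2)[OF f(1)[OF that(1)] f(1)[OF that(2)], symmetric]
      using that sn_rep_add[OF V that] sn_rep_add[OF W] f(1,2) by (intro eqI) auto
    have F_scale: "F (scal V c x) = pm_scale c (F x)" if "x \<in> num V" for c x
      unfolding F_def w(3)[OF f(1)[OF that], symmetric]
      using that sn_rep_scale[OF V that] sn_rep_scale[OF W] f(1,3) by (intro eqI) auto
    have F_zero: "F x = 0 \<longleftrightarrow> \<Phi> x = 0" if "x \<in> num V" for x
      unfolding F_def using w(4)[OF f(1)[OF that]] f(4)[OF that] v(4)[OF that] by simp
    have F_act: "F (act V p x) = a' p (F x)" if "p \<in> perms n" "x \<in> num V" for p x
      unfolding F_def w(8)[OF that(1) f(1)[OF that(2)], symmetric]
      using that sn_rep_act[OF V that] sn_rep_act[OF W] f(1,6) by (intro eqI) auto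
    have F_diff: "F (x - y) = F x - F y" if "x \<in> num V" "y \<in> num V" for x y
      using F_add[OF vd(1)[OF that] that(2)] by (simp add: algebra_simps)
    have F_cong: "F x = F y" if "x \<in> num V" "y \<in> num V" "\<Phi> x = \<Phi> y" for x y
      using F_zero[OF vd(1)[OF that(1,2)]] F_diff[OF that(1,2)] vd(2)[OF that(1,2)] that(3) by simp
    define T where "T = pm.construct ?E (\<lambda>b. F (\<Psi> b))"
    have T: "pm.lin T" unfolding T_def by (rule pm.linear_construct[OF E(2)])
    have TF: "T (\<Phi> x) = F x" if x: "x \<in> num V" for x
    proof -
      have "\<exists>y\<in>num V. \<Phi> y = u \<and> T u = F y" if "u \<in> pm.span ?E" for u
        using that
      proof (induction u rule: pm.span_induct_alt)
        case base
        have "\<Psi> 0 \<in> num V" "\<Phi> (\<Psi> 0) = 0" by (rule v(5)[OF pm.span_zero], rule v(6)[OF pm.span_zero])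
        then show ?case using F_zero[of "\<Psi> 0"] pm.lin_0[OF T] by (intro bexI[of _ "\<Psi> 0"]) auto
      next
        case (step c b u)
        then obtain y where y: "y \<in> num V" "\<Phi> y = u" "T u = F y" by blast
        have b: "\<Psi> b \<in> num V" "\<Phi> (\<Psi> b) = b" using v(5,6)[OF pm.span_base[OF step.hyps(1)]] by auto
        have Tb: "T b = F (\<Psi> b)" unfolding T_def by (rule pm.construct_basis[OF E(2) step.hyps(1)])
        have s: "scal V c (\<Psi> b) \<in> num V" by (rule sn_rep_scale[OF V b(1)])
        show ?case
        proof (intro bexI[of _ "scal V c (\<Psi> b) + y"] conjI)
          show "\<Phi> (scal V c (\<Psi> b) + y) = pm_scale c b + u" using v(2)[OF s y(1)] v(3)[OF b(1)] b(2) y(2) by simp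
          show "T (pm_scale c b + u) = F (scal V c (\<Psi> b) + y)"
            using F_add[OF s y(1)] F_scale[OF b(1)] Tb y(3) by (simp add: pm.lin_add[OF T] pm.lin_scale[OF T])
          show "scal V c (\<Psi> b) + y \<in> num V" by (rule sn_rep_add[OF V s y(1)])
        qed
      qed
      then obtain y where "y \<in> num V" "\<Phi> y = \<Phi> x" "T (\<Phi> x) = F y" using v(1)[OF x] by blast
      then show ?thesis using F_cong[of y x] x by simp
    qed
    have T\<Psi>: "T u = F (\<Psi> u)" if "u \<in> pm.span ?E" for u using TF[OF v(5)[OF that]] v(6)[OF that] by simp
    have inj: "inj_on T (pm.span ?E)"
    proof (rule inj_onI)
      fix u u' assume u: "u \<in> pm.span ?E" "u' \<in> pm.span ?E" "T u = T u'"
      have d: "u - u' \<in> pm.span ?E" using u pm.span_diff by blast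
      have "T (u - u') = 0" using u(3) pm.lin_diff[OF T] by simp
      then have "\<Phi> (\<Psi> (u - u')) = 0" using T\<Psi>[OF d] F_zero[OF v(5)[OF d]] by simp
      then show "u = u'" using v(6)[OF d] by simp
    qed
    have surj: "T ` pm.span ?E = pm.span ?E'"
    proof (intro equalityI subsetI)
      fix z assume "z \<in> T ` pm.span ?E"
      then show "z \<in> pm.span ?E'" using T\<Psi> v(5) f(1) w(1) unfolding F_def by auto
    next
      fix z assume z: "z \<in> pm.span ?E'"
      obtain x where x: "x \<in> num V" "\<Psi>' z - f x \<in> den W" using f(5)[OF w(5)[OF z]] by blast
      have "z = F x" using eqI[OF w(5)[OF z] f(1)[OF x(1)] x(2)] w(6)[OF z] by (simp add: F_def)
      then show "z \<in> T ` pm.span ?E" using TF[OF x(1)] v(1)[OF x(1)] by (intro image_eqI[of _ _ "\<Phi> x"]) auto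
    qed
    show "\<forall>p\<in>perms n. quot_trace V (act V p) = quot_trace W (act W p)"
    proof
      fix p assume p: "p \<in> perms n"
      have stab: "a p ` ?E \<subseteq> pm.span ?E"
        using pm.repD(2)[OF v(7) p] pm.span_base by (metis (no_types, lifting) image_subsetI)
      have "pm.tr (T ` ?E) (a' p) = pm.tr ?E (a p)"
      proof (rule pm.tr_image[OF E(1,2) T inj stab])
        fix b assume "b \<in> ?E"
        then have b: "b \<in> pm.span ?E" by (rule pm.span_base)
        show "a' p (T b) = T (a p b)"
          using T\<Psi>[OF b] F_act[OF p v(5)[OF b]] TF[OF sn_rep_act[OF V p v(5)[OF b]]] v(8)[OF p v(5)[OF b]] v(6)[OF b] by simp
      qed
      moreover have "pm.tr ?E' (a' p) = pm.tr (T ` ?E) (a' p)"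
      proof (rule pm.tr_basis_independent[OF E'(1,2)])
        show "pm.independent (T ` ?E)" by (rule pm.independent_image[OF T E(2) inj])
        show "pm.span ?E' = pm.span (T ` ?E)" using surj pm.lin_span_image[OF T] by simp
        show "pm.lin (a' p)" by (rule pm.repD(1)[OF w(7) p])
        show "a' p ` pm.span ?E' \<subseteq> pm.span ?E'" using pm.repD(2)[OF w(7) p] by blast
      qed (use E(1) in simp)
      ultimately show "quot_trace V (act V p) = quot_trace W (act W p)" using v(9)[OF p] w(9)[OF p] by simp
    qed
  qed
qed

lemma quot_trace_class_function:
  assumes V: "sn_rep n (V :: ('k::field_char_0, 'v::ab_group_add) subquot)" and p: "p \<in> perms n" and h: "h \<in> perms n"
  shows "quot_trace V (act V (h \<circ> p \<circ> inv h)) = quot_trace V (act V p)"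
proof -
  obtain d \<Phi> \<Psi> a where cV: "coordinatisation n V d \<Phi> \<Psi> a" using coordinatisation_exists[OF V] by blast
  note v = coordinatisationD[OF cV]
  let ?E = "std_basis d :: (nat \<Rightarrow>\<^sub>0 'k) set" and ?q = "h \<circ> p \<circ> inv h"
  note E = pm_single_basis[where d = d and 'k = 'k] and r = v(7)
  have q: "?q \<in> perms n" using comp_perms[OF comp_perms[OF h p] inv_perms[OF h]] .
  have L: "pm.lin (a h)" by (rule pm.repD(1)[OF r h])
  have inj: "inj_on (a h) (pm.span ?E)" by (rule inj_onI) (metis pm.rep_inv[OF r h])
  have span: "pm.span (a h ` ?E) = pm.span ?E"
  proof -
    have "a h ` pm.span ?E = pm.span ?E"
    proof (intro equalityI subsetI)
      fix u assume u: "u \<in> pm.span ?E"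
      have "inv (inv h) = h" using h permutes_bij inv_inv_eq by blast
      then have "a h (a (inv h) u) = u" using pm.rep_inv[OF r inv_perms[OF h] u] by simp
      then show "u \<in> a h ` pm.span ?E" using pm.repD(2)[OF r inv_perms[OF h] u] by (metis imageI)
    qed (use pm.repD(2)[OF r h] in blast)
    then show ?thesis using pm.lin_span_image[OF L] by simp
  qed
  have "pm.tr (a h ` ?E) (a ?q) = pm.tr ?E (a p)"
  proof (rule pm.tr_image[OF E(1,2) L inj])
    show "a p ` ?E \<subseteq> pm.span ?E" using pm.repD(2)[OF r p] pm.span_base by (metis (no_types, lifting) image_subsetI)
    fix b assume "b \<in> ?E"
    then have b: "b \<in> pm.span ?E" by (rule pm.span_base)
    have "?q \<circ> h = h \<circ> p" using h permutes_inv_o(2)[of h] by (simp add: comp_assoc)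
    then show "a ?q (a h b) = a h (a p b)" using pm.repD(4)[OF r q h b] pm.repD(4)[OF r h p b] by simp
  qed
  moreover have "pm.tr (a h ` ?E) (a ?q) = pm.tr ?E (a ?q)"
    by (rule pm.tr_basis_independent[OF _ pm.independent_image[OF L E(2) inj] E(1,2) span pm.repD(1)[OF r q]])
       (use E(1) pm.repD(2)[OF r q] span in auto)
  ultimately show ?thesis using v(9)[OF p] v(9)[OF q] by simp
qed

section \<open>Generators on the edge\<close>

lemma nth_merge_list:
  "m < length L \<Longrightarrow> l < length L - 1 \<Longrightarrow>
    (take m L @ a # drop (m + 2) L) ! l = (if l < m then L ! l else if l = m then a else L ! Suc l)"
  by (auto simp: nth_append nth_Cons' min_def)

text \<open>Ordered set partitions of \<open>{1..n}\<close> with block sizes \<open>\<beta>\<close>.\<close>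

definition osp :: "nat \<Rightarrow> nat list \<Rightarrow> nat set list set" where
  "osp n \<beta> = {Bs. map card Bs = \<beta> \<and> distinct Bs \<and> partition_on {1..n} (set Bs)}"

definition word :: "nat \<Rightarrow> nat set list \<Rightarrow> nat \<Rightarrow> nat" where
  "word n Bs = restrict (\<lambda>e. THE v. v < length Bs \<and> e \<in> Bs ! v) {1..n}"

lemma osp_disjoint: "Bs \<in> osp n \<beta> \<Longrightarrow> v < length Bs \<Longrightarrow> w < length Bs \<Longrightarrow> v \<noteq> w \<Longrightarrow> Bs ! v \<inter> Bs ! w = {}"
  unfolding osp_def partition_on_def disjoint_def by (auto simp: nth_eq_iff_index_eq)

lemma osp_subset: "Bs \<in> osp n \<beta> \<Longrightarrow> v < length Bs \<Longrightarrow> Bs ! v \<subseteq> {1..n}"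
  unfolding osp_def partition_on_def by auto

lemma osp_length: "Bs \<in> osp n \<beta> \<Longrightarrow> length Bs = length \<beta>"
  unfolding osp_def by auto

lemma osp_card: "Bs \<in> osp n \<beta> \<Longrightarrow> v < length \<beta> \<Longrightarrow> card (Bs ! v) = \<beta> ! v"
  unfolding osp_def by auto

lemma word_iff:
  assumes B: "Bs \<in> osp n \<beta>" and e: "e \<in> {1..n}"
  shows "word n Bs e < length Bs" "v < length Bs \<Longrightarrow> word n Bs e = v \<longleftrightarrow> e \<in> Bs ! v"
proof -
  have "\<Union> (set Bs) = {1..n}" using B unfolding osp_def partition_on_def by blast
  then obtain C where C: "C \<in> set Bs" "e \<in> C" using e by blast
  then obtain w where w: "w < length Bs" "e \<in> Bs ! w" by (metis in_set_conv_nth)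
  have uniq: "v = w" if "v < length Bs" "e \<in> Bs ! v" for v
    using osp_disjoint[OF B that(1) w(1)] that(2) w(2) by blast
  have "(THE v. v < length Bs \<and> e \<in> Bs ! v) = w" by (rule the_equality) (use w uniq in blast)+
  then have "word n Bs e = w" using e by (simp only: word_def restrict_apply if_True)
  then show "word n Bs e < length Bs" "v < length Bs \<Longrightarrow> word n Bs e = v \<longleftrightarrow> e \<in> Bs ! v"
    using w uniq[of v] by blast+
qed

lemma osp_nth_word: "Bs \<in> osp n \<beta> \<Longrightarrow> v < length Bs \<Longrightarrow> Bs ! v = {e \<in> {1..n}. word n Bs e = v}"
  using word_iff(2) osp_subset by blast

lemma word_block_words:
  assumes B: "Bs \<in> osp n \<beta>"
  shows "word n Bs \<in> block_words n \<beta>"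
  unfolding block_words_def
proof (intro CollectI conjI allI impI)
  show "word n Bs \<in> extensional {1..n}" by (simp add: word_def)
  show "word n Bs ` {1..n} \<subseteq> {..<length \<beta>}" using word_iff(1)[OF B] osp_length[OF B] by (auto simp del: atLeastAtMost_iff)
  fix v assume "v < length \<beta>"
  then show "card {i \<in> {1..n}. word n Bs i = v} = \<beta> ! v"
    using osp_nth_word[OF B, of v] osp_card[OF B, of v] osp_length[OF B] by simp
qed

lemma word_inj: "Bs \<in> osp n \<beta> \<Longrightarrow> Cs \<in> osp n \<beta> \<Longrightarrow> word n Bs = word n Cs \<Longrightarrow> Bs = Cs"
  using osp_nth_word[of Bs n \<beta>] osp_nth_word[of Cs n \<beta>] osp_length by (intro nth_equalityI) auto

lemma word_surj:
  assumes u: "u \<in> block_words n \<beta>" and pos: "\<And>v. v < length \<beta> \<Longrightarrow> 0 < \<beta> ! v"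
  shows "\<exists>Bs\<in>osp n \<beta>. word n Bs = u"
proof -
  define Bs where "Bs = map (\<lambda>v. {e \<in> {1..n}. u e = v}) [0..<length \<beta>]"
  have len: "length Bs = length \<beta>" by (simp add: Bs_def)
  have nth: "Bs ! v = {e \<in> {1..n}. u e = v}" if "v < length \<beta>" for v using that by (simp add: Bs_def)
  have card: "card (Bs ! v) = \<beta> ! v" if "v < length \<beta>" for v using nth[OF that] block_wordsD(3)[OF u that] by simp
  have ne: "Bs ! v \<noteq> {}" if "v < length \<beta>" for v using card[OF that] pos[OF that] by (intro notI) simp
  have B: "Bs \<in> osp n \<beta>"
    unfolding osp_def
  proof (intro CollectI conjI)
    show "map card Bs = \<beta>" using card len by (intro nth_equalityI) auto
    show "distinct Bs"
    proof (unfold distinct_conv_nth, intro allI impI notI)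
      fix v w assume h: "v < length Bs" "w < length Bs" "v \<noteq> w" "Bs ! v = Bs ! w"
      then obtain e where "e \<in> Bs ! v" "e \<in> Bs ! w" using ne[of v] len by auto
      then have "u e = v" "u e = w" using nth[of v] nth[of w] h(1,2) len by auto
      then show False using h(3) by simp
    qed
    show "partition_on {1..n} (set Bs)"
    proof (rule partition_onI)
      show "\<Union> (set Bs) = {1..n}" using block_wordsD(2)[OF u] unfolding Bs_def by fastforce
      show "disjnt A B" if "A \<in> set Bs" "B \<in> set Bs" "A \<noteq> B" for A B using that unfolding Bs_def disjnt_def by auto
      show "{} \<notin> set Bs" using ne len by (auto simp: in_set_conv_nth)
    qed
  qed
  moreover have "word n Bs = u"
  proof (rule extensionalityI[of _ "{1..n}"])
    fix e assume e: "e \<in> {1..n}"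
    have "u e < length \<beta>" by (rule block_wordsD(2)[OF u e])
    then show "word n Bs e = u e" using word_iff(2)[OF B e, of "u e"] len nth e by simp
  qed (use block_wordsD(1)[OF u] in \<open>auto simp: word_def\<close>)
  ultimately show ?thesis by blast
qed

lemma osp_image:
  assumes B: "Bs \<in> osp n \<beta>" and p: "p \<in> perms n"
  shows "map ((`) p) Bs \<in> osp n \<beta>" "word n (map ((`) p) Bs) = word n Bs \<circ> inv p"
proof -
  have pp: "p permutes {1..n}" using p by simp
  have inj: "inj p" using pp by (rule permutes_inj)
  show P: "map ((`) p) Bs \<in> osp n \<beta>"
    unfolding osp_def
  proof (intro CollectI conjI)
    show "map card (map ((`) p) Bs) = \<beta>"
      using B inj by (auto simp: osp_def card_image inj_on_subset[OF inj])
    show "distinct (map ((`) p) Bs)"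
      using B inj by (auto simp: osp_def distinct_map inj_on_def inj_image_eq_iff)
    have part: "\<Union> (set Bs) = {1..n}" "disjoint (set Bs)" "{} \<notin> set Bs"
      using B by (simp_all add: osp_def partition_on_def)
    show "partition_on {1..n} (set (map ((`) p) Bs))"
    proof (rule partition_onI)
      have "\<Union> (set (map ((`) p) Bs)) = p ` \<Union> (set Bs)" unfolding set_map by blast
      then show "\<Union> (set (map ((`) p) Bs)) = {1..n}" unfolding part(1) permutes_image[OF pp] .
    next
      fix C D assume CD: "C \<in> set (map ((`) p) Bs)" "D \<in> set (map ((`) p) Bs)" "C \<noteq> D"
      obtain C' D' where C': "C' \<in> set Bs" "D' \<in> set Bs" "C = p ` C'" "D = p ` D'" using CD(1,2) unfolding set_map by blast
      then have "C' \<inter> D' = {}" using part(2) CD(3) by (auto dest: disjointD)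
      then show "disjnt C D" unfolding disjnt_def C'(3,4) image_Int[OF inj, symmetric] by simp
    next
      show "{} \<notin> set (map ((`) p) Bs)" using part(3) by auto
    qed
  qed
  show "word n (map ((`) p) Bs) = word n Bs \<circ> inv p"
  proof (rule extensionalityI[of _ "{1..n}"])
    show "word n (map ((`) p) Bs) \<in> extensional {1..n}" by (simp add: word_def)
    show "word n Bs \<circ> inv p \<in> extensional {1..n}" by (rule ext_comp_perm[OF inv_perms[OF p]]) (simp add: word_def)
    fix e assume e: "e \<in> {1..n}"
    have ie: "inv p e \<in> {1..n}" using permutes_in_image[OF permutes_inv[OF pp]] e by blast
    let ?v = "word n Bs (inv p e)"
    have v: "?v < length Bs" by (rule word_iff(1)[OF B ie])
    have "inv p e \<in> Bs ! ?v" using word_iff(2)[OF B ie v] by simp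
    then have "p (inv p e) \<in> map ((`) p) Bs ! ?v" using v by simp
    then have "e \<in> map ((`) p) Bs ! ?v" using pp by (simp add: permutes_inverses)
    then show "word n (map ((`) p) Bs) e = (word n Bs \<circ> inv p) e" using word_iff(2)[OF P e, of ?v] v by simp
  qed
qed

lemma lin_ext_superset:
  assumes "finite I" "keys v \<subseteq> I"
  shows "lin_ext f v = (\<Sum>b\<in>I. pm_scale (lookup v b) (f b :: 'c \<Rightarrow>\<^sub>0 'k::field_char_0))"
  unfolding lin_ext_def using assms by (intro sum.mono_neutral_left) (auto simp: in_keys_iff)

lemma lin_ext_add: "lin_ext f (v + w) = lin_ext f v + (lin_ext f w :: 'c \<Rightarrow>\<^sub>0 'k::field_char_0)"
proof -
  let ?I = "keys v \<union> keys w"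
  have "keys (v + w) \<subseteq> ?I" by (rule keys_add)
  then show ?thesis
    by (simp add: lin_ext_superset[of ?I] lookup_add pm.scale_left_distrib sum.distrib)
qed

lemma lin_ext_scale: "lin_ext f (pm_scale c v) = pm_scale c (lin_ext f v :: 'c \<Rightarrow>\<^sub>0 'k::field_char_0)"
proof -
  have "keys (pm_scale c v) \<subseteq> keys v" by (auto simp: in_keys_iff)
  then show ?thesis
    by (simp add: lin_ext_superset[of "keys v"] pm.scale_sum_right)
qed

lemma lin_ext_single: "lin_ext f (single b 1) = (f b :: 'c \<Rightarrow>\<^sub>0 'k::field_char_0)"
  by (simp add: lin_ext_def)

lemma lin_ext_lin: "pm.lin (lin_ext f :: ('c \<Rightarrow>\<^sub>0 'k::field_char_0) \<Rightarrow> _)"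
  by (rule pm.linI) (simp_all add: lin_ext_add lin_ext_scale)

text \<open>What the generators on the edge carry besides an ordered set partition: the sizes of the blocks and
decorations with a single \<open>\<sigma>\<close>-cycle each.\<close>

definition labels :: "nat \<Rightarrow> nat \<Rightarrow> nat \<Rightarrow> nat \<Rightarrow> (nat list \<times> deco list) set" where
  "labels n k i j = {(\<beta>, xs). length \<beta> = k \<and> coarser \<beta> (zigzag n) \<and> xs \<in> cyclic_lists \<beta> \<and> lsum deg_t \<beta> xs = i \<and> lsum deg_q \<beta> xs = j}"

lemma lsum_nth: "length xs = length \<beta> \<Longrightarrow> lsum f \<beta> xs = (\<Sum>m<length \<beta>. f (\<beta> ! m) (xs ! m))"
  by (simp add: lsum_def sum_list_sum_nth atLeast0LessThan)

lemma gens_iff: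
  "(Bs, xs) \<in> gens n k i j \<longleftrightarrow> length Bs = k \<and> Bs \<in> osp n (map card Bs) \<and> coarser (map card Bs) (zigzag n) \<and>
    xs \<in> deco_lists (map card Bs) \<and> lsum deg_t (map card Bs) xs = i \<and> lsum deg_q (map card Bs) xs = j"
proof (cases "length Bs = k \<and> length xs = k")
  case True
  then have "lsum f (map card Bs) xs = (\<Sum>m<k. f (card (Bs ! m)) (xs ! m))" for f
    using lsum_nth[of xs "map card Bs" f] by simp
  then have "(Bs, xs) \<in> gens n k i j \<longleftrightarrow> distinct Bs \<and> partition_on {1..n} (set Bs) \<and> coarser (map card Bs) (zigzag n) \<and>
      (\<forall>m<k. xs ! m \<in> decos (card (Bs ! m))) \<and> lsum deg_t (map card Bs) xs = i \<and> lsum deg_q (map card Bs) xs = j"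
    using True by (simp only: gens_def mem_Collect_eq case_prod_conv simp_thms)
  moreover have "Bs \<in> osp n (map card Bs) \<longleftrightarrow> distinct Bs \<and> partition_on {1..n} (set Bs)"
    by (simp only: osp_def mem_Collect_eq simp_thms)
  moreover have "xs \<in> deco_lists (map card Bs) \<longleftrightarrow> (\<forall>m<k. xs ! m \<in> decos (card (Bs ! m)))"
    using True by (simp add: deco_lists_def list_all2_conv_all_nth)
  ultimately show ?thesis using True by blast
next
  case False
  then show ?thesis by (auto simp: gens_def deco_lists_def dest: list_all2_lengthD)
qed

text \<open>A left factor with a single \<open>\<sigma>\<close>-cycle cannot be longer than another left factor of the same
decoration: its cycle would contain the proper invariant subset \<open>{1..c}\<close>.\<close>

lemma cyclic_factor_lt:
  assumes x: "\<xi> \<in> decos (2 * c)" "\<eta> \<in> decos (2 * d)" "\<xi>' \<in> decos m" "\<eta>' \<in> decos m'"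
    and one: "scyc (2 * d) \<eta> = 1" and c: "0 < c"
    and eq: "deco_prod (2 * c) \<xi> \<xi>' = deco_prod (2 * d) \<eta> \<eta>'"
  shows "\<not> c < d"
proof
  assume cd: "c < d"
  let ?s = "fst \<xi>" and ?r = "fst \<eta>"
  have s: "?s permutes {1..c}" and r: "?r permutes {1..d}" using x by (auto simp: decos_def)
  have P: "hat c (fst \<xi>') \<circ> ?s = hat d (fst \<eta>') \<circ> ?r"
    using eq unfolding deco_prod_eq[OF x(1,3)] deco_prod_eq[OF x(2,4)] by simp
  have "orbit ?r 1 \<subseteq> {1..c}"
  proof (rule orbit_subset_closed)
    show "1 \<in> {1..c}" using c by simp
    fix y assume y: "y \<in> {1..c}"
    have sy: "?s y \<in> {1..c}" using permutes_in_image[OF s] y by blast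
    have ry: "?r y \<in> {1..d}" using permutes_in_image[OF r, of y] y cd by auto
    have "?s y = ?r y" using fun_cong[OF P, of y] sy ry by (simp add: hat_le)
    then show "?r y \<in> {1..c}" using sy by simp
  qed
  moreover have "d \<in> orbit ?r 1"
  proof -
    have "card (orbit ?r ` {1..d}) = 1" using one by simp
    then obtain C where C: "orbit ?r ` {1..d} = {C}" by (rule card_1_singletonE)
    have "1 \<in> {1..d}" "d \<in> {1..d}" using cd c by simp_all
    then have "orbit ?r 1 \<in> {C}" "orbit ?r d \<in> {C}" unfolding C[symmetric] by blast+
    then have "orbit ?r 1 = C" "orbit ?r d = C" by simp_all
    then show ?thesis using perm_self_in_orbit[OF r finite_atLeastAtMost, of d] by metis
  qed
  ultimately have "d \<in> {1..c}" by blast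
  then show False using cd by simp
qed

text \<open>The edge, where homological degree and \<open>q\<close>-degree add up to the number of parts of the zigzag
composition.\<close>

locale homology_edge =
  fixes n k i j :: nat
  assumes n: "0 < n" and kj: "k + j = (n + 1) div 2"
begin

text \<open>The number of \<open>\<sigma>\<close>-cycles of a generator is \<open>\<lceil>n/2\<rceil> - j = k\<close>, and each of its \<open>k\<close> blocks has at
least one.\<close>

lemma gens_labels: "(Bs, xs) \<in> gens n k i j \<longleftrightarrow> Bs \<in> osp n (map card Bs) \<and> (map card Bs, xs) \<in> labels n k i j"
proof -
  have "xs \<in> cyclic_lists \<beta>" if b: "coarser \<beta> (zigzag n)" "xs \<in> deco_lists \<beta>" "lsum deg_q \<beta> xs = j" "length \<beta> = k" for \<beta>
  proof -
    have c: "composition n \<beta>" "even_init \<beta>" using b(1) by (auto simp: coarser_zigzag_iff)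
    have "lsum scyc \<beta> xs = length \<beta>" using lsum_degrees_cyclic[OF c b(2)] b(3,4) kj by simp
    then show ?thesis using lsum_scyc_ge(2)[OF c(1) b(2)] b(2) by (simp add: cyclic_lists_def)
  qed
  then show ?thesis unfolding gens_iff labels_def by (auto simp: cyclic_lists_def)
qed

text \<open>There would be \<open>k + 1\<close> blocks and only \<open>k\<close> cycles.\<close>

lemma gens_Suc_empty: "gens n (Suc k) i j = {}"
proof -
  have False if "(Bs, xs) \<in> gens n (Suc k) i j" for Bs xs
  proof -
    note g = that[unfolded gens_iff]
    have c: "composition n (map card Bs)" "even_init (map card Bs)" using g by (auto simp: coarser_zigzag_iff)
    have "lsum scyc (map card Bs) xs = k" using lsum_degrees_cyclic[OF c, of xs] g kj by simp
    then show False using lsum_scyc_ge(1)[OF c(1), of xs] g by simp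
  qed
  then show ?thesis by auto
qed

lemma labels_facts:
  assumes "(\<beta>, xs) \<in> labels n k i j"
  shows "composition n \<beta>" "length \<beta> = k" "length xs = k" "m < k - 1 \<Longrightarrow> even (\<beta> ! m)"
    "l < k \<Longrightarrow> xs ! l \<in> decos (\<beta> ! l)" "l < k \<Longrightarrow> scyc (\<beta> ! l) (xs ! l) = 1" "l < k \<Longrightarrow> 0 < \<beta> ! l"
proof -
  have c: "composition n \<beta>" "even_init \<beta>" "xs \<in> cyclic_lists \<beta>" "length \<beta> = k"
    using assms by (auto simp: labels_def coarser_zigzag_iff)
  show "composition n \<beta>" "length \<beta> = k" by (fact c)+
  have d: "list_all2 (\<lambda>b x. x \<in> decos b) \<beta> xs" "list_all2 (\<lambda>b x. scyc b x = 1) \<beta> xs"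
    using c(3) by (auto simp: cyclic_lists_def deco_lists_def)
  show "length xs = k" using d(1) c(4) by (simp add: list_all2_lengthD)
  show "even (\<beta> ! m)" if "m < k - 1"
  proof -
    have "\<beta> ! m = butlast \<beta> ! m" using that c(4) by (simp add: nth_butlast)
    moreover have "butlast \<beta> ! m \<in> set (butlast \<beta>)" using that c(4) by (intro nth_mem) simp
    ultimately show ?thesis using c(2) by simp
  qed
  show "xs ! l \<in> decos (\<beta> ! l)" if "l < k" using list_all2_nthD[OF d(1)] that c(4) by simp
  show "scyc (\<beta> ! l) (xs ! l) = 1" if "l < k" using list_all2_nthD[OF d(2)] that c(4) by simp
  show "0 < \<beta> ! l" if "l < k" using composition_pos[OF c(1)] that c(4) by simp
qed

lemma finite_labels: "finite (labels n k i j)"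
proof (rule finite_subset)
  show "labels n k i j \<subseteq> (SIGMA \<beta>:{\<beta>. composition n \<beta>}. deco_lists \<beta>)"
    by (auto simp: labels_def coarser_def sum_list_zigzag cyclic_lists_def)
  show "finite (SIGMA \<beta>:{\<beta>. composition n \<beta>}. deco_lists \<beta>)" using finite_compositions by (intro finite_SigmaI) auto
qed

text \<open>What remains of a generator when only the separations in \<open>T\<close> between its blocks are kept: sizes and
decorations of all blocks, and the coarsened partition.\<close>

definition key :: "nat set \<Rightarrow> gen \<Rightarrow> deco list \<times> nat list \<times> (nat \<Rightarrow> nat)" where
  "key T x = (snd x, map card (fst x), coarsen n T (word n (fst x)))"

lemma genD:
  assumes "x \<in> gens n k i j"
  shows "fst x \<in> osp n (map card (fst x))" "(map card (fst x), snd x) \<in> labels n k i j"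
    "word n (fst x) \<in> block_words n (map card (fst x))" "length (fst x) = k" "length (snd x) = k"
    "composition n (map card (fst x))"
proof -
  have g: "fst x \<in> osp n (map card (fst x))" "(map card (fst x), snd x) \<in> labels n k i j"
    using assms gens_labels[of "fst x" "snd x"] by auto
  then show "fst x \<in> osp n (map card (fst x))" "(map card (fst x), snd x) \<in> labels n k i j" by blast+
  show "word n (fst x) \<in> block_words n (map card (fst x))" by (rule word_block_words[OF g(1)])
  show "length (fst x) = k" "length (snd x) = k" "composition n (map card (fst x))" using labels_facts(1-3)[OF g(2)] by simp_all
qed

lemma finite_gens: "finite (gens n k i j)"
proof (rule finite_subset)
  let ?S = "SIGMA Bs:{Bs. set Bs \<subseteq> Pow {1..n} \<and> length Bs = k}. deco_lists (map card Bs)"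
  show "gens n k i j \<subseteq> ?S"
  proof
    fix x assume x: "x \<in> gens n k i j"
    obtain Bs xs where xx: "x = (Bs, xs)" by (cases x)
    have "\<Union> (set Bs) = {1..n}" using genD(1)[OF x] unfolding xx osp_def partition_on_def by simp
    then have "set Bs \<subseteq> Pow {1..n}" by blast
    then show "x \<in> ?S" using x unfolding xx gens_iff by auto
  qed
  show "finite ?S" by (intro finite_SigmaI finite_lists_length_eq) auto
qed

lemma gen_eqI: "x \<in> gens n k i j \<Longrightarrow> y \<in> gens n k i j \<Longrightarrow> snd x = snd y \<Longrightarrow> map card (fst x) = map card (fst y) \<Longrightarrow>
    word n (fst x) = word n (fst y) \<Longrightarrow> x = y"
  using word_inj[of "fst x" n "map card (fst x)" "fst y"] genD(1) by (metis prod_eqI)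

lemma sorted_fibres_gens: "sorted_fibres (gens n k i j) {..<k - 1} (\<lambda>x. descents n (word n (fst x))) key
    (\<lambda>x y. lex_less n (word n (fst x)) (word n (fst y)))"
proof
  show "finite (gens n k i j)" by (rule finite_gens)
  show "finite {..<k - 1}" by simp
next
  fix x assume x: "x \<in> gens n k i j"
  show "descents n (word n (fst x)) \<subseteq> {..<k - 1}" using descents_subset[OF genD(3)[OF x]] genD(4)[OF x] by simp
next
  fix T T' x y assume "T \<subseteq> T'" "T' \<subseteq> {..<k - 1}" "key T' x = key T' y"
  moreover from this have "finite T'" using finite_subset by blast
  ultimately show "key T x = key T y" using block_of_refine[of T' T] unfolding key_def coarsen_eq_iff prod.inject by blast
next
  fix x T assume x: "x \<in> gens n k i j" and T: "T \<subseteq> {..<k - 1}"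
  have fin: "finite T" using T finite_subset by blast
  let ?b = "map card (fst x)"
  obtain w where w: "w \<in> block_words n ?b" "descents n w \<subseteq> T" "coarsen n T w = coarsen n T (word n (fst x))"
    using sorted_word_exists[OF genD(3)[OF x] fin] by blast
  obtain Bs where B: "Bs \<in> osp n ?b" "word n Bs = w"
    using word_surj[OF w(1) entry_pos[OF genD(6)[OF x] n]] by blast
  have mb: "map card Bs = ?b" using B(1) by (simp add: osp_def)
  have "(Bs, snd x) \<in> gens n k i j" unfolding gens_labels mb using B(1) genD(2)[OF x] by blast
  then show "\<exists>y\<in>gens n k i j. descents n (word n (fst y)) \<subseteq> T \<and> key T y = key T x"
    using w B mb by (intro bexI[of _ "(Bs, snd x)"]) (auto simp: key_def)
next
  fix x y assume xy: "x \<in> gens n k i j" "y \<in> gens n k i j" "x \<noteq> y"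
    and eq: "key (descents n (word n (fst x))) x = key (descents n (word n (fst x))) y"
  have e: "snd x = snd y" "map card (fst x) = map card (fst y)"
    "coarsen n (descents n (word n (fst x))) (word n (fst x)) = coarsen n (descents n (word n (fst x))) (word n (fst y))"
    using eq by (auto simp: key_def)
  have "word n (fst x) \<noteq> word n (fst y)" using gen_eqI[OF xy(1,2) e(1,2)] xy(3) by blast
  then show "lex_less n (word n (fst x)) (word n (fst y))"
    using lex_less_fibre[OF genD(3)[OF xy(1)] _ entry_pos[OF genD(6)[OF xy(1)] n] e(3)] genD(3)[OF xy(2)] e(2) by simp
next
  show "asymp_on (gens n k i j) (\<lambda>x y. lex_less n (word n (fst x)) (word n (fst y)))"
    by (rule asymp_onI) (use lex_less_trans lex_less_irrefl in blast)
  show "transp_on (gens n k i j) (\<lambda>x y. lex_less n (word n (fst x)) (word n (fst y)))"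
    by (rule transp_onI) (use lex_less_trans in blast)
qed

lemma block_of_merge:
  assumes "m < k - 1"
  shows "block_of ({..<k - 1} - {m}) (Suc m) = block_of ({..<k - 1} - {m}) m"
    "v < k \<Longrightarrow> l < k \<Longrightarrow> l \<noteq> m \<Longrightarrow> l \<noteq> Suc m \<Longrightarrow> block_of ({..<k - 1} - {m}) v = block_of ({..<k - 1} - {m}) l \<Longrightarrow> v = l"
proof -
  let ?T = "{..<k - 1} - {m}"
  have fin: "finite ?T" by simp
  show "block_of ?T (Suc m) = block_of ?T m" using block_of_Suc[OF fin, of m] by simp
  assume h: "v < k" "l < k" "l \<noteq> m" "l \<noteq> Suc m" "block_of ?T v = block_of ?T l"
  show "v = l"
  proof (cases v l rule: linorder_cases)
    case less
    then have "\<forall>t\<in>?T. \<not> (v \<le> t \<and> t < l)" using block_of_eq_iff[OF fin, of v l] h(5) by simp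
    then have "l - 1 \<notin> ?T" using less by (metis One_nat_def Suc_pred diff_Suc_less gr_implies_not0 less_Suc_eq_le not_gr_zero)
    then show ?thesis using less h assms by auto
  next
    case greater
    then have "\<forall>t\<in>?T. \<not> (l \<le> t \<and> t < v)" using block_of_eq_iff[OF fin, of l v] h(5) by simp
    then have "l \<notin> ?T" using greater by blast
    then show ?thesis using greater h by auto
  qed
qed

text \<open>The merged block is the only one with two \<open>\<sigma>\<close>-cycles, so the place of the merge can be seen. The
sizes of the two factors are determined because both have a single cycle (\<open>cyclic_factor_lt\<close>), and
then the factors are (\<open>deco_prod_inj\<close>).\<close>

lemma merge_eq_iff:
  assumes x: "x \<in> gens n k i j" and y: "y \<in> gens n k i j" and m: "m < k - 1" and m': "m' < k - 1"
  shows "merge m x = merge m' y \<longleftrightarrow> m = m' \<and> key ({..<k - 1} - {m}) x = key ({..<k - 1} - {m}) y"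
proof -
  obtain Bs xs where xx: "x = (Bs, xs)" by (cases x)
  obtain Cs ys where yy: "y = (Cs, ys)" by (cases y)
  note gx = genD[OF x, unfolded xx fst_conv snd_conv] and gy = genD[OF y, unfolded yy fst_conv snd_conv]
  note lx = labels_facts[OF gx(2)] and ly = labels_facts[OF gy(2)]
  let ?T = "{..<k - 1} - {m}"
  let ?mB = "\<lambda>m Bs. take m Bs @ (Bs ! m \<union> Bs ! Suc m) # drop (m + 2) Bs"
  let ?mx = "\<lambda>m Bs xs. take m xs @ deco_prod (card (Bs ! m)) (xs ! m) (xs ! Suc m) # drop (m + 2) xs"
  have mx: "merge m x = (?mB m Bs, ?mx m Bs xs)" and my: "merge m' y = (?mB m' Cs, ?mx m' Cs ys)"
    by (simp_all add: merge_def xx yy)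
  have nB: "?mB m Bs ! l = (if l < m then Bs ! l else if l = m then Bs ! m \<union> Bs ! Suc m else Bs ! Suc l)"
    "?mx m Bs xs ! l = (if l < m then xs ! l else if l = m then deco_prod (card (Bs ! m)) (xs ! m) (xs ! Suc m) else xs ! Suc l)"
    if "l < k - 1" for l
    using nth_merge_list[of m Bs l] nth_merge_list[of m xs l] that m gx(4,5) by simp_all
  have nC: "?mB m' Cs ! l = (if l < m' then Cs ! l else if l = m' then Cs ! m' \<union> Cs ! Suc m' else Cs ! Suc l)"
    "?mx m' Cs ys ! l = (if l < m' then ys ! l else if l = m' then deco_prod (card (Cs ! m')) (ys ! m') (ys ! Suc m') else ys ! Suc l)"
    if "l < k - 1" for l
    using nth_merge_list[of m' Cs l] nth_merge_list[of m' ys l] that m' gy(4,5) by simp_all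
  have cardU: "card (Bs ! m \<union> Bs ! Suc m) = card (Bs ! m) + card (Bs ! Suc m)" if B: "Bs \<in> osp n \<beta>" "length Bs = k" for Bs \<beta>
  proof (rule card_Un_disjoint)
    have l: "m < length Bs" "Suc m < length Bs" using m B(2) by simp_all
    show "finite (Bs ! m)" by (rule finite_subset[OF osp_subset[OF B(1) l(1)]]) simp
    show "finite (Bs ! Suc m)" by (rule finite_subset[OF osp_subset[OF B(1) l(2)]]) simp
    show "Bs ! m \<inter> Bs ! Suc m = {}" by (rule osp_disjoint[OF B(1) l]) simp
  qed
  have mk: "m < k" "Suc m < k" using m by auto
  have cB: "map card Bs ! l = card (Bs ! l)" if "l < k" for l using that gx(4) by simp
  have cC: "map card Cs ! l = card (Cs ! l)" if "l < k" for l using that gy(4) by simp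
  show ?thesis
  proof
    assume eq: "merge m x = merge m' y"
    then have eqB: "?mB m Bs = ?mB m' Cs" and eqx: "?mx m Bs xs = ?mx m' Cs ys" unfolding mx my by auto
    obtain c where c: "card (Bs ! m) = 2 * c" using lx(4)[OF m] cB[OF mk(1)] by auto
    have xm: "xs ! m \<in> decos (2 * c)" "xs ! Suc m \<in> decos (card (Bs ! Suc m))"
      using lx(5)[OF mk(1)] lx(5)[OF mk(2)] c cB mk by auto
    have one: "scyc (2 * c) (xs ! m) = 1" "scyc (card (Bs ! Suc m)) (xs ! Suc m) = 1" "0 < c"
      using lx(6)[OF mk(1)] lx(6)[OF mk(2)] lx(7)[OF mk(1)] c cB mk by auto
    have mm: "m = m'"
    proof (rule ccontr)
      assume ne: "m \<noteq> m'"
      have x1: "?mB m Bs ! m = Bs ! m \<union> Bs ! Suc m" unfolding nB(1)[OF m] by simp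
      have x2: "?mx m Bs xs ! m = deco_prod (card (Bs ! m)) (xs ! m) (xs ! Suc m)" unfolding nB(2)[OF m] by simp
      have two: "scyc (card (?mB m Bs ! m)) (?mx m Bs xs ! m) = 2"
        unfolding x1 x2 unfolding cardU[OF gx(1,4)] c scyc_deco_prod[OF xm] one by simp
      have "scyc (card (?mB m' Cs ! m)) (?mx m' Cs ys ! m) = 1"
        unfolding nC[OF m] using ne ly(6)[OF mk(1)] ly(6)[OF mk(2)] cC mk by simp
      then show False using two eqB eqx by simp
    qed
    have same: "Bs ! l = Cs ! l \<and> xs ! l = ys ! l" if l: "l < k" "l \<noteq> m" "l \<noteq> Suc m" for l
    proof (cases "l < m")
      case True
      then have l': "l < k - 1" using m by simp
      show ?thesis using nB[OF l'] nC[OF l'] eqB eqx mm True by simp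
    next
      case False
      then obtain l0 where l0: "l = Suc l0" "m < l0" using l by (cases l) auto
      then have l': "l0 < k - 1" using l by simp
      show ?thesis using nB[OF l'] nC[OF l'] eqB eqx mm l0 by simp
    qed
    have un: "Bs ! m \<union> Bs ! Suc m = Cs ! m \<union> Cs ! Suc m" using nB(1)[OF m] nC(1)[OF m] eqB mm by simp
    have prod: "deco_prod (card (Bs ! m)) (xs ! m) (xs ! Suc m) = deco_prod (card (Cs ! m)) (ys ! m) (ys ! Suc m)"
      using nB(2)[OF m] nC(2)[OF m] eqx mm by simp
    obtain d where d: "card (Cs ! m) = 2 * d" using ly(4)[OF m] cC[OF mk(1)] by auto
    have ym: "ys ! m \<in> decos (2 * d)" "ys ! Suc m \<in> decos (card (Cs ! Suc m))"
      using ly(5)[OF mk(1)] ly(5)[OF mk(2)] d cC mk by auto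
    have oney: "scyc (2 * d) (ys ! m) = 1" "0 < d"
      using ly(6)[OF mk(1)] ly(7)[OF mk(1)] d cC mk by auto
    note pr = prod[unfolded c d]
    have "c = d"
      using cyclic_factor_lt[OF xm(1) ym(1) xm(2) ym(2) oney(1) one(3) pr]
        cyclic_factor_lt[OF ym(1) xm(1) ym(2) xm(2) one(1) oney(2) pr[symmetric]] by simp
    then have pe: "xs ! m = ys ! m" "xs ! Suc m = ys ! Suc m"
      using deco_prod_inj[OF xm, of "ys ! m" "ys ! Suc m"] ym pr by auto
    have "xs = ys"
    proof (rule nth_equalityI)
      show "length xs = length ys" using gx gy by simp
      fix l assume "l < length xs"
      then show "xs ! l = ys ! l" using same[of l] pe gx(5) by (cases "l = m \<or> l = Suc m") auto
    qed
    moreover have "map card Bs = map card Cs"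
    proof (rule nth_equalityI)
      show "length (map card Bs) = length (map card Cs)" using gx gy by simp
      fix l assume "l < length (map card Bs)"
      then have l: "l < k" using gx(4) by simp
      have "card (Bs ! m) = card (Cs ! m)" using c d \<open>c = d\<close> by simp
      moreover from this have "card (Bs ! Suc m) = card (Cs ! Suc m)" using cardU[OF gx(1,4)] cardU[OF gy(1,4)] un by simp
      ultimately show "map card Bs ! l = map card Cs ! l"
        using same[of l] l cB[OF l] cC[OF l] by (cases "l = m \<or> l = Suc m") auto
    qed
    moreover have "coarsen n ?T (word n Bs) = coarsen n ?T (word n Cs)"
      unfolding coarsen_eq_iff
    proof
      fix e assume e: "e \<in> {1..n}"
      let ?v = "word n Bs e"
      have v: "?v < k" "e \<in> Bs ! ?v" using word_iff[OF gx(1) e] gx(4) by auto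
      show "block_of ?T ?v = block_of ?T (word n Cs e)"
      proof (cases "?v = m \<or> ?v = Suc m")
        case True
        then have "e \<in> Bs ! m \<union> Bs ! Suc m" using v(2) by (metis UnI1 UnI2)
        then have "e \<in> Cs ! m \<union> Cs ! Suc m" unfolding un .
        then have "word n Cs e = m \<or> word n Cs e = Suc m"
          using word_iff(2)[OF gy(1) e, of m] word_iff(2)[OF gy(1) e, of "Suc m"] mk gy(4) by auto
        then show ?thesis using True block_of_merge(1)[OF m] by auto
      next
        case False
        then have "e \<in> Cs ! ?v" using same[OF v(1)] v(2) by simp
        then have "word n Cs e = ?v" using word_iff(2)[OF gy(1) e, of ?v] v(1) gy(4) by simp
        then show ?thesis by simp
      qed
    qed
    ultimately show "m = m' \<and> key ?T x = key ?T y" using mm by (simp add: key_def xx yy)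
  next
    assume h: "m = m' \<and> key ?T x = key ?T y"
    then have mm: "m = m'" and xs: "xs = ys" and cards: "map card Bs = map card Cs"
      and co: "\<And>e. e \<in> {1..n} \<Longrightarrow> block_of ?T (word n Bs e) = block_of ?T (word n Cs e)"
      by (auto simp: key_def xx yy coarsen_eq_iff simp del: atLeastAtMost_iff)
    have wk: "word n Bs e < k" "word n Cs e < k" if "e \<in> {1..n}" for e
      using word_iff(1)[OF gx(1) that] word_iff(1)[OF gy(1) that] gx(4) gy(4) by auto
    have same: "Bs ! l = Cs ! l" if l: "l < k" "l \<noteq> m" "l \<noteq> Suc m" for l
    proof -
      have "word n Bs e = l \<longleftrightarrow> word n Cs e = l" if e: "e \<in> {1..n}" for e
        using block_of_merge(2)[OF m wk(1)[OF e] l] block_of_merge(2)[OF m wk(2)[OF e] l] co[OF e] by auto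
      then show ?thesis using osp_nth_word[OF gx(1)] osp_nth_word[OF gy(1)] l(1) gx(4) gy(4) by auto
    qed
    have un: "Bs ! m \<union> Bs ! Suc m = Cs ! m \<union> Cs ! Suc m"
    proof -
      have "word n Bs e = m \<or> word n Bs e = Suc m \<longleftrightarrow> word n Cs e = m \<or> word n Cs e = Suc m" if e: "e \<in> {1..n}" for e
        using block_of_merge(2)[OF m wk(1)[OF e] wk(2)[OF e]] block_of_merge(2)[OF m wk(2)[OF e] wk(1)[OF e]] co[OF e] by metis
      then show ?thesis
        using osp_nth_word[OF gx(1)] osp_nth_word[OF gy(1)] mk gx(4) gy(4) by auto
    qed
    have "?mB m Bs = ?mB m Cs"
    proof (rule nth_equalityI)
      show "length (?mB m Bs) = length (?mB m Cs)" using gx(4) gy(4) by simp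
      fix l assume "l < length (?mB m Bs)"
      then have l: "l < k - 1" using gx(4) m by simp
      show "?mB m Bs ! l = ?mB m Cs ! l"
        unfolding nB(1)[OF l] nC(1)[OF l, folded mm] using same[of l] same[of "Suc l"] un l by auto
    qed
    moreover have "card (Bs ! m) = card (Cs ! m)" using cB[OF mk(1)] cC[OF mk(1)] cards by simp
    ultimately show "merge m x = merge m' y" unfolding mx my using mm xs by simp
  qed
qed

end

section \<open>The homology on the edge\<close>

lemma lin_eq_on_singles:
  fixes f g :: "('c \<Rightarrow>\<^sub>0 'k::field_char_0) \<Rightarrow> ('c \<Rightarrow>\<^sub>0 'k)"
  assumes "pm.lin f" "pm.lin g" "\<And>x. f (single x 1) = g (single x 1)"
  shows "f v = g v"
proof -
  have v: "v = (\<Sum>x\<in>keys v. pm_scale (lookup v x) (single x 1))"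
  proof (rule poly_mapping_eqI)
    fix y
    have "(\<Sum>x\<in>keys v. lookup (pm_scale (lookup v x) (single x 1)) y) =
      (\<Sum>x\<in>keys v. if x = y then lookup v y else 0)"
      by (intro sum.cong refl) (auto simp: lookup_single when_def)
    also have "\<dots> = lookup v y" by (simp add: in_keys_iff)
    finally show "lookup v y = lookup (\<Sum>x\<in>keys v. pm_scale (lookup v x) (single x 1)) y"
      unfolding lookup_sum by (rule sym)
  qed
  have "f v = (\<Sum>x\<in>keys v. pm_scale (lookup v x) (f (single x 1)))"
    by (subst v) (simp add: pm.lin_sum[OF assms(1)] pm.lin_scale[OF assms(1)])
  also have "\<dots> = (\<Sum>x\<in>keys v. pm_scale (lookup v x) (g (single x 1)))"
    by (simp only: assms(3))
  also have "\<dots> = g (\<Sum>x\<in>keys v. pm_scale (lookup v x) (single x 1))"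
    by (simp add: pm.lin_sum[OF assms(2)] pm.lin_scale[OF assms(2)])
  also have "\<dots> = g v" by (subst (3) v) (rule refl)
  finally show ?thesis .
qed

definition move :: "(nat \<Rightarrow> nat) \<Rightarrow> gen \<Rightarrow> gen" where
  "move p x = (map ((`) p) (fst x), snd x)"

lemma relabel_single: "relabel p (single x 1) = single (move p x) (1::'k::field_char_0)"
  unfolding relabel_def lin_ext_single move_def by (simp add: case_prod_unfold)

lemma relabel_lin: "pm.lin (relabel p :: (gen \<Rightarrow>\<^sub>0 'k::field_char_0) \<Rightarrow> _)"
  unfolding relabel_def by (rule lin_ext_lin)

lemma move_comp: "move (p \<circ> q) x = move p (move q x)"
  by (simp add: move_def image_comp)

lemma move_id: "move id x = x"
  by (simp add: move_def)

lemma relabel_comp: "relabel (p \<circ> q) v = relabel p (relabel q v :: gen \<Rightarrow>\<^sub>0 'k::field_char_0)"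
proof (rule lin_eq_on_singles[of "relabel (p \<circ> q)" "\<lambda>v. relabel p (relabel q v)"])
  show "pm.lin (\<lambda>v. relabel p (relabel q v :: gen \<Rightarrow>\<^sub>0 'k))"
    by (rule pm.linI) (simp_all add: pm.lin_add[OF relabel_lin] pm.lin_scale[OF relabel_lin])
qed (simp_all add: relabel_lin relabel_single move_comp)

lemma relabel_id: "relabel id v = (v :: gen \<Rightarrow>\<^sub>0 'k::field_char_0)"
proof (rule lin_eq_on_singles[of "relabel id" "\<lambda>v. v"])
  show "pm.lin (\<lambda>v :: gen \<Rightarrow>\<^sub>0 'k. v)" by (rule pm.linI) simp_all
qed (simp_all add: relabel_lin relabel_single move_id)

lemma honest_coords:
  fixes V :: "('k::field_char_0, 'i \<Rightarrow>\<^sub>0 'k) subquot"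
  assumes V: "scal V = pm_scale" "den V = {0}" and S: "finite S" "pm.independent S" and x: "x \<in> pm.span S"
  shows "quot_coords V S x c \<longleftrightarrow> c = pm.representation S x"
proof
  assume "quot_coords V S x c"
  then have c: "\<And>y. y \<notin> S \<Longrightarrow> c y = 0" "x = (\<Sum>y\<in>S. pm_scale (c y) y)" unfolding quot_coords_def V by auto
  have sub: "{b. c b \<noteq> 0} \<subseteq> S" using c(1) by blast
  have "(\<Sum>b | c b \<noteq> 0. pm_scale (c b) b) = x"
    unfolding c(2) using S(1) sub by (intro sum.mono_neutral_left) auto
  then have "pm.representation S x = c"
    using sub S(1) finite_subset by (intro pm.representation_eqI[OF S(2) x]) auto
  then show "c = pm.representation S x" by (rule sym)
next
  assume c: "c = pm.representation S x"
  have "(\<Sum>y\<in>S. pm_scale (pm.representation S x y) y) = x" by (rule pm.sum_representation_eq[OF S(2) x S(1)]) simp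
  moreover have "\<forall>y. y \<notin> S \<longrightarrow> pm.representation S x y = 0" using pm.representation_ne_zero by blast
  ultimately show "quot_coords V S x c" unfolding quot_coords_def V c by simp
qed

lemma honest_basis:
  fixes V :: "('k::field_char_0, 'i \<Rightarrow>\<^sub>0 'k) subquot"
  assumes V: "scal V = pm_scale" "den V = {0}" "pm.subspace (num V)"
  shows "quot_basis V S \<longleftrightarrow> finite S \<and> pm.independent S \<and> pm.span S = num V"
proof
  assume "quot_basis V S"
  then have S: "finite S" "S \<subseteq> num V" "\<And>x. x \<in> num V \<Longrightarrow> \<exists>!c. quot_coords V S x c" unfolding quot_basis_def by auto
  have "pm.independent S"
  proof (rule pm.independent_if_scalars_zero[OF S(1)])
    fix f y assume f: "(\<Sum>y\<in>S. pm_scale (f y) y) = 0" and y: "y \<in> S"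
    have "quot_coords V S 0 (\<lambda>y. if y \<in> S then f y else 0)" "quot_coords V S 0 (\<lambda>_. 0)"
      unfolding quot_coords_def V using f by (simp_all cong: sum.cong)
    then have "(\<lambda>y. if y \<in> S then f y else 0) = (\<lambda>_. 0)" using S(3)[OF pm.subspace_0[OF V(3)]] by blast
    from fun_cong[OF this, of y] show "f y = 0" using y by simp
  qed
  moreover have "pm.span S = num V"
  proof
    show "pm.span S \<subseteq> num V" by (rule pm.span_minimal[OF S(2) V(3)])
    show "num V \<subseteq> pm.span S"
    proof
      fix x assume "x \<in> num V"
      then obtain c where "quot_coords V S x c" using S(3) by blast
      then have "x = (\<Sum>y\<in>S. pm_scale (c y) y)" unfolding quot_coords_def V by auto
      moreover have "(\<Sum>y\<in>S. pm_scale (c y) y) \<in> pm.span S" by (intro pm.span_sum pm.span_scale pm.span_base)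
      ultimately show "x \<in> pm.span S" by simp
    qed
  qed
  ultimately show "finite S \<and> pm.independent S \<and> pm.span S = num V" using S(1) by blast
next
  assume S: "finite S \<and> pm.independent S \<and> pm.span S = num V"
  then show "quot_basis V S" unfolding quot_basis_def
    using honest_coords[OF V(1,2), of S] pm.span_superset[of S] by auto
qed

text \<open>When \<open>den V\<close> is zero, \<open>quot_trace\<close> is the ordinary trace, in any basis.\<close>

lemma honest_trace:
  fixes V :: "('k::field_char_0, 'i \<Rightarrow>\<^sub>0 'k) subquot"
  assumes V: "scal V = pm_scale" "den V = {0}" and B: "finite B" "pm.independent B" "pm.span B = num V"
    and T: "pm.lin T" "T ` num V \<subseteq> num V"
  shows "quot_trace V T = pm.tr B T"
proof -
  have sub: "pm.subspace (num V)" unfolding B(3)[symmetric] by (rule pm.subspace_span)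
  define S where "S = (SOME S. quot_basis V S)"
  have "quot_basis V B" using honest_basis[OF V sub] B by blast
  then have "quot_basis V S" unfolding S_def by (rule someI)
  then have S: "finite S" "pm.independent S" "pm.span S = num V" using honest_basis[OF V sub] by auto
  have "(THE c. quot_coords V S (T y) c) = pm.representation S (T y)" if y: "y \<in> S" for y
  proof -
    have Ty: "T y \<in> pm.span S" using T(2) pm.span_base[OF y] unfolding S(3) by blast
    show ?thesis unfolding honest_coords[OF V S(1,2) Ty] by (rule the_eq_trivial)
  qed
  then have "quot_trace V T = pm.tr S T" unfolding quot_trace_def S_def[symmetric] Let_def pm.tr_def by (intro sum.cong) auto
  also have "\<dots> = pm.tr B T" using T unfolding S(3)[symmetric]
    by (intro pm.tr_basis_independent[OF S(1,2) B(1,2) _ T(1)]) (simp_all add: S(3) B(3))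
  finally show ?thesis .
qed

context homology_edge begin

lemma move_gens:
  assumes x: "x \<in> gens n k i j" and p: "p \<in> perms n"
  shows "move p x \<in> gens n k i j" "map card (fst (move p x)) = map card (fst x)"
    "word n (fst (move p x)) = word n (fst x) \<circ> inv p"
proof -
  note o = osp_image[OF genD(1)[OF x] p]
  show c: "map card (fst (move p x)) = map card (fst x)" using o(1) by (simp add: move_def osp_def)
  show "word n (fst (move p x)) = word n (fst x) \<circ> inv p" using o(2) by (simp add: move_def)
  have "(fst (move p x), snd (move p x)) \<in> gens n k i j"
    unfolding gens_labels c using o(1) genD(2)[OF x] by (simp add: move_def)
  then show "move p x \<in> gens n k i j" by simp
qed

lemma key_move: "x \<in> gens n k i j \<Longrightarrow> p \<in> perms n \<Longrightarrow>
    key T (move p x) = (snd x, map card (fst x), coarsen n T (word n (fst x)) \<circ> inv p)"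
  unfolding key_def move_gens(2,3) coarsen_comp[OF inv_perms] by (simp add: move_def)

lemma key_move_iff:
  assumes "x \<in> gens n k i j" "y \<in> gens n k i j" "p \<in> perms n"
  shows "key T (move p x) = key T (move p y) \<longleftrightarrow> key T x = key T y"
proof -
  have "inv p \<circ> p = id" using assms(3) permutes_inv_o(2) by blast
  then have "f \<circ> inv p = g \<circ> inv p \<longleftrightarrow> f = g" for f g :: "nat \<Rightarrow> nat" by (metis comp_assoc comp_id)
  then show ?thesis unfolding key_move[OF assms(1,3)] key_move[OF assms(2,3)] by (simp add: key_def)
qed

lemma move_inv:
  assumes "p \<in> perms n"
  shows "move p (move (inv p) x) = x" "move (inv p) (move p x) = x"
proof -
  have "p \<circ> inv p = id" "inv p \<circ> p = id" using assms permutes_inv_o by blast+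
  then show "move p (move (inv p) x) = x" "move (inv p) (move p x) = x" unfolding move_comp[symmetric] by (simp_all add: move_id)
qed

lemma lookup_boundary:
  assumes v: "keys v \<subseteq> gens n k i j"
  shows "lookup (boundary v :: gen \<Rightarrow>\<^sub>0 'k::field_char_0) z =
    (\<Sum>x\<in>gens n k i j. lookup v x * (\<Sum>m<k - 1. ((- 1) ^ m when merge m x = z)))"
proof -
  have "boundary v = (\<Sum>x\<in>gens n k i j. pm_scale (lookup v x)
      (\<Sum>m<length (fst x) - 1. single (merge m x) ((- 1) ^ m)))"
    unfolding boundary_def by (rule lin_ext_superset[OF finite_gens v])
  then have "lookup (boundary v) z = (\<Sum>x\<in>gens n k i j. lookup v x *
      (\<Sum>m<length (fst x) - 1. lookup (single (merge m x) ((- 1) ^ m)) z))"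
    by (simp only: lookup_sum lookup_pm_scale)
  also have "\<dots> = (\<Sum>x\<in>gens n k i j. lookup v x * (\<Sum>m<k - 1. ((- 1) ^ m when merge m x = z)))"
    by (intro sum.cong refl) (simp only: genD(4) lookup_single)
  finally show ?thesis .
qed

lemma lookup_boundary_merge:
  assumes v: "keys v \<subseteq> gens n k i j" and x0: "x0 \<in> gens n k i j" and m0: "m0 < k - 1"
  shows "lookup (boundary v :: gen \<Rightarrow>\<^sub>0 'k::field_char_0) (merge m0 x0) =
    (- 1) ^ m0 * (\<Sum>y | y \<in> gens n k i j \<and> key ({..<k - 1} - {m0}) y = key ({..<k - 1} - {m0}) x0. lookup v y)"
proof -
  let ?T = "{..<k - 1} - {m0}"
  have inner: "(\<Sum>m<k - 1. ((- 1) ^ m when merge m x = merge m0 x0)) = (if key ?T x = key ?T x0 then (- 1) ^ m0 else (0::'k))"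
    if x: "x \<in> gens n k i j" for x
  proof -
    have "(\<Sum>m<k - 1. ((- 1) ^ m when merge m x = merge m0 x0)) =
      (\<Sum>m<k - 1. if m = m0 then (if key ?T x = key ?T x0 then (- 1) ^ m0 else 0) else (0::'k))"
    proof (intro sum.cong refl)
      fix m assume "m \<in> {..<k - 1}"
      then have "merge m x = merge m0 x0 \<longleftrightarrow> m = m0 \<and> key ({..<k - 1} - {m}) x = key ({..<k - 1} - {m}) x0"
        by (intro merge_eq_iff[OF x x0 _ m0]) simp
      then show "((- 1) ^ m when merge m x = merge m0 x0) = (if m = m0 then (if key ?T x = key ?T x0 then (- 1) ^ m0 else 0) else (0::'k))"
        by (cases "m = m0") (simp_all add: when_def)
    qed
    also have "\<dots> = (if key ?T x = key ?T x0 then (- 1) ^ m0 else 0)" using m0 by (simp only: sum.delta finite_lessThan lessThan_iff if_True)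
    finally show ?thesis .
  qed
  have "lookup (boundary v) (merge m0 x0) = (\<Sum>x\<in>gens n k i j. if key ?T x = key ?T x0 then (- 1) ^ m0 * lookup v x else 0)"
    unfolding lookup_boundary[OF v] by (intro sum.cong refl) (simp only: inner, simp)
  also have "\<dots> = (- 1) ^ m0 * (\<Sum>y | y \<in> gens n k i j \<and> key ?T y = key ?T x0. lookup v y)"
    unfolding sum_distrib_left by (rule sum.inter_filter[OF finite_gens, symmetric])
  finally show ?thesis .
qed

text \<open>By \<open>merge_eq_iff\<close>, the boundary has as coefficient at a merge, up to sign, the sum of the
coefficients over the generators with that merge.\<close>

lemma num_homology:
  "num (homology n k i j :: ('k::field_char_0, gen \<Rightarrow>\<^sub>0 'k) subquot) = {v. keys v \<subseteq> gens n k i j \<and>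
    (\<forall>m\<in>{..<k - 1}. \<forall>x\<in>gens n k i j. (\<Sum>y | y \<in> gens n k i j \<and> key ({..<k - 1} - {m}) y = key ({..<k - 1} - {m}) x. lookup v y) = 0)}"
proof -
  have "boundary v = 0 \<longleftrightarrow>
    (\<forall>m\<in>{..<k - 1}. \<forall>x\<in>gens n k i j. (\<Sum>y | y \<in> gens n k i j \<and> key ({..<k - 1} - {m}) y = key ({..<k - 1} - {m}) x. lookup v y) = 0)"
    (is "_ \<longleftrightarrow> ?R") if v: "keys v \<subseteq> gens n k i j" for v :: "gen \<Rightarrow>\<^sub>0 'k"
  proof
    assume "boundary v = 0"
    then show ?R using lookup_boundary_merge[OF v] by simp
  next
    assume R: ?R
    show "boundary v = 0"
    proof (rule poly_mapping_eqI)
      fix z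
      show "lookup (boundary v) z = lookup 0 z"
      proof (cases "\<exists>x\<in>gens n k i j. \<exists>m<k - 1. z = merge m x")
        case True
        then obtain x m where x: "x \<in> gens n k i j" "m < k - 1" "z = merge m x" by blast
        show ?thesis unfolding x(3) lookup_boundary_merge[OF v x(1,2)] using R x(1,2) by simp
      next
        case False
        then have "(\<Sum>m<k - 1. ((- 1) ^ m when merge m x = z)) = (0::'k)" if "x \<in> gens n k i j" for x
          using that by (intro sum.neutral) (auto simp: when_def)
        then show ?thesis unfolding lookup_boundary[OF v] by simp
      qed
    qed
  qed
  then show ?thesis by (auto simp: homology_def chains_def)
qed

lemma den_homology: "den (homology n k i j :: ('k::field_char_0, gen \<Rightarrow>\<^sub>0 'k) subquot) = {0}"
proof -
  have "chains n (Suc k) i j = {0 :: gen \<Rightarrow>\<^sub>0 'k}" unfolding chains_def gens_Suc_empty by auto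
  moreover have "boundary (0 :: gen \<Rightarrow>\<^sub>0 'k) = 0" unfolding boundary_def by (rule pm.lin_0[OF lin_ext_lin])
  ultimately show ?thesis by (simp add: homology_def)
qed

definition fixed_gens :: "nat set \<Rightarrow> (nat \<Rightarrow> nat) \<Rightarrow> gen set" where
  "fixed_gens T p = {x \<in> gens n k i j. descents n (word n (fst x)) \<subseteq> T \<and> key T (move p x) = key T x}"

lemma homology_basis:
  obtains B where "finite B" "pm.independent B" "pm.span B = num (homology n k i j :: ('k::field_char_0, gen \<Rightarrow>\<^sub>0 'k) subquot)"
    "\<And>p. p \<in> perms n \<Longrightarrow> relabel p ` num (homology n k i j :: ('k, gen \<Rightarrow>\<^sub>0 'k) subquot) \<subseteq> num (homology n k i j)"
    "\<And>p. p \<in> perms n \<Longrightarrow> pm.tr B (relabel p) =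
      (\<Sum>T\<in>Pow {..<k - 1}. (- 1) ^ card ({..<k - 1} - T) * of_nat (card (fixed_gens T p)))"
proof -
  interpret sf: sorted_fibres "gens n k i j" "{..<k - 1}" "\<lambda>x. descents n (word n (fst x))" key
    "\<lambda>x y. lex_less n (word n (fst x)) (word n (fst y))" "TYPE('k)" by (rule sorted_fibres_gens)
  have num: "num (homology n k i j :: ('k, gen \<Rightarrow>\<^sub>0 'k) subquot) = sf.kernel"
    unfolding num_homology sf.kernel_def ..
  have act: "relabel p ` (sf.kernel :: (gen \<Rightarrow>\<^sub>0 'k) set) \<subseteq> sf.kernel"
      "pm.tr (sf.dual ` sf.top_set) (relabel p :: (gen \<Rightarrow>\<^sub>0 'k) \<Rightarrow> _) =
        (\<Sum>T\<in>Pow {..<k - 1}. (- 1) ^ card ({..<k - 1} - T) * of_nat (card (fixed_gens T p)))"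
    if p: "p \<in> perms n" for p
  proof -
    interpret fa: fibre_action "gens n k i j" "{..<k - 1}" "\<lambda>x. descents n (word n (fst x))" key
      "\<lambda>x y. lex_less n (word n (fst x)) (word n (fst y))" "TYPE('k)" "move p" "move (inv p)" "relabel p"
      by (intro fibre_action.intro fibre_action_axioms.intro sorted_fibres_gens relabel_lin relabel_single move_inv[OF p]
        move_gens(1)[OF _ p] move_gens(1)[OF _ inv_perms[OF p]] key_move_iff[OF _ _ p]) assumption+
    show "relabel p ` (sf.kernel :: (gen \<Rightarrow>\<^sub>0 'k) set) \<subseteq> sf.kernel" using fa.act_kernel by blast
    show "pm.tr (sf.dual ` sf.top_set) (relabel p :: (gen \<Rightarrow>\<^sub>0 'k) \<Rightarrow> _) =
        (\<Sum>T\<in>Pow {..<k - 1}. (- 1) ^ card ({..<k - 1} - T) * of_nat (card (fixed_gens T p)))"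
      unfolding fixed_gens_def by (rule fa.kernel_trace[OF relabel_lin relabel_single])
  qed
  have fin: "finite (sf.dual ` sf.top_set :: (gen \<Rightarrow>\<^sub>0 'k) set)" using finite_gens by simp
  show ?thesis
  proof (rule that[of "sf.dual ` sf.top_set"])
    show "pm.span (sf.dual ` sf.top_set) = num (homology n k i j :: ('k, gen \<Rightarrow>\<^sub>0 'k) subquot)" unfolding num by (rule sf.span_dual)
    show "relabel p ` num (homology n k i j :: ('k, gen \<Rightarrow>\<^sub>0 'k) subquot) \<subseteq> num (homology n k i j)" if "p \<in> perms n" for p
      unfolding num by (rule act(1)[OF that])
  qed (rule fin sf.dual_independent act(2), assumption?)+
qed

lemma homology_simps:
  "scal (homology n k i j :: ('k::field_char_0, gen \<Rightarrow>\<^sub>0 'k) subquot) = pm_scale"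
  "act (homology n k i j :: ('k::field_char_0, gen \<Rightarrow>\<^sub>0 'k) subquot) = relabel"
  by (simp_all add: homology_def)

lemma sn_rep_homology: "sn_rep n (homology n k i j :: ('k::field_char_0, gen \<Rightarrow>\<^sub>0 'k) subquot)"
proof -
  let ?H = "homology n k i j :: ('k, gen \<Rightarrow>\<^sub>0 'k) subquot"
  obtain B where B: "finite B" "pm.independent B" "pm.span B = num ?H"
    and a: "\<And>p. p \<in> perms n \<Longrightarrow> relabel p ` num ?H \<subseteq> num ?H"
    by (rule homology_basis[where 'k = 'k]) (rule that)
  have sub: "pm.subspace (num ?H)" unfolding B(3)[symmetric] by (rule pm.subspace_span)
  have S: "\<exists>S. quot_basis ?H S" using honest_basis[OF homology_simps(1) den_homology sub] B by blast
  have z: "relabel p 0 = (0 :: gen \<Rightarrow>\<^sub>0 'k)" for p by (rule pm.lin_0[OF relabel_lin])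
  show ?thesis
    unfolding sn_rep_def homology_simps den_homology
  proof (intro conjI allI impI ballI)
    show "vector_space (pm_scale :: 'k \<Rightarrow> (gen \<Rightarrow>\<^sub>0 'k) \<Rightarrow> _)" by (rule vector_space_pm)
    show "pm.subspace (num ?H)" by (rule sub)
    show "pm.subspace {0}" by (rule pm.subspace_single_0)
    show "{0} \<subseteq> num ?H" using pm.subspace_0[OF sub] by simp
    show "\<exists>S. quot_basis ?H S" by (rule S)
    show "relabel p ` num ?H \<subseteq> num ?H" if "p permutes {1..n}" for p using a that by blast
    show "relabel p ` {0 :: gen \<Rightarrow>\<^sub>0 'k} \<subseteq> {0}" for p using z by simp
  qed (simp_all add: pm.lin_add[OF relabel_lin] pm.lin_scale[OF relabel_lin] relabel_id relabel_comp)
qed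

text \<open>A generator is a label together with a word of the corresponding shape.\<close>

lemma card_fixed_gens:
  assumes p: "p \<in> perms n" and T: "T \<subseteq> {..<k - 1}"
  shows "card (fixed_gens T p) =
    (\<Sum>l\<in>labels n k i j. card {w \<in> block_words n (merge_blocks T (fst l)). w \<circ> p = w})"
proof -
  let ?F = "\<lambda>\<beta>. {u \<in> block_words n \<beta>. descents n u \<subseteq> T \<and> coarsen n T (u \<circ> inv p) = coarsen n T u}"
  let ?X = "{x \<in> gens n k i j. descents n (word n (fst x)) \<subseteq> T \<and> key T (move p x) = key T x}"
  let ?f = "\<lambda>x::gen. ((map card (fst x), snd x), word n (fst x))"
  have fixed: "key T (move p x) = key T x \<longleftrightarrow> coarsen n T (word n (fst x) \<circ> inv p) = coarsen n T (word n (fst x))"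
    if "x \<in> gens n k i j" for x
    using move_gens(2,3)[OF that p] by (simp add: key_def move_def)
  have "bij_betw ?f ?X (SIGMA l:labels n k i j. ?F (fst l))"
    unfolding bij_betw_def
  proof
    show "inj_on ?f ?X" by (rule inj_onI) (use gen_eqI in blast)
    show "?f ` ?X = (SIGMA l:labels n k i j. ?F (fst l))"
    proof (intro equalityI subsetI)
      fix y assume "y \<in> ?f ` ?X"
      then obtain x where x: "x \<in> gens n k i j" "descents n (word n (fst x)) \<subseteq> T" "key T (move p x) = key T x" "y = ?f x" by blast
      show "y \<in> (SIGMA l:labels n k i j. ?F (fst l))"
        unfolding x(4) using x(2,3) fixed[OF x(1)] genD(2,3)[OF x(1)] by simp
    next
      fix y assume "y \<in> (SIGMA l:labels n k i j. ?F (fst l))"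
      then obtain \<beta> xs u where y: "y = ((\<beta>, xs), u)" "(\<beta>, xs) \<in> labels n k i j" "u \<in> ?F \<beta>" by auto
      have u: "u \<in> block_words n \<beta>" using y(3) by blast
      obtain Bs where Bs: "Bs \<in> osp n \<beta>" "word n Bs = u"
        using word_surj[OF u entry_pos[OF labels_facts(1)[OF y(2)] n]] by blast
      have mc: "map card Bs = \<beta>" using Bs(1) by (simp add: osp_def)
      have g: "(Bs, xs) \<in> gens n k i j" unfolding gens_labels mc using Bs(1) y(2) by blast
      have "(Bs, xs) \<in> ?X" using g fixed[OF g] y(3) Bs(2) by simp
      moreover have "y = ?f (Bs, xs)" using y(1) mc Bs(2) by simp
      ultimately show "y \<in> ?f ` ?X" by (rule rev_image_eqI)
    qed
  qed
  then have "card ?X = card (SIGMA l:labels n k i j. ?F (fst l))" by (rule bij_betw_same_card)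
  also have "\<dots> = (\<Sum>l\<in>labels n k i j. card (?F (fst l)))"
    using finite_labels by (intro card_SigmaI) auto
  also have "\<dots> = (\<Sum>l\<in>labels n k i j. card {w \<in> block_words n (merge_blocks T (fst l)). w \<circ> p = w})"
  proof (intro sum.cong refl)
    fix l assume "l \<in> labels n k i j"
    then have l: "composition n (fst l)" "length (fst l) = k" using labels_facts(1,2)[of "fst l" "snd l"] by auto
    have id: "p \<circ> inv p = id" "inv p \<circ> p = id" using p permutes_inv_o by blast+
    have "w \<circ> inv p = w \<longleftrightarrow> w \<circ> p = w" for w :: "nat \<Rightarrow> nat" using id by (metis comp_assoc comp_id)
    then show "card (?F (fst l)) = card {w \<in> block_words n (merge_blocks T (fst l)). w \<circ> p = w}"
      using card_fixed_sorted[OF l(1) n, of T "inv p"] T l(2) inv_perms[OF p] by simp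
  qed
  finally show ?thesis unfolding fixed_gens_def .
qed

lemma trace_homology:
  assumes p: "p \<in> perms n"
  shows "quot_trace (homology n k i j :: ('k::field_char_0, gen \<Rightarrow>\<^sub>0 'k) subquot) (relabel p) =
    (\<Sum>l\<in>labels n k i j. \<Sum>T\<in>Pow {..<k - 1}. (- 1) ^ card ({..<k - 1} - T) *
      of_nat (card {w \<in> block_words n (merge_blocks T (fst l)). w \<circ> p = w}))"
proof -
  let ?H = "homology n k i j :: ('k, gen \<Rightarrow>\<^sub>0 'k) subquot"
  have "quot_trace ?H (relabel p) = (\<Sum>T\<in>Pow {..<k - 1}. (- 1) ^ card ({..<k - 1} - T) * of_nat (card (fixed_gens T p)))"
  proof (rule homology_basis[where 'k = 'k])
    fix B assume B: "finite B" "pm.independent B" "pm.span B = num ?H"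
      and a: "\<And>p. p \<in> perms n \<Longrightarrow> relabel p ` num ?H \<subseteq> num ?H"
      and t: "\<And>p. p \<in> perms n \<Longrightarrow> pm.tr B (relabel p) =
        (\<Sum>T\<in>Pow {..<k - 1}. (- 1) ^ card ({..<k - 1} - T) * of_nat (card (fixed_gens T p)))"
    show ?thesis unfolding t[OF p, symmetric] by (rule honest_trace[OF homology_simps(1) den_homology B relabel_lin a[OF p]])
  qed
  also have "\<dots> = (\<Sum>T\<in>Pow {..<k - 1}. \<Sum>l\<in>labels n k i j. (- 1) ^ card ({..<k - 1} - T) *
      of_nat (card {w \<in> block_words n (merge_blocks T (fst l)). w \<circ> p = w}))"
    by (intro sum.cong refl) (simp only: Pow_iff card_fixed_gens[OF p] of_nat_sum sum_distrib_left)
  also have "\<dots> = (\<Sum>l\<in>labels n k i j. \<Sum>T\<in>Pow {..<k - 1}. (- 1) ^ card ({..<k - 1} - T) *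
      of_nat (card {w \<in> block_words n (merge_blocks T (fst l)). w \<circ> p = w}))" by (rule sum.swap)
  finally show ?thesis .
qed

end

lemma mconst_sum: "mconst (\<Sum>i\<in>I. f i) = (\<Sum>i\<in>I. mconst (f i))"
  by (rule mps_eqI) (simp add: mconst_def)

lemma mconst_sign: "mconst ((- 1) ^ m) = (- 1) ^ m"
proof -
  have "mconst (- 1) = (- 1 :: 'a mps)" by (rule mps_eqI) (simp add: mconst_def uminus_mps_def mcoeff_1)
  then show ?thesis by (induction m) (simp_all only: power_0 power_Suc mconst_mult mconst_1)
qed

context homology_edge begin

lemma frob_homology:
  "frob n (homology n k i j :: ('k::field_char_0, gen \<Rightarrow>\<^sub>0 'k) subquot) = (\<Sum>l\<in>labels n k i j. ribbon (fst l))"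
proof -
  let ?M = "{..<k - 1}"
  let ?P = "\<lambda>p. (\<Prod>C\<in>perm_cycles p {1..n}. psym (card C)) :: 'k mps"
  let ?c = "\<lambda>T l p. of_nat (card {w \<in> block_words n (merge_blocks T (fst l)). w \<circ> p = w}) :: 'k"
  have "(\<Sum>p\<in>perms n. mconst (quot_trace (homology n k i j :: ('k, gen \<Rightarrow>\<^sub>0 'k) subquot) (relabel p)) * ?P p) =
    (\<Sum>p\<in>perms n. \<Sum>l\<in>labels n k i j. \<Sum>T\<in>Pow ?M. (- 1) ^ card (?M - T) * (mconst (?c T l p) * ?P p))"
    by (intro sum.cong refl) (simp only: trace_homology mconst_sum mconst_mult mconst_sign sum_distrib_right mult.assoc)
  also have "\<dots> = (\<Sum>l\<in>labels n k i j. \<Sum>T\<in>Pow ?M. \<Sum>p\<in>perms n. (- 1) ^ card (?M - T) * (mconst (?c T l p) * ?P p))"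
    by (subst sum.swap) (intro sum.cong refl sum.swap)
  also have "\<dots> = (\<Sum>l\<in>labels n k i j. mconst (of_nat (fact n)) * ribbon (fst l))"
  proof (intro sum.cong refl)
    fix l assume "l \<in> labels n k i j"
    then have l: "composition n (fst l)" "length (fst l) = k" using labels_facts(1,2)[of "fst l" "snd l"] by auto
    have "(\<Sum>T\<in>Pow ?M. \<Sum>p\<in>perms n. (- 1) ^ card (?M - T) * (mconst (?c T l p) * ?P p)) =
      (\<Sum>T\<in>Pow ?M. mconst (of_nat (fact n)) * ((- 1) ^ card (?M - T) * prod_list (map hsym (merge_blocks T (fst l)))))"
    proof (intro sum.cong refl)
      fix T assume "T \<in> Pow ?M"
      then have "composition n (merge_blocks T (fst l))" using merge_composition[OF l(1) n] l(2) by simp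
      then have "(\<Sum>p\<in>perms n. mconst (?c T l p) * ?P p) = mconst (of_nat (fact n)) * prod_list (map hsym (merge_blocks T (fst l)))"
        by (rule frob_block_words)
      then show "(\<Sum>p\<in>perms n. (- 1) ^ card (?M - T) * (mconst (?c T l p) * ?P p)) =
        mconst (of_nat (fact n)) * ((- 1) ^ card (?M - T) * prod_list (map hsym (merge_blocks T (fst l))))"
        unfolding sum_distrib_left[symmetric] by (simp only: mult.left_commute)
    qed
    also have "\<dots> = mconst (of_nat (fact n)) * ribbon (fst l)"
      unfolding ribbon_merge_sum[OF l(1) n] l(2) sum_distrib_left ..
    finally show "(\<Sum>T\<in>Pow ?M. \<Sum>p\<in>perms n. (- 1) ^ card (?M - T) * (mconst (?c T l p) * ?P p)) =
      mconst (of_nat (fact n)) * ribbon (fst l)" .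
  qed
  also have "\<dots> = mconst (of_nat (fact n)) * (\<Sum>l\<in>labels n k i j. ribbon (fst l))" by (rule sum_distrib_left[symmetric])
  finally have "frob n (homology n k i j :: ('k, gen \<Rightarrow>\<^sub>0 'k) subquot) =
    mconst (1 / fact n * of_nat (fact n)) * (\<Sum>l\<in>labels n k i j. ribbon (fst l))"
    unfolding frob_def homology_simps mconst_mult mult.assoc by (rule arg_cong)
  also have "(1 / fact n * of_nat (fact n) :: 'k) = 1" by (simp add: of_nat_fact)
  finally show ?thesis by simp
qed

text \<open>A list of decorations that are cyclic in \<open>\<sigma>\<close> and have total \<open>q\<close>-degree \<open>j\<close> has exactly \<open>k\<close> entries, so
the labels are precisely the summands of \<open>coeff_defect_zero\<close>.\<close>

lemma sum_labels:
  "(\<Sum>l\<in>labels n k i j. ribbon (fst l)) = coeff (coeff (defect_series n 0 :: 'a::comm_ring_1 mps poly poly) j) i"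
proof -
  let ?X = "\<lambda>\<beta>. {xs \<in> cyclic_lists \<beta>. lsum deg_t \<beta> xs = i \<and> lsum deg_q \<beta> xs = j}"
  have labels: "labels n k i j = (SIGMA \<beta>:{\<beta>. coarser \<beta> (zigzag n)}. ?X \<beta>)"
  proof -
    have "length \<beta> = k" if b: "coarser \<beta> (zigzag n)" "xs \<in> cyclic_lists \<beta>" "lsum deg_q \<beta> xs = j" for \<beta> xs
    proof -
      have c: "composition n \<beta>" "even_init \<beta>" using b(1) by (auto simp: coarser_zigzag_iff)
      have d: "xs \<in> deco_lists \<beta>" "list_all2 (\<lambda>b x. scyc b x = 1) \<beta> xs" using b(2) by (auto simp: cyclic_lists_def)
      have "lsum scyc \<beta> xs = length \<beta>" using lsum_scyc_ge(2)[OF c(1) d(1)] d(2) by blast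
      then show ?thesis using lsum_degrees_cyclic[OF c d(1)] b(3) kj by simp
    qed
    then show ?thesis unfolding labels_def by blast
  qed
  have fin: "finite {\<beta>. coarser \<beta> (zigzag n)}"
    by (rule finite_subset[OF _ finite_compositions[of n]]) (auto simp: coarser_zigzag_iff)
  have "(\<Sum>\<beta> | coarser \<beta> (zigzag n). \<Sum>xs\<in>?X \<beta>. ribbon \<beta> :: 'a mps) = (\<Sum>(\<beta>, xs)\<in>labels n k i j. ribbon \<beta>)"
    unfolding labels by (rule sum.Sigma[OF fin]) (simp add: cyclic_lists_def)
  then show ?thesis unfolding coeff_defect_zero[OF n] by (simp add: case_prod_unfold)
qed

end

text \<open>Apply \<open>class_function_zero\<close> to the difference of the traces.\<close>

lemma frob_eq_iff_traces:
  assumes V: "sn_rep n (V :: ('k::field_char_0, 'v::ab_group_add) subquot)" and W: "sn_rep n (W :: ('k, 'w::ab_group_add) subquot)"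
  shows "frob n V = frob n W \<longleftrightarrow> (\<forall>p\<in>perms n. quot_trace V (act V p) = quot_trace W (act W p))"
proof
  assume eq: "frob n V = frob n W"
  let ?P = "\<lambda>p. (\<Prod>C\<in>perm_cycles p {1..n}. psym (card C)) :: 'k mps"
  let ?\<psi> = "\<lambda>p. quot_trace V (act V p) - quot_trace W (act W p)"
  have inv: "mconst (fact n) * (mconst (1 / fact n) * f) = f" for f :: "'k mps"
    unfolding mult.assoc[symmetric] mconst_mult[symmetric] by simp
  have "(\<Sum>p\<in>perms n. mconst (quot_trace V (act V p)) * ?P p) = (\<Sum>p\<in>perms n. mconst (quot_trace W (act W p)) * ?P p)"
    using arg_cong[OF eq, of "(*) (mconst (fact n))"] unfolding frob_def inv .
  moreover have "mconst (a - b) = mconst a - (mconst b :: 'k mps)" for a b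
    by (rule mps_eqI) (simp add: mconst_def minus_mps_def)
  ultimately have zero: "(\<Sum>p\<in>perms n. mconst (?\<psi> p) * ?P p) = 0"
    by (simp only: left_diff_distrib sum_subtractf) simp
  show "\<forall>p\<in>perms n. quot_trace V (act V p) = quot_trace W (act W p)"
  proof
    fix p assume p: "p \<in> perms n"
    have "?\<psi> p = 0"
      by (rule class_function_zero[OF _ zero p]) (simp only: quot_trace_class_function[OF V] quot_trace_class_function[OF W])
    then show "quot_trace V (act V p) = quot_trace W (act W p)" by simp
  qed
next
  assume "\<forall>p\<in>perms n. quot_trace V (act V p) = quot_trace W (act W p)"
  then show "frob n V = frob n W" unfolding frob_def by (intro arg_cong2[of _ _ _ _ "(*)"] refl sum.cong) simp
qed

theorem corollary4p7:
  shows
    "(\<forall>N\<ge>1. (defect_series (2 * N) 0 :: 'k::field_char_0 mps poly poly) =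
       (\<Sum>\<mu> | composition N \<mu>.
          uvar ^ (N - length \<mu>) *
          (\<Prod>a<length \<mu>. of_nat (fact (\<mu> ! a - 1)) * pochhammer tvar (\<mu> ! a + 1)) *
          symc (ribbon (dbl \<mu>))))
   \<and> (\<forall>N. (defect_series (2 * N + 1) 0 :: 'k mps poly poly) =
       (\<Sum>\<mu> | composition (N + 1) \<mu>.
          uvar ^ (N + 1 - length \<mu>) *
          (\<Prod>a<length \<mu>. of_nat (fact (\<mu> ! a - 1))) *
          (\<Prod>a<length \<mu> - 1. pochhammer tvar (\<mu> ! a + 1)) *
          pochhammer tvar (last \<mu>) *
          symc (ribbon (dbl_dec \<mu>))))
   \<and> (\<forall>n\<ge>1. \<forall>k i j. k + j = length (zigzag n) \<longrightarrow>
       frob n (homology n k i j :: ('k, gen \<Rightarrow>\<^sub>0 'k) subquot) =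
         coeff (coeff (defect_series n 0) j) i \<and>
       (\<forall>W :: ('k, 'w::ab_group_add) subquot. sn_rep n W \<longrightarrow>
          (sn_iso n (homology n k i j :: ('k, gen \<Rightarrow>\<^sub>0 'k) subquot) W \<longleftrightarrow>
           frob n W = coeff (coeff (defect_series n 0) j) i)))"
proof (intro conjI allI impI)
  show "(defect_series (2 * N) 0 :: 'k::field_char_0 mps poly poly) =
       (\<Sum>\<mu> | composition N \<mu>. uvar ^ (N - length \<mu>) *
          (\<Prod>a<length \<mu>. of_nat (fact (\<mu> ! a - 1)) * pochhammer tvar (\<mu> ! a + 1)) *
          symc (ribbon (dbl \<mu>)))" if "1 \<le> N" for N
    using that by (intro defect_zero_even) simp
  show "(defect_series (2 * N + 1) 0 :: 'k mps poly poly) =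
       (\<Sum>\<mu> | composition (N + 1) \<mu>. uvar ^ (N + 1 - length \<mu>) *
          (\<Prod>a<length \<mu>. of_nat (fact (\<mu> ! a - 1))) *
          (\<Prod>a<length \<mu> - 1. pochhammer tvar (\<mu> ! a + 1)) *
          pochhammer tvar (last \<mu>) * symc (ribbon (dbl_dec \<mu>)))" for N
    by (rule defect_zero_odd)
next
  fix n k i j :: nat
  assume "1 \<le> n" "k + j = length (zigzag n)"
  then interpret homology_edge n k i j by unfold_locales (simp_all add: length_zigzag)
  let ?H = "homology n k i j :: ('k, gen \<Rightarrow>\<^sub>0 'k) subquot"
  show F: "frob n ?H = coeff (coeff (defect_series n 0) j) i" unfolding frob_homology by (rule sum_labels)
  fix W :: "('k, 'w) subquot"
  assume W: "sn_rep n W"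
  have "sn_iso n ?H W \<longleftrightarrow> frob n ?H = frob n W"
    unfolding sn_iso_iff_traces[OF sn_rep_homology W] frob_eq_iff_traces[OF sn_rep_homology W] ..
  then show "sn_iso n ?H W \<longleftrightarrow> frob n W = coeff (coeff (defect_series n 0) j) i" unfolding F by auto
qed

end
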